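(* A complex Banach space $X$ has the analytic Radon-Nikodým Property (ARNP) if and only if for every analytic vector measure $m\in M^+(\mathbb{T}^{\mathbb{N}},X)$ there exists $f\in H_1(\mathbb{T}^{\mathbb{N}},X)$ satisfying $$m(A)=\int_A f(\omega)\,d\omega\quad\text{for every Borel set }A\subset\mathbb{T}^{\mathbb{N}}.$$
   Context: $X$ has the ARNP if for every bounded holomorphic function $F:\mathbb{D}\to X$ on the open unit disc the radial limit $\lim_{R\to1^-}F(R\omega)$ exists (in norm) for almost every $\omega\in\mathbb{T}$. $\mathbb{Z}^{(\mathbb{N})}$ (resp. $\mathbb{N}_0^{(\mathbb{N})}$) is the set of eventually zero sequences of integers (resp. of elements of $\mathbb{N}_0=\mathbb{N}\cup\{0\}$). $\mathbb{T}^{\mathbb{N}}$ is the infinite-dimensional torus with normalized Haar measure $d\omega$, and $\omega^\alpha=\prod_j\omega_j^{\alpha_j}$ for $\alpha\in\mathbb{Z}^{(\mathbb{N})}$. $H_1(\mathbb{T}^{\mathbb{N}},X)$ is the closed subspace of the Bochner space $L_1(\mathbb{T}^{\mathbb{N}},X)$ consisting of those $f$ with $\widehat f(\alpha)=\int_{\mathbb{T}^{\mathbb{N}}}f(\omega)\omega^{-\alpha}d\omega=0$ for all $\alpha\in\mathbb{Z}^{(\mathbb{N})}\setminus\mathbb{N}_0^{(\mathbb{N})}$. A vector measure $m$ on the Borel $\sigma$-algebra of $\mathbb{T}^{\mathbb{N}}$ with values in $X$ is of bounded variation if $\sup_\pi\sum_{A\in\pi}\|m(A)\|_X<\infty$,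 the supremum being over all finite partitions $\pi$ of $\mathbb{T}^{\mathbb{N}}$ into Borel sets. $M(\mathbb{T}^{\mathbb{N}},X)$ is the space of all regular countably additive $X$-valued Borel vector measures on $\mathbb{T}^{\mathbb{N}}$ of bounded variation. $M^+(\mathbb{T}^{\mathbb{N}},X)$ is the subspace of analytic ones, i.e. those $m$ with $\widehat m(\alpha):=\int_{\mathbb{T}^{\mathbb{N}}}\omega^{-\alpha}\,dm=0$ for every $\alpha\in\mathbb{Z}^{(\mathbb{N})}\setminus\mathbb{N}_0^{(\mathbb{N})}$. *)

theory Defs
  imports "HOL-Probability.Probability"
begin

section \<open>Complex Banach spaces\<close>

class scaleC =
  fixes scaleC :: "complex \<Rightarrow> 'a \<Rightarrow> 'a"  (infixr \<open>*\<^sub>C\<close> 75)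

class complex_banach = banach + scaleC +
  assumes scaleC_add_right: "c *\<^sub>C (x + y) = c *\<^sub>C x + c *\<^sub>C y"
    and scaleC_add_left: "(c + d) *\<^sub>C x = c *\<^sub>C x + d *\<^sub>C x"
    and scaleC_scaleC: "c *\<^sub>C d *\<^sub>C x = (c * d) *\<^sub>C x"
    and scaleC_of_real: "complex_of_real r *\<^sub>C x = r *\<^sub>R x"
    and norm_scaleC: "norm (c *\<^sub>C x) = cmod c * norm x"

instantiation complex :: complex_banach
begin

definition scaleC_complex :: "complex \<Rightarrow> complex \<Rightarrow> complex" where
  "scaleC_complex c z = c * z"

instance
  by standard (simp_all add: scaleC_complex_def algebra_simps scaleR_conv_of_real norm_mult)

end


section \<open>Bochner integral\<close>

text \<open>
  The Bochner integral of the library is only available for second countable spaces. Since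
  the Banach space \<open>X\<close> may be non-separable, it is defined here once more, with Borel
  measurability replaced by strong measurability (almost everywhere limit of simple functions).
\<close>

definition strongly_measurable :: "'b measure \<Rightarrow> ('b \<Rightarrow> 'a::real_normed_vector) \<Rightarrow> bool" where
  "strongly_measurable M f \<longleftrightarrow>
     (\<exists>s. (\<forall>n. simple_function M (s n)) \<and> (AE x in M. (\<lambda>n::nat. s n x) \<longlonglongrightarrow> f x))"

definition has_bochner_int :: "'b measure \<Rightarrow> ('b \<Rightarrow> 'a::real_normed_vector) \<Rightarrow> 'a \<Rightarrow> bool" where
  "has_bochner_int M f I \<longleftrightarrow>
     strongly_measurable M f \<and>
     (\<exists>s. (\<forall>n. Bochner_Integration.simple_bochner_integrable M (s n)) \<and>
          (\<lambda>n::nat. \<integral>\<^sup>+x. ennreal (norm (f x - s n x)) \<partial>M) \<longlonglongrightarrow> 0 \<and>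
          (\<lambda>n. Bochner_Integration.simple_bochner_integral M (s n)) \<longlonglongrightarrow> I)"

definition bochner_integrable :: "'b measure \<Rightarrow> ('b \<Rightarrow> 'a::real_normed_vector) \<Rightarrow> bool" where
  "bochner_integrable M f \<longleftrightarrow> (\<exists>I. has_bochner_int M f I)"

definition bochner_int :: "'b measure \<Rightarrow> ('b \<Rightarrow> 'a::real_normed_vector) \<Rightarrow> 'a" where
  "bochner_int M f = (THE I. has_bochner_int M f I)"

definition set_bochner_int :: "'b measure \<Rightarrow> 'b set \<Rightarrow> ('b \<Rightarrow> 'a::real_normed_vector) \<Rightarrow> 'a" where
  "set_bochner_int M A f = bochner_int M (\<lambda>x. indicat_real A x *\<^sub>R f x)"


section \<open>Circle and infinite-dimensional torus\<close>

text \<open>Normalized arc length, i.e. normalized Haar measure of the unit circle.\<close>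

definition circle :: "complex measure" where
  "circle = distr (uniform_measure lborel {0..2 * pi}) (restrict_space borel (sphere 0 1)) cis"

definition torus :: "(nat \<Rightarrow> complex) set" where
  "torus = {\<omega>. \<forall>j. cmod (\<omega> j) = 1}"

text \<open>The type \<open>nat \<Rightarrow> complex\<close> carries the product topology, so this is the Borel
  \<open>\<sigma>\<close>-algebra of the compact space \<open>torus\<close>.\<close>

abbreviation borel_torus :: "(nat \<Rightarrow> complex) measure" where
  "borel_torus \<equiv> restrict_space borel torus"

text \<open>The normalized Haar measure of the torus is the product of those of its factors.\<close>

definition haar :: "(nat \<Rightarrow> complex) measure" where
  "haar = Pi\<^sub>M UNIV (\<lambda>_. circle)"

lemma space_circle: "space circle = sphere 0 1"
  by (simp add: circle_def space_restrict_space)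

lemma sets_circle: "sets circle = sets (restrict_space borel (sphere 0 1))"
  by (simp add: circle_def)

lemma prob_space_circle: "prob_space circle"
  unfolding circle_def
proof (rule prob_space.prob_space_distr)
  show "prob_space (uniform_measure lborel {0..2 * pi})"
    by (rule prob_space_uniform_measure) (auto simp: ennreal_eq_0_iff not_le)
  show "cis \<in> uniform_measure lborel {0..2 * pi} \<rightarrow>\<^sub>M restrict_space borel (sphere 0 1)"
    by (rule measurable_restrict_space2)
      (auto intro!: borel_measurable_continuous_onI continuous_intros
        simp: measurable_cong_sets[OF sets_uniform_measure refl])
qed

lemma prob_space_haar: "prob_space haar"
  unfolding haar_def by (intro prob_space_PiM prob_space_circle)

lemma space_haar: "space haar = torus"
  by (auto simp: haar_def torus_def space_PiM space_circle PiE_def extensional_def)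

lemma sets_haar: "sets haar = sets borel_torus"
proof (rule antisym)
  have "(\<lambda>\<omega>. \<omega>) \<in> borel_torus \<rightarrow>\<^sub>M haar"
    unfolding haar_def
  proof (rule measurable_PiM_single')
    show "(\<lambda>\<omega>. \<omega> i) \<in> borel_torus \<rightarrow>\<^sub>M circle" for i :: nat
    proof -
      have "(\<lambda>\<omega>. \<omega> i) \<in> borel_torus \<rightarrow>\<^sub>M restrict_space borel (sphere 0 1)"
        by (rule measurable_restrict_space2)
          (auto simp: torus_def space_restrict_space
            intro!: measurable_restrict_space1 measurable_product_coordinates)
      then show ?thesis
        by (simp add: measurable_cong_sets[OF refl sets_circle])
    qed
  qed (auto simp: space_restrict_space torus_def space_circle PiE_def extensional_def)
  then show "sets haar \<subseteq> sets borel_torus"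
    using measurable_sets[of "\<lambda>\<omega>. \<omega>" borel_torus haar] sets.sets_into_space[of _ haar]
    by (fastforce simp: space_haar space_restrict_space Int_absorb2)
  have "(\<lambda>\<omega>. \<omega>) \<in> haar \<rightarrow>\<^sub>M Pi\<^sub>M UNIV (\<lambda>_. borel)"
  proof (rule measurable_PiM_single')
    show "(\<lambda>\<omega>. \<omega> i) \<in> haar \<rightarrow>\<^sub>M borel" for i :: nat
    proof -
      have "(\<lambda>\<omega>. \<omega> i) \<in> haar \<rightarrow>\<^sub>M circle"
        unfolding haar_def by measurable
      then have "(\<lambda>\<omega>. \<omega> i) \<in> haar \<rightarrow>\<^sub>M restrict_space borel (sphere 0 1)"
        by (simp add: measurable_cong_sets[OF refl sets_circle])
      then show ?thesis
        by (simp add: measurable_restrict_space2_iff)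
    qed
  qed (auto simp: PiE_def extensional_def)
  then have "(\<lambda>\<omega>. \<omega>) \<in> haar \<rightarrow>\<^sub>M borel"
    by (simp add: measurable_cong_sets[OF refl sets_PiM_equal_borel])
  then have "(\<lambda>\<omega>. \<omega>) \<in> haar \<rightarrow>\<^sub>M borel_torus"
    by (intro measurable_restrict_space2) (auto simp: space_haar)
  then show "sets borel_torus \<subseteq> sets haar"
    using measurable_sets[of "\<lambda>\<omega>. \<omega>" haar borel_torus] sets.sets_into_space[of _ borel_torus]
    by (fastforce simp: space_haar space_restrict_space Int_absorb2)
qed


section \<open>Analytic Radon-Nikodym property\<close>

text \<open>Complex differentiability as in \<open>has_field_derivative\<close>: the Frechet derivative at
  \<open>z\<close> is the complex linear map \<open>h \<mapsto> h *\<^sub>C d\<close>.\<close>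

definition vec_holomorphic_on :: "(complex \<Rightarrow> 'a::complex_banach) \<Rightarrow> complex set \<Rightarrow> bool" where
  "vec_holomorphic_on F S \<longleftrightarrow>
     (\<forall>z\<in>S. \<exists>d. (F has_derivative (\<lambda>h. h *\<^sub>C d)) (at z within S))"

definition ARNP :: "'a::complex_banach itself \<Rightarrow> bool" where
  "ARNP (_::'a itself) \<longleftrightarrow>
     (\<forall>F::complex \<Rightarrow> 'a.
        vec_holomorphic_on F (ball 0 1) \<and> bounded (F ` ball 0 1) \<longrightarrow>
        (AE \<omega> in circle. \<exists>l. ((\<lambda>R. F (of_real R * \<omega>)) \<longlongrightarrow> l) (at_left (1::real))))"


section \<open>Fourier coefficients and \<open>H\<^sub>1\<close>\<close>

definition Z_fin :: "(nat \<Rightarrow> int) set" where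
  "Z_fin = {\<alpha>. finite {j. \<alpha> j \<noteq> 0}}"

definition N0_fin :: "(nat \<Rightarrow> int) set" where
  "N0_fin = {\<alpha> \<in> Z_fin. \<forall>j. 0 \<le> \<alpha> j}"

definition monomial :: "(nat \<Rightarrow> int) \<Rightarrow> (nat \<Rightarrow> complex) \<Rightarrow> complex" where
  "monomial \<alpha> \<omega> = (\<Prod>j | \<alpha> j \<noteq> 0. \<omega> j powi \<alpha> j)"

definition fourier_fun :: "((nat \<Rightarrow> complex) \<Rightarrow> 'a::complex_banach) \<Rightarrow> (nat \<Rightarrow> int) \<Rightarrow> 'a" where
  "fourier_fun f \<alpha> = bochner_int haar (\<lambda>\<omega>. monomial (\<lambda>j. - \<alpha> j) \<omega> *\<^sub>C f \<omega>)"

text \<open>Elements of \<open>H\<^sub>1\<close> are represented by functions, not by classes of almost everywhere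
  equal functions.\<close>

definition H1 :: "((nat \<Rightarrow> complex) \<Rightarrow> 'a::complex_banach) set" where
  "H1 = {f. bochner_integrable haar f \<and> (\<forall>\<alpha>\<in>Z_fin - N0_fin. fourier_fun f \<alpha> = 0)}"


section \<open>Vector measures\<close>

text \<open>A vector measure on the \<open>\<sigma>\<close>-algebra of \<open>M\<close> is a function on sets of which only the
  values on \<open>sets M\<close> matter; the measure part of \<open>M\<close> is irrelevant throughout this section.\<close>

definition countably_additive_vm :: "'b measure \<Rightarrow> ('b set \<Rightarrow> 'a::real_normed_vector) \<Rightarrow> bool" where
  "countably_additive_vm M m \<longleftrightarrow>
     (\<forall>A::nat \<Rightarrow> 'b set. range A \<subseteq> sets M \<longrightarrow> disjoint_family A \<longrightarrow>
        (\<lambda>n. m (A n)) sums m (\<Union>n. A n))"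

definition bounded_variation_vm :: "'b measure \<Rightarrow> ('b set \<Rightarrow> 'a::real_normed_vector) \<Rightarrow> bool" where
  "bounded_variation_vm M m \<longleftrightarrow>
     bdd_above {\<Sum>A\<in>P. norm (m A) | P. finite P \<and> partition_on (space M) P \<and> P \<subseteq> sets M}"

text \<open>Smallness of \<open>m\<close> on all measurable subsets of \<open>U - K\<close> is the same as smallness of its
  semivariation on \<open>U - K\<close>, up to a constant factor.\<close>

definition regular_vm ::
  "'b::topological_space measure \<Rightarrow> ('b set \<Rightarrow> 'a::real_normed_vector) \<Rightarrow> bool" where
  "regular_vm M m \<longleftrightarrow>
     (\<forall>A\<in>sets M. \<forall>\<epsilon>>0. \<exists>K U. compact K \<and> open U \<and> K \<subseteq> A \<and> A \<subseteq> U \<and>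
        (\<forall>B\<in>sets M. B \<subseteq> U - K \<longrightarrow> norm (m B) < \<epsilon>))"

definition M_torus :: "((nat \<Rightarrow> complex) set \<Rightarrow> 'a::complex_banach) set" where
  "M_torus = {m. countably_additive_vm borel_torus m \<and> bounded_variation_vm borel_torus m \<and>
                 regular_vm borel_torus m}"

text \<open>Integral of a bounded measurable scalar function with respect to a vector measure:
  the limit of the integrals of any sequence of simple functions converging uniformly to it.\<close>

definition simple_vm_int ::
  "'b measure \<Rightarrow> ('b set \<Rightarrow> 'a::complex_banach) \<Rightarrow> ('b \<Rightarrow> complex) \<Rightarrow> 'a" where
  "simple_vm_int M m s = (\<Sum>c\<in>s ` space M. c *\<^sub>C m {x \<in> space M. s x = c})"

definition has_vm_int ::
  "'b measure \<Rightarrow> ('b set \<Rightarrow> 'a::complex_banach) \<Rightarrow> ('b \<Rightarrow> complex) \<Rightarrow> 'a \<Rightarrow> bool" where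
  "has_vm_int M m g I \<longleftrightarrow>
     (\<exists>s. (\<forall>n. simple_function M (s n)) \<and> uniform_limit (space M) s g sequentially \<and>
          (\<lambda>n. simple_vm_int M m (s n)) \<longlonglongrightarrow> I)"

definition vm_int ::
  "'b measure \<Rightarrow> ('b set \<Rightarrow> 'a::complex_banach) \<Rightarrow> ('b \<Rightarrow> complex) \<Rightarrow> 'a" where
  "vm_int M m g = (THE I. has_vm_int M m g I)"

definition fourier_vm :: "((nat \<Rightarrow> complex) set \<Rightarrow> 'a::complex_banach) \<Rightarrow> (nat \<Rightarrow> int) \<Rightarrow> 'a" where
  "fourier_vm m \<alpha> = vm_int borel_torus m (monomial (\<lambda>j. - \<alpha> j))"

definition M_plus_torus :: "((nat \<Rightarrow> complex) set \<Rightarrow> 'a::complex_banach) set" where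
  "M_plus_torus = {m \<in> M_torus. \<forall>\<alpha>\<in>Z_fin - N0_fin. fourier_vm m \<alpha> = 0}"

end

theory Submission
  imports Defs "HOL-Complex_Analysis.Complex_Analysis"
begin

text \<open>
 Both directions pass between the torus and the disc. All vector-valued estimates rest on one
 maximal inequality (\<open>maximal_inequality\<close>): the radial maximal function of a function
 \<open>G\<close> that is continuous on the closed disc and holomorphic inside has integral at most \<open>16\<close>
 times that of \<open>norm G\<close> on the circle. By the theorem of Hahn and Banach and the maximum principle,
 \<open>norm G\<close> is dominated in the disc by \<open>\<bar>exp p\<bar>\<close> as soon as it is dominated on the circle, where \<open>p\<close> is
 an entire function with \<open>Re p\<close> close to \<open>ln (norm G)\<close>. Thus it suffices to bound the maximal function
 of the scalar function \<open>exp (p / 2)\<close> in \<open>L\<^sup>2\<close>; its Poisson averages are mixtures of averages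
 over arcs, which the maximal ergodic theorem for rotations controls.

 From the property to densities. Let \<open>m\<close> be an analytic measure. The circle acts on the torus by
 multiplying the \<open>j\<close>th coordinate by \<open>z ^ (j + 1)\<close>. Since the Fourier coefficients of \<open>m\<close> live on
 nonnegative exponents, and there are only subexponentially many of these of a given weight, the
 Fourier series, summed along an orbit by weight, converges in the disc (\<open>extension\<close>). This
 extension need not be bounded, but its radial maximal function is integrable over the torus: the
 Fejer means of \<open>m\<close> are bounded in the mean by the variation of \<open>m\<close> (\<open>fejer_mean_norm_le\<close>), they
 are polynomials along the orbits, and the action preserves Haar measure
 (\<open>maximal_function_integral\<close>). The property speaks of bounded functions, but dividing by outer
 functions extends it to all functions with bounded logarithmic means (\<open>ARNP_radial_limits\<close>).
 Hence the extension has limits at almost every point, and by dominated convergence the limit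
 function has the Fourier coefficients of \<open>m\<close>. As trigonometric polynomials are
 dense and \<open>m\<close> is regular, it is the density of \<open>m\<close> (\<open>measure_eq_set_bochner_int\<close>).

 From densities to the property. Let \<open>F\<close> be bounded and holomorphic with Taylor coefficients
 \<open>taylor n\<close>. Integration against \<open>F (r * w 0)\<close> is bounded on \<open>L\<^sup>1\<close> uniformly in \<open>r\<close> and converges on
 monomials as \<open>r\<close> tends to \<open>1\<close>, hence on all bounded functions; the limit defines a measure, dominated by
 a multiple of Haar measure, with \<open>taylor n\<close> as its Fourier coefficient at \<open>n\<close> times the first unit
 vector and no others. It is analytic, so it has a density. Up to a measure of small variation this density
 is a trigonometric polynomial, so that its Fejer means, which are polynomials in \<open>w 0\<close> alone, form
 a Cauchy sequence in the mean (\<open>fejer_poly_Cauchy\<close>). By the maximal inequality they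
 converge to \<open>F\<close> uniformly along almost every radius, at least for a subsequence, and \<open>F\<close> inherits
 their radial limits (\<open>density_imp_radial_limits\<close>).
\<close>

section \<open>Complex linear functionals\<close>

lemma scaleC_zero_left [simp]: "0 *\<^sub>C (x::'a::complex_banach) = 0"
 using scaleC_of_real[of 0 x] by simp

lemma scaleC_zero_right [simp]: "c *\<^sub>C (0::'a::complex_banach) = 0"
 using norm_scaleC[of c "0::'a"] by simp

lemma scaleC_one [simp]: "1 *\<^sub>C (x::'a::complex_banach) = x"
 using scaleC_of_real[of 1 x] by simp

lemma scaleC_minus_one: "(-1) *\<^sub>C (x::'a::complex_banach) = - x"
 using scaleC_of_real[of "-1" x] by simp

lemma scaleC_minus_right: "c *\<^sub>C (- x) = - (c *\<^sub>C (x::'a::complex_banach))"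
 using scaleC_add_right[of c x "- x"] by (simp add: eq_neg_iff_add_eq_0 add.commute)

lemma scaleC_minus_left: "(- c) *\<^sub>C x = - (c *\<^sub>C (x::'a::complex_banach))"
 using scaleC_add_left[of c "- c" x] by (simp add: eq_neg_iff_add_eq_0 add.commute)

lemma scaleC_diff_right: "c *\<^sub>C (x - y) = c *\<^sub>C x - c *\<^sub>C (y::'a::complex_banach)"
 using scaleC_add_right[of c x "- y"] by (simp add: scaleC_minus_right)

lemma scaleC_diff_left: "(c - d) *\<^sub>C x = c *\<^sub>C x - d *\<^sub>C (x::'a::complex_banach)"
 using scaleC_add_left[of c "- d" x] by (simp add: scaleC_minus_left)

lemma scaleC_sum_right: "c *\<^sub>C (\<Sum>i\<in>I. f i) = (\<Sum>i\<in>I. c *\<^sub>C (f i :: 'a::complex_banach))"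
 by (induction I rule: infinite_finite_induct) (auto simp: scaleC_add_right)

lemma scaleC_sum_left: "(\<Sum>i\<in>I. f i) *\<^sub>C x = (\<Sum>i\<in>I. f i *\<^sub>C (x :: 'a::complex_banach))"
 by (induction I rule: infinite_finite_induct) (auto simp: scaleC_add_left)

lemma scaleR_scaleC: "r *\<^sub>R x = complex_of_real r *\<^sub>C (x::'a::complex_banach)"
 by (simp add: scaleC_of_real)

lemma bounded_bilinear_scaleC: "bounded_bilinear ((*\<^sub>C) :: complex \<Rightarrow> 'a::complex_banach \<Rightarrow> 'a)"
proof
 show "\<exists>K. \<forall>c (x::'a). norm (c *\<^sub>C x) \<le> norm c * norm x * K"
  by (rule exI[of _ 1]) (simp add: norm_scaleC)
qed (auto simp: scaleC_add_left scaleC_add_right scaleR_scaleC[where 'a='a] scaleC_scaleC mult.commute scaleR_conv_of_real)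

lemmas tendsto_scaleC [tendsto_intros] = bounded_bilinear.tendsto[OF bounded_bilinear_scaleC]
lemmas continuous_on_scaleC [continuous_intros] = bounded_bilinear.continuous_on[OF bounded_bilinear_scaleC]

text \<open>The functionals of norm at most one in the dual of the complex space.\<close>

definition contractive :: "('a::complex_banach \<Rightarrow> complex) \<Rightarrow> bool" where
 "contractive l \<longleftrightarrow>
   (\<forall>x y. l (x + y) = l x + l y) \<and> (\<forall>c x. l (c *\<^sub>C x) = c * l x) \<and> (\<forall>x. cmod (l x) \<le> norm x)"

lemma contractiveD:
 assumes "contractive l"
 shows "l (x + y) = l x + l y" "l (c *\<^sub>C x) = c * l x" "cmod (l x) \<le> norm x"
 using assms by (auto simp: contractive_def)

lemma contractive_bounded_linear:
 fixes l :: "'a::complex_banach \<Rightarrow> complex"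
 assumes "contractive l"
 shows "bounded_linear l"
 by (rule bounded_linear_intro[where K=1])
  (simp_all add: contractiveD[OF assms] scaleR_scaleC[where 'a='a] scaleR_conv_of_real)

definition sublinear :: "('a::real_normed_vector \<Rightarrow> real) \<Rightarrow> bool" where
 "sublinear q \<longleftrightarrow> (\<forall>x y. q (x + y) \<le> q x + q y) \<and> (\<forall>t x. t \<ge> 0 \<longrightarrow> q (t *\<^sub>R x) = t * q x)"

lemma sublinear_neg_le: "sublinear q \<Longrightarrow> - q (- x) \<le> q x"
 unfolding sublinear_def
 by (metis add.right_inverse mult_zero_left scaleR_zero_left zero_le_numeral le_numeral_extra(3) neg_le_iff_le
   diff_le_eq diff_0 add.commute minus_minus)

text \<open>Moving from \<open>x\<close> in the direction \<open>y\<close> and paying for it linearly lowers \<open>q\<close>.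
 This is the step that lets a minimal sublinear functional be seen to be additive, since it
 is a fixed point of the step for every \<open>y\<close>.\<close>

lemma sublinear_shift:
 fixes q :: "'a::real_normed_vector \<Rightarrow> real" and y :: 'a
 defines "q' \<equiv> \<lambda>x. INF t\<in>{0..}. q (x + t *\<^sub>R y) - t * q y"
 assumes q: "sublinear q"
 shows "sublinear q'" "\<And>x. q' x \<le> q x" "q' (- y) \<le> - q y"
proof -
 have sub: "q (a + b) \<le> q a + q b" and hom: "t \<ge> 0 \<Longrightarrow> q (t *\<^sub>R a) = t * q a" for a b t
  using q by (auto simp: sublinear_def)
 have lower: "- q (- x) \<le> q (x + t *\<^sub>R y) - t * q y" if "t \<ge> 0" for x t
  using sub[of "x + t *\<^sub>R y" "- x"] hom[OF that, of y] by simp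
 have bdd: "bdd_below ((\<lambda>t. q (x + t *\<^sub>R y) - t * q y) ` {0..})" for x
  by (rule bdd_belowI2[where m = "- q (- x)"]) (use lower in auto)
 have le: "q' x \<le> q (x + t *\<^sub>R y) - t * q y" if "t \<ge> 0" for x t
  unfolding q'_def by (rule cINF_lower[OF bdd]) (use that in auto)
 have ge: "c \<le> q' x" if "\<And>t. t \<ge> 0 \<Longrightarrow> c \<le> q (x + t *\<^sub>R y) - t * q y" for c x
  unfolding q'_def by (rule cINF_greatest) (use that in auto)
 show "q' x \<le> q x" for x using le[of 0 x] by simp
 show "q' (- y) \<le> - q y" using le[of 1 "- y"] hom[of 0 0] by simp
 show "sublinear q'"
  unfolding sublinear_def
 proof (intro conjI allI impI)
  fix a b
  have "q' (a + b) - (q (b + s *\<^sub>R y) - s * q y) \<le> q' a" if s: "s \<ge> 0" for s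
  proof (rule ge)
   fix t :: real assume t: "t \<ge> 0"
   have "q' (a + b) \<le> q ((a + b) + (t + s) *\<^sub>R y) - (t + s) * q y"
    by (rule le) (use s t in auto)
   also have "q ((a + b) + (t + s) *\<^sub>R y) \<le> q (a + t *\<^sub>R y) + q (b + s *\<^sub>R y)"
    using sub[of "a + t *\<^sub>R y" "b + s *\<^sub>R y"] by (simp add: algebra_simps)
   finally show "q' (a + b) - (q (b + s *\<^sub>R y) - s * q y) \<le> q (a + t *\<^sub>R y) - t * q y"
    by (simp add: algebra_simps)
  qed
  then have "q' (a + b) - q' a \<le> q' b"
   by (intro ge) (force simp: algebra_simps)
  then show "q' (a + b) \<le> q' a + q' b" by simp
 next
  fix r :: real and x assume r: "r \<ge> 0"
  have scaled: "q' (r *\<^sub>R x) \<le> r * q' x" if r: "r > 0" for r x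
  proof -
   have "q' (r *\<^sub>R x) / r \<le> q' x"
   proof (rule ge)
    fix t :: real assume t: "t \<ge> 0"
    have "q' (r *\<^sub>R x) \<le> q (r *\<^sub>R x + (r * t) *\<^sub>R y) - (r * t) * q y"
     by (rule le) (use r t in auto)
    also have "q (r *\<^sub>R x + (r * t) *\<^sub>R y) = r * q (x + t *\<^sub>R y)"
     using hom[of r "x + t *\<^sub>R y"] r by (simp add: scaleR_add_right)
    finally show "q' (r *\<^sub>R x) / r \<le> q (x + t *\<^sub>R y) - t * q y"
     using r by (simp add: field_simps)
   qed
   then show ?thesis using r by (simp add: field_simps)
  qed
  show "q' (r *\<^sub>R x) = r * q' x"
  proof (cases "r = 0")
   case True
   have "q (t *\<^sub>R y) - t * q y = 0" if "t \<ge> 0" for t using hom[OF that, of y] by simp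
   then have "q' 0 = 0"
    unfolding q'_def by simp
   then show ?thesis using True by simp
  next
   case False
   then have "r > 0" using r by simp
   then have "q' x \<le> inverse r * q' (r *\<^sub>R x)" using scaled[of "inverse r" "r *\<^sub>R x"] by simp
   then show ?thesis using scaled[OF \<open>r > 0\<close>, of x] \<open>r > 0\<close> by (simp add: field_simps)
  qed
 qed
qed

text \<open>Zorn's lemma applies because the pointwise infimum of a chain of sublinear functionals is
 sublinear; it is finite since \<open>- q (- x) \<le> q x\<close> bounds it from below.\<close>

lemma minimal_sublinear_exists:
 fixes q0 :: "'a::real_normed_vector \<Rightarrow> real"
 assumes q0: "sublinear q0"
 obtains q where "sublinear q" "\<And>x. q x \<le> q0 x"
  "\<And>p. sublinear p \<Longrightarrow> (\<And>x. p x \<le> q x) \<Longrightarrow> p = q"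
proof -
 define A where "A = {q. sublinear q \<and> (\<forall>x. q x \<le> q0 x)}"
 define P where "P = (\<lambda>a b :: 'a \<Rightarrow> real. \<forall>x. b x \<le> a x)"
 have "\<exists>m\<in>A. \<forall>a\<in>A. P m a \<longrightarrow> a = m"
 proof (rule predicate_Zorn)
  show "partial_order_on A (relation_of P A)"
   by (rule partial_order_on_relation_ofI) (auto simp: P_def fun_eq_iff intro: order_trans antisym)
  fix C assume "C \<in> Chains (relation_of P A)"
  then have CA: "C \<subseteq> A" and tot: "\<And>a b. a \<in> C \<Longrightarrow> b \<in> C \<Longrightarrow> P a b \<or> P b a"
   by (auto simp: Chains_def relation_of_def)
  show "\<exists>u\<in>A. \<forall>a\<in>C. P a u"
  proof (cases "C = {}")
   case True
   then show ?thesis using q0 by (auto simp: A_def)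
  next
   case False
   define u where "u x = (INF q\<in>C. q x)" for x
   have low: "- q0 (- x) \<le> q x" if "q \<in> C" for q x
    using sublinear_neg_le[of q x] that CA unfolding A_def by (smt (verit) mem_Collect_eq subsetD)
   have bdd: "bdd_below ((\<lambda>q. q x) ` C)" for x
    by (rule bdd_belowI2[where m = "- q0 (- x)"]) (use low in auto)
   have le: "u x \<le> q x" if "q \<in> C" for q x
    unfolding u_def by (rule cINF_lower[OF bdd that])
   have ge: "c \<le> u x" if "\<And>q. q \<in> C \<Longrightarrow> c \<le> q x" for c x
    unfolding u_def by (rule cINF_greatest) (use False that in auto)
   have sc: "sublinear q" if "q \<in> C" for q using that CA by (auto simp: A_def)
   have "sublinear u"
    unfolding sublinear_def
   proof (intro conjI allI impI)
    fix a b
    have "u (a + b) - p a \<le> q b" if pq: "p \<in> C" "q \<in> C" for p q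
    proof -
     obtain r where r: "r \<in> C" "\<And>x. r x \<le> p x" "\<And>x. r x \<le> q x"
      using tot[OF pq] pq unfolding P_def by (metis order_refl)
     have "u (a + b) \<le> r (a + b)" by (rule le[OF r(1)])
     also have "\<dots> \<le> r a + r b" using sc[OF r(1)] by (simp add: sublinear_def)
     also have "\<dots> \<le> p a + q b" using r by (simp add: add_mono)
     finally show ?thesis by simp
    qed
    then have "u (a + b) - p a \<le> u b" if "p \<in> C" for p
     using that by (intro ge) auto
    then have "u (a + b) - u b \<le> u a"
     by (intro ge) (force simp: algebra_simps)
    then show "u (a + b) \<le> u a + u b" by simp
   next
    fix t :: real and x assume t: "t \<ge> 0"
    have hom: "q (t *\<^sub>R x) = t * q x" if "q \<in> C" for q
     using sc[OF that] t by (simp add: sublinear_def)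
    show "u (t *\<^sub>R x) = t * u x"
    proof (rule antisym)
     show "t * u x \<le> u (t *\<^sub>R x)"
      by (rule ge) (simp add: hom le mult_left_mono t)
     show "u (t *\<^sub>R x) \<le> t * u x"
     proof (cases "t = 0")
      case True
      obtain q where "q \<in> C" using False by auto
      then show ?thesis using le[of q "t *\<^sub>R x"] hom[of q] True by simp
     next
      case False
      then have "u (t *\<^sub>R x) / t \<le> u x"
       by (intro ge) (use t le hom in \<open>fastforce simp: field_simps\<close>)
      then show ?thesis using False t by (simp add: field_simps)
     qed
    qed
   qed
   moreover have "u x \<le> q0 x" for x
   proof -
    obtain q where "q \<in> C" using False by auto
    then show ?thesis using le[of q x] CA unfolding A_def by (smt (verit) mem_Collect_eq subsetD)
   qed
   ultimately have "u \<in> A" by (simp add: A_def)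
   then show ?thesis using le by (auto simp: P_def)
  qed
 qed
 then obtain m where m: "m \<in> A" "\<And>a. a \<in> A \<Longrightarrow> P m a \<Longrightarrow> a = m" by blast
 show thesis
 proof (rule that[of m])
  fix p assume p: "sublinear p" "\<And>x. p x \<le> m x"
  then have "p \<in> A" using m(1) unfolding A_def by (auto intro: order_trans)
  then show "p = m" using m(2) p(2) by (simp add: P_def)
 qed (use m(1) in \<open>auto simp: A_def\<close>)
qed

text \<open>The Hahn--Banach theorem in the form in which it turns statements on vectors into
 statements on complex numbers.\<close>

theorem norming_functional_exists:
 fixes v :: "'a::complex_banach"
 obtains l where "contractive l" "l v = of_real (norm v)"
proof -
 have norm_sub: "sublinear (norm :: 'a \<Rightarrow> real)"
  by (simp add: sublinear_def norm_triangle_ineq)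
 \<comment> \<open>The value at \<open>- v\<close> is at most \<open>- norm v\<close>, which forces a minimal functional to attain the norm at \<open>v\<close>.\<close>
 define q0 where "q0 x = (INF t\<in>{0..}. norm (x + t *\<^sub>R v) - t * norm v)" for x
 note q0 = sublinear_shift[OF norm_sub, where y = v, folded q0_def]
 obtain u where u: "sublinear u" "\<And>x. u x \<le> q0 x"
   and min: "\<And>p. sublinear p \<Longrightarrow> (\<And>x. p x \<le> u x) \<Longrightarrow> p = u"
  using minimal_sublinear_exists[OF q0(1)] by blast
 have neg: "u (- y) = - u y" for y
 proof -
  have eq: "(\<lambda>x. INF t\<in>{0..}. u (x + t *\<^sub>R y) - t * u y) = u"
   by (rule min, rule sublinear_shift(1)[OF u(1)], rule sublinear_shift(2)[OF u(1)])
  have "u (- y) \<le> - u y"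
   using sublinear_shift(3)[OF u(1), where y = y] unfolding fun_cong[OF eq, of "- y"] .
  then show ?thesis using sublinear_neg_le[OF u(1), of y] by simp
 qed
 have sub: "u (a + b) \<le> u a + u b" for a b using u(1) by (simp add: sublinear_def)
 have add: "u (a + b) = u a + u b" for a b
  using sub[of "a + b" "- b"] sub[of a b] by (simp add: neg)
 have scale: "u (t *\<^sub>R x) = t * u x" for t x
 proof (cases "t \<ge> 0")
  case True then show ?thesis using u(1) by (simp add: sublinear_def)
 next
  case False
  have "0 \<le> - t \<longrightarrow> u ((- t) *\<^sub>R x) = (- t) * u x" using u(1) unfolding sublinear_def by blast
  then show ?thesis using neg[of "t *\<^sub>R x"] False by simp
 qed
 have le_norm: "u x \<le> norm x" for x by (rule order_trans[OF u(2) q0(2)])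
 have uv: "u v = norm v"
  using u(2)[of "- v"] q0(3) le_norm[of v] by (simp add: neg)
 \<comment> \<open>The complex linear functional with real part \<open>u\<close>.\<close>
 define l where "l x = Complex (u x) (- u (\<i> *\<^sub>C x))" for x
 have ladd: "l (x + y) = l x + l y" for x y
  by (simp add: l_def complex_eq_iff add scaleC_add_right)
 have diff: "u (a - b) = u a - u b" for a b using add[of a "- b"] neg[of b] by simp
 have lscale: "l (c *\<^sub>C x) = c * l x" for c x
 proof -
  have c: "c *\<^sub>C x = Re c *\<^sub>R x + Im c *\<^sub>R (\<i> *\<^sub>C x)" for c :: complex and x :: 'a
  proof -
   have "c *\<^sub>C x = (complex_of_real (Re c) + complex_of_real (Im c) * \<i>) *\<^sub>C x"
    using complex_eq[of c] by (simp add: mult.commute)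
   then show ?thesis by (simp only: scaleC_add_left scaleC_scaleC[symmetric] scaleC_of_real)
  qed
  have "\<i> *\<^sub>C c *\<^sub>C x = Re c *\<^sub>R (\<i> *\<^sub>C x) - Im c *\<^sub>R x"
   using c[of "\<i> * c" x] by (simp add: scaleC_scaleC)
  moreover have "u (Re c *\<^sub>R (\<i> *\<^sub>C x) - Im c *\<^sub>R x) = Re c * u (\<i> *\<^sub>C x) - Im c * u x"
   by (simp only: diff scale)
  moreover have "u (c *\<^sub>C x) = Re c * u x + Im c * u (\<i> *\<^sub>C x)"
   by (simp only: c[of c x] add scale)
  ultimately show ?thesis
   unfolding l_def by (simp add: complex_eq_iff)
 qed
 have lnorm: "cmod (l x) \<le> norm x" for x
 proof (cases "l x = 0")
  case False
  define c where "c = cnj (sgn (l x))"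
  have "cmod c = 1" using False by (simp add: c_def norm_sgn)
  have "c * l x = of_real (cmod (l x))"
   using False complex_norm_square[of "l x"]
   by (simp add: c_def sgn_eq field_simps power2_eq_square)
  then have "cmod (l x) = u (c *\<^sub>C x)"
   using lscale[of c x] by (simp add: l_def complex_eq_iff)
  also have "\<dots> \<le> norm x"
   using le_norm[of "c *\<^sub>C x"] \<open>cmod c = 1\<close> by (simp add: norm_scaleC)
  finally show ?thesis .
 qed simp
 have "l v = of_real (norm v)"
 proof -
  have "(norm v)\<^sup>2 + (u (\<i> *\<^sub>C v))\<^sup>2 \<le> (norm v)\<^sup>2"
   using power_mono[OF lnorm[of v] norm_ge_zero, of 2] by (simp add: cmod_power2 l_def uv)
  then have "u (\<i> *\<^sub>C v) = 0" by simp
  then show ?thesis by (simp add: l_def uv complex_eq_iff)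
 qed
 then show thesis
  using that[of l] ladd lscale lnorm by (auto simp: contractive_def)
qed

lemma norm_le_by_functionals:
 fixes v :: "'a::complex_banach"
 assumes "\<And>l. contractive l \<Longrightarrow> cmod (l v) \<le> B"
 shows "norm v \<le> B"
proof -
 obtain l where "contractive l" "l v = of_real (norm v)"
  by (rule norming_functional_exists)
 then show ?thesis using assms[of l] by simp
qed

section \<open>Circle and torus\<close>

type_synonym point = "nat \<Rightarrow> complex"

lemma borel_measurable_circle:
 assumes "continuous_on (sphere 0 1) g"
 shows "g \<in> borel_measurable circle"
 unfolding measurable_cong_sets[OF sets_circle refl]
 by (rule borel_measurable_continuous_on_restrict[OF assms])

lemma borel_measurable_haar:
 assumes "continuous_on torus g"
 shows "g \<in> borel_measurable haar"
 unfolding measurable_cong_sets[OF sets_haar refl]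
 by (rule borel_measurable_continuous_on_restrict[OF assms])

interpretation circle: prob_space circle by (rule prob_space_circle)
interpretation haar: prob_space haar by (rule prob_space_haar)
interpretation coords: product_prob_space "\<lambda>_::nat. circle" UNIV by unfold_locales

lemma measurable_coordinate_haar [measurable]: "(\<lambda>w. w j) \<in> haar \<rightarrow>\<^sub>M circle"
 unfolding haar_def by measurable

lemma distr_haar_coordinate: "distr haar circle (\<lambda>w. w j) = circle"
 unfolding haar_def by (rule coords.PiM_component) simp

lemma measurable_into_haar:
 assumes "\<And>j. (\<lambda>x. f x j) \<in> M \<rightarrow>\<^sub>M circle"
 shows "f \<in> M \<rightarrow>\<^sub>M haar"
 unfolding haar_def
 by (rule measurable_PiM_single')
  (use assms in \<open>auto simp: PiE_def extensional_def dest: measurable_space\<close>)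

lemma measurable_circle_borel [measurable]: "(\<lambda>z. z) \<in> circle \<rightarrow>\<^sub>M borel"
 by (rule borel_measurable_circle) (rule continuous_on_id)

lemma measurable_into_circle:
 assumes "f \<in> M \<rightarrow>\<^sub>M borel" "\<And>x. x \<in> space M \<Longrightarrow> cmod (f x) = 1"
 shows "f \<in> M \<rightarrow>\<^sub>M circle"
proof -
 have "f \<in> M \<rightarrow>\<^sub>M restrict_space borel (sphere 0 1)"
  by (rule measurable_restrict_space2) (use assms in auto)
 then show ?thesis by (simp add: measurable_cong_sets[OF refl sets_circle])
qed

lemma measurable_rotation_circle [measurable]:
 "cmod \<mu> = 1 \<Longrightarrow> (\<lambda>z. \<mu> * z) \<in> circle \<rightarrow>\<^sub>M circle"
 by (rule measurable_into_circle) (auto simp: space_circle norm_mult)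

lemma emeasure_lborel_translate:
 fixes X :: "real set"
 assumes "X \<in> sets borel"
 shows "emeasure lborel {x. b + x \<in> X} = emeasure lborel X"
proof -
 have "emeasure lborel X = emeasure (distr lborel borel ((+) b)) X"
  by (simp add: lborel_distr_plus)
 also have "\<dots> = emeasure lborel {x. b + x \<in> X}"
  using assms by (subst emeasure_distr) (auto simp: vimage_def)
 finally show ?thesis ..
qed

lemma emeasure_lborel_period:
 fixes P :: "real set"
 assumes P[measurable]: "P \<in> sets borel" and per: "\<And>x. x + p \<in> P \<longleftrightarrow> x \<in> P" and b: "0 \<le> b" "b \<le> p"
 shows "emeasure lborel ({b<..b + p} \<inter> P) = emeasure lborel ({0<..p} \<inter> P)"
proof -
 have "emeasure lborel ({b<..b + p} \<inter> P)
   = emeasure lborel (({b<..p} \<inter> P) \<union> ({p<..b + p} \<inter> P))"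
  by (rule arg_cong[where f = "emeasure lborel"]) (use b in auto)
 also have "\<dots> = emeasure lborel ({b<..p} \<inter> P) + emeasure lborel ({p<..b + p} \<inter> P)"
  by (rule plus_emeasure[symmetric]) auto
 also have "emeasure lborel ({p<..b + p} \<inter> P) = emeasure lborel {x. p + x \<in> {p<..b + p} \<inter> P}"
  by (rule emeasure_lborel_translate[symmetric]) auto
 also have "{x. p + x \<in> {p<..b + p} \<inter> P} = {0<..b} \<inter> P"
  using per by (auto simp: add.commute)
 also have "emeasure lborel ({b<..p} \<inter> P) + emeasure lborel ({0<..b} \<inter> P)
   = emeasure lborel (({b<..p} \<inter> P) \<union> ({0<..b} \<inter> P))"
  by (rule plus_emeasure) auto
 also have "({b<..p} \<inter> P) \<union> ({0<..b} \<inter> P) = {0<..p} \<inter> P" using b by auto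
 finally show ?thesis .
qed

lemma emeasure_circle:
 assumes "A \<in> sets circle"
 shows "emeasure circle A = emeasure lborel ({0<..2 * pi} \<inter> {\<theta>. cis \<theta> \<in> A}) / emeasure lborel {0..2 * pi}"
proof -
 have cis[measurable]: "cis \<in> borel \<rightarrow>\<^sub>M circle"
  by (rule measurable_into_circle) (auto intro!: borel_measurable_continuous_onI continuous_intros)
 have B: "{\<theta>. cis \<theta> \<in> A} \<in> sets borel"
  using measurable_sets[OF cis assms] by (simp add: vimage_def)
 have "emeasure circle A = emeasure (uniform_measure lborel {0..2 * pi}) {\<theta>. cis \<theta> \<in> A}"
  unfolding circle_def
  using assms cis by (subst emeasure_distr)
   (auto simp: sets_circle vimage_def measurable_cong_sets[OF sets_uniform_measure refl]
    measurable_cong_sets[OF refl sets_circle])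
 also have "\<dots> = emeasure lborel ({0..2 * pi} \<inter> {\<theta>. cis \<theta> \<in> A}) / emeasure lborel {0..2 * pi}"
  using B by (subst emeasure_uniform_measure) auto
 also have "emeasure lborel ({0..2 * pi} \<inter> {\<theta>. cis \<theta> \<in> A})
   = emeasure lborel ({0<..2 * pi} \<inter> {\<theta>. cis \<theta> \<in> A})"
 proof (rule emeasure_eq_AE)
  show "AE x in lborel. (x \<in> {0..2 * pi} \<inter> {\<theta>. cis \<theta> \<in> A}) = (x \<in> {0<..2 * pi} \<inter> {\<theta>. cis \<theta> \<in> A})"
   using AE_lborel_singleton[of "0::real"] by eventually_elim auto
 qed (use B in auto)
 finally show ?thesis .
qed

text \<open>Rotation by \<open>cis b\<close> is translation by \<open>b\<close> on the line, and a periodic set has the same measure in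
 every period.\<close>

lemma circle_rotation_invariant:
 assumes \<mu>: "cmod \<mu> = 1"
 shows "distr circle circle ((*) \<mu>) = circle"
proof (rule measure_eqI)
 fix A assume "A \<in> sets (distr circle circle ((*) \<mu>))"
 then have A[measurable]: "A \<in> sets circle" by simp
 define b where "b = Arg2pi \<mu>"
 have b: "0 \<le> b" "b \<le> 2 * pi" "\<mu> = cis b"
  using Arg2pi_ge_0[of \<mu>] Arg2pi_lt_2pi[of \<mu>] Arg2pi_eq[of \<mu>] \<mu> by (auto simp: b_def cis_conv_exp)
 have cis[measurable]: "cis \<in> borel \<rightarrow>\<^sub>M circle"
  by (rule measurable_into_circle) (auto intro!: borel_measurable_continuous_onI continuous_intros)
 define P where "P = {\<theta>. cis \<theta> \<in> A}"
 have P: "P \<in> sets borel"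
  using measurable_sets[OF cis A] by (simp add: vimage_def P_def)
 have B: "(*) \<mu> -` A \<inter> space circle \<in> sets circle"
  using \<mu> by (intro measurable_sets[OF _ A]) measurable
 have "emeasure (distr circle circle ((*) \<mu>)) A = emeasure circle ((*) \<mu> -` A \<inter> space circle)"
  using \<mu> by (subst emeasure_distr) auto
 also have "\<dots> = emeasure lborel ({0<..2 * pi} \<inter> {\<theta>. b + \<theta> \<in> P}) / emeasure lborel {0..2 * pi}"
  unfolding emeasure_circle[OF B] by (simp add: P_def b(3) cis_mult space_circle)
 also have "{0<..2 * pi} \<inter> {\<theta>. b + \<theta> \<in> P} = {x. b + x \<in> {b<..b + 2 * pi} \<inter> P}"
  by auto
 also have "emeasure lborel \<dots> = emeasure lborel ({b<..b + 2 * pi} \<inter> P)"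
  by (rule emeasure_lborel_translate) (use P in auto)
 also have "\<dots> = emeasure lborel ({0<..2 * pi} \<inter> P)"
  by (rule emeasure_lborel_period[OF P])
   (use b in \<open>auto simp: P_def cis_mult[symmetric] simp flip: cis_mult\<close>)
 also have "\<dots> / emeasure lborel {0..2 * pi} = emeasure circle A"
  by (simp add: emeasure_circle[OF A] P_def)
 finally show "emeasure (distr circle circle ((*) \<mu>)) A = emeasure circle A" .
qed simp

lemma measurable_rotation_haar [measurable]:
 "\<tau> \<in> torus \<Longrightarrow> (\<lambda>w j. \<tau> j * w j) \<in> haar \<rightarrow>\<^sub>M haar"
 by (intro measurable_into_haar measurable_compose[OF measurable_coordinate_haar measurable_rotation_circle])
  (auto simp: torus_def)

text \<open>A product measure is determined by its values on boxes, where the invariance of the factors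
 applies.\<close>

lemma haar_rotation_invariant:
 assumes \<tau>: "\<tau> \<in> torus"
 shows "distr haar haar (\<lambda>w j. \<tau> j * w j) = haar"
proof (rule measure_eqI_PiM_infinite[where M = "\<lambda>_. circle" and I = UNIV])
 show "finite_measure (distr haar haar (\<lambda>w j. \<tau> j * w j))"
  by (intro prob_space.finite_measure haar.prob_space_distr measurable_rotation_haar \<tau>)
 fix A :: "nat \<Rightarrow> complex set" and J :: "nat set" assume J: "finite J" and A: "\<And>j. j \<in> J \<Longrightarrow> A j \<in> sets circle"
 define A' where "A' j = (*) (\<tau> j) -` A j \<inter> space circle" for j
 have \<tau>j: "cmod (\<tau> j) = 1" for j using \<tau> by (simp add: torus_def)
 have A': "A' j \<in> sets circle" if "j \<in> J" for j
  unfolding A'_def using \<tau>j A[OF that] by (intro measurable_sets[of _ circle circle]) auto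
 have em: "emeasure circle (A' j) = emeasure circle (A j)" if "j \<in> J" for j
 proof -
  have "emeasure circle (A j) = emeasure (distr circle circle ((*) (\<tau> j))) (A j)"
   by (simp add: circle_rotation_invariant[OF \<tau>j])
  also have "\<dots> = emeasure circle (A' j)"
   unfolding A'_def using A[OF that] \<tau>j by (subst emeasure_distr) auto
  finally show ?thesis ..
 qed
 have X: "prod_emb UNIV (\<lambda>_. circle) J (Pi\<^sub>E J A) \<in> sets haar"
  unfolding haar_def using J A by (intro sets_PiM_I) auto
 have "emeasure (distr haar haar (\<lambda>w j. \<tau> j * w j)) (prod_emb UNIV (\<lambda>_. circle) J (Pi\<^sub>E J A))
   = emeasure haar ((\<lambda>w j. \<tau> j * w j) -` prod_emb UNIV (\<lambda>_. circle) J (Pi\<^sub>E J A) \<inter> space haar)"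
  using X \<tau> by (subst emeasure_distr) auto
 also have "(\<lambda>w j. \<tau> j * w j) -` prod_emb UNIV (\<lambda>_. circle) J (Pi\<^sub>E J A) \<inter> space haar
   = prod_emb UNIV (\<lambda>_. circle) J (Pi\<^sub>E J A')"
  using \<tau>j by (auto simp: prod_emb_def space_haar torus_def space_circle A'_def PiE_iff norm_mult restrict_def
    extensional_def)
 also have "emeasure haar \<dots> = (\<Prod>j\<in>J. emeasure circle (A' j))"
  unfolding haar_def by (rule coords.emeasure_PiM_emb) (use J A' in auto)
 also have "\<dots> = (\<Prod>j\<in>J. emeasure circle (A j))"
  by (rule prod.cong) (auto simp: em)
 also have "\<dots> = emeasure haar (prod_emb UNIV (\<lambda>_. circle) J (Pi\<^sub>E J A))"
  unfolding haar_def by (rule coords.emeasure_PiM_emb[symmetric]) (use J A in auto)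
 finally show "emeasure (distr haar haar (\<lambda>w j. \<tau> j * w j)) (prod_emb UNIV (\<lambda>_. circle) J (Pi\<^sub>E J A))
  = emeasure haar (prod_emb UNIV (\<lambda>_. circle) J (Pi\<^sub>E J A))" .
qed (simp_all add: haar_def)

lemma continuous_on_coordinate [continuous_intros]: "continuous_on S (\<lambda>w::nat \<Rightarrow> complex. w j)"
 by (rule continuous_on_subset[OF continuous_on_product_coordinates]) simp

text \<open>By Tychonoff's theorem.\<close>

lemma compact_torus: "compact torus"
proof -
 have "compactin (product_topology (\<lambda>_::nat. euclidean) UNIV) (PiE UNIV (\<lambda>_. sphere (0::complex) 1))"
  by (subst compactin_PiE) auto
 moreover have "PiE UNIV (\<lambda>_. sphere (0::complex) 1) = torus"
  by (auto simp: torus_def PiE_def extensional_def)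
 ultimately show ?thesis by (simp add: euclidean_product_topology)
qed

lemma integrable_haar_bounded:
 fixes g :: "point \<Rightarrow> 'b::{banach, second_countable_topology}"
 assumes "g \<in> borel_measurable haar" "\<And>w. w \<in> torus \<Longrightarrow> norm (g w) \<le> B"
 shows "integrable haar g"
 by (rule haar.integrable_const_bound[where B = B]) (use assms in \<open>auto simp: space_haar[symmetric]\<close>)


section \<open>Monomials and trigonometric polynomials\<close>

lemma monomial_superset:
 assumes "finite J" "{j. a j \<noteq> 0} \<subseteq> J"
 shows "monomial a w = (\<Prod>j\<in>J. w j powi a j)"
 unfolding monomial_def using assms by (intro prod.mono_neutral_left) auto

lemma Z_fin_add: "a \<in> Z_fin \<Longrightarrow> \<beta> \<in> Z_fin \<Longrightarrow> (\<lambda>j. a j + \<beta> j) \<in> Z_fin"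
 unfolding Z_fin_def by (auto elim: finite_subset[rotated] intro: finite_subset[of _ "{j. a j \<noteq> 0} \<union> {j. \<beta> j \<noteq> 0}"])

lemma Z_fin_uminus: "a \<in> Z_fin \<Longrightarrow> (\<lambda>j. - a j) \<in> Z_fin"
 by (simp add: Z_fin_def)

lemma Z_fin_diff: "a \<in> Z_fin \<Longrightarrow> \<beta> \<in> Z_fin \<Longrightarrow> (\<lambda>j. a j - \<beta> j) \<in> Z_fin"
 using Z_fin_add[OF _ Z_fin_uminus, of a \<beta>] by simp

lemma monomial_zero [simp]: "monomial (\<lambda>_. 0) w = 1"
 by (simp add: monomial_def)

lemma monomial_add:
 assumes "a \<in> Z_fin" "\<beta> \<in> Z_fin" "w \<in> torus"
 shows "monomial (\<lambda>j. a j + \<beta> j) w = monomial a w * monomial \<beta> w"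
proof -
 let ?J = "{j. a j \<noteq> 0} \<union> {j. \<beta> j \<noteq> 0}"
 have fin: "finite ?J" using assms by (simp add: Z_fin_def)
 have "w j \<noteq> 0" for j using assms(3) by (auto simp: torus_def dest: spec[of _ j])
 then show ?thesis
  using fin by (subst (1 2 3) monomial_superset[of ?J]) (auto simp: power_int_add prod.distrib)
qed

lemma monomial_mult_arg: "monomial a (\<lambda>j. \<tau> j * w j) = monomial a \<tau> * monomial a w"
 by (simp add: monomial_def power_int_mult_distrib prod.distrib)

lemma torus_nonzero: "w \<in> torus \<Longrightarrow> w j \<noteq> 0"
proof
 assume v: "w \<in> torus" and z: "w j = 0"
 have "cmod (w j) = 1" using v by (simp add: torus_def)
 then show False using z by simp
qed

lemma norm_monomial: "w \<in> torus \<Longrightarrow> cmod (monomial a w) = 1"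
 by (simp add: monomial_def prod_norm[symmetric] norm_power_int torus_def)

lemma cnj_monomial: "w \<in> torus \<Longrightarrow> cnj (monomial a w) = monomial (\<lambda>j. - a j) w"
proof -
 assume v: "w \<in> torus"
 have "cnj (w j) = inverse (w j)" for j
  using v by (intro inverse_unique[symmetric]) (simp add: torus_def complex_norm_square[symmetric] mult.commute)
 then show ?thesis
  by (simp add: monomial_def power_int_minus power_int_inverse)
qed

lemma monomial_diff:
 assumes "a \<in> Z_fin" "\<beta> \<in> Z_fin" "w \<in> torus"
 shows "monomial (\<lambda>j. a j - \<beta> j) w = monomial a w * cnj (monomial \<beta> w)"
 using monomial_add[OF assms(1) Z_fin_uminus[OF assms(2)] assms(3)] assms(3) by (simp add: cnj_monomial)

lemma torus_mult: "\<tau> \<in> torus \<Longrightarrow> w \<in> torus \<Longrightarrow> (\<lambda>j. \<tau> j * w j) \<in> torus"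
 by (simp add: torus_def norm_mult)

lemma torus_cnj: "w \<in> torus \<Longrightarrow> (\<lambda>j. cnj (w j)) \<in> torus"
 by (simp add: torus_def)

lemma monomial_cnj_arg: "w \<in> torus \<Longrightarrow> monomial a (\<lambda>j. cnj (w j)) = cnj (monomial a w)"
 by (simp add: monomial_def)

lemma continuous_on_monomial: "continuous_on torus (monomial a)"
 unfolding monomial_def
 by (intro continuous_intros) (auto dest: torus_nonzero)

lemma borel_measurable_monomial [measurable]: "monomial a \<in> borel_measurable haar"
 by (rule borel_measurable_haar[OF continuous_on_monomial])

lemma integrable_monomial: "integrable haar (monomial a)"
 by (rule integrable_haar_bounded[where B = 1]) (auto simp: norm_monomial)

text \<open>Rotating one coordinate by a suitable angle changes the sign of the monomial, but not
 the measure.\<close>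

lemma integral_monomial:
 assumes "a \<in> Z_fin"
 shows "integral\<^sup>L haar (monomial a) = (if a = (\<lambda>_. 0) then 1 else 0)"
proof (cases "a = (\<lambda>_. 0)")
 case True
 have "monomial (\<lambda>_. 0) = (\<lambda>_. 1)" by (simp add: fun_eq_iff)
 then show ?thesis using True by (simp add: haar.prob_space)
next
 case False
 then obtain i where i: "a i \<noteq> 0" by auto
 define \<tau> where "\<tau> j = (if j = i then cis (pi / of_int (a i)) else 1)" for j
 have \<tau>: "\<tau> \<in> torus" by (simp add: \<tau>_def torus_def)
 have "monomial a \<tau> = (\<Prod>j | a j \<noteq> 0. if j = i then -1 else 1)"
  unfolding monomial_def
  by (rule prod.cong) (use i in \<open>auto simp: \<tau>_def cis_power_int\<close>)
 also have "\<dots> = -1"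
  using assms i by (simp add: Z_fin_def prod.delta)
 finally have m: "monomial a \<tau> = -1" .
 have "integral\<^sup>L haar (monomial a) = integral\<^sup>L (distr haar haar (\<lambda>w j. \<tau> j * w j)) (monomial a)"
  by (simp add: haar_rotation_invariant[OF \<tau>])
 also have "\<dots> = integral\<^sup>L haar (\<lambda>w. monomial a (\<lambda>j. \<tau> j * w j))"
  using \<tau> by (intro integral_distr) auto
 also have "\<dots> = - integral\<^sup>L haar (monomial a)"
  by (simp add: monomial_mult_arg m)
 finally show ?thesis using False by simp
qed

text \<open>Agreement is required only on the torus, so that products of monomials are again of this form.\<close>

inductive trig :: "(point \<Rightarrow> complex) \<Rightarrow> bool" where
 trig_monomial: "a \<in> Z_fin \<Longrightarrow> (\<And>w. w \<in> torus \<Longrightarrow> t w = c * monomial a w) \<Longrightarrow> trig t"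
| trig_add: "trig s \<Longrightarrow> trig t \<Longrightarrow> (\<And>w. w \<in> torus \<Longrightarrow> u w = s w + t w) \<Longrightarrow> trig u"

lemma trig_mult:
 assumes "trig s" "trig t" "\<And>w. w \<in> torus \<Longrightarrow> u w = s w * t w"
 shows "trig u"
 using assms(1,3)
proof (induction s arbitrary: u rule: trig.induct)
 case (trig_monomial a s c)
 from assms(2) trig_monomial(3) show ?case
 proof (induction t arbitrary: u rule: trig.induct)
  case (trig_monomial \<beta> t d)
  show ?case
   by (rule trig.trig_monomial[of "\<lambda>j. a j + \<beta> j" _ "c * d"])
    (use trig_monomial \<open>a \<in> Z_fin\<close> \<open>\<And>w. w \<in> torus \<Longrightarrow> s w = c * monomial a w\<close>
     in \<open>auto simp: Z_fin_add monomial_add\<close>)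
 next
  case (trig_add t1 t2 t)
  have "trig (\<lambda>w. s w * t1 w)" "trig (\<lambda>w. s w * t2 w)" using trig_add by auto
  then show ?case
   by (rule trig.trig_add) (use trig_add in \<open>auto simp: distrib_left\<close>)
 qed
next
 case (trig_add s1 s2 s)
 have "trig (\<lambda>w. s1 w * t w)" "trig (\<lambda>w. s2 w * t w)" using trig_add by auto
 then show ?case
  by (rule trig.trig_add) (use trig_add in \<open>auto simp: distrib_right\<close>)
qed

lemma trig_const: "trig (\<lambda>_. c)"
 by (rule trig_monomial[of "\<lambda>_. 0" _ c]) (auto simp: Z_fin_def)

lemma trig_coordinate: "trig (\<lambda>w. w j)" "trig (\<lambda>w. cnj (w j))"
proof -
 have 1: "monomial (\<lambda>i. if i = j then 1 else 0) w = w j" for w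
  by (simp add: monomial_superset[of "{j}"])
 show "trig (\<lambda>w. w j)"
  by (rule trig_monomial[of "\<lambda>i. if i = j then 1 else 0" _ 1]) (auto simp: Z_fin_def 1)
 show "trig (\<lambda>w. cnj (w j))"
  by (rule trig_monomial[of "\<lambda>i. - (if i = j then 1 else 0)" _ 1])
   (auto simp: Z_fin_def cnj_monomial[symmetric] 1)
qed

text \<open>The Stone--Weierstrass theorem: real trigonometric polynomials separate the points of the torus
 by the real and imaginary parts of the coordinates.\<close>

theorem trig_dense:
 fixes u :: "point \<Rightarrow> real"
 assumes "continuous_on torus u" "\<epsilon> > 0"
 obtains t where "trig (\<lambda>w. of_real (t w))" "continuous_on torus t"
  "\<And>w. w \<in> torus \<Longrightarrow> \<bar>u w - t w\<bar> < \<epsilon>"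
proof -
 define P where "P = (\<lambda>t :: point \<Rightarrow> real. trig (\<lambda>w. of_real (t w)) \<and> continuous_on torus t)"
 have "\<exists>t. P t \<and> (\<forall>w\<in>torus. \<bar>u w - t w\<bar> < \<epsilon>)"
 proof (rule Stone_Weierstrass_HOL[OF compact_torus _ _ _ _ _ assms])
  show "P (\<lambda>x. c)" for c by (simp add: P_def trig_const)
  show "continuous_on torus f" if "P f" for f using that by (simp add: P_def)
  show "P (\<lambda>x. f x + g x)" if "P f \<and> P g" for f g
   using that by (auto simp: P_def intro: trig_add[of "\<lambda>x. of_real (f x)" "\<lambda>x. of_real (g x)"] continuous_intros)
  show "P (\<lambda>x. f x * g x)" if "P f \<and> P g" for f g
   using that by (auto simp: P_def intro: trig_mult[of "\<lambda>x. of_real (f x)" "\<lambda>x. of_real (g x)"] continuous_intros)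
  show "\<exists>f. P f \<and> f x \<noteq> f y" if xy: "x \<in> torus \<and> y \<in> torus \<and> x \<noteq> y" for x y
  proof -
   obtain j where j: "x j \<noteq> y j" using xy by auto
   have "trig (\<lambda>w. of_real (Re (w j)))"
   proof (rule trig_mult[OF trig_const[of "1/2"]])
    show "trig (\<lambda>w. w j + cnj (w j))"
     by (rule trig_add[OF trig_coordinate]) auto
   qed (simp add: complex_add_cnj)
   then have 1: "P (\<lambda>w. Re (w j))"
    by (auto simp: P_def intro!: continuous_intros)
   have "trig (\<lambda>w. of_real (Im (w j)))"
   proof (rule trig_mult[OF trig_const[of "1 / (2 * \<i>)"]])
    have "trig (\<lambda>w. (- 1) * cnj (w j))"
     by (rule trig_mult[OF trig_const[of "-1"] trig_coordinate(2)[of j]]) simp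
    then show "trig (\<lambda>w. w j + (- 1) * cnj (w j))"
     by (rule trig_add[OF trig_coordinate(1)[of j]]) simp
   qed (simp add: complex_eq_iff)
   then have 2: "P (\<lambda>w. Im (w j))"
    by (auto simp: P_def intro!: continuous_intros)
   have "Re (x j) \<noteq> Re (y j) \<or> Im (x j) \<noteq> Im (y j)" using j by (simp add: complex_eq_iff)
   then show ?thesis
   proof
    assume "Re (x j) \<noteq> Re (y j)"
    then show ?thesis using 1 by (intro exI[of _ "\<lambda>w. Re (w j)"]) simp
   next
    assume "Im (x j) \<noteq> Im (y j)"
    then show ?thesis using 2 by (intro exI[of _ "\<lambda>w. Im (w j)"]) simp
   qed
  qed
 qed
 then show thesis using that by (auto simp: P_def)
qed

text \<open>Every continuous real function on the circle is nearly the real part of an entire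
 function: the negative powers in a trigonometric polynomial can be conjugated away.\<close>

theorem entire_real_part_dense:
 fixes u :: "complex \<Rightarrow> real"
 assumes "continuous_on (sphere 0 1) u" "\<epsilon> > 0"
 obtains p where "p holomorphic_on UNIV" "\<And>z. cmod z = 1 \<Longrightarrow> u z \<le> Re (p z) \<and> Re (p z) \<le> u z + \<epsilon>"
proof -
 have "continuous_on torus (\<lambda>w. u (w 0) + \<epsilon> / 2)"
  by (intro continuous_intros continuous_on_compose2[OF assms(1)])
   (auto simp: torus_def)
 then obtain t where t: "trig (\<lambda>w. of_real (t w))"
   "\<And>w. w \<in> torus \<Longrightarrow> \<bar>u (w 0) + \<epsilon> / 2 - t w\<bar> < \<epsilon> / 2"
  using trig_dense[of "\<lambda>w. u (w 0) + \<epsilon> / 2" "\<epsilon> / 2"] assms(2) by auto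
 define \<iota> where "\<iota> z = (\<lambda>j::nat. if j = 0 then z else 1 :: complex)" for z
 have \<iota>: "\<iota> z \<in> torus" if "cmod z = 1" for z using that by (auto simp: \<iota>_def torus_def)
 have "\<exists>p. p holomorphic_on UNIV \<and> (\<forall>z. cmod z = 1 \<longrightarrow> Re (s (\<iota> z)) = Re (p z))" if "trig s" for s
  using that
 proof (induction rule: trig.induct)
  case (trig_monomial a t c)
  have fin: "finite {j. a j \<noteq> 0}" using trig_monomial(1) by (simp add: Z_fin_def)
  have mono: "monomial a (\<iota> z) = z powi a 0" for z
  proof -
   have "monomial a (\<iota> z) = (\<Prod>j\<in>insert 0 {j. a j \<noteq> 0}. \<iota> z j powi a j)"
    by (rule monomial_superset) (use fin in auto)
   also have "\<dots> = (\<Prod>j\<in>insert 0 {j. a j \<noteq> 0}. if j = 0 then z powi a 0 else 1)"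
    by (rule prod.cong) (auto simp: \<iota>_def)
   also have "\<dots> = z powi a 0"
    using fin by (subst prod.delta) auto
   finally show ?thesis .
  qed
  show ?case
  proof (cases "a 0 \<ge> 0")
   case True
   then have "z powi a 0 = z ^ nat (a 0)" for z :: complex by (simp add: power_int_def)
   then show ?thesis
    by (intro exI[of _ "\<lambda>z. c * z ^ nat (a 0)"])
     (auto simp: trig_monomial(2) \<iota> mono intro!: holomorphic_intros)
  next
   case False
   have "Re (c * z powi a 0) = Re (cnj c * z ^ nat (- a 0))" if z: "cmod z = 1" for z
   proof -
    have "z \<noteq> 0" using z by auto
    have "inverse z = cnj z"
     using z by (intro inverse_unique) (simp add: complex_norm_square[symmetric])
    then have "z powi a 0 = cnj (z ^ nat (- a 0))"
     using False by (simp add: power_int_def)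
    then have "c * z powi a 0 = cnj (cnj c * z ^ nat (- a 0))" by simp
    then show ?thesis by (metis complex_cnj(1) complex.sel(1) cnj.sel(1))
   qed
   then show ?thesis
    by (intro exI[of _ "\<lambda>z. cnj c * z ^ nat (- a 0)"])
     (auto simp: trig_monomial(2) \<iota> mono intro!: holomorphic_intros)
  qed
 next
  case (trig_add s t u)
  then obtain p q where "p holomorphic_on UNIV" "q holomorphic_on UNIV"
   "\<And>z. cmod z = 1 \<Longrightarrow> Re (s (\<iota> z)) = Re (p z)" "\<And>z. cmod z = 1 \<Longrightarrow> Re (t (\<iota> z)) = Re (q z)"
   by blast
  then show ?case
   by (intro exI[of _ "\<lambda>z. p z + q z"]) (auto simp: trig_add \<iota> intro!: holomorphic_intros)
 qed
 from this[OF t(1)] obtain p where p: "p holomorphic_on UNIV" "\<And>z. cmod z = 1 \<Longrightarrow> t (\<iota> z) = Re (p z)"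
  by auto
 show thesis
 proof (rule that[OF p(1)])
  fix z :: complex assume z: "cmod z = 1"
  show "u z \<le> Re (p z) \<and> Re (p z) \<le> u z + \<epsilon>"
  proof -
   have "\<bar>u z + \<epsilon> / 2 - Re (p z)\<bar> < \<epsilon> / 2"
    using t(2)[OF \<iota>[OF z]] p(2)[OF z] by (simp add: \<iota>_def)
   then show ?thesis by linarith
  qed
 qed
qed

section \<open>The maximal ergodic inequality\<close>

fun max_partial_sum :: "('b \<Rightarrow> 'b) \<Rightarrow> ('b \<Rightarrow> real) \<Rightarrow> nat \<Rightarrow> 'b \<Rightarrow> real" where
 "max_partial_sum T h 0 x = 0"
| "max_partial_sum T h (Suc N) x = max 0 (h x + max_partial_sum T h N (T x))"

lemma partial_sum_le_max: "k \<le> N \<Longrightarrow> (\<Sum>j<k. h ((T ^^ j) x)) \<le> max_partial_sum T h N x"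
proof (induction N arbitrary: k x)
 case (Suc N)
 show ?case
 proof (cases k)
  case (Suc k')
  have "(\<Sum>j<k. h ((T ^^ j) x)) = h x + (\<Sum>j<k'. h ((T ^^ j) (T x)))"
   unfolding Suc sum.lessThan_Suc_shift by (simp add: funpow_swap1)
  then show ?thesis using Suc.IH[of k' "T x"] Suc.prems Suc by simp
 qed simp
qed simp

lemma max_partial_sum_pos:
 assumes "max_partial_sum T h N x > 0"
 shows "\<exists>k\<in>{1..N}. (\<Sum>j<k. h ((T ^^ j) x)) > 0"
proof -
 have "\<exists>k\<le>N. max_partial_sum T h N x = (\<Sum>j<k. h ((T ^^ j) x))"
 proof (induction N arbitrary: x)
  case (Suc N)
  obtain k where k: "k \<le> N" "max_partial_sum T h N (T x) = (\<Sum>j<k. h ((T ^^ j) (T x)))"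
   using Suc by blast
  have "h x + max_partial_sum T h N (T x) = (\<Sum>j<Suc k. h ((T ^^ j) x))"
   unfolding k(2) sum.lessThan_Suc_shift by (simp add: funpow_swap1)
  then show ?case
   by (cases "h x + max_partial_sum T h N (T x) \<le> 0")
    (use k(1) in \<open>auto simp: max_def intro: exI[of _ 0] exI[of _ "Suc k"]\<close>)
 qed (auto intro: exI[of _ 0])
 then obtain k where "k \<le> N" "max_partial_sum T h N x = (\<Sum>j<k. h ((T ^^ j) x))" by blast
 moreover from this assms have "k \<noteq> 0" by (cases k) auto
 ultimately show ?thesis using assms by (intro bexI[of _ k]) auto
qed

lemma max_partial_sum_nonneg: "0 \<le> max_partial_sum T h N x"
 by (cases N) auto

lemma max_partial_sum_mono: "max_partial_sum T h N x \<le> max_partial_sum T h (Suc N) x"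
proof (induction N arbitrary: x)
 case (Suc N)
 have "max 0 (h x + max_partial_sum T h N (T x)) \<le> max 0 (h x + max_partial_sum T h (Suc N) (T x))"
  using Suc.IH[of "T x"] by (intro max.mono add_left_mono) auto
 then show ?case
  by (simp only: max_partial_sum.simps(2)[of T h N x] max_partial_sum.simps(2)[of T h "Suc N" x])
qed simp

definition max_average :: "('b \<Rightarrow> 'b) \<Rightarrow> ('b \<Rightarrow> real) \<Rightarrow> nat \<Rightarrow> 'b \<Rightarrow> real" where
 "max_average T g N x = Max ((\<lambda>k. (\<Sum>j<k. g ((T ^^ j) x)) / real k) ` {1..N})"

lemma average_le_max_average:
 "k \<in> {1..N} \<Longrightarrow> (\<Sum>j<k. g ((T ^^ j) x)) \<le> real k * max_average T g N x"
proof -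
 assume k: "k \<in> {1..N}"
 then have "(\<Sum>j<k. g ((T ^^ j) x)) / real k \<le> max_average T g N x"
  unfolding max_average_def by (intro Max_ge) auto
 then show ?thesis using k by (simp add: field_simps)
qed

locale measure_preserving = prob_space +
 fixes T :: "'a \<Rightarrow> 'a"
 assumes measurable_T [measurable]: "T \<in> M \<rightarrow>\<^sub>M M" and distr_T: "distr M M T = M"
begin

lemma measurable_funpow [measurable]: "T ^^ j \<in> M \<rightarrow>\<^sub>M M"
 by (induction j) (auto intro: measurable_comp simp: id_def)

lemma measurable_max_partial_sum [measurable]:
 assumes [measurable]: "h \<in> borel_measurable M"
 shows "max_partial_sum T h N \<in> borel_measurable M"
proof (induction N)
 case 0
 have "max_partial_sum T h 0 = (\<lambda>_. 0)" by auto
 then show ?case by simp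
next
 case (Suc N)
 note [measurable] = Suc
 have "max_partial_sum T h (Suc N) = (\<lambda>x. max 0 (h x + max_partial_sum T h N (T x)))" by auto
 then show ?case by simp
qed

lemma measurable_max_average [measurable]:
 assumes [measurable]: "g \<in> borel_measurable M"
 shows "max_average T g N \<in> borel_measurable M"
 unfolding max_average_def[abs_def] by measurable

lemma max_partial_sum_le:
 assumes "\<And>x. x \<in> space M \<Longrightarrow> h x \<le> B" "0 \<le> B"
 shows "x \<in> space M \<Longrightarrow> max_partial_sum T h N x \<le> real N * B"
proof (induction N arbitrary: x)
 case (Suc N)
 have "T x \<in> space M" using Suc.prems measurable_space[OF measurable_T] by blast
 then have "max_partial_sum T h N (T x) \<le> real N * B" by (rule Suc.IH)
 then show ?case using assms(1)[OF Suc.prems] assms(2) by (simp add: algebra_simps)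
qed simp

text \<open>Garsia's argument: where the maximal partial sum \<open>S\<close> is positive, \<open>h\<close> is at least
 \<open>S - S \<circ> T\<close>, and elsewhere that difference is at most \<open>0\<close>; and its integral vanishes.\<close>

lemma maximal_ergodic:
 assumes h[measurable]: "h \<in> borel_measurable M" and B: "\<And>x. x \<in> space M \<Longrightarrow> \<bar>h x\<bar> \<le> B"
 shows "0 \<le> (\<integral>x. indicator {x. max_partial_sum T h N x > 0} x * h x \<partial>M)"
proof -
 let ?S = "max_partial_sum T h N"
 obtain x0 where "x0 \<in> space M" using not_empty by blast
 then have B0: "0 \<le> B" using B[of x0] by simp
 have int_S: "integrable M ?S"
  by (rule integrable_const_bound[where B = "real N * B"])
   (use B B0 max_partial_sum_le[of h B] in \<open>auto simp: max_partial_sum_nonneg abs_le_iff\<close>)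
 have "integrable (distr M M T) ?S" using int_S by (simp add: distr_T)
 then have int_ST: "integrable M (\<lambda>x. ?S (T x))" by (subst (asm) integrable_distr_eq) auto
 have "(\<integral>x. ?S x \<partial>M) = (\<integral>x. ?S x \<partial>distr M M T)" by (simp add: distr_T)
 also have "\<dots> = (\<integral>x. ?S (T x) \<partial>M)" by (rule integral_distr) auto
 finally have "0 = (\<integral>x. ?S x - ?S (T x) \<partial>M)" using int_S int_ST by simp
 also have "\<dots> \<le> (\<integral>x. indicator {x. ?S x > 0} x * h x \<partial>M)"
 proof (rule integral_mono)
  show "integrable M (\<lambda>x. indicator {x. ?S x > 0} x * h x)"
   by (rule integrable_const_bound[where B = B])
    (use B B0 in \<open>auto simp: indicator_def\<close>)
  fix x assume "x \<in> space M"
  show "?S x - ?S (T x) \<le> indicator {x. ?S x > 0} x * h x"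
  proof (cases "?S x > 0")
   case True
   then obtain N' where N: "N = Suc N'" by (cases N) auto
   have "?S x \<le> h x + max_partial_sum T h N' (T x)" using True unfolding N by simp
   also have "max_partial_sum T h N' (T x) \<le> ?S (T x)" unfolding N by (rule max_partial_sum_mono)
   finally show ?thesis using True by simp
  next
   case False
   then show ?thesis using max_partial_sum_nonneg[of T h N "T x"] by simp
  qed
 qed (use int_S int_ST in auto)
 finally show ?thesis .
qed

text \<open>The maximal average of \<open>g\<close> exceeds \<open>a\<close> exactly where some partial sum of \<open>g - a\<close> is positive.\<close>

lemma maximal_ergodic_average:
 assumes g[measurable]: "g \<in> borel_measurable M" and B: "\<And>x. x \<in> space M \<Longrightarrow> \<bar>g x\<bar> \<le> B" and N: "N \<ge> 1"
 shows "0 \<le> (\<integral>x. indicator {x. max_average T g N x > a} x * (g x - a) \<partial>M)"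
proof -
 have sum: "(\<Sum>j<k. g ((T ^^ j) x) - a) = (\<Sum>j<k. g ((T ^^ j) x)) - real k * a" for k x
  by (simp add: sum_subtractf)
 have "max_average T g N x > a \<longleftrightarrow> max_partial_sum T (\<lambda>x. g x - a) N x > 0" for x
 proof
  assume "max_average T g N x > a"
  then obtain k where k: "k \<in> {1..N}" "(\<Sum>j<k. g ((T ^^ j) x)) / real k > a"
   unfolding max_average_def using N by (subst (asm) Max_gr_iff) auto
  then have "0 < (\<Sum>j<k. g ((T ^^ j) x) - a)" unfolding sum by (simp add: field_simps)
  also have "\<dots> \<le> max_partial_sum T (\<lambda>x. g x - a) N x"
   using k by (intro partial_sum_le_max) auto
  finally show "max_partial_sum T (\<lambda>x. g x - a) N x > 0" .
 next
  assume "max_partial_sum T (\<lambda>x. g x - a) N x > 0"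
  then obtain k where k: "k \<in> {1..N}" "(\<Sum>j<k. g ((T ^^ j) x) - a) > 0"
   using max_partial_sum_pos[of T "\<lambda>x. g x - a" N x] by auto
  then have "real k * a < (\<Sum>j<k. g ((T ^^ j) x))" unfolding sum by simp
  also have "\<dots> \<le> real k * max_average T g N x" by (rule average_le_max_average[OF k(1)])
  finally show "max_average T g N x > a" using k(1) by simp
 qed
 then show ?thesis
  using maximal_ergodic[of "\<lambda>x. g x - a" "B + \<bar>a\<bar>" N] B by (force intro: order_trans[OF abs_triangle_ineq4])
qed

end

text \<open>A Riemann sum for \<open>\<integral>\<^sub>0\<^sup>b (g - t) dt = b g - b\<^sup>2 / 2\<close>.\<close>

lemma layer_sum_le:
 fixes b g \<delta> :: real
 assumes "0 < \<delta>" "0 \<le> b" "0 \<le> g" "b \<le> real n * \<delta>"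
 shows "(\<Sum>i<n. \<delta> * (indicator {t. t < b} (real i * \<delta>) * (g - real i * \<delta>))) \<le> (b + \<delta>) * g - b * (b - \<delta>) / 2"
proof -
 define c where "c = nat \<lceil>b / \<delta>\<rceil>"
 have "0 \<le> b / \<delta>" using assms by simp
 then have c: "b / \<delta> \<le> real c" "real c < b / \<delta> + 1" unfolding c_def by linarith+
 have lt: "real i * \<delta> < b \<longleftrightarrow> i < c" for i
 proof -
  have "real i * \<delta> < b \<longleftrightarrow> real i < b / \<delta>" using assms(1) by (simp add: field_simps)
  also have "\<dots> \<longleftrightarrow> i < c" unfolding c_def by linarith
  finally show ?thesis .
 qed
 have "b / \<delta> \<le> real n" using assms by (simp add: field_simps)
 then have "c \<le> n" unfolding c_def by linarith
 have gauss: "(\<Sum>i<m. real i) = real m * (real m - 1) / 2" for m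
  by (induction m) (auto simp: field_simps)
 have "(\<Sum>i<n. \<delta> * (indicator {t. t < b} (real i * \<delta>) * (g - real i * \<delta>)))
   = (\<Sum>i<n. if i < c then \<delta> * (g - real i * \<delta>) else 0)"
  by (rule sum.cong) (auto simp: lt)
 also have "\<dots> = (\<Sum>i<c. \<delta> * (g - real i * \<delta>))"
  using \<open>c \<le> n\<close> by (intro sum.mono_neutral_cong_right) auto
 also have "\<dots> = \<delta> * (real c * g - \<delta> * (\<Sum>i<c. real i))"
  by (simp add: sum_distrib_left sum_subtractf algebra_simps)
 also have "\<dots> = (\<delta> * real c) * g - (\<delta> * real c) * (\<delta> * real c - \<delta>) / 2"
  unfolding gauss by (simp add: field_simps)
 also have "\<dots> \<le> (b + \<delta>) * g - b * (b - \<delta>) / 2"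
 proof -
  define d where "d = \<delta> * real c"
  have d: "b \<le> d" "d \<le> b + \<delta>" using c assms(1) by (auto simp: d_def field_simps)
  have "b * (b - \<delta>) \<le> d * (d - \<delta>)"
  proof (cases "c = 0")
   case True
   then have "d = 0" "b = 0" using d assms by (auto simp: d_def)
   then show ?thesis by simp
  next
   case False
   then have "\<delta> * 1 \<le> \<delta> * real c" using assms(1) by (intro mult_left_mono) auto
   then have "\<delta> \<le> d" by (simp add: d_def)
   then have "b * (b - \<delta>) \<le> b * (d - \<delta>)" "b * (d - \<delta>) \<le> d * (d - \<delta>)"
    using d assms by (auto intro: mult_left_mono mult_right_mono)
   then show ?thesis by simp
  qed
  moreover have "d * g \<le> (b + \<delta>) * g" using d assms by (intro mult_right_mono) auto
  ultimately show ?thesis unfolding d_def[symmetric] by linarith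
 qed
 finally show ?thesis .
qed

text \<open>Integrating the weak-type inequality over all levels \<open>a\<close>, discretized in steps \<open>\<delta>\<close>, bounds the integral of
 \<open>b\<^sup>2\<close> by that of \<open>2 * b * g\<close>, where \<open>b\<close> is the maximal average, and \<open>2 * b * g \<le> b\<^sup>2 / 2 + 2 * g\<^sup>2\<close>.\<close>

theorem (in measure_preserving) maximal_ergodic_L2:
 assumes g[measurable]: "g \<in> borel_measurable M" and B: "\<And>x. x \<in> space M \<Longrightarrow> 0 \<le> g x \<and> g x \<le> B" and N: "N \<ge> 1"
 shows "(\<integral>x. (max_average T g N x)\<^sup>2 \<partial>M) \<le> 4 * (\<integral>x. (g x)\<^sup>2 \<partial>M)"
proof -
 let ?b = "max_average T g N"
 have Tsp: "(T ^^ j) x \<in> space M" if "x \<in> space M" for j x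
  using that measurable_space[OF measurable_funpow] by blast
 obtain x0 where "x0 \<in> space M" using not_empty by blast
 then have B0: "0 \<le> B" using B[of x0] by simp
 have a_le: "?b x \<le> B" if "x \<in> space M" for x
  unfolding max_average_def
 proof (subst Max_le_iff)
  show "\<forall>y\<in>(\<lambda>k. (\<Sum>j<k. g ((T ^^ j) x)) / real k) ` {1..N}. y \<le> B"
  proof safe
   fix k assume k: "k \<in> {1..N}"
   have "(\<Sum>j<k. g ((T ^^ j) x)) \<le> real (card {..<k}) * B"
    by (rule sum_bounded_above) (use B Tsp[OF that] in auto)
   then show "(\<Sum>j<k. g ((T ^^ j) x)) / real k \<le> B" using k by (simp add: field_simps)
  qed
 qed (use N in auto)
 have a_ge: "0 \<le> ?b x" if "x \<in> space M" for x
 proof -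
  have "0 \<le> (\<Sum>j<1. g ((T ^^ j) x))" using B that by simp
  also have "\<dots> \<le> real 1 * ?b x" by (rule average_le_max_average) (use N in auto)
  finally show ?thesis by simp
 qed
 have bdint: "integrable M f" if "f \<in> borel_measurable M" "\<And>x. x \<in> space M \<Longrightarrow> \<bar>f x\<bar> \<le> C" for f :: "'a \<Rightarrow> real" and C
  by (rule integrable_const_bound[of f C]) (use that in auto)
 have i1: "integrable M (\<lambda>x. ?b x * g x)"
  by (rule bdint[of _ "B * B"]) (use B a_le a_ge B0 in \<open>auto simp: abs_mult intro!: mult_mono\<close>)
 have i2: "integrable M (\<lambda>x. (?b x)\<^sup>2)"
  by (rule bdint[of _ "B\<^sup>2"]) (use a_le a_ge in \<open>auto intro!: power_mono\<close>)
 have i3: "integrable M (\<lambda>x. (g x)\<^sup>2)"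
  by (rule bdint[of _ "B\<^sup>2"]) (use B in \<open>auto intro!: power_mono\<close>)
 have i4: "integrable M g" by (rule bdint[of _ B]) (use B in auto)
 have i5: "integrable M ?b" by (rule bdint[of _ B]) (use a_le a_ge in auto)
 have main: "(\<integral>x. (?b x)\<^sup>2 \<partial>M) \<le> 2 * (\<integral>x. ?b x * g x \<partial>M) + \<delta> * (3 * B)" if \<delta>: "\<delta> > 0" for \<delta>
 proof -
  obtain n :: nat where "B / \<delta> \<le> real n" using real_arch_simple by blast
  then have n: "B \<le> real n * \<delta>" using \<delta> by (simp add: field_simps)
  have ind: "indicator {x. ?b x > real i * \<delta>} x = (indicator {t. t < ?b x} (real i * \<delta>) :: real)" for i x
   by (auto simp: indicator_def)
  have ii: "integrable M (\<lambda>x. indicator {x. ?b x > real i * \<delta>} x * (g x - real i * \<delta>))" for i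
  proof (rule bdint[of _ "B + real i * \<delta>"])
   fix x assume x: "x \<in> space M"
   have "0 \<le> real i * \<delta>" using \<delta> by simp
   then have "\<bar>g x - real i * \<delta>\<bar> \<le> B + real i * \<delta>" using B[OF x] by linarith
   then show "\<bar>indicator {x. ?b x > real i * \<delta>} x * (g x - real i * \<delta>)\<bar> \<le> B + real i * \<delta>"
    using B0 \<delta> by (auto simp: indicator_def)
  qed measurable
  have "0 \<le> (\<Sum>i<n. \<delta> * (\<integral>x. indicator {x. ?b x > real i * \<delta>} x * (g x - real i * \<delta>) \<partial>M))"
   using maximal_ergodic_average[OF g, of B N] B N \<delta>
   by (intro sum_nonneg mult_nonneg_nonneg) auto
  also have "\<dots> = (\<integral>x. (\<Sum>i<n. \<delta> * (indicator {x. ?b x > real i * \<delta>} x * (g x - real i * \<delta>))) \<partial>M)"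
   using ii by simp
  also have "\<dots> \<le> (\<integral>x. (?b x + \<delta>) * g x - ?b x * (?b x - \<delta>) / 2 \<partial>M)"
  proof (rule integral_mono)
   show "integrable M (\<lambda>x. (?b x + \<delta>) * g x - ?b x * (?b x - \<delta>) / 2)"
    using i1 i2 i4 i5 by (simp add: algebra_simps power2_eq_square)
   fix x assume x: "x \<in> space M"
   show "(\<Sum>i<n. \<delta> * (indicator {x. ?b x > real i * \<delta>} x * (g x - real i * \<delta>)))
     \<le> (?b x + \<delta>) * g x - ?b x * (?b x - \<delta>) / 2"
    unfolding ind by (rule layer_sum_le) (use \<delta> a_ge[OF x] B[OF x] a_le[OF x] n in auto)
  qed (use ii in auto)
  also have "\<dots> = (\<integral>x. ?b x * g x + \<delta> * g x - (?b x)\<^sup>2 / 2 + \<delta> * ?b x / 2 \<partial>M)"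
   by (simp add: algebra_simps power2_eq_square diff_divide_distrib add_divide_distrib)
  also have "\<dots> = (\<integral>x. ?b x * g x \<partial>M) + \<delta> * (\<integral>x. g x \<partial>M) - (\<integral>x. (?b x)\<^sup>2 \<partial>M) / 2 + \<delta> * (\<integral>x. ?b x \<partial>M) / 2"
   using i1 i2 i4 i5 by simp
  finally have "(\<integral>x. (?b x)\<^sup>2 \<partial>M) \<le> 2 * (\<integral>x. ?b x * g x \<partial>M) + \<delta> * (2 * (\<integral>x. g x \<partial>M) + (\<integral>x. ?b x \<partial>M))"
   by (simp add: algebra_simps)
  moreover have "(\<integral>x. g x \<partial>M) \<le> B" "(\<integral>x. ?b x \<partial>M) \<le> B"
   using integral_mono[OF i4, of "\<lambda>_. B"] integral_mono[OF i5, of "\<lambda>_. B"] B a_le by (auto simp: prob_space)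
  then have "\<delta> * (2 * (\<integral>x. g x \<partial>M) + (\<integral>x. ?b x \<partial>M)) \<le> \<delta> * (3 * B)"
   using \<delta> by (intro mult_left_mono) auto
  ultimately show ?thesis by linarith
 qed
 have "(\<integral>x. (?b x)\<^sup>2 \<partial>M) \<le> 2 * (\<integral>x. ?b x * g x \<partial>M)"
 proof (rule field_le_epsilon)
  fix e :: real assume e: "e > 0"
  have "(\<integral>x. (?b x)\<^sup>2 \<partial>M) \<le> 2 * (\<integral>x. ?b x * g x \<partial>M) + (e / (3 * B + 1)) * (3 * B)"
   by (rule main) (use e B0 in auto)
  also have "(e / (3 * B + 1)) * (3 * B) \<le> e" using e B0 by (simp add: field_simps)
  finally show "(\<integral>x. (?b x)\<^sup>2 \<partial>M) \<le> 2 * (\<integral>x. ?b x * g x \<partial>M) + e" by simp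
 qed
 also have "\<dots> = (\<integral>x. 2 * (?b x * g x) \<partial>M)" by simp
 also have "\<dots> \<le> (\<integral>x. (?b x)\<^sup>2 / 2 + 2 * (g x)\<^sup>2 \<partial>M)"
 proof (rule integral_mono)
  fix x
  have "0 \<le> (?b x - 2 * g x)\<^sup>2" by simp
  then show "2 * (?b x * g x) \<le> (?b x)\<^sup>2 / 2 + 2 * (g x)\<^sup>2"
   by (simp add: power2_eq_square algebra_simps)
 qed (use i1 i2 i3 in auto)
 also have "\<dots> = (\<integral>x. (?b x)\<^sup>2 \<partial>M) / 2 + 2 * (\<integral>x. (g x)\<^sup>2 \<partial>M)"
  using i2 i3 by simp
 finally show ?thesis by simp
qed

lemma measure_preserving_rotation: "cmod \<mu> = 1 \<Longrightarrow> measure_preserving circle ((*) \<mu>)"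
 by unfold_locales (auto simp: circle_rotation_invariant measurable_rotation_circle)

lemma funpow_rotation: "(((*) \<mu>) ^^ j) z = \<mu> ^ j * (z::complex)"
 by (induction j) auto

section \<open>Radial maximal functions of holomorphic functions\<close>

lemma circle_integral_rotate:
 fixes u :: "complex \<Rightarrow> 'b::{banach, second_countable_topology}"
 assumes "u \<in> borel_measurable circle" "cmod \<mu> = 1"
 shows "(\<integral>z. u (\<mu> * z) \<partial>circle) = (\<integral>z. u z \<partial>circle)"
 using integral_distr[OF measurable_rotation_circle[OF assms(2)] assms(1)]
 by (simp add: circle_rotation_invariant[OF assms(2)])

lemma integrable_circle:
 fixes u :: "complex \<Rightarrow> 'b::{banach, second_countable_topology}"
 assumes "continuous_on (sphere 0 1) u"
 shows "integrable circle u"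
proof -
 have "compact (u ` sphere 0 1)" by (rule compact_continuous_image[OF assms]) simp
 then obtain B where "\<And>z. z \<in> sphere 0 1 \<Longrightarrow> norm (u z) \<le> B"
  using compact_imp_bounded bounded_iff by (metis imageI)
 then show ?thesis
  by (intro circle.integrable_const_bound[where B = B] borel_measurable_circle assms)
   (auto simp: space_circle[symmetric])
qed

lemma circle_integral_power: "(\<integral>z. z ^ n \<partial>circle) = (if n = 0 then 1 else 0)"
proof (cases "n = 0")
 case False
 define \<mu> where "\<mu> = cis (pi / real n)"
 have "\<mu> ^ n = -1" using False by (simp add: \<mu>_def Complex.DeMoivre)
 have "(\<integral>z. z ^ n \<partial>circle) = (\<integral>z. (\<mu> * z) ^ n \<partial>circle)"
  by (rule circle_integral_rotate[symmetric]) (auto simp: \<mu>_def intro!: borel_measurable_circle continuous_intros)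
 also have "\<dots> = - (\<integral>z. z ^ n \<partial>circle)" by (simp add: power_mult_distrib \<open>\<mu> ^ n = -1\<close>)
 finally show ?thesis using False by simp
qed (simp add: circle.prob_space)

text \<open>Integrate the power series termwise.\<close>

lemma circle_mean_value:
 assumes f: "f holomorphic_on ball 0 R" and R: "R > 1"
 shows "(\<integral>z. f z \<partial>circle) = f 0"
proof -
 define c where "c n = (deriv ^^ n) f 0 / fact n" for n
 have sums: "(\<lambda>n. c n * w ^ n) sums f w" if "w \<in> ball 0 R" for w
  using holomorphic_power_series[OF f that] by (simp add: c_def)
 have "summable (\<lambda>n. c n * of_real ((1 + R) / 2) ^ n)"
  by (rule sums_summable[OF sums]) (use R in \<open>simp del: of_real_divide of_real_add\<close>)
 from powser_insidea[OF this, of 1] have c: "summable (\<lambda>n. cmod (c n))" using R by (simp del: of_real_divide of_real_add)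
 have int: "integrable circle (\<lambda>z. c n * z ^ n)" for n by (intro integrable_circle continuous_intros)
 have "(\<integral>z. f z \<partial>circle) = (\<integral>z. (\<Sum>n. c n * z ^ n) \<partial>circle)"
  by (rule Bochner_Integration.integral_cong[OF refl]) (use R in \<open>auto simp: space_circle sums_unique[OF sums]\<close>)
 also have "\<dots> = (\<Sum>n. \<integral>z. c n * z ^ n \<partial>circle)"
 proof (rule integral_suminf[OF int])
  have nrm: "norm (c n * z ^ n) = cmod (c n)" if "z \<in> space circle" for z n
   using that by (simp add: space_circle norm_mult norm_power)
  then show "AE z in circle. summable (\<lambda>n. norm (c n * z ^ n))" using c by (auto simp: nrm)
  have "(\<integral>z. norm (c n * z ^ n) \<partial>circle) = (\<integral>z. cmod (c n) \<partial>circle)" for n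
   by (rule Bochner_Integration.integral_cong[OF refl]) (simp only: nrm)
  then have "(\<integral>z. norm (c n * z ^ n) \<partial>circle) = cmod (c n)" for n by (simp add: circle.prob_space)
  then show "summable (\<lambda>n. \<integral>z. norm (c n * z ^ n) \<partial>circle)" using c by simp
 qed
 also have "\<dots> = (\<Sum>n. if n = 0 then c 0 else 0)"
  by (intro suminf_cong) (simp add: circle_integral_power)
 also have "\<dots> = c 0" using suminf_finite[of "{0}" "\<lambda>n. if n = 0 then c 0 else 0"] by simp
 also have "\<dots> = f 0" by (simp add: c_def)
 finally show ?thesis .
qed

lemma circle_mean_value_entire:
 assumes "p holomorphic_on UNIV"
 shows "(\<integral>z. Re (p z) \<partial>circle) = Re (p 0)"
proof -
 have "(\<integral>z. p z \<partial>circle) = p 0"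
  by (rule circle_mean_value[of p 2]) (use assms holomorphic_on_subset in auto)
 moreover have "integrable circle p"
  by (rule integrable_circle, rule holomorphic_on_imp_continuous_on, rule holomorphic_on_subset[OF assms]) simp
 ultimately show ?thesis by (metis integral_Re)
qed

text \<open>The mean of \<open>u\<close> over the rotations of a point by \<open>n\<close>th roots of unity is invariant under these roots,
 hence almost constant, and its integral is that of \<open>u\<close>.\<close>

lemma riemann_sum_circle:
 fixes u :: "complex \<Rightarrow> real"
 assumes u: "continuous_on (sphere 0 1) u"
 shows "(\<lambda>n. (\<Sum>j<n. u (cis (2 * pi / real n) ^ j)) / real n) \<longlonglongrightarrow> (\<integral>z. u z \<partial>circle)"
proof (rule LIMSEQ_I)
 fix e :: real assume e: "e > 0"
 have "uniformly_continuous_on (sphere 0 1) u" by (rule compact_uniformly_continuous[OF u]) simp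
 then obtain d where d: "d > 0"
  "\<And>z w. z \<in> sphere 0 1 \<Longrightarrow> w \<in> sphere 0 1 \<Longrightarrow> dist w z < d \<Longrightarrow> dist (u w) (u z) < e / 2"
  unfolding uniformly_continuous_on_def using e by (metis half_gt_zero)
 obtain n0 :: nat where n0: "2 * pi / d < real n0" using reals_Archimedean2 by blast
 show "\<exists>n0. \<forall>n\<ge>n0. norm ((\<Sum>j<n. u (cis (2 * pi / real n) ^ j)) / real n - (\<integral>z. u z \<partial>circle)) < e"
 proof (intro exI allI impI)
  fix n assume n: "n \<ge> n0"
  have "0 < 2 * pi / d" using d(1) by simp
  moreover have large: "2 * pi / d < real n" using n0 n by linarith
  ultimately have n_pos: "real n > 0" by linarith
  then have nd: "2 * pi / real n < d" using large d(1) by (simp add: field_simps)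
  define \<eta> where "\<eta> = cis (2 * pi / real n)"
  have \<eta>: "cmod \<eta> = 1" "\<eta> ^ n = 1" using n_pos by (auto simp: \<eta>_def Complex.DeMoivre)
  define A where "A \<zeta> = (\<Sum>j<n. u (\<eta> ^ j * \<zeta>)) / real n" for \<zeta>
  have shift: "A (\<eta> ^ i * \<zeta>) = A \<zeta>" for i \<zeta>
  proof (induction i)
   case (Suc i)
   let ?f = "\<lambda>j. u (\<eta> ^ j * (\<eta> ^ i * \<zeta>))"
   have "(\<Sum>j<n. ?f (Suc j)) + ?f 0 = (\<Sum>j<n. ?f j) + ?f n"
    using sum.lessThan_Suc_shift[of ?f n] by simp
   then have "(\<Sum>j<n. u (\<eta> ^ j * (\<eta> ^ Suc i * \<zeta>))) = (\<Sum>j<n. ?f j)"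
    by (simp add: \<eta>(2) mult_ac)
   then show ?case using Suc by (simp add: A_def)
  qed simp
  have close: "\<bar>A \<zeta> - A 1\<bar> \<le> e / 2" if \<zeta>: "cmod \<zeta> = 1" for \<zeta>
  proof -
   define \<theta> where "\<theta> = Arg2pi \<zeta>"
   have \<theta>: "0 \<le> \<theta>" "\<zeta> = cis \<theta>"
    using Arg2pi_ge_0[of \<zeta>] Arg2pi_eq[of \<zeta>] \<zeta> by (auto simp: \<theta>_def cis_conv_exp)
   define i where "i = nat \<lfloor>real n * \<theta> / (2 * pi)\<rfloor>"
   have "0 \<le> real n * \<theta> / (2 * pi)" using \<theta> by simp
   then have i: "real i \<le> real n * \<theta> / (2 * pi)" "real n * \<theta> / (2 * pi) < real i + 1"
    unfolding i_def by linarith+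
   define t where "t = \<theta> - 2 * pi * real i / real n"
   have t: "0 \<le> t" "t \<le> 2 * pi / real n"
   proof -
    have "2 * pi * real i / real n \<le> \<theta>" "\<theta> \<le> 2 * pi * (real i + 1) / real n"
     using i n_pos by (simp_all add: field_simps)
    then show "0 \<le> t" "t \<le> 2 * pi / real n"
     by (simp_all add: t_def distrib_left add_divide_distrib)
   qed
   have "\<zeta> = \<eta> ^ i * cis t"
    using n_pos by (simp add: \<theta>(2) \<eta>_def Complex.DeMoivre cis_mult t_def mult_ac)
   then have "A \<zeta> = A (cis t)" by (simp add: shift)
   have "cmod (cis t - 1) = 2 * \<bar>sin (t / 2)\<bar>"
    using dist_exp_i_1[of t] by (simp add: cis_conv_exp)
   also have "\<dots> \<le> t" using abs_sin_x_le_abs_x[of "t / 2"] t by simp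
   finally have "dist (cis t) 1 < d" using t nd by (simp add: dist_norm)
   then have "dist (\<eta> ^ j * cis t) (\<eta> ^ j * 1) < d" for j
    using \<eta>(1) by (simp add: dist_norm right_diff_distrib[symmetric] norm_mult norm_power flip: right_diff_distrib mult_1_right)
   then have "\<bar>u (\<eta> ^ j * cis t) - u (\<eta> ^ j * 1)\<bar> < e / 2" for j
    using d(2)[of "\<eta> ^ j * 1" "\<eta> ^ j * cis t"] \<eta>(1) by (simp add: norm_mult norm_power dist_real_def)
   then have "\<bar>\<Sum>j<n. u (\<eta> ^ j * cis t) - u (\<eta> ^ j * 1)\<bar> \<le> real (card {..<n}) * (e / 2)"
    by (intro order_trans[OF sum_abs] sum_bounded_above) (auto intro: less_imp_le)
   then have "\<bar>A (cis t) - A 1\<bar> \<le> e / 2"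
    using n_pos unfolding A_def by (simp add: sum_subtractf field_simps flip: diff_divide_distrib)
   then show ?thesis using \<open>A \<zeta> = A (cis t)\<close> by simp
  qed
  have cont: "continuous_on (sphere 0 1) (\<lambda>\<zeta>. u (\<eta> ^ j * \<zeta>))" for j
   by (rule continuous_on_compose2[OF u]) (use \<eta> in \<open>auto simp: norm_mult norm_power intro!: continuous_intros\<close>)
  have intA: "integrable circle A"
   unfolding A_def using cont by (intro integrable_circle continuous_intros) (use n_pos in auto)
  have "(\<integral>\<zeta>. A \<zeta> \<partial>circle) = (\<Sum>j<n. \<integral>\<zeta>. u (\<eta> ^ j * \<zeta>) \<partial>circle) / real n"
   unfolding A_def using integrable_circle[OF cont] by simp
  also have "\<dots> = (\<integral>z. u z \<partial>circle)"
   using n_pos \<eta>(1) by (simp add: circle_integral_rotate borel_measurable_circle[OF u] norm_power)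
  finally have "A 1 - (\<integral>z. u z \<partial>circle) = (\<integral>\<zeta>. A 1 - A \<zeta> \<partial>circle)"
   using intA by (simp add: circle.prob_space)
  also have "\<bar>\<dots>\<bar> \<le> (\<integral>\<zeta>. \<bar>A 1 - A \<zeta>\<bar> \<partial>circle)" using intA by (intro integral_abs_bound)
  also have "\<dots> \<le> (\<integral>\<zeta>. e / 2 \<partial>circle)"
   using intA close by (intro integral_mono) (auto simp: space_circle abs_minus_commute)
  also have "\<dots> < e" using e by (simp add: circle.prob_space)
  finally show "norm ((\<Sum>j<n. u (cis (2 * pi / real n) ^ j)) / real n - (\<integral>z. u z \<partial>circle)) < e"
   by (simp add: A_def \<eta>_def)
 qed
qed

text \<open>Compare \<open>poisson_cis\<close> for the usual formula.\<close>

definition poisson :: "real \<Rightarrow> complex \<Rightarrow> real" where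
 "poisson \<rho> z = (1 - \<rho>\<^sup>2) / (cmod (1 - of_real \<rho> * z))\<^sup>2"

lemma poisson_denominator_nonzero:
 assumes "0 \<le> \<rho>" "\<rho> < 1" "cmod z = 1"
 shows "1 - of_real \<rho> * z \<noteq> 0"
proof
 assume "1 - of_real \<rho> * z = 0"
 then have "cmod (of_real \<rho> * z) = 1" by simp
 then show False using assms by (simp add: norm_mult)
qed

lemma poisson_nonneg: "0 \<le> \<rho> \<Longrightarrow> \<rho> < 1 \<Longrightarrow> 0 \<le> poisson \<rho> z"
 unfolding poisson_def by (intro divide_nonneg_nonneg) (auto simp: power_le_one)

lemma continuous_on_poisson:
 assumes "0 \<le> \<rho>" "\<rho> < 1"
 shows "continuous_on (sphere 0 1) (poisson \<rho>)"
 unfolding poisson_def using poisson_denominator_nonzero[OF assms]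
 by (intro continuous_intros) auto

lemma poisson_cis: "poisson \<rho> (cis t) = (1 - \<rho>\<^sup>2) / (1 + \<rho>\<^sup>2 - 2 * \<rho> * cos t)"
proof -
 have "(cmod (1 - of_real \<rho> * cis t))\<^sup>2 = (1 - \<rho> * cos t)\<^sup>2 + (\<rho> * sin t)\<^sup>2"
  by (simp add: cmod_power2)
 also have "\<dots> = 1 - 2 * \<rho> * cos t + \<rho>\<^sup>2 * ((cos t)\<^sup>2 + (sin t)\<^sup>2)"
  by algebra
 also have "(cos t)\<^sup>2 + (sin t)\<^sup>2 = 1" by simp
 finally show ?thesis by (simp add: poisson_def algebra_simps)
qed

lemma poisson_cis_antimono:
 assumes \<rho>: "0 \<le> \<rho>" "\<rho> < 1" and "0 \<le> s" "s \<le> t" "t \<le> pi"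
 shows "poisson \<rho> (cis t) \<le> poisson \<rho> (cis s)"
proof -
 have cos: "cos t \<le> cos s" using assms by (intro cos_monotone_0_pi_le) auto
 have "0 < (1 - \<rho>)\<^sup>2" using \<rho> by simp
 also have "\<dots> \<le> 1 + \<rho>\<^sup>2 - 2 * \<rho> * cos s"
  using mult_left_mono[OF cos_le_one[of s], of \<rho>] \<rho> by (simp add: power2_eq_square algebra_simps)
 finally have pos: "0 < 1 + \<rho>\<^sup>2 - 2 * \<rho> * cos s" .
 moreover have "1 + \<rho>\<^sup>2 - 2 * \<rho> * cos s \<le> 1 + \<rho>\<^sup>2 - 2 * \<rho> * cos t"
  using mult_left_mono[OF cos, of \<rho>] \<rho> by simp
 moreover have "0 \<le> 1 - \<rho>\<^sup>2" using \<rho> by (simp add: power_le_one)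
 ultimately show ?thesis unfolding poisson_cis by (intro divide_left_mono) auto
qed

lemma poisson_integral:
 assumes \<rho>: "0 \<le> \<rho>" "\<rho> < 1"
 shows "(\<integral>z. poisson \<rho> z \<partial>circle) = 1"
proof -
 \<comment> \<open>The Poisson kernel is the real part of this function on the circle.\<close>
 define K where "K z = (1 + of_real \<rho> * z) / (1 - of_real \<rho> * z)" for z :: complex
 define R where "R = 2 / (1 + \<rho>)"
 have R: "R > 1" "\<rho> * R < 1" using \<rho> by (auto simp: R_def field_simps)
 have nz: "1 - of_real \<rho> * z \<noteq> 0" if "z \<in> ball 0 R" for z :: complex
 proof
  assume "1 - of_real \<rho> * z = 0"
  then have "1 = cmod (of_real \<rho> * z)" by simp
  also have "\<dots> \<le> \<rho> * R" using that \<rho> by (auto simp: norm_mult intro!: mult_left_mono)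
  finally show False using R by simp
 qed
 have "K holomorphic_on ball 0 R"
  unfolding K_def by (intro holomorphic_intros) (use nz in auto)
 from circle_mean_value[OF this R(1)] have "(\<integral>z. K z \<partial>circle) = 1" by (simp add: K_def)
 moreover have "integrable circle K"
  unfolding K_def using poisson_denominator_nonzero[OF \<rho>] by (intro integrable_circle continuous_intros) auto
 ultimately have "(\<integral>z. Re (K z) \<partial>circle) = 1" by simp
 moreover have "Re (K z) = poisson \<rho> z" if "cmod z = 1" for z
 proof -
  let ?d = "1 - of_real \<rho> * z"
  have z: "z * cnj z = 1" using that by (simp add: complex_norm_square[symmetric])
  have "K z = (1 + of_real \<rho> * z) * cnj ?d / of_real ((cmod ?d)\<^sup>2)"
   unfolding K_def by (subst complex_div_cnj) simp
  also have "(1 + of_real \<rho> * z) * cnj ?d = of_real (1 - \<rho>\<^sup>2) + of_real \<rho> * (z - cnj z)"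
   using z by (simp add: algebra_simps power2_eq_square)
  finally show ?thesis unfolding poisson_def by (simp del: of_real_power)
 qed
 then have "(\<integral>z. Re (K z) \<partial>circle) = (\<integral>z. poisson \<rho> z \<partial>circle)"
  by (intro Bochner_Integration.integral_cong) (auto simp: space_circle)
 ultimately show ?thesis by simp
qed

text \<open>On the circle the Poisson kernel times \<open>\<psi> - \<psi>(\<rho>)\<close> coincides with a holomorphic
 function that vanishes at the origin.\<close>

lemma poisson_formula:
 assumes \<psi>: "\<psi> holomorphic_on UNIV" and \<rho>: "0 \<le> \<rho>" "\<rho> < 1"
 shows "(\<integral>z. of_real (poisson \<rho> z) * \<psi> z \<partial>circle) = \<psi> (of_real \<rho>)"
proof -
 define r where "r = complex_of_real \<rho>"
 define G where "G = (\<lambda>z. if z = r then deriv \<psi> r else (\<psi> z - \<psi> r) / (z - r))"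
 define H where "H z = (1 - r\<^sup>2) * z / (1 - r * z) * G z" for z
 define R where "R = 2 / (1 + \<rho>)"
 have R: "R > 1" "\<rho> * R < 1" using \<rho> by (auto simp: R_def field_simps)
 have nz: "1 - r * z \<noteq> 0" if "z \<in> ball 0 R" for z
 proof
  assume "1 - r * z = 0"
  then have "1 = cmod (r * z)" by simp
  also have "\<dots> \<le> \<rho> * R" using that \<rho> by (auto simp: norm_mult r_def intro!: mult_left_mono)
  finally show False using R by simp
 qed
 have "G holomorphic_on UNIV"
  unfolding G_def by (rule pole_lemma_open[OF \<psi>]) simp
 then have "G holomorphic_on ball 0 R" by (rule holomorphic_on_subset) simp
 then have "H holomorphic_on ball 0 R"
  unfolding H_def by (intro holomorphic_intros) (use nz in auto)
 from circle_mean_value[OF this R(1)] have H0: "(\<integral>z. H z \<partial>circle) = 0" by (simp add: H_def)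
 have eq: "of_real (poisson \<rho> z) * (\<psi> z - \<psi> r) = H z" if z: "cmod z = 1" for z
 proof -
  let ?d = "1 - r * z"
  have zz: "z * cnj z = 1" using z by (simp add: complex_norm_square[symmetric])
  have d: "?d \<noteq> 0" using poisson_denominator_nonzero[OF \<rho> z] by (simp add: r_def)
  have "z \<noteq> r" using z \<rho> by (auto simp: r_def)
  have "z * cnj ?d = z - r" using zz by (simp add: r_def algebra_simps)
  moreover have "of_real ((cmod ?d)\<^sup>2) * z = ?d * (z * cnj ?d)" by (simp only: complex_norm_square mult_ac)
  moreover have "z \<noteq> 0" using z by auto
  ultimately have "complex_of_real ((cmod ?d)\<^sup>2) = ?d * (z - r) / z"
   by (simp add: nonzero_eq_divide_eq del: of_real_power)
  moreover have "of_real (poisson \<rho> z) = of_real (1 - \<rho>\<^sup>2) / complex_of_real ((cmod ?d)\<^sup>2)"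
   by (simp only: poisson_def of_real_divide r_def)
  moreover have "of_real (1 - \<rho>\<^sup>2) = 1 - r\<^sup>2" by (simp add: r_def)
  ultimately have "of_real (poisson \<rho> z) = (1 - r\<^sup>2) / (?d * (z - r) / z)" by simp
  then show ?thesis using d \<open>z \<noteq> r\<close> by (simp add: H_def G_def)
 qed
 have \<psi>c: "continuous_on S \<psi>" for S
  using \<psi> by (auto intro: holomorphic_on_imp_continuous_on holomorphic_on_subset)
 have Pc: "continuous_on (sphere 0 1) (\<lambda>z. complex_of_real (poisson \<rho> z))"
  using continuous_on_poisson[OF \<rho>] by (intro continuous_intros)
 have i1: "integrable circle (\<lambda>z. of_real (poisson \<rho> z) * \<psi> z)"
  by (intro integrable_circle continuous_on_mult Pc \<psi>c)
 have i2: "integrable circle (\<lambda>z. complex_of_real (poisson \<rho> z) * \<psi> r)"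
  by (intro integrable_circle continuous_on_mult Pc continuous_on_const)
 have "(\<integral>z. H z \<partial>circle) = (\<integral>z. of_real (poisson \<rho> z) * \<psi> z - of_real (poisson \<rho> z) * \<psi> r \<partial>circle)"
  by (intro Bochner_Integration.integral_cong) (auto simp: space_circle eq[symmetric] algebra_simps)
 also have "\<dots> = (\<integral>z. of_real (poisson \<rho> z) * \<psi> z \<partial>circle) - (\<integral>z. complex_of_real (poisson \<rho> z) * \<psi> r \<partial>circle)"
  using i1 i2 by simp
 also have "(\<integral>z. complex_of_real (poisson \<rho> z) * \<psi> r \<partial>circle) = complex_of_real (\<integral>z. poisson \<rho> z \<partial>circle) * \<psi> r"
  by (simp add: integral_complex_of_real)
 finally show ?thesis using H0 by (simp add: poisson_integral[OF \<rho>] r_def)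
qed

text \<open>The Poisson formula and the triangle inequality.\<close>

lemma norm_le_poisson_average:
 assumes \<phi>: "\<phi> holomorphic_on UNIV" and \<rho>: "0 \<le> \<rho>" "\<rho> < 1"
 shows "cmod (\<phi> (of_real \<rho> * \<zeta>)) \<le> (\<integral>z. poisson \<rho> z * cmod (\<phi> (z * \<zeta>)) \<partial>circle)"
proof -
 have "(\<phi> \<circ> (\<lambda>z. z * \<zeta>)) holomorphic_on UNIV"
  by (intro holomorphic_on_compose holomorphic_intros holomorphic_on_subset[OF \<phi>]) simp
 then have "(\<lambda>z. \<phi> (z * \<zeta>)) holomorphic_on UNIV" by (simp add: o_def)
 from poisson_formula[OF this \<rho>]
 have "\<phi> (of_real \<rho> * \<zeta>) = (\<integral>z. of_real (poisson \<rho> z) * \<phi> (z * \<zeta>) \<partial>circle)" by simp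
 also have "cmod \<dots> \<le> (\<integral>z. cmod (of_real (poisson \<rho> z) * \<phi> (z * \<zeta>)) \<partial>circle)"
  by (rule integral_norm_bound)
 also have "\<dots> = (\<integral>z. poisson \<rho> z * cmod (\<phi> (z * \<zeta>)) \<partial>circle)"
  by (simp add: norm_mult poisson_nonneg[OF \<rho>])
 finally show ?thesis .
qed

text \<open>Abel summation: a sum with decreasing weights is a mixture of partial sums.\<close>

lemma decreasing_weights_le:
 fixes w a :: "nat \<Rightarrow> real"
 assumes w: "\<And>i. i < N \<Longrightarrow> 0 \<le> w i" "\<And>i. Suc i < N \<Longrightarrow> w (Suc i) \<le> w i"
  and a: "\<And>k. k \<in> {1..N} \<Longrightarrow> (\<Sum>j<k. a j) \<le> real k * M"
 shows "(\<Sum>j<N. w j * a j) \<le> (\<Sum>j<N. w j) * M"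
proof -
 define b where "b j = a j - M" for j
 have b: "(\<Sum>j<k. b j) \<le> 0" if "k \<le> N" for k
  using a[of k] that by (cases "k = 0") (auto simp: b_def sum_subtractf)
 have step: "(\<Sum>j<Suc k. w j * b j) \<le> w k * (\<Sum>j<Suc k. b j)" if "Suc k \<le> N" for k
  using that
 proof (induction k)
  case (Suc k)
  have "(\<Sum>j<Suc (Suc k). w j * b j) \<le> w k * (\<Sum>j<Suc k. b j) + w (Suc k) * b (Suc k)"
   using Suc by simp
  also have "w k * (\<Sum>j<Suc k. b j) \<le> w (Suc k) * (\<Sum>j<Suc k. b j)"
   using b[of "Suc k"] w(2)[of k] Suc.prems by (intro mult_right_mono_neg) auto
  finally show ?case by (simp add: algebra_simps)
 qed simp
 have "(\<Sum>j<N. w j * b j) \<le> 0"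
 proof (cases N)
  case (Suc k)
  have "(\<Sum>j<N. w j * b j) \<le> w k * (\<Sum>j<N. b j)" using step[of k] Suc by simp
  also have "\<dots> \<le> 0" using w(1)[of k] b[of N] Suc by (intro mult_nonneg_nonpos) auto
  finally show ?thesis .
 qed simp
 then show ?thesis by (simp add: b_def right_diff_distrib sum_subtractf sum_distrib_right)
qed

text \<open>Starting at the point \<open>1\<close> and going around the circle in either direction, the weights decrease on
 the way to \<open>-1\<close>. The two halves of the sum are thus mixtures of averages along the two rotations.\<close>

lemma poisson_sum_le_max_average:
 fixes g :: "complex \<Rightarrow> real"
 assumes \<rho>: "0 \<le> \<rho>" "\<rho> < 1" and N: "N \<ge> 1" and g: "\<And>z. 0 \<le> g z"
 defines "\<eta> \<equiv> cis (pi / real N)"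
 shows "(\<Sum>j<2 * N. poisson \<rho> (\<eta> ^ j) * g (\<eta> ^ j * \<zeta>))
  \<le> (\<Sum>j<2 * N. poisson \<rho> (\<eta> ^ j)) * (max_average ((*) \<eta>) g N \<zeta> + max_average ((*) (cnj \<eta>)) g N (cnj \<eta> * \<zeta>))"
proof -
 let ?P = "\<lambda>j. poisson \<rho> (\<eta> ^ j)" and ?Q = "\<lambda>j. poisson \<rho> (cnj \<eta> ^ Suc j)"
 let ?A = "max_average ((*) \<eta>) g N \<zeta>" and ?B = "max_average ((*) (cnj \<eta>)) g N (cnj \<eta> * \<zeta>)"
 have pow: "\<eta> ^ j = cis (pi * real j / real N)" for j by (simp add: \<eta>_def Complex.DeMoivre mult_ac)
 have cpow: "cnj \<eta> ^ j = cis (- (pi * real j / real N))" for j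
  by (simp add: \<eta>_def cis_cnj Complex.DeMoivre mult_ac)
 have Q: "?Q j = poisson \<rho> (cis (pi * real (Suc j) / real N))" for j
  unfolding cpow by (simp add: poisson_cis)
 have refl: "\<eta> ^ (2 * N - Suc j) = cnj \<eta> ^ Suc j" if "j < N" for j
 proof -
  have "cnj \<eta> * \<eta> = 1" by (simp add: \<eta>_def cis_cnj cis_mult)
  then have "cnj \<eta> ^ Suc j * \<eta> ^ Suc j = 1" by (simp flip: power_mult_distrib del: power_Suc)
  moreover have "\<eta> ^ (2 * N - Suc j) * \<eta> ^ Suc j = 1"
   using that N by (simp flip: power_add del: power_Suc) (simp add: pow, metis cis_2pi mult.commute)
  ultimately have "\<eta> ^ (2 * N - Suc j) * \<eta> ^ Suc j = cnj \<eta> ^ Suc j * \<eta> ^ Suc j" by (simp only:)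
  moreover have "\<eta> ^ Suc j \<noteq> 0" by (simp add: \<eta>_def)
  ultimately show ?thesis using mult_right_cancel by blast
 qed
 have split: "(\<Sum>j<2 * N. F (\<eta> ^ j)) = (\<Sum>j<N. F (\<eta> ^ j)) + (\<Sum>j<N. F (cnj \<eta> ^ Suc j))" for F :: "complex \<Rightarrow> real"
 proof -
  have "(\<Sum>j<2 * N. F (\<eta> ^ j)) = (\<Sum>j<N. F (\<eta> ^ j)) + (\<Sum>j\<in>{N..<2 * N}. F (\<eta> ^ j))"
   by (subst sum.union_disjoint[symmetric]) (auto intro: sum.cong)
  also have "(\<Sum>j\<in>{N..<2 * N}. F (\<eta> ^ j)) = (\<Sum>j<N. F (\<eta> ^ (2 * N - Suc j)))"
   by (rule sum.reindex_bij_witness[of _ "\<lambda>j. 2 * N - Suc j" "\<lambda>j. 2 * N - Suc j"]) auto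
  also have "\<dots> = (\<Sum>j<N. F (cnj \<eta> ^ Suc j))" by (rule sum.cong) (auto simp: refl simp del: power_Suc)
  finally show ?thesis .
 qed
 have mono: "poisson \<rho> (cis (pi * real k / real N)) \<le> poisson \<rho> (cis (pi * real i / real N))"
  if "i \<le> k" "k \<le> N" for i k
 proof (rule poisson_cis_antimono[OF \<rho>])
  show "0 \<le> pi * real i / real N" by simp
  show "pi * real i / real N \<le> pi * real k / real N"
   using that by (intro divide_right_mono mult_left_mono) auto
  have "real k / real N \<le> 1" using that N by simp
  then have "pi * (real k / real N) \<le> pi * 1" by (intro mult_left_mono) auto
  then show "pi * real k / real N \<le> pi" by simp
 qed
 have one: "(\<Sum>j<N. ?P j * g (\<eta> ^ j * \<zeta>)) \<le> (\<Sum>j<N. ?P j) * ?A"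
 proof (rule decreasing_weights_le)
  show "(\<Sum>j<k. g (\<eta> ^ j * \<zeta>)) \<le> real k * ?A" if "k \<in> {1..N}" for k
   using average_le_max_average[OF that, of g "(*) \<eta>" \<zeta>] by (simp add: funpow_rotation)
  show "?P (Suc i) \<le> ?P i" if "Suc i < N" for i
   unfolding pow by (rule mono) (use that in auto)
 qed (use poisson_nonneg \<rho> in auto)
 have two: "(\<Sum>j<N. ?Q j * g (cnj \<eta> ^ Suc j * \<zeta>)) \<le> (\<Sum>j<N. ?Q j) * ?B"
 proof (rule decreasing_weights_le)
  show "(\<Sum>j<k. g (cnj \<eta> ^ Suc j * \<zeta>)) \<le> real k * ?B" if "k \<in> {1..N}" for k
   using average_le_max_average[OF that, of g "(*) (cnj \<eta>)" "cnj \<eta> * \<zeta>"] by (simp add: funpow_rotation mult_ac)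
  show "?Q (Suc i) \<le> ?Q i" if "Suc i < N" for i
   unfolding Q by (rule mono) (use that in auto)
 qed (use poisson_nonneg \<rho> in auto)
 have A0: "0 \<le> ?A" using average_le_max_average[of 1 N g "(*) \<eta>" \<zeta>] N g[of \<zeta>] by simp
 have B0: "0 \<le> ?B" using average_le_max_average[of 1 N g "(*) (cnj \<eta>)" "cnj \<eta> * \<zeta>"] N g[of "cnj \<eta> * \<zeta>"] by simp
 have P0: "0 \<le> (\<Sum>j<N. ?P j)" "0 \<le> (\<Sum>j<N. ?Q j)" using poisson_nonneg \<rho> by (auto intro!: sum_nonneg)
 have "(\<Sum>j<2 * N. ?P j * g (\<eta> ^ j * \<zeta>)) \<le> (\<Sum>j<N. ?P j) * ?A + (\<Sum>j<N. ?Q j) * ?B"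
  using split[of "\<lambda>z. poisson \<rho> z * g (z * \<zeta>)"] one two by simp
 also have "\<dots> \<le> ((\<Sum>j<N. ?P j) + (\<Sum>j<N. ?Q j)) * (?A + ?B)"
  using mult_nonneg_nonneg[OF P0(1) B0] mult_nonneg_nonneg[OF P0(2) A0] by (simp add: algebra_simps)
 also have "(\<Sum>j<N. ?P j) + (\<Sum>j<N. ?Q j) = (\<Sum>j<2 * N. ?P j)"
  using split[of "poisson \<rho>"] by simp
 finally show ?thesis .
qed

text \<open>The radial maximal function is dominated by the lower limit, over finer and finer
 discrete rotations, of the maximal ergodic averages in the two directions.\<close>

theorem maximal_inequality_H2:
 assumes \<phi>: "\<phi> holomorphic_on UNIV" and C: "C \<subseteq> {0..<1}"
 shows "(\<integral>\<^sup>+\<zeta>. (SUP \<rho>\<in>C. ennreal ((cmod (\<phi> (of_real \<rho> * \<zeta>)))\<^sup>2)) \<partial>circle)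
  \<le> 16 * (\<integral>\<^sup>+\<zeta>. ennreal ((cmod (\<phi> \<zeta>))\<^sup>2) \<partial>circle)"
proof -
 define g where "g z = cmod (\<phi> z)" for z
 have \<phi>c: "continuous_on S \<phi>" for S
  using \<phi> by (auto intro: holomorphic_on_imp_continuous_on holomorphic_on_subset)
 have gc: "continuous_on S g" for S unfolding g_def using \<phi>c by (intro continuous_intros)
 have gm: "g \<in> borel_measurable circle" by (rule borel_measurable_circle[OF gc])
 have "compact (g ` sphere 0 1)" by (rule compact_continuous_image[OF gc]) simp
 then obtain B where B: "\<And>z. z \<in> sphere 0 1 \<Longrightarrow> norm (g z) \<le> B"
  using compact_imp_bounded bounded_iff by (metis imageI)
 have g0: "0 \<le> g z" for z by (simp add: g_def)
 define \<eta> where "\<eta> N = cis (pi / real N)" for N :: nat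
 have \<eta>: "cmod (\<eta> N) = 1" "cmod (cnj (\<eta> N)) = 1" for N by (auto simp: \<eta>_def)
 define a where "a N = max_average ((*) (\<eta> N)) g N" for N
 define b where "b N = (\<lambda>\<zeta>. max_average ((*) (cnj (\<eta> N))) g N (cnj (\<eta> N) * \<zeta>))" for N
 have a_meas: "a N \<in> borel_measurable circle" for N
  unfolding a_def by (rule measure_preserving.measurable_max_average[OF measure_preserving_rotation[OF \<eta>(1)] gm])
 have b_meas: "b N \<in> borel_measurable circle" for N
  unfolding b_def
  by (rule measurable_compose[OF measurable_rotation_circle[OF \<eta>(2)]
     measure_preserving.measurable_max_average[OF measure_preserving_rotation[OF \<eta>(2)] gm]])
 have L2: "(\<integral>x. (max_average ((*) \<mu>) g N x)\<^sup>2 \<partial>circle) \<le> 4 * (\<integral>x. (g x)\<^sup>2 \<partial>circle)"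
  if "N \<ge> 1" "cmod \<mu> = 1" for N \<mu>
  by (rule measure_preserving.maximal_ergodic_L2[OF measure_preserving_rotation[OF that(2)] gm _ that(1), where B = B])
   (use B g0 in \<open>auto simp: space_circle\<close>)
 have bdd: "\<bar>max_average ((*) \<mu>) g N x\<bar> \<le> B" if "N \<ge> 1" "cmod \<mu> = 1" "cmod x = 1" for N \<mu> x
 proof -
  have "max_average ((*) \<mu>) g N x \<in> (\<lambda>k. (\<Sum>j<k. g ((((*) \<mu>) ^^ j) x)) / real k) ` {1..N}"
   unfolding max_average_def using that(1) by (intro Max_in) auto
  then obtain k where k: "k \<in> {1..N}" "max_average ((*) \<mu>) g N x = (\<Sum>j<k. g (\<mu> ^ j * x)) / real k"
   by (auto simp: funpow_rotation)
  have "(\<Sum>j<k. g (\<mu> ^ j * x)) \<le> real (card {..<k}) * B"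
   by (rule sum_bounded_above) (use B g0 that in \<open>auto simp: norm_mult norm_power\<close>)
  moreover have "0 \<le> (\<Sum>j<k. g (\<mu> ^ j * x))" using g0 by (intro sum_nonneg)
  ultimately show ?thesis unfolding k(2) using k(1) by (simp add: field_simps)
 qed
 have int2: "integrable circle (\<lambda>x. (a N x)\<^sup>2)" "integrable circle (\<lambda>x. (b N x)\<^sup>2)" if "N \<ge> 1" for N
 proof -
  have "\<bar>a N x\<bar> \<le> B" "\<bar>b N x\<bar> \<le> B" if "cmod x = 1" for x
   unfolding a_def b_def using \<open>N \<ge> 1\<close> that \<eta>[of N] by (auto intro!: bdd simp: norm_mult)
  then have "\<bar>(a N x)\<^sup>2\<bar> \<le> B\<^sup>2" "\<bar>(b N x)\<^sup>2\<bar> \<le> B\<^sup>2" if "x \<in> space circle" for x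
   using that power_mono[of "\<bar>a N x\<bar>" B 2] power_mono[of "\<bar>b N x\<bar>" B 2] by (auto simp: space_circle)
  then show "integrable circle (\<lambda>x. (a N x)\<^sup>2)" "integrable circle (\<lambda>x. (b N x)\<^sup>2)"
   using a_meas b_meas by (auto intro!: circle.integrable_const_bound[where B = "B\<^sup>2"])
 qed
 have g2: "integrable circle (\<lambda>x. (g x)\<^sup>2)" using gc by (intro integrable_circle continuous_intros)
 have bound: "(\<integral>\<^sup>+x. ennreal ((a N x + b N x)\<^sup>2) \<partial>circle) \<le> 16 * (\<integral>\<^sup>+x. ennreal ((g x)\<^sup>2) \<partial>circle)"
  if N: "N \<ge> 1" for N
 proof -
  have "(\<integral>\<^sup>+x. ennreal ((a N x + b N x)\<^sup>2) \<partial>circle) \<le> (\<integral>\<^sup>+x. ennreal (2 * (a N x)\<^sup>2 + 2 * (b N x)\<^sup>2) \<partial>circle)"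
  proof (intro nn_integral_mono ennreal_leI)
   fix x
   have "0 \<le> (a N x - b N x)\<^sup>2" by simp
   then show "(a N x + b N x)\<^sup>2 \<le> 2 * (a N x)\<^sup>2 + 2 * (b N x)\<^sup>2"
    by (simp add: power2_eq_square algebra_simps)
  qed
  also have "\<dots> = ennreal (\<integral>x. 2 * (a N x)\<^sup>2 + 2 * (b N x)\<^sup>2 \<partial>circle)"
   using int2[OF N] by (intro nn_integral_eq_integral) auto
  also have "(\<integral>x. 2 * (a N x)\<^sup>2 + 2 * (b N x)\<^sup>2 \<partial>circle)
    = 2 * (\<integral>x. (a N x)\<^sup>2 \<partial>circle) + 2 * (\<integral>x. (b N x)\<^sup>2 \<partial>circle)"
   using int2[OF N] by simp
  also have "(\<integral>x. (b N x)\<^sup>2 \<partial>circle) = (\<integral>x. (max_average ((*) (cnj (\<eta> N))) g N x)\<^sup>2 \<partial>circle)"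
   unfolding b_def
   using measure_preserving.measurable_max_average[OF measure_preserving_rotation[OF \<eta>(2)] gm]
   by (intro circle_integral_rotate[OF _ \<eta>(2)]) measurable
  also have "ennreal (2 * (\<integral>x. (a N x)\<^sup>2 \<partial>circle) + 2 * (\<integral>x. (max_average ((*) (cnj (\<eta> N))) g N x)\<^sup>2 \<partial>circle))
    \<le> ennreal (16 * (\<integral>x. (g x)\<^sup>2 \<partial>circle))"
   using L2[OF N \<eta>(1)[of N]] L2[OF N \<eta>(2)[of N]] unfolding a_def by (intro ennreal_leI) linarith
  also have "\<dots> = 16 * (\<integral>\<^sup>+x. ennreal ((g x)\<^sup>2) \<partial>circle)"
   using g2 by (simp add: nn_integral_eq_integral ennreal_mult'')
  finally show ?thesis .
 qed
 have le: "(SUP \<rho>\<in>C. ennreal ((cmod (\<phi> (of_real \<rho> * \<zeta>)))\<^sup>2)) \<le> liminf (\<lambda>N. ennreal ((a N \<zeta> + b N \<zeta>)\<^sup>2))"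
  if \<zeta>: "\<zeta> \<in> space circle" for \<zeta>
 proof (rule SUP_least)
  fix \<rho> assume "\<rho> \<in> C"
  then have \<rho>: "0 \<le> \<rho>" "\<rho> < 1" using C by auto
  define x where "x N = (\<Sum>j<2 * N. poisson \<rho> (\<eta> N ^ j) * g (\<eta> N ^ j * \<zeta>)) / real (2 * N)" for N
  define \<kappa> where "\<kappa> N = (\<Sum>j<2 * N. poisson \<rho> (\<eta> N ^ j)) / real (2 * N)" for N
  have sub: "filterlim (\<lambda>N::nat. 2 * N) sequentially sequentially"
   by (rule filterlim_subseq) (auto simp: strict_mono_def)
  have eta2: "cis (2 * pi / real (2 * N)) = \<eta> N" for N by (simp add: \<eta>_def)
  have c1: "continuous_on (sphere 0 1) (\<lambda>z. poisson \<rho> z * g (z * \<zeta>))"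
   using continuous_on_poisson[OF \<rho>] by (intro continuous_intros continuous_on_compose2[OF gc[of UNIV]]) auto
  have lim_x: "x \<longlonglongrightarrow> (\<integral>z. poisson \<rho> z * g (z * \<zeta>) \<partial>circle)"
   using filterlim_compose[OF riemann_sum_circle[OF c1] sub] unfolding eta2 x_def .
  have lim_\<kappa>: "\<kappa> \<longlonglongrightarrow> 1"
   using filterlim_compose[OF riemann_sum_circle[OF continuous_on_poisson[OF \<rho>]] sub]
   unfolding eta2 \<kappa>_def poisson_integral[OF \<rho>] .
  have "(\<lambda>N. x N / \<kappa> N) \<longlonglongrightarrow> (\<integral>z. poisson \<rho> z * g (z * \<zeta>) \<partial>circle) / 1"
   by (intro tendsto_divide lim_x lim_\<kappa>) simp
  then have lim: "(\<lambda>N. ennreal ((x N / \<kappa> N)\<^sup>2)) \<longlonglongrightarrow> ennreal ((\<integral>z. poisson \<rho> z * g (z * \<zeta>) \<partial>circle)\<^sup>2)"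
   by (intro tendsto_ennrealI tendsto_power) simp
  have "ennreal ((cmod (\<phi> (of_real \<rho> * \<zeta>)))\<^sup>2) \<le> ennreal ((\<integral>z. poisson \<rho> z * g (z * \<zeta>) \<partial>circle)\<^sup>2)"
   using norm_le_poisson_average[OF \<phi> \<rho>, of \<zeta>] by (intro ennreal_leI power_mono) (auto simp: g_def)
  also have "\<dots> = liminf (\<lambda>N. ennreal ((x N / \<kappa> N)\<^sup>2))"
   using lim_imp_Liminf[OF _ lim] by simp
  also have "\<dots> \<le> liminf (\<lambda>N. ennreal ((a N \<zeta> + b N \<zeta>)\<^sup>2))"
  proof (rule Liminf_mono)
   have "eventually (\<lambda>N. \<kappa> N > 0) sequentially"
    using order_tendstoD(1)[OF lim_\<kappa>, of 0] by simp
   then show "eventually (\<lambda>N. ennreal ((x N / \<kappa> N)\<^sup>2) \<le> ennreal ((a N \<zeta> + b N \<zeta>)\<^sup>2)) sequentially"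
    using eventually_ge_at_top[of 1]
   proof eventually_elim
    case (elim N)
    have "x N \<le> \<kappa> N * (a N \<zeta> + b N \<zeta>)"
     using poisson_sum_le_max_average[OF \<rho> elim(2), of g \<zeta>] g0 elim(2)
     unfolding x_def \<kappa>_def a_def b_def \<eta>_def by (simp add: field_simps)
    then have "x N / \<kappa> N \<le> a N \<zeta> + b N \<zeta>" using elim(1) by (simp add: field_simps)
    moreover have "0 \<le> x N" unfolding x_def
     using poisson_nonneg[OF \<rho>] g0 by (intro divide_nonneg_nonneg sum_nonneg) auto
    ultimately show ?case using elim(1) by (intro ennreal_leI power_mono) auto
   qed
  qed
  finally show "ennreal ((cmod (\<phi> (of_real \<rho> * \<zeta>)))\<^sup>2) \<le> liminf (\<lambda>N. ennreal ((a N \<zeta> + b N \<zeta>)\<^sup>2))" .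
 qed
 have "(\<integral>\<^sup>+\<zeta>. (SUP \<rho>\<in>C. ennreal ((cmod (\<phi> (of_real \<rho> * \<zeta>)))\<^sup>2)) \<partial>circle)
   \<le> (\<integral>\<^sup>+\<zeta>. liminf (\<lambda>N. ennreal ((a N \<zeta> + b N \<zeta>)\<^sup>2)) \<partial>circle)"
  by (rule nn_integral_mono) (use le in auto)
 also have "\<dots> \<le> liminf (\<lambda>N. \<integral>\<^sup>+\<zeta>. ennreal ((a N \<zeta> + b N \<zeta>)\<^sup>2) \<partial>circle)"
  using a_meas b_meas by (intro nn_integral_liminf) measurable
 also have "\<dots> \<le> liminf (\<lambda>N. 16 * (\<integral>\<^sup>+x. ennreal ((g x)\<^sup>2) \<partial>circle))"
  by (rule Liminf_mono) (use bound in \<open>auto simp: eventually_sequentially intro!: exI[of _ 1]\<close>)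
 also have "\<dots> = 16 * (\<integral>\<^sup>+x. ennreal ((g x)\<^sup>2) \<partial>circle)" by (simp add: Liminf_const)
 finally show ?thesis by (simp add: g_def)
qed

section \<open>Vector-valued holomorphic functions\<close>

text \<open>Holomorphy is only asked for weakly. This is all that the maximum principle needs, and it is easily
 checked for dilations and for polynomials.\<close>

definition disc_algebra :: "(complex \<Rightarrow> 'a::complex_banach) \<Rightarrow> bool" where
 "disc_algebra G \<longleftrightarrow> continuous_on (cball 0 1) G \<and>
   (\<forall>l. contractive l \<longrightarrow> (\<lambda>z. l (G z)) holomorphic_on ball 0 1)"

lemma vec_holomorphic_on_imp_continuous_on:
 assumes "vec_holomorphic_on F S"
 shows "continuous_on S F"
 unfolding continuous_on_eq_continuous_within
proof
 fix z assume "z \<in> S"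
 then obtain d where "(F has_derivative (\<lambda>h. h *\<^sub>C d)) (at z within S)"
  using assms unfolding vec_holomorphic_on_def by blast
 then show "continuous (at z within S) F" by (rule has_derivative_continuous)
qed

lemma vec_holomorphic_on_functional:
 assumes F: "vec_holomorphic_on F S" and l: "contractive l"
 shows "(\<lambda>z. l (F z)) holomorphic_on S"
 unfolding holomorphic_on_def
proof
 fix z assume "z \<in> S"
 then obtain d where d: "(F has_derivative (\<lambda>h. h *\<^sub>C d)) (at z within S)"
  using F unfolding vec_holomorphic_on_def by blast
 have "((\<lambda>z. l (F z)) has_derivative (\<lambda>h. l (h *\<^sub>C d))) (at z within S)"
  by (rule bounded_linear.has_derivative[OF contractive_bounded_linear[OF l] d])
 then have "((\<lambda>z. l (F z)) has_field_derivative l d) (at z within S)"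
  unfolding has_field_derivative_def contractiveD(2)[OF l] by (simp add: mult_commute_abs)
 then show "(\<lambda>z. l (F z)) field_differentiable at z within S"
  by (auto simp: field_differentiable_def)
qed

lemma vec_holomorphic_on_scaleC:
 assumes h: "h holomorphic_on S" and F: "vec_holomorphic_on F S"
 shows "vec_holomorphic_on (\<lambda>z. h z *\<^sub>C F z) S"
 unfolding vec_holomorphic_on_def
proof
 fix z assume z: "z \<in> S"
 obtain d where d: "(F has_derivative (\<lambda>h. h *\<^sub>C d)) (at z within S)"
  using F z unfolding vec_holomorphic_on_def by blast
 obtain h' where h': "(h has_field_derivative h') (at z within S)"
  using h z unfolding holomorphic_on_def field_differentiable_def by blast
 have "((\<lambda>z. h z *\<^sub>C F z) has_derivative (\<lambda>t. h z *\<^sub>C t *\<^sub>C d + (h' * t) *\<^sub>C F z)) (at z within S)"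
  by (rule bounded_bilinear.FDERIV[OF bounded_bilinear_scaleC h'[unfolded has_field_derivative_def] d])
 also have "(\<lambda>t. h z *\<^sub>C t *\<^sub>C d + (h' * t) *\<^sub>C F z) = (\<lambda>t. t *\<^sub>C (h z *\<^sub>C d + h' *\<^sub>C F z))"
  by (simp add: scaleC_add_right scaleC_scaleC mult.commute)
 finally show "\<exists>d. ((\<lambda>z. h z *\<^sub>C F z) has_derivative (\<lambda>h. h *\<^sub>C d)) (at z within S)" ..
qed

lemma vec_holomorphic_on_const: "vec_holomorphic_on (\<lambda>_. x) S"
 unfolding vec_holomorphic_on_def
 by (intro ballI exI[of _ 0]) simp

lemma disc_algebra_dilation:
 assumes F: "vec_holomorphic_on F (ball 0 1)" and r: "0 \<le> r" "r < 1"
 shows "disc_algebra (\<lambda>z. F (of_real r * z))"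
 unfolding disc_algebra_def
proof (intro conjI allI impI)
 have sub: "(\<lambda>z. complex_of_real r * z) ` cball 0 1 \<subseteq> ball 0 1"
 proof safe
  fix z :: complex assume "z \<in> cball 0 1"
  then have "r * cmod z \<le> r * 1" using r by (intro mult_left_mono) auto
  then show "complex_of_real r * z \<in> ball 0 1" using r by (simp add: norm_mult)
 qed
 show "continuous_on (cball 0 1) (\<lambda>z. F (of_real r * z))"
  by (rule continuous_on_compose2[OF vec_holomorphic_on_imp_continuous_on[OF F] _ sub]) (intro continuous_intros)
 fix l :: "'a \<Rightarrow> complex" assume l: "contractive l"
 have "((\<lambda>z. l (F z)) \<circ> (\<lambda>z. of_real r * z)) holomorphic_on ball 0 1"
  by (intro holomorphic_on_compose holomorphic_intros
    holomorphic_on_subset[OF vec_holomorphic_on_functional[OF F l]]) (use sub in force)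
 then show "(\<lambda>z. l (F (of_real r * z))) holomorphic_on ball 0 1" by (simp add: o_def)
qed

lemma disc_algebra_const: "disc_algebra (\<lambda>_. x)"
 by (simp add: disc_algebra_def)

text \<open>The maximum principle for \<open>G\<close> divided by the outer function \<open>exp p\<close>, after pairing with
 a functional that norms the value in question.\<close>

lemma norm_le_outer_function:
 fixes G :: "complex \<Rightarrow> 'a::complex_banach"
 assumes G: "disc_algebra G" and p: "p holomorphic_on UNIV"
  and le: "\<And>z. cmod z = 1 \<Longrightarrow> norm (G z) \<le> exp (Re (p z))" and z: "cmod z \<le> 1"
 shows "norm (G z) \<le> exp (Re (p z))"
proof -
 have "norm (exp (- p z) *\<^sub>C G z) \<le> 1"
 proof (rule norm_le_by_functionals)
  fix l :: "'a \<Rightarrow> complex" assume l: "contractive l"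
  have pc: "continuous_on S p" for S
   using p by (auto intro: holomorphic_on_imp_continuous_on holomorphic_on_subset)
  have "cmod (exp (- p z) * l (G z)) \<le> 1"
  proof (rule maximum_modulus_frontier[of "\<lambda>z. exp (- p z) * l (G z)" "cball 0 1"])
   show "(\<lambda>z. exp (- p z) * l (G z)) holomorphic_on interior (cball 0 1)"
    using G l holomorphic_on_subset[OF p] by (auto simp: disc_algebra_def intro!: holomorphic_intros)
   show "continuous_on (closure (cball 0 1)) (\<lambda>z. exp (- p z) * l (G z))"
    using G by (auto simp: disc_algebra_def intro!: continuous_intros pc
      bounded_linear.continuous_on[OF contractive_bounded_linear[OF l]])
   fix w :: complex assume "w \<in> frontier (cball 0 1)"
   then have w: "cmod w = 1" by simp
   have "cmod (exp (- p w) * l (G w)) = exp (- Re (p w)) * cmod (l (G w))" by (simp add: norm_mult)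
   also have "\<dots> \<le> exp (- Re (p w)) * exp (Re (p w))"
    using contractiveD(3)[OF l, of "G w"] le[OF w] by (intro mult_left_mono) auto
   also have "\<dots> = 1" by (simp flip: exp_add)
   finally show "cmod (exp (- p w) * l (G w)) \<le> 1" .
  qed (use z in auto)
  then show "cmod (l (exp (- p z) *\<^sub>C G z)) \<le> 1" by (simp add: contractiveD(2)[OF l])
 qed
 then have "exp (- Re (p z)) * norm (G z) \<le> 1" by (simp add: norm_scaleC)
 then have "exp (Re (p z)) * (exp (- Re (p z)) * norm (G z)) \<le> exp (Re (p z)) * 1"
  by (intro mult_left_mono) auto
 then show ?thesis by (simp flip: exp_add mult.assoc)
qed

lemma continuous_on_ln_add:
 fixes g :: "'b::topological_space \<Rightarrow> real"
 assumes "continuous_on S g" "\<And>z. 0 \<le> g z" "0 < e"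
 shows "continuous_on S (\<lambda>z. ln (g z + e))"
proof (intro continuous_on_ln continuous_on_add assms(1) continuous_on_const ballI)
 fix z show "g z + e \<noteq> 0" using assms(2)[of z] assms(3) by simp
qed

text \<open>With \<open>Re p\<close> slightly above \<open>ln (norm G + e)\<close> on the circle, \<open>norm G\<close> is at most the square of \<open>cmod (exp (p / 2))\<close>
 in the disc, while the integral of this square over the circle is close to that of \<open>norm G\<close>.\<close>

theorem maximal_inequality:
 fixes G :: "complex \<Rightarrow> 'a::complex_banach"
 assumes G: "disc_algebra G" and C: "C \<subseteq> {0..<1}"
 shows "(\<integral>\<^sup>+w. (SUP \<rho>\<in>C. ennreal (norm (G (of_real \<rho> * w)))) \<partial>circle)
  \<le> 16 * (\<integral>\<^sup>+w. ennreal (norm (G w)) \<partial>circle)"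
proof -
 have Gc: "continuous_on (sphere 0 1) (\<lambda>z. norm (G z))"
  using G by (auto simp: disc_algebra_def intro!: continuous_on_norm intro: continuous_on_subset)
 have int: "integrable circle (\<lambda>z. norm (G z))" by (rule integrable_circle[OF Gc])
 define I where "I = (\<integral>z. norm (G z) \<partial>circle)"
 have bound: "(\<integral>\<^sup>+w. (SUP \<rho>\<in>C. ennreal (norm (G (of_real \<rho> * w)))) \<partial>circle)
  \<le> ennreal (16 * (exp e * (I + e)))" if e: "e > 0" for e
 proof -
  have "continuous_on (sphere 0 1) (\<lambda>z. ln (norm (G z) + e))"
   by (rule continuous_on_ln_add[OF Gc _ e]) simp
  then obtain p where p: "p holomorphic_on UNIV"
   "\<And>z. cmod z = 1 \<Longrightarrow> ln (norm (G z) + e) \<le> Re (p z) \<and> Re (p z) \<le> ln (norm (G z) + e) + e"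
   using entire_real_part_dense[of "\<lambda>z. ln (norm (G z) + e)" e] e by blast
  have pos: "0 < norm (G z) + e" for z using e by (simp add: add_nonneg_pos)
  have lower: "norm (G z) \<le> exp (Re (p z))" if "cmod z = 1" for z
  proof -
   have "norm (G z) + e \<le> exp (Re (p z))" using p(2)[OF that] pos[of z] by (metis exp_le_cancel_iff exp_ln)
   then show ?thesis using e by simp
  qed
  define \<phi> where "\<phi> z = exp (p z / 2)" for z
  have \<phi>: "\<phi> holomorphic_on UNIV" unfolding \<phi>_def using p(1) by (intro holomorphic_intros) auto
  have sq: "(cmod (\<phi> z))\<^sup>2 = exp (Re (p z))" for z
   by (simp add: \<phi>_def power2_eq_square flip: exp_add)
  have "(\<integral>\<^sup>+w. (SUP \<rho>\<in>C. ennreal (norm (G (of_real \<rho> * w)))) \<partial>circle)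
   \<le> (\<integral>\<^sup>+w. (SUP \<rho>\<in>C. ennreal ((cmod (\<phi> (of_real \<rho> * w)))\<^sup>2)) \<partial>circle)"
  proof (intro nn_integral_mono SUP_subset_mono order_refl)
   fix w \<rho> assume w: "w \<in> space circle" and "\<rho> \<in> C"
   then have "0 \<le> \<rho>" "\<rho> \<le> 1" using C by auto
   then show "ennreal (norm (G (of_real \<rho> * w))) \<le> ennreal ((cmod (\<phi> (of_real \<rho> * w)))\<^sup>2)"
    unfolding sq using norm_le_outer_function[OF G p(1) lower] w
    by (intro ennreal_leI) (simp add: norm_mult space_circle)
  qed
  also have "\<dots> \<le> 16 * (\<integral>\<^sup>+w. ennreal ((cmod (\<phi> w))\<^sup>2) \<partial>circle)"
   by (rule maximal_inequality_H2[OF \<phi> C])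
  also have "(\<integral>\<^sup>+w. ennreal ((cmod (\<phi> w))\<^sup>2) \<partial>circle) \<le> (\<integral>\<^sup>+w. ennreal (exp e * (norm (G w) + e)) \<partial>circle)"
  proof (intro nn_integral_mono ennreal_leI)
   fix w assume "w \<in> space circle"
   then have "Re (p w) \<le> ln (norm (G w) + e) + e" using p(2) by (simp add: space_circle)
   then have "exp (Re (p w)) \<le> exp (ln (norm (G w) + e) + e)" by simp
   also have "\<dots> = exp e * (norm (G w) + e)" using pos[of w] by (simp add: exp_add)
   finally show "(cmod (\<phi> w))\<^sup>2 \<le> exp e * (norm (G w) + e)" by (simp add: sq)
  qed
  also have "(\<integral>\<^sup>+w. ennreal (exp e * (norm (G w) + e)) \<partial>circle) = ennreal (\<integral>w. exp e * (norm (G w) + e) \<partial>circle)"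
   using int e by (intro nn_integral_eq_integral) auto
  also have "(\<integral>w. exp e * (norm (G w) + e) \<partial>circle) = exp e * (I + e)"
   using int by (simp add: I_def circle.prob_space)
  also have "16 * ennreal (exp e * (I + e)) = ennreal (16 * (exp e * (I + e)))"
   by (subst ennreal_mult'') (use e in \<open>auto simp: I_def intro!: mult_nonneg_nonneg add_nonneg_nonneg integral_nonneg\<close>)
  finally show ?thesis by (simp add: mult_left_mono)
 qed
 have "((\<lambda>e. ennreal (16 * (exp e * (I + e)))) \<longlongrightarrow> ennreal (16 * (exp 0 * (I + 0)))) (at_right 0)"
  by (intro tendsto_ennrealI tendsto_intros)
 then have "(\<integral>\<^sup>+w. (SUP \<rho>\<in>C. ennreal (norm (G (of_real \<rho> * w)))) \<partial>circle) \<le> ennreal (16 * (exp 0 * (I + 0)))"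
  by (rule tendsto_lowerbound) (auto simp: eventually_at_right_less intro!: eventually_mono[OF eventually_at_right_less] bound)
 also have "\<dots> = 16 * (\<integral>\<^sup>+w. ennreal (norm (G w)) \<partial>circle)"
  using int by (simp add: nn_integral_eq_integral I_def ennreal_mult'')
 finally show ?thesis .
qed


section \<open>Radial limits of holomorphic functions with integrable logarithm\<close>

text \<open>Jensen's inequality: \<open>norm G\<close> is dominated by the modulus of an outer function \<open>exp p\<close>, and \<open>Re p\<close> is
 harmonic.\<close>

lemma log_norm_zero_le_mean:
 fixes G :: "complex \<Rightarrow> 'a::complex_banach"
 assumes G: "disc_algebra G" and e: "0 < e" and G0: "G 0 \<noteq> 0"
 shows "ln (norm (G 0)) \<le> e + (\<integral>z. ln (norm (G z) + e) \<partial>circle)"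
proof -
 have Gc: "continuous_on (sphere 0 1) (\<lambda>z. norm (G z))"
  using G by (auto simp: disc_algebra_def intro!: continuous_on_norm intro: continuous_on_subset)
 have uc: "continuous_on (sphere 0 1) (\<lambda>z. ln (norm (G z) + e))"
  by (rule continuous_on_ln_add[OF Gc _ e]) simp
 then obtain p where p: "p holomorphic_on UNIV"
  "\<And>z. cmod z = 1 \<Longrightarrow> ln (norm (G z) + e) \<le> Re (p z) \<and> Re (p z) \<le> ln (norm (G z) + e) + e"
  using entire_real_part_dense[of "\<lambda>z. ln (norm (G z) + e)" e] e by blast
 have pos: "0 < norm (G z) + e" for z using e by (simp add: add_nonneg_pos)
 have lower: "norm (G z) \<le> exp (Re (p z))" if "cmod z = 1" for z
 proof -
  have "norm (G z) + e \<le> exp (Re (p z))" using p(2)[OF that] pos[of z] by (metis exp_le_cancel_iff exp_ln)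
  then show ?thesis using e by simp
 qed
 have pc: "continuous_on (sphere 0 1) (\<lambda>z. Re (p z))"
  using p(1) by (intro continuous_intros) (auto intro: holomorphic_on_imp_continuous_on holomorphic_on_subset)
 have "ln (norm (G 0)) \<le> ln (exp (Re (p 0)))"
  using norm_le_outer_function[OF G p(1) lower, of 0] G0 by (subst ln_le_cancel_iff) auto
 also have "\<dots> = (\<integral>z. Re (p z) \<partial>circle)" by (simp add: circle_mean_value_entire[OF p(1)])
 also have "\<dots> \<le> (\<integral>z. ln (norm (G z) + e) + e \<partial>circle)"
  using p(2) integrable_circle[OF uc] integrable_circle[OF pc] by (intro integral_mono) (auto simp: space_circle)
 also have "\<dots> = e + (\<integral>z. ln (norm (G z) + e) \<partial>circle)"
  using integrable_circle[OF uc] by (simp add: circle.prob_space)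
 finally show ?thesis .
qed

text \<open>The integral of \<open>- ln \<bar>h\<bar>\<close> over circles stays below \<open>- ln \<bar>h 0\<bar>\<close>; a set of positive measure on
 which \<open>h\<close> tends to \<open>0\<close> would make it unbounded.\<close>

lemma radial_limit_nonzero:
 fixes h :: "complex \<Rightarrow> complex"
 assumes h: "h holomorphic_on ball 0 1" and le: "\<And>z. z \<in> ball 0 1 \<Longrightarrow> cmod (h z) \<le> 1" and h0: "h 0 \<noteq> 0"
  and \<rho>: "\<And>k. 0 \<le> \<rho> k" "\<And>k. \<rho> k < 1"
 shows "AE z in circle. \<not> (\<lambda>k. h (of_real (\<rho> k) * z)) \<longlonglongrightarrow> 0"
proof -
 define g where "g k z = cmod (h (of_real (\<rho> k) * z))" for k z
 have vh: "vec_holomorphic_on h (ball 0 1)"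
  unfolding vec_holomorphic_on_def scaleC_complex_def
  using h by (force simp: holomorphic_on_def field_differentiable_def has_field_derivative_def mult.commute)
 have da: "disc_algebra (\<lambda>z. h (of_real (\<rho> k) * z))" for k
  by (rule disc_algebra_dilation[OF vh \<rho>])
 have gc: "continuous_on (sphere 0 1) (g k)" for k
  using da[of k] unfolding g_def by (auto simp: disc_algebra_def intro!: continuous_on_norm intro: continuous_on_subset)
 have gm[measurable]: "g k \<in> borel_measurable circle" for k by (rule borel_measurable_circle[OF gc])
 have g1: "g k z \<le> 1" if "cmod z = 1" for k z
  unfolding g_def using \<rho>[of k] that by (intro le) (simp add: norm_mult)
 have g0: "0 \<le> g k z" for k z by (simp add: g_def)
 define N where "N = {z \<in> space circle. limsup (\<lambda>k. ennreal (g k z)) = 0}"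
 have N[measurable]: "N \<in> sets circle" unfolding N_def by measurable
 define K where "K = 1 + ln 2 - ln (cmod (h 0))"
 have main: "ennreal (ln 2 - ln e) * emeasure circle N \<le> ennreal K" if e: "0 < e" "e \<le> 1" for e
 proof -
  let ?u = "\<lambda>k z. ln 2 - ln (g k z + e)"
  have uc: "continuous_on (sphere 0 1) (\<lambda>z. ln (g k z + e))" for k
   by (rule continuous_on_ln_add[OF gc g0 e(1)])
  have uint: "integrable circle (?u k)" for k using integrable_circle[OF uc] by auto
  have unn: "0 \<le> ?u k z" if "cmod z = 1" for k z
   using g1[OF that, of k] g0[of k z] e by (simp add: add_nonneg_pos)
  have "(\<integral>\<^sup>+z. ennreal (?u k z) \<partial>circle) \<le> ennreal K" for k
  proof -
   have "(\<integral>\<^sup>+z. ennreal (?u k z) \<partial>circle) = ennreal (\<integral>z. ?u k z \<partial>circle)"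
    by (rule nn_integral_eq_integral[OF uint]) (use unn in \<open>auto simp: space_circle\<close>)
   also have "(\<integral>z. ?u k z \<partial>circle) = ln 2 - (\<integral>z. ln (g k z + e) \<partial>circle)"
    using integrable_circle[OF uc] by (simp add: circle.prob_space)
   also have "\<dots> \<le> K"
    using log_norm_zero_le_mean[OF da e(1), of k] h0 e by (simp add: g_def K_def)
   finally show ?thesis by (simp add: ennreal_leI)
  qed
  then have "liminf (\<lambda>k. \<integral>\<^sup>+z. ennreal (?u k z) \<partial>circle) \<le> ennreal K"
   by (intro Liminf_le[OF trivial_limit_sequentially] eventuallyI)
  then have fatou: "(\<integral>\<^sup>+z. liminf (\<lambda>k. ennreal (?u k z)) \<partial>circle) \<le> ennreal K"
   by (rule order_trans[rotated]) (intro nn_integral_liminf, measurable)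
  have "ennreal (ln 2 - ln e) * emeasure circle N = (\<integral>\<^sup>+z. ennreal (ln 2 - ln e) * indicator N z \<partial>circle)"
   by (simp add: nn_integral_cmult_indicator)
  also have "\<dots> \<le> (\<integral>\<^sup>+z. liminf (\<lambda>k. ennreal (?u k z)) \<partial>circle)"
  proof (rule nn_integral_mono)
   fix z assume "z \<in> space circle"
   show "ennreal (ln 2 - ln e) * indicator N z \<le> liminf (\<lambda>k. ennreal (?u k z))"
   proof (cases "z \<in> N")
    case True
    then have "limsup (\<lambda>k. ennreal (g k z)) = 0" by (simp add: N_def)
    then have "(\<lambda>k. ennreal (g k z)) \<longlonglongrightarrow> 0"
     by (intro tendsto_0_if_Limsup_eq_0_ennreal)
    then have "(\<lambda>k. ennreal (g k z)) \<longlonglongrightarrow> ennreal 0" by simp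
    then have "(\<lambda>k. g k z) \<longlonglongrightarrow> 0"
     by (subst (asm) tendsto_ennreal_iff) (auto simp: g0)
    then have "(\<lambda>k. ?u k z) \<longlonglongrightarrow> ln 2 - ln (0 + e)"
     using e by (intro tendsto_intros) auto
    then have "(\<lambda>k. ennreal (?u k z)) \<longlonglongrightarrow> ennreal (ln 2 - ln e)"
     by (intro tendsto_ennrealI) simp
    then show ?thesis using True lim_imp_Liminf[of sequentially] by fastforce
   qed simp
  qed
  also note fatou
  finally show ?thesis .
 qed
 have "emeasure circle N = 0"
 proof (rule ccontr)
  assume "emeasure circle N \<noteq> 0"
  then have pos: "measure circle N > 0"
   by (simp add: circle.emeasure_eq_measure zero_less_measure_iff)
  \<comment> \<open>Small enough for the integral of \<open>- ln e\<close> over \<open>N\<close> to exceed the bound \<open>K\<close>.\<close>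
  define e where "e = exp (- (\<bar>K\<bar> + 1) / measure circle N)"
  have e: "0 < e" "e \<le> 1" using pos by (auto simp: e_def intro!: divide_nonpos_pos)
  have "(ln 2 - ln e) * measure circle N = ln 2 * measure circle N + (\<bar>K\<bar> + 1)"
   using pos by (simp add: e_def field_simps)
  also have "\<dots> > \<bar>K\<bar>" using pos by (simp add: add_pos_pos add_strict_increasing2)
  finally have gt: "(ln 2 - ln e) * measure circle N > \<bar>K\<bar>" .
  have "ln e \<le> 0" using e by simp
  then have "0 \<le> ln 2 - ln e" using ln_gt_zero[of "2::real"] by linarith
  then have "ennreal ((ln 2 - ln e) * measure circle N) \<le> ennreal K"
   using main[OF e] by (simp add: circle.emeasure_eq_measure ennreal_mult)
  then have "ennreal ((ln 2 - ln e) * measure circle N) \<le> ennreal \<bar>K\<bar>"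
   by (rule order_trans) (simp add: ennreal_leI)
  then show False using gt by (simp add: ennreal_le_iff)
 qed
 then have "N \<in> null_sets circle" using N by auto
 then have "AE z in circle. z \<notin> N" by (rule AE_not_in)
 then show ?thesis
 proof (rule AE_mp, intro AE_I2 impI notI)
  fix z assume z: "z \<in> space circle" "z \<notin> N" "(\<lambda>k. h (of_real (\<rho> k) * z)) \<longlonglongrightarrow> 0"
  have "(\<lambda>k. g k z) \<longlonglongrightarrow> 0" unfolding g_def using z(3) by (rule tendsto_norm_zero)
  then have "(\<lambda>k. ennreal (g k z)) \<longlonglongrightarrow> ennreal 0" by (rule tendsto_ennrealI)
  then have "limsup (\<lambda>k. ennreal (g k z)) = 0" using lim_imp_Limsup[OF trivial_limit_sequentially] by fastforce
  then show False using z by (simp add: N_def)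
 qed
qed

text \<open>Dividing by outer functions \<open>exp p\<close> that dominate \<open>1 + \<parallel>F\<parallel>\<close> on larger and larger circles
 yields, by Montel's theorem, a bounded holomorphic \<open>h\<close> with \<open>h 0 \<noteq> 0\<close> for which
 \<open>h F\<close> is bounded. The property applies to \<open>h F\<close> and to \<open>h\<close>, and a quotient of radial
 limits is the radial limit of \<open>F\<close>.\<close>

theorem ARNP_radial_limits:
 fixes F :: "complex \<Rightarrow> 'a::complex_banach"
 assumes X: "ARNP TYPE('a)" and F: "vec_holomorphic_on F (ball 0 1)"
  and \<rho>: "\<And>k. 0 \<le> \<rho> k" "\<And>k. \<rho> k < 1" "\<rho> \<longlonglongrightarrow> 1"
  and bound: "\<And>k. (\<integral>z. ln (1 + norm (F (of_real (\<rho> k) * z))) \<partial>circle) \<le> C"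
 shows "AE z in circle. \<exists>l. ((\<lambda>R. F (of_real R * z)) \<longlongrightarrow> l) (at_left (1::real))"
proof (cases "\<exists>x::'a. x \<noteq> 0")
 case False
 then have "F z = 0" for z by auto
 then show ?thesis by (auto intro!: AE_I2 exI[of _ 0])
next
 case True
 then obtain x :: 'a where x: "x \<noteq> 0" by blast
 define G where "G k z = F (of_real (\<rho> k) * z)" for k z
 have G: "disc_algebra (G k)" for k unfolding G_def by (rule disc_algebra_dilation[OF F \<rho>(1,2)])
 have Gc: "continuous_on (sphere 0 1) (\<lambda>z. norm (G k z))" for k
  using G[of k] by (auto simp: disc_algebra_def intro!: continuous_on_norm intro: continuous_on_subset)
 have uc: "continuous_on (sphere 0 1) (\<lambda>z. ln (1 + norm (G k z)))" for k
  unfolding add.commute[of 1] by (rule continuous_on_ln_add[OF Gc]) auto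
 have "\<exists>p. p holomorphic_on UNIV \<and> (\<forall>z. cmod z = 1 \<longrightarrow>
   ln (1 + norm (G k z)) \<le> Re (p z) \<and> Re (p z) \<le> ln (1 + norm (G k z)) + 1)" for k
  using entire_real_part_dense[OF uc zero_less_one, of k] by blast
 then obtain p where p: "\<And>k. p k holomorphic_on UNIV"
   "\<And>k z. cmod z = 1 \<Longrightarrow> ln (1 + norm (G k z)) \<le> Re (p k z)"
   "\<And>k z. cmod z = 1 \<Longrightarrow> Re (p k z) \<le> ln (1 + norm (G k z)) + 1"
  by metis
 have Re_pos: "0 \<le> Re (p k z)" if "cmod z \<le> 1" for k z
 proof -
  have "norm (1::complex) \<le> exp (Re (p k z))"
  proof (rule norm_le_outer_function[OF disc_algebra_const p(1) _ that])
   fix w :: complex assume w: "cmod w = 1"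
   have "0 \<le> ln (1 + norm (G k w))" by simp
   also note p(2)[OF w]
   finally show "norm (1::complex) \<le> exp (Re (p k w))" by simp
  qed
  then show ?thesis by simp
 qed
 have dom: "norm (G k z) \<le> exp (Re (p k z))" if "cmod z \<le> 1" for k z
 proof (rule norm_le_outer_function[OF G p(1) _ that])
  fix w :: complex assume w: "cmod w = 1"
  have pos: "0 < 1 + norm (G k w)" by (simp add: add_pos_nonneg)
  have "norm (G k w) \<le> exp (ln (1 + norm (G k w)))" using pos by simp
  also have "\<dots> \<le> exp (Re (p k w))" using p(2)[OF w] by simp
  finally show "norm (G k w) \<le> exp (Re (p k w))" .
 qed
 have at0: "Re (p k 0) \<le> C + 1" for k
 proof -
  have pc: "continuous_on (sphere 0 1) (\<lambda>z. Re (p k z))"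
   using p(1) by (intro continuous_intros) (auto intro: holomorphic_on_imp_continuous_on holomorphic_on_subset)
  have "Re (p k 0) = (\<integral>z. Re (p k z) \<partial>circle)" by (simp add: circle_mean_value_entire[OF p(1)])
  also have "\<dots> \<le> (\<integral>z. ln (1 + norm (G k z)) + 1 \<partial>circle)"
   using p(3) integrable_circle[OF uc] integrable_circle[OF pc] by (intro integral_mono) (auto simp: space_circle)
  also have "\<dots> \<le> C + 1"
   using integrable_circle[OF uc] bound[of k] by (simp add: circle.prob_space G_def)
  finally show ?thesis .
 qed
 \<comment> \<open>The reciprocals of the outer functions are bounded by \<open>1\<close>, so a subsequence converges.\<close>
 define H where "H k z = exp (- p k z)" for k z
 have Hle: "cmod (H k z) \<le> 1" if "cmod z \<le> 1" for k z using Re_pos[OF that, of k] by (simp add: H_def)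
 have HG: "cmod (H k z) * norm (G k z) \<le> 1" if "cmod z \<le> 1" for k z
 proof -
  have "cmod (H k z) * norm (G k z) \<le> exp (- Re (p k z)) * exp (Re (p k z))"
   using dom[OF that, of k] by (simp add: H_def)
  then show ?thesis by (simp flip: exp_add)
 qed
 obtain h r where h: "h holomorphic_on ball 0 1" and r: "strict_mono (r :: nat \<Rightarrow> nat)"
  and lim: "\<And>z. z \<in> ball 0 1 \<Longrightarrow> (\<lambda>n. H (r n) z) \<longlonglongrightarrow> h z"
 proof (rule Montel[of "ball 0 1" "{f. f holomorphic_on ball 0 1 \<and> (\<forall>z\<in>ball 0 1. cmod (f z) \<le> 1)}" H])
  show "range H \<subseteq> {f. f holomorphic_on ball 0 1 \<and> (\<forall>z\<in>ball 0 1. cmod (f z) \<le> 1)}"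
  proof -
   have "H k holomorphic_on ball 0 1" for k
    unfolding H_def[abs_def] using holomorphic_on_subset[OF p(1)] by (intro holomorphic_intros) auto
   then show ?thesis using Hle by auto
  qed
  show "\<exists>B. \<forall>h\<in>{f. f holomorphic_on ball 0 1 \<and> (\<forall>z\<in>ball 0 1. cmod (f z) \<le> 1)}. \<forall>z\<in>K. norm (h z) \<le> B"
   if "compact K" "K \<subseteq> ball 0 1" for K
   using that by (intro exI[of _ 1]) auto
 qed (use that in auto)
 have h1: "cmod (h z) \<le> 1" if z: "z \<in> ball 0 1" for z
  by (rule LIMSEQ_le_const2[OF tendsto_norm[OF lim[OF z]]]) (use Hle z in auto)
 have h0: "h 0 \<noteq> 0"
 proof -
  have "exp (- (C + 1)) \<le> cmod (H k 0)" for k using at0[of k] by (simp add: H_def)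
  then have "exp (- (C + 1)) \<le> cmod (h 0)"
   by (intro LIMSEQ_le_const[OF tendsto_norm[OF lim]]) auto
  then show ?thesis using exp_gt_zero[of "- (C + 1)"] by auto
 qed
 have hF: "norm (h z *\<^sub>C F z) \<le> 1" if z: "z \<in> ball 0 1" for z
 proof -
  have "(\<lambda>n. complex_of_real (\<rho> (r n)) * z) \<longlonglongrightarrow> of_real 1 * z"
   using LIMSEQ_subseq_LIMSEQ[OF \<rho>(3) r] by (intro tendsto_intros) (simp add: o_def)
  then have conv: "(\<lambda>n. complex_of_real (\<rho> (r n)) * z) \<longlonglongrightarrow> z" by simp
  have inb: "complex_of_real (\<rho> (r n)) * z \<in> ball 0 1" for n
  proof -
   have "\<rho> (r n) * cmod z \<le> 1 * cmod z" using \<rho>(2)[of "r n"] by (intro mult_right_mono) auto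
   then show ?thesis using \<rho>(1)[of "r n"] z by (simp add: norm_mult)
  qed
  have "continuous (at z) F"
   using vec_holomorphic_on_imp_continuous_on[OF F] z by (simp add: continuous_on_eq_continuous_at)
  then have "(\<lambda>n. G (r n) z) \<longlonglongrightarrow> F z"
   unfolding G_def using conv by (rule continuous_at_sequentially[THEN iffD1, rule_format, unfolded o_def])
  then have "(\<lambda>n. cmod (H (r n) z) * norm (G (r n) z)) \<longlonglongrightarrow> cmod (h z) * norm (F z)"
   by (intro tendsto_intros lim z)
  then have "cmod (h z) * norm (F z) \<le> 1"
   by (rule LIMSEQ_le_const2) (use HG z in auto)
  then show ?thesis by (simp add: norm_scaleC)
 qed
 have 1: "AE z in circle. \<exists>l. ((\<lambda>R. h (of_real R * z) *\<^sub>C F (of_real R * z)) \<longlongrightarrow> l) (at_left (1::real))"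
 proof -
  have "bounded ((\<lambda>z. h z *\<^sub>C F z) ` ball 0 1)" unfolding bounded_iff using hF by (intro exI[of _ 1]) auto
  then show ?thesis
   using X[unfolded ARNP_def, rule_format, of "\<lambda>z. h z *\<^sub>C F z"] vec_holomorphic_on_scaleC[OF h F] by auto
 qed
 have 2: "AE z in circle. \<exists>l. ((\<lambda>R. h (of_real R * z) *\<^sub>C x) \<longlongrightarrow> l) (at_left (1::real))"
 proof -
  have "norm (h z *\<^sub>C x) \<le> norm x" if "z \<in> ball 0 1" for z
   using mult_right_mono[OF h1[OF that], of "norm x"] by (simp add: norm_scaleC)
  then have "bounded ((\<lambda>z. h z *\<^sub>C x) ` ball 0 1)"
   unfolding bounded_iff by (intro exI[of _ "norm x"]) auto
  then show ?thesis
   using X[unfolded ARNP_def, rule_format, of "\<lambda>z. h z *\<^sub>C x"]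
    vec_holomorphic_on_scaleC[OF h vec_holomorphic_on_const] by auto
 qed
 have 3: "AE z in circle. \<not> (\<lambda>k. h (of_real (\<rho> k) * z)) \<longlonglongrightarrow> 0"
  by (rule radial_limit_nonzero[OF h h1 h0 \<rho>(1,2)])
 obtain l where l: "contractive l" "l x = of_real (norm x)" by (rule norming_functional_exists)
 have \<rho>_left: "filterlim \<rho> (at_left 1) sequentially"
  unfolding filterlim_at using \<rho>(2,3) by (auto intro!: always_eventually simp: less_imp_neq)
 from 1 2 3 show ?thesis
 proof eventually_elim
  case (elim z)
  obtain L where L: "((\<lambda>R. h (of_real R * z) *\<^sub>C F (of_real R * z)) \<longlongrightarrow> L) (at_left (1::real))"
   using elim(1) by blast
  obtain L' where L': "((\<lambda>R. h (of_real R * z) *\<^sub>C x) \<longlongrightarrow> L') (at_left (1::real))" using elim(2) by blast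
  from bounded_linear.tendsto[OF contractive_bounded_linear[OF l(1)] L']
  have "((\<lambda>R. h (of_real R * z) * of_real (norm x)) \<longlongrightarrow> l L') (at_left (1::real))"
   by (simp add: contractiveD(2)[OF l(1)] l(2))
  from tendsto_mult_right[OF this, of "inverse (of_real (norm x))"]
  have hL: "((\<lambda>R. h (of_real R * z)) \<longlongrightarrow> l L' * inverse (of_real (norm x))) (at_left (1::real))"
   using x by (simp add: mult.assoc)
  define c where "c = l L' * inverse (of_real (norm x))"
  have c: "c \<noteq> 0"
   using filterlim_compose[OF hL \<rho>_left] elim(3) by (auto simp: c_def)
  have "((\<lambda>R. inverse (h (of_real R * z)) *\<^sub>C (h (of_real R * z) *\<^sub>C F (of_real R * z))) \<longlongrightarrow> inverse c *\<^sub>C L) (at_left (1::real))"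
   by (intro tendsto_intros L hL[folded c_def] c)
  moreover have "\<forall>\<^sub>F R in at_left (1::real). inverse (h (of_real R * z)) *\<^sub>C (h (of_real R * z) *\<^sub>C F (of_real R * z)) = F (of_real R * z)"
   using tendsto_imp_eventually_ne[OF hL[folded c_def] c]
   by eventually_elim (simp add: scaleC_scaleC)
  ultimately have "((\<lambda>R. F (of_real R * z)) \<longlongrightarrow> inverse c *\<^sub>C L) (at_left (1::real))"
   by (rule Lim_transform_eventually)
  then show ?case ..
 qed
qed

section \<open>The Bochner integral\<close>

abbreviation "simple_bochner_integrable \<equiv> Bochner_Integration.simple_bochner_integrable"
abbreviation "L1_dist M f g \<equiv> \<integral>\<^sup>+x. ennreal (norm (f x - g x)) \<partial>M"
abbreviation "simple_bochner_integral \<equiv> Bochner_Integration.simple_bochner_integral"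

text \<open>Rounding both coordinates down to multiples of \<open>1 / (n + 1)\<close> approximates bounded
 measurable scalar functions uniformly by simple ones.\<close>

lemma simple_uniform_approx:
 fixes \<phi> :: "'b \<Rightarrow> complex"
 assumes \<phi>[measurable]: "\<phi> \<in> borel_measurable M" and B: "\<And>x. x \<in> space M \<Longrightarrow> cmod (\<phi> x) \<le> B" and e: "e > 0"
 obtains s where "simple_function M s" "\<And>x. x \<in> space M \<Longrightarrow> cmod (s x - \<phi> x) \<le> e"
proof -
 obtain N :: nat where N: "2 / e < real N" using reals_Archimedean2 by blast
 have "0 < 2 / e" using e by simp
 then have N0: "0 < real N" using N by linarith
 have N2: "2 / real N < e" using N N0 e by (simp add: field_simps)
 define rd where "rd x = real_of_int \<lfloor>x * real N\<rfloor> / real N" for x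
 have rd: "\<bar>rd x - x\<bar> \<le> 1 / real N" for x
 proof -
  have "\<bar>real_of_int \<lfloor>x * real N\<rfloor> - x * real N\<bar> \<le> 1" by linarith
  then have "\<bar>real_of_int \<lfloor>x * real N\<rfloor> - x * real N\<bar> / real N \<le> 1 / real N" by (intro divide_right_mono) auto
  moreover have "rd x - x = (real_of_int \<lfloor>x * real N\<rfloor> - x * real N) / real N"
   using N0 by (simp add: rd_def field_simps)
  ultimately show ?thesis by simp
 qed
 define s where "s x = Complex (rd (Re (\<phi> x))) (rd (Im (\<phi> x)))" for x
 show thesis
 proof (rule that[of s])
  show "simple_function M s"
  proof (rule simple_function_borel_measurable)
   have "s = (\<lambda>x. complex_of_real (rd (Re (\<phi> x))) + \<i> * complex_of_real (rd (Im (\<phi> x))))"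
    by (auto simp: s_def complex_eq_iff)
   also have "\<dots> \<in> borel_measurable M" unfolding rd_def by measurable
   finally show "s \<in> borel_measurable M" .
   define K where "K = \<lceil>B * real N\<rceil> + 1"
   have fl: "\<lfloor>y * real N\<rfloor> \<in> {- K..K}" if "\<bar>y\<bar> \<le> B" for y
   proof -
    have "\<bar>y\<bar> * real N \<le> B * real N" using that by (intro mult_right_mono) auto
    then have "\<bar>y * real N\<bar> \<le> B * real N" by (simp add: abs_mult)
    then show ?thesis unfolding K_def atLeastAtMost_iff by linarith
   qed
   have "s ` space M \<subseteq> (\<lambda>(i, j). Complex (real_of_int i / real N) (real_of_int j / real N)) ` ({- K..K} \<times> {- K..K})"
   proof
    fix y assume "y \<in> s ` space M"
    then obtain x where x: "x \<in> space M" "y = s x" by blast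
    have "\<bar>Re (\<phi> x)\<bar> \<le> B" "\<bar>Im (\<phi> x)\<bar> \<le> B"
     using B[OF x(1)] abs_Re_le_cmod[of "\<phi> x"] abs_Im_le_cmod[of "\<phi> x"] by linarith+
    then show "y \<in> (\<lambda>(i, j). Complex (real_of_int i / real N) (real_of_int j / real N)) ` ({- K..K} \<times> {- K..K})"
     unfolding x(2) s_def rd_def using fl
     by (intro image_eqI[of _ _ "(\<lfloor>Re (\<phi> x) * real N\<rfloor>, \<lfloor>Im (\<phi> x) * real N\<rfloor>)"]) auto
   qed
   then show "finite (s ` space M)" by (rule finite_subset) auto
  qed
  fix x
  have "cmod (s x - \<phi> x) \<le> \<bar>rd (Re (\<phi> x)) - Re (\<phi> x)\<bar> + \<bar>rd (Im (\<phi> x)) - Im (\<phi> x)\<bar>"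
   using cmod_le[of "s x - \<phi> x"] by (simp add: s_def)
  also have "\<dots> \<le> 2 / real N" using rd[of "Re (\<phi> x)"] rd[of "Im (\<phi> x)"] by simp
  finally show "cmod (s x - \<phi> x) \<le> e" using N2 by simp
 qed
qed

text \<open>The version without exceptional set has measurable norms, also when the target space is not
 separable.\<close>

definition pointwise_measurable :: "'b measure \<Rightarrow> ('b \<Rightarrow> 'a::real_normed_vector) \<Rightarrow> bool" where
 "pointwise_measurable M f \<longleftrightarrow>
   (\<exists>s. (\<forall>n. simple_function M (s n)) \<and> (\<forall>x\<in>space M. (\<lambda>n::nat. s n x) \<longlonglongrightarrow> f x))"

lemma pointwise_measurable_norm:
 assumes "pointwise_measurable M f"
 shows "(\<lambda>x. norm (f x)) \<in> borel_measurable M"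
proof -
 obtain s where s: "\<And>n. simple_function M (s n)" "\<And>x. x \<in> space M \<Longrightarrow> (\<lambda>n::nat. s n x) \<longlonglongrightarrow> f x"
  using assms by (auto simp: pointwise_measurable_def)
 show ?thesis
 proof (rule borel_measurable_LIMSEQ_real)
  show "(\<lambda>n. norm (s n x)) \<longlonglongrightarrow> norm (f x)" if "x \<in> space M" for x
   by (rule tendsto_norm[OF s(2)[OF that]])
  show "(\<lambda>x. norm (s n x)) \<in> borel_measurable M" for n
   using simple_function_compose1[OF s(1), of norm n] by (rule borel_measurable_simple_function)
 qed
qed

lemma pointwise_measurable_combine:
 assumes f: "pointwise_measurable M f" and g: "pointwise_measurable M g"
  and p: "\<And>(u::nat \<Rightarrow> _) v a b. u \<longlonglongrightarrow> a \<Longrightarrow> v \<longlonglongrightarrow> b \<Longrightarrow> (\<lambda>n. p (u n) (v n)) \<longlonglongrightarrow> p a b"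
 shows "pointwise_measurable M (\<lambda>x. p (f x) (g x))"
proof -
 obtain s where s: "\<And>n. simple_function M (s n)" "\<And>x. x \<in> space M \<Longrightarrow> (\<lambda>n::nat. s n x) \<longlonglongrightarrow> f x"
  using f by (auto simp: pointwise_measurable_def)
 obtain t where t: "\<And>n. simple_function M (t n)" "\<And>x. x \<in> space M \<Longrightarrow> (\<lambda>n::nat. t n x) \<longlonglongrightarrow> g x"
  using g by (auto simp: pointwise_measurable_def)
 show ?thesis
  unfolding pointwise_measurable_def
 proof (intro exI[of _ "\<lambda>n x. p (s n x) (t n x)"] conjI allI ballI)
  show "simple_function M (\<lambda>x. p (s n x) (t n x))" for n by (rule simple_function_compose2[OF s(1) t(1)])
  show "(\<lambda>n. p (s n x) (t n x)) \<longlonglongrightarrow> p (f x) (g x)" if "x \<in> space M" for x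
   by (rule p[OF s(2)[OF that] t(2)[OF that]])
 qed
qed

lemma pointwise_measurable_simple:
 "simple_function M s \<Longrightarrow> pointwise_measurable M s"
 unfolding pointwise_measurable_def by (rule exI[of _ "\<lambda>_. s"]) auto

lemma pointwise_measurable_diff:
 "pointwise_measurable M f \<Longrightarrow> pointwise_measurable M g \<Longrightarrow>
  pointwise_measurable M (\<lambda>x. f x - g x)"
 by (rule pointwise_measurable_combine) (auto intro: tendsto_diff)

lemma pointwise_measurable_norm_diff:
 assumes "pointwise_measurable M f" "pointwise_measurable M g"
 shows "(\<lambda>x. ennreal (norm (f x - g x))) \<in> borel_measurable M"
 using pointwise_measurable_norm[OF pointwise_measurable_diff[OF assms]] by measurable

lemma everywhere_imp_strongly_measurable:
 "pointwise_measurable M f \<Longrightarrow> strongly_measurable M f"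
 unfolding pointwise_measurable_def strongly_measurable_def by (auto intro!: AE_I2)

text \<open>Redefine the function as \<open>0\<close> on a measurable null set that contains the exceptional one.\<close>

lemma strongly_measurable_version:
 assumes "strongly_measurable M f"
 obtains f' where "pointwise_measurable M f'" "AE x in M. f x = f' x"
proof -
 obtain s where s: "\<And>n. simple_function M (s n)" "AE x in M. (\<lambda>n::nat. s n x) \<longlonglongrightarrow> f x"
  using assms by (auto simp: strongly_measurable_def)
 from AE_E[OF s(2)] obtain N where N: "{x \<in> space M. \<not> (\<lambda>n. s n x) \<longlonglongrightarrow> f x} \<subseteq> N" "emeasure M N = 0" "N \<in> sets M"
  by blast
 show thesis
 proof (rule that[of "\<lambda>x. if x \<in> N then 0 else f x"])
  show "pointwise_measurable M (\<lambda>x. if x \<in> N then 0 else f x)"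
   unfolding pointwise_measurable_def
  proof (intro exI[of _ "\<lambda>n x. if x \<in> N then 0 else s n x"] conjI allI ballI)
   show "simple_function M (\<lambda>x. if x \<in> N then 0 else s n x)" for n
    by (rule simple_function_If_set[OF simple_function_const s(1)]) (use N(3) in auto)
   show "(\<lambda>n. if x \<in> N then 0 else s n x) \<longlonglongrightarrow> (if x \<in> N then 0 else f x)" if "x \<in> space M" for x
    using N(1) that by auto
  qed
  have "N \<in> null_sets M" using N by auto
  from AE_not_in[OF this] show "AE x in M. f x = (if x \<in> N then 0 else f x)" by eventually_elim simp
 qed
qed

lemma simple_bochner_integral_dist_le:
 assumes s: "simple_bochner_integrable M s" and t: "simple_bochner_integrable M t"
 shows "ennreal (norm (simple_bochner_integral M s - simple_bochner_integral M t)) \<le> (L1_dist M s t)"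
proof -
 have d: "simple_bochner_integrable M (\<lambda>x. s x - t x)"
  by (rule simple_bochner_integrable_compose2[OF _ s t]) simp
 have n: "simple_bochner_integrable M (\<lambda>x. norm (s x - t x))"
  by (rule simple_bochner_integrable_compose2[OF _ s t]) simp
 have "norm (simple_bochner_integral M s - simple_bochner_integral M t)
   = norm (simple_bochner_integral M (\<lambda>x. s x - t x))"
  by (simp add: simple_bochner_integral_diff[OF s t])
 also have "\<dots> \<le> simple_bochner_integral M (\<lambda>x. norm (s x - t x))"
  by (rule simple_bochner_integral_norm_bound[OF d])
 finally have "ennreal (norm (simple_bochner_integral M s - simple_bochner_integral M t))
   \<le> ennreal (simple_bochner_integral M (\<lambda>x. norm (s x - t x)))" by (rule ennreal_leI)
 also have "\<dots> = (L1_dist M s t)"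
  by (rule simple_bochner_integral_eq_nn_integral[OF n]) simp
 finally show ?thesis .
qed

lemma nn_integral_triangle:
 fixes f g h :: "'b \<Rightarrow> 'a::real_normed_vector"
 assumes "strongly_measurable M f" "strongly_measurable M g" "strongly_measurable M h"
 shows "(L1_dist M f h)
  \<le> (L1_dist M f g) + (L1_dist M g h)"
proof -
 obtain f' where f': "pointwise_measurable M f'" "AE x in M. f x = f' x"
  using strongly_measurable_version[OF assms(1)] .
 obtain g' where g': "pointwise_measurable M g'" "AE x in M. g x = g' x"
  using strongly_measurable_version[OF assms(2)] .
 obtain h' where h': "pointwise_measurable M h'" "AE x in M. h x = h' x"
  using strongly_measurable_version[OF assms(3)] .
 note [measurable] = pointwise_measurable_norm_diff[OF f'(1) g'(1)]
  pointwise_measurable_norm_diff[OF g'(1) h'(1)]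
 have "(L1_dist M f h) = (L1_dist M f' h')"
  by (rule nn_integral_cong_AE) (use f'(2) h'(2) in eventually_elim, simp)
 also have "\<dots> \<le> (\<integral>\<^sup>+x. ennreal (norm (f' x - g' x)) + ennreal (norm (g' x - h' x)) \<partial>M)"
 proof (rule nn_integral_mono)
  fix x
  have "norm (f' x - h' x) \<le> norm (f' x - g' x) + norm (g' x - h' x)" by (rule norm_diff_triangle_le) auto
  then show "ennreal (norm (f' x - h' x)) \<le> ennreal (norm (f' x - g' x)) + ennreal (norm (g' x - h' x))"
   by (simp add: ennreal_leI flip: ennreal_plus)
 qed
 also have "\<dots> = (L1_dist M f' g') + (L1_dist M g' h')"
  by (rule nn_integral_add) measurable
 also have "(L1_dist M f' g') = (L1_dist M f g)"
  by (rule nn_integral_cong_AE) (use f'(2) g'(2) in eventually_elim, simp)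
 also have "(L1_dist M g' h') = (L1_dist M g h)"
  by (rule nn_integral_cong_AE) (use g'(2) h'(2) in eventually_elim, simp)
 finally show ?thesis .
qed

lemma simple_bochner_strongly_measurable:
 "simple_bochner_integrable M s \<Longrightarrow> strongly_measurable M s"
 by (intro everywhere_imp_strongly_measurable pointwise_measurable_simple)
  (auto elim: Bochner_Integration.simple_bochner_integrable.cases)

text \<open>This estimate gives the uniqueness of the integral, its triangle inequality and all later
 comparisons of integrals.\<close>

theorem bochner_dist_le:
 assumes f: "has_bochner_int M f I" and g: "has_bochner_int M g J"
 shows "ennreal (norm (I - J)) \<le> (L1_dist M f g)"
proof -
 obtain s where s: "\<And>n. simple_bochner_integrable M (s n)"
   "(\<lambda>n::nat. L1_dist M f (s n)) \<longlonglongrightarrow> 0" "(\<lambda>n. simple_bochner_integral M (s n)) \<longlonglongrightarrow> I"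
  using f unfolding has_bochner_int_def by blast
 obtain t where t: "\<And>n. simple_bochner_integrable M (t n)"
   "(\<lambda>n::nat. L1_dist M g (t n)) \<longlonglongrightarrow> 0" "(\<lambda>n. simple_bochner_integral M (t n)) \<longlonglongrightarrow> J"
  using g unfolding has_bochner_int_def by blast
 have fm: "strongly_measurable M f" and gm: "strongly_measurable M g"
  using f g unfolding has_bochner_int_def by blast+
 let ?D = "L1_dist M f g"
 have "ennreal (norm (simple_bochner_integral M (s n) - simple_bochner_integral M (t n)))
   \<le> (L1_dist M f (s n)) + (?D + (L1_dist M g (t n)))" for n
 proof -
  note sm = simple_bochner_strongly_measurable[OF s(1)] and tm = simple_bochner_strongly_measurable[OF t(1)]
  have "ennreal (norm (simple_bochner_integral M (s n) - simple_bochner_integral M (t n)))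
    \<le> (L1_dist M (s n) (t n))" by (rule simple_bochner_integral_dist_le[OF s(1) t(1)])
  also have "\<dots> \<le> (L1_dist M (s n) f) + (L1_dist M f (t n))"
   by (rule nn_integral_triangle[OF sm fm tm])
  also have "(L1_dist M f (t n)) \<le> ?D + (L1_dist M g (t n))"
   by (rule nn_integral_triangle[OF fm gm tm])
  finally show ?thesis by (simp add: norm_minus_commute add_left_mono)
 qed
 moreover have "(\<lambda>n. (L1_dist M f (s n)) + (?D + (L1_dist M g (t n)))) \<longlonglongrightarrow> 0 + (?D + 0)"
  by (intro tendsto_add tendsto_const s t)
 moreover have "(\<lambda>n. ennreal (norm (simple_bochner_integral M (s n) - simple_bochner_integral M (t n)))) \<longlonglongrightarrow> ennreal (norm (I - J))"
  by (intro tendsto_ennrealI tendsto_norm tendsto_diff s t)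
 ultimately show ?thesis using LIMSEQ_le by fastforce
qed

lemma has_bochner_int_unique:
 assumes "has_bochner_int M f I" "has_bochner_int M f J"
 shows "I = J"
 using bochner_dist_le[OF assms] by simp

lemma bochner_int_eq: "has_bochner_int M f I \<Longrightarrow> bochner_int M f = I"
 unfolding bochner_int_def by (blast intro: has_bochner_int_unique)

lemma bochner_integrableD: "bochner_integrable M f \<Longrightarrow> has_bochner_int M f (bochner_int M f)"
 unfolding bochner_integrable_def using bochner_int_eq by blast

lemma has_bochner_int_simple:
 "simple_bochner_integrable M s \<Longrightarrow> has_bochner_int M s (simple_bochner_integral M s)"
 unfolding has_bochner_int_def
 by (intro conjI simple_bochner_strongly_measurable exI[of _ "\<lambda>_. s"]) auto

text \<open>The integrals of the approximating functions form a Cauchy sequence.\<close>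

lemma bochner_integrableI_simple_limit:
 fixes f :: "'b \<Rightarrow> 'a::banach"
 assumes f: "strongly_measurable M f" and s: "\<And>n. simple_bochner_integrable M (s n)"
  and lim: "(\<lambda>n::nat. L1_dist M f (s n)) \<longlonglongrightarrow> 0"
 shows "bochner_integrable M f"
proof -
 let ?S = "\<lambda>n. simple_bochner_integral M (s n)"
 note sm = simple_bochner_strongly_measurable[OF s]
 have "Cauchy ?S"
 proof (rule metric_CauchyI)
  fix e :: real assume e: "e > 0"
  then have "0 < ennreal (e / 2)" by simp
  from order_tendstoD(2)[OF lim this]
  obtain N where N: "\<And>n. n \<ge> N \<Longrightarrow> (L1_dist M f (s n)) < ennreal (e / 2)"
   unfolding eventually_sequentially by blast
  have "dist (?S k) (?S n) < e" if "k \<ge> N" "n \<ge> N" for k n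
  proof -
   have "ennreal (norm (?S k - ?S n)) \<le> (L1_dist M (s k) (s n))"
    by (rule simple_bochner_integral_dist_le[OF s s])
   also have "\<dots> \<le> (L1_dist M (s k) f) + (L1_dist M f (s n))"
    by (rule nn_integral_triangle[OF sm f sm])
   also have "\<dots> < ennreal (e / 2) + ennreal (e / 2)"
    using N[OF that(1)] N[OF that(2)] by (intro add_strict_mono) (simp_all add: norm_minus_commute)
   also have "\<dots> = ennreal e" using e by (simp flip: ennreal_plus)
   finally show ?thesis by (simp add: dist_norm ennreal_less_iff)
  qed
  then show "\<exists>N. \<forall>k\<ge>N. \<forall>n\<ge>N. dist (?S k) (?S n) < e" by blast
 qed
 then obtain I where "?S \<longlonglongrightarrow> I" using Cauchy_convergent convergent_def by blast
 then show ?thesis unfolding bochner_integrable_def has_bochner_int_def using f s lim by blast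
qed

lemma bochner_integrable_approx:
 assumes "bochner_integrable M f" "e > 0"
 obtains s where "simple_bochner_integrable M s" "(L1_dist M f s) \<le> ennreal e"
proof -
 obtain s where s: "\<And>n. simple_bochner_integrable M (s n)"
   "(\<lambda>n::nat. L1_dist M f (s n)) \<longlonglongrightarrow> 0"
  using assms unfolding bochner_integrable_def has_bochner_int_def by blast
 have "0 < ennreal e" using assms by simp
 from order_tendstoD(2)[OF s(2) this] obtain n where "(L1_dist M f (s n)) < ennreal e"
  by (auto simp: eventually_sequentially)
 then show thesis using that[of "s n"] s(1) by simp
qed

lemma strongly_measurable_combine:
 assumes f: "strongly_measurable M f" and g: "strongly_measurable M g"
  and p: "\<And>(u::nat \<Rightarrow> _) v a b. u \<longlonglongrightarrow> a \<Longrightarrow> v \<longlonglongrightarrow> b \<Longrightarrow> (\<lambda>n. p (u n) (v n)) \<longlonglongrightarrow> p a b"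
 shows "strongly_measurable M (\<lambda>x. p (f x) (g x))"
proof -
 obtain s where s: "\<And>n. simple_function M (s n)" "AE x in M. (\<lambda>n::nat. s n x) \<longlonglongrightarrow> f x"
  using f by (auto simp: strongly_measurable_def)
 obtain t where t: "\<And>n. simple_function M (t n)" "AE x in M. (\<lambda>n::nat. t n x) \<longlonglongrightarrow> g x"
  using g by (auto simp: strongly_measurable_def)
 have "AE x in M. (\<lambda>n. p (s n x) (t n x)) \<longlonglongrightarrow> p (f x) (g x)"
  using s(2) t(2) by eventually_elim (rule p)
 then show ?thesis
  unfolding strongly_measurable_def
  by (intro exI[of _ "\<lambda>n x. p (s n x) (t n x)"] conjI allI simple_function_compose2[OF s(1) t(1)])
qed

lemma has_bochner_int_add:
 assumes f: "has_bochner_int M f I" and g: "has_bochner_int M g J"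
 shows "has_bochner_int M (\<lambda>x. f x + g x) (I + J)"
proof -
 obtain s where s: "\<And>n. simple_bochner_integrable M (s n)"
   "(\<lambda>n::nat. L1_dist M f (s n)) \<longlonglongrightarrow> 0" "(\<lambda>n. simple_bochner_integral M (s n)) \<longlonglongrightarrow> I"
  using f unfolding has_bochner_int_def by blast
 obtain t where t: "\<And>n. simple_bochner_integrable M (t n)"
   "(\<lambda>n::nat. L1_dist M g (t n)) \<longlonglongrightarrow> 0" "(\<lambda>n. simple_bochner_integral M (t n)) \<longlonglongrightarrow> J"
  using g unfolding has_bochner_int_def by blast
 have fm: "strongly_measurable M f" and gm: "strongly_measurable M g"
  using f g unfolding has_bochner_int_def by blast+
 have sum: "strongly_measurable M (\<lambda>x. f x + g x)"
  by (rule strongly_measurable_combine[OF fm gm]) (rule tendsto_add)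
 have le: "(\<integral>\<^sup>+x. ennreal (norm (f x + g x - (s n x + t n x))) \<partial>M)
   \<le> (L1_dist M f (s n)) + (L1_dist M g (t n))" for n
 proof -
  note sm = simple_bochner_strongly_measurable[OF s(1), of n] and tm = simple_bochner_strongly_measurable[OF t(1), of n]
  have st: "strongly_measurable M (\<lambda>x. s n x + t n x)"
   by (rule strongly_measurable_combine[OF sm tm]) (rule tendsto_add)
  have sg: "strongly_measurable M (\<lambda>x. s n x + g x)"
   by (rule strongly_measurable_combine[OF sm gm]) (rule tendsto_add)
  show ?thesis using nn_integral_triangle[OF sum sg st] by (simp add: algebra_simps)
 qed
 have lim: "(\<lambda>n. \<integral>\<^sup>+x. ennreal (norm (f x + g x - (s n x + t n x))) \<partial>M) \<longlonglongrightarrow> 0"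
  by (rule tendsto_sandwich[OF _ _ tendsto_const tendsto_add[OF s(2) t(2), simplified]]) (auto simp: le)
 show ?thesis
  unfolding has_bochner_int_def
 proof (intro conjI sum exI[of _ "\<lambda>n x. s n x + t n x"] allI lim)
  show "simple_bochner_integrable M (\<lambda>x. s n x + t n x)" for n
   by (rule simple_bochner_integrable_compose2[OF _ s(1) t(1)]) simp
  show "(\<lambda>n. simple_bochner_integral M (\<lambda>x. s n x + t n x)) \<longlonglongrightarrow> I + J"
   unfolding simple_bochner_integral_add[OF s(1) t(1)] by (intro tendsto_add s t)
 qed
qed

lemma has_bochner_int_zero: "has_bochner_int M (\<lambda>_. 0) 0"
proof -
 have "simple_bochner_integrable M (\<lambda>_. 0)"
  by (rule Bochner_Integration.simple_bochner_integrable.intros) auto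
 moreover have "simple_bochner_integral M (\<lambda>_. 0) = 0"
  unfolding simple_bochner_integral_def by (rule sum.neutral) auto
 ultimately show ?thesis using has_bochner_int_simple by metis
qed

lemma has_bochner_int_sum:
 assumes "\<And>i. i \<in> S \<Longrightarrow> has_bochner_int M (f i) (I i)"
 shows "has_bochner_int M (\<lambda>x. \<Sum>i\<in>S. f i x) (\<Sum>i\<in>S. I i)"
 using assms
 by (induction S rule: infinite_finite_induct) (auto intro!: has_bochner_int_zero has_bochner_int_add)

lemma (in finite_measure) simple_bochner_integrableI:
 "simple_function M s \<Longrightarrow> simple_bochner_integrable M s"
 by (rule Bochner_Integration.simple_bochner_integrable.intros) (auto simp: emeasure_eq_measure)

text \<open>Simple functions \<open>s n\<close> that converge to \<open>f\<close> are made dominated by cutting them off where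
 they exceed \<open>2 * norm f\<close>.\<close>

theorem (in finite_measure) bochner_integrable_iff:
 fixes f :: "'a \<Rightarrow> 'c::banach"
 shows "bochner_integrable M f \<longleftrightarrow> strongly_measurable M f \<and> (\<integral>\<^sup>+x. ennreal (norm (f x)) \<partial>M) < \<infinity>"
proof (intro iffI conjI)
 assume f: "bochner_integrable M f"
 then show fm: "strongly_measurable M f" unfolding bochner_integrable_def has_bochner_int_def by blast
 obtain s where s: "simple_bochner_integrable M s" "(L1_dist M f s) \<le> ennreal 1"
  using bochner_integrable_approx[OF f, of 1] by auto
 have "simple_function M s" using s(1) by (auto elim: Bochner_Integration.simple_bochner_integrable.cases)
 then have "finite (s ` space M)" by (rule simple_functionD(1))
 then have "bounded (s ` space M)" by (rule finite_imp_bounded)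
 then obtain C where C: "C > 0" "\<And>x. x \<in> space M \<Longrightarrow> norm (s x) \<le> C" by (auto simp: bounded_pos)
 have zero: "strongly_measurable M (\<lambda>_. 0 :: 'c)"
  by (intro everywhere_imp_strongly_measurable pointwise_measurable_simple) simp
 have "(\<integral>\<^sup>+x. ennreal (norm (f x)) \<partial>M) = (\<integral>\<^sup>+x. ennreal (norm (f x - 0)) \<partial>M)" by simp
 also have "\<dots> \<le> (L1_dist M f s) + (\<integral>\<^sup>+x. ennreal (norm (s x - 0)) \<partial>M)"
  by (rule nn_integral_triangle[OF fm simple_bochner_strongly_measurable[OF s(1)] zero])
 also have "\<dots> \<le> ennreal 1 + (\<integral>\<^sup>+x. ennreal C \<partial>M)"
  using s(2) C by (intro add_mono nn_integral_mono) (auto intro: ennreal_leI)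
 also have "\<dots> < \<infinity>" by (simp add: emeasure_eq_measure ennreal_mult_less_top)
 finally show "(\<integral>\<^sup>+x. ennreal (norm (f x)) \<partial>M) < \<infinity>" .
next
 assume "strongly_measurable M f \<and> (\<integral>\<^sup>+x. ennreal (norm (f x)) \<partial>M) < \<infinity>"
 then have fm: "strongly_measurable M f" and fin: "(\<integral>\<^sup>+x. ennreal (norm (f x)) \<partial>M) < \<infinity>" by auto
 obtain f' where f': "pointwise_measurable M f'" "AE x in M. f x = f' x"
  using strongly_measurable_version[OF fm] .
 obtain s where s: "\<And>n. simple_function M (s n)" "\<And>x. x \<in> space M \<Longrightarrow> (\<lambda>n::nat. s n x) \<longlonglongrightarrow> f' x"
  using f'(1) by (auto simp: pointwise_measurable_def)
 define t where "t n x = (if norm (s n x) \<le> 2 * norm (f' x) then s n x else 0)" for n x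
 have [measurable]: "(\<lambda>x. norm (f' x)) \<in> borel_measurable M" "(\<lambda>x. norm (s n x)) \<in> borel_measurable M" for n
  by (intro pointwise_measurable_norm pointwise_measurable_simple f' s)+
 have "{x \<in> space M. norm (s n x) \<le> 2 * norm (f' x)} \<in> sets M" for n by measurable
 then have tsimple: "simple_function M (t n)" for n
  unfolding t_def by (intro simple_function_If s) simp_all
 have tlim: "(\<lambda>n. t n x) \<longlonglongrightarrow> f' x" if x: "x \<in> space M" for x
 proof (cases "f' x = 0")
  case False
  then have "\<forall>\<^sub>F n in sequentially. norm (s n x) < 2 * norm (f' x)"
   by (intro order_tendstoD(2)[OF tendsto_norm[OF s(2)[OF x]]]) simp
  then have "\<forall>\<^sub>F n in sequentially. s n x = t n x" by eventually_elim (simp add: t_def)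
  then show ?thesis by (rule Lim_transform_eventually[OF s(2)[OF x]])
 next
  case True
  then have "t n x = 0" for n by (simp add: t_def)
  then show ?thesis using True by simp
 qed
 have "(\<lambda>n. L1_dist M f' (t n)) \<longlonglongrightarrow> (\<integral>\<^sup>+x. 0 \<partial>M)"
 proof (rule nn_integral_dominated_convergence[where w = "\<lambda>x. 3 * ennreal (norm (f' x))"])
  show "(\<lambda>x. ennreal (norm (f' x - t n x))) \<in> borel_measurable M" for n
   by (intro pointwise_measurable_norm_diff pointwise_measurable_simple f' tsimple)
  have "(\<integral>\<^sup>+x. ennreal (norm (f' x)) \<partial>M) = (\<integral>\<^sup>+x. ennreal (norm (f x)) \<partial>M)"
   by (rule nn_integral_cong_AE) (use f'(2) in eventually_elim, simp)
  then show "(\<integral>\<^sup>+x. 3 * ennreal (norm (f' x)) \<partial>M) < \<infinity>"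
   using fin by (simp add: nn_integral_cmult ennreal_mult_less_top)
  show "AE x in M. ennreal (norm (f' x - t n x)) \<le> 3 * ennreal (norm (f' x))" for n
  proof (rule AE_I2)
   fix x
   have "norm (f' x - t n x) \<le> 3 * norm (f' x)"
    using norm_triangle_ineq4[of "f' x" "t n x"] by (auto simp: t_def)
   then have "ennreal (norm (f' x - t n x)) \<le> ennreal (3 * norm (f' x))" by (rule ennreal_leI)
   then show "ennreal (norm (f' x - t n x)) \<le> 3 * ennreal (norm (f' x))" by (simp add: ennreal_mult)
  qed
  show "AE x in M. (\<lambda>n. ennreal (norm (f' x - t n x))) \<longlonglongrightarrow> 0"
  proof (rule AE_I2)
   fix x assume "x \<in> space M"
   then have "(\<lambda>n. ennreal (norm (f' x - t n x))) \<longlonglongrightarrow> ennreal (norm (f' x - f' x))"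
    by (intro tendsto_ennrealI tendsto_norm tendsto_diff tendsto_const tlim)
   then show "(\<lambda>n. ennreal (norm (f' x - t n x))) \<longlonglongrightarrow> 0" by simp
  qed
 qed auto
 moreover have "(L1_dist M f' (t n)) = (L1_dist M f (t n))" for n
  by (rule nn_integral_cong_AE) (use f'(2) in eventually_elim, simp)
 ultimately have "(\<lambda>n. L1_dist M f (t n)) \<longlonglongrightarrow> 0" by simp
 then show "bochner_integrable M f"
  by (rule bochner_integrableI_simple_limit[OF fm simple_bochner_integrableI[OF tsimple]])
qed

lemma (in finite_measure) bochner_integrable_scaleC:
 fixes f :: "'a \<Rightarrow> 'c::complex_banach"
 assumes f: "bochner_integrable M f" and \<phi>: "\<phi> \<in> borel_measurable M" "\<And>x. x \<in> space M \<Longrightarrow> cmod (\<phi> x) \<le> B"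
 shows "bochner_integrable M (\<lambda>x. \<phi> x *\<^sub>C f x)"
 unfolding bochner_integrable_iff
proof
 have fm: "strongly_measurable M f" and fin: "(\<integral>\<^sup>+x. ennreal (norm (f x)) \<partial>M) < \<infinity>"
  using f unfolding bochner_integrable_iff by auto
 have \<phi>m: "pointwise_measurable M \<phi>"
  using borel_measurable_implies_sequence_metric[OF \<phi>(1), of 0] unfolding pointwise_measurable_def by blast
 show "strongly_measurable M (\<lambda>x. \<phi> x *\<^sub>C f x)"
  by (rule strongly_measurable_combine[OF everywhere_imp_strongly_measurable[OF \<phi>m] fm]) (rule tendsto_scaleC)
 obtain f' where f': "pointwise_measurable M f'" "AE x in M. f x = f' x"
  using strongly_measurable_version[OF fm] .
 have [measurable]: "(\<lambda>x. norm (f' x)) \<in> borel_measurable M" by (rule pointwise_measurable_norm[OF f'(1)])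
 have eq: "(\<integral>\<^sup>+x. ennreal (norm (f' x)) \<partial>M) = (\<integral>\<^sup>+x. ennreal (norm (f x)) \<partial>M)"
  by (rule nn_integral_cong_AE) (use f'(2) in eventually_elim, simp)
 have "(\<integral>\<^sup>+x. ennreal (norm (\<phi> x *\<^sub>C f x)) \<partial>M) \<le> (\<integral>\<^sup>+x. ennreal \<bar>B\<bar> * ennreal (norm (f' x)) \<partial>M)"
 proof (rule nn_integral_mono_AE)
  show "AE x in M. ennreal (norm (\<phi> x *\<^sub>C f x)) \<le> ennreal \<bar>B\<bar> * ennreal (norm (f' x))"
   using f'(2) AE_space
  proof eventually_elim
   case (elim x)
   then have "norm (\<phi> x *\<^sub>C f x) \<le> \<bar>B\<bar> * norm (f' x)"
    unfolding norm_scaleC using \<phi>(2)[of x] by (simp add: mult_right_mono)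
   then show ?case by (simp add: ennreal_leI flip: ennreal_mult)
  qed
 qed
 also have "\<dots> < \<infinity>" using fin by (simp add: nn_integral_cmult eq ennreal_mult_less_top)
 finally show "(\<integral>\<^sup>+x. ennreal (norm (\<phi> x *\<^sub>C f x)) \<partial>M) < \<infinity>" .
qed

section \<open>Integration against a vector measure\<close>

text \<open>Finite additivity and a bound on the variation are enough to integrate bounded functions.\<close>

locale bounded_vector_measure =
 fixes M :: "'b measure" and m :: "'b set \<Rightarrow> 'a::complex_banach" and V :: real
 assumes additive: "A \<in> sets M \<Longrightarrow> B \<in> sets M \<Longrightarrow> A \<inter> B = {} \<Longrightarrow> m (A \<union> B) = m A + m B"
  and variation: "finite P \<Longrightarrow> P \<subseteq> sets M \<Longrightarrow> disjoint P \<Longrightarrow> (\<Sum>A\<in>P. norm (m A)) \<le> V"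
begin

lemma m_empty [simp]: "m {} = 0"
 using additive[of "{}" "{}"] by simp

lemma V_nonneg: "0 \<le> V"
 using variation[of "{}"] by simp

lemma m_UN:
 assumes "finite I" "\<And>i. i \<in> I \<Longrightarrow> A i \<in> sets M" "disjoint_family_on A I"
 shows "m (\<Union>i\<in>I. A i) = (\<Sum>i\<in>I. m (A i))"
 using assms
proof (induction I)
 case (insert i I)
 have meas: "A j \<in> sets M" if "j \<in> insert i I" for j by (rule insert.prems(1)[OF that])
 have disj: "disjoint_family_on A I" by (rule disjoint_family_on_mono[OF subset_insertI insert.prems(2)])
 have U: "(\<Union>j\<in>I. A j) \<in> sets M" using insert.hyps(1) meas by (intro sets.finite_UN) auto
 have "A i \<inter> A j = {}" if "j \<in> I" for j
  by (rule disjoint_family_onD[OF insert.prems(2)]) (use insert.hyps(2) that in auto)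
 then have "A i \<inter> (\<Union>j\<in>I. A j) = {}" by auto
 then have "m (A i \<union> (\<Union>j\<in>I. A j)) = m (A i) + m (\<Union>j\<in>I. A j)"
  by (rule additive[OF meas[OF insertI1] U])
 also have "m (\<Union>j\<in>I. A j) = (\<Sum>j\<in>I. m (A j))"
  by (rule insert.IH[OF meas disj]) (rule insertI2)
 finally show ?case using insert.hyps by simp
qed simp

lemma simple_function_level_sets: "simple_function M t \<Longrightarrow> {x \<in> space M. t x = d} \<in> sets M"
 by (drule simple_functionD(2)[of _ _ "{d}"]) (simp add: vimage_def Int_def conj_commute)

lemma sum_norm_level_sets:
 assumes t: "simple_function M t"
 shows "(\<Sum>d\<in>t ` space M. norm (m {x \<in> space M. t x = d})) \<le> V"
proof -
 let ?L = "\<lambda>d. {x \<in> space M. t x = d}"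
 have inj: "inj_on ?L (t ` space M)" by (rule inj_onI) blast
 have "(\<Sum>A\<in>?L ` t ` space M. norm (m A)) \<le> V"
 proof (rule variation)
  show "finite (?L ` t ` space M)" using simple_functionD(1)[OF t] by simp
  show "?L ` t ` space M \<subseteq> sets M" using simple_function_level_sets[OF t] by auto
  show "disjoint (?L ` t ` space M)" by (auto simp: disjoint_def)
 qed
 then show ?thesis by (simp add: sum.reindex[OF inj])
qed

text \<open>A common refinement: the integral may be computed from the level sets of any simple function
 through which the integrand factors.\<close>

lemma simple_vm_int_compose:
 assumes t: "simple_function M t"
 shows "simple_vm_int M m (\<lambda>x. h (t x)) = (\<Sum>d\<in>t ` space M. h d *\<^sub>C m {x \<in> space M. t x = d})"
proof -
 let ?T = "t ` space M" and ?L = "\<lambda>d. {x \<in> space M. t x = d}"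
 have fin: "finite ?T" by (rule simple_functionD(1)[OF t])
 have "m {x \<in> space M. h (t x) = c} = (\<Sum>d | d \<in> ?T \<and> h d = c. m (?L d))" for c
 proof -
  have eq: "{x \<in> space M. h (t x) = c} = (\<Union>d\<in>{d \<in> ?T. h d = c}. ?L d)" by auto
  show ?thesis
   unfolding eq by (rule m_UN) (use fin simple_function_level_sets[OF t] in \<open>auto simp: disjoint_family_on_def\<close>)
 qed
 then have "simple_vm_int M m (\<lambda>x. h (t x)) = (\<Sum>c\<in>h ` ?T. \<Sum>d | d \<in> ?T \<and> h d = c. c *\<^sub>C m (?L d))"
  unfolding simple_vm_int_def by (simp add: image_image scaleC_sum_right)
 also have "\<dots> = (\<Sum>c\<in>h ` ?T. \<Sum>d | d \<in> ?T \<and> h d = c. h d *\<^sub>C m (?L d))"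
  by (intro sum.cong refl) auto
 also have "\<dots> = (\<Sum>d\<in>?T. h d *\<^sub>C m (?L d))"
  by (rule sum.image_gen[OF fin, symmetric])
 finally show ?thesis .
qed

lemma simple_vm_int_add:
 assumes s: "simple_function M s" and t: "simple_function M t"
 shows "simple_vm_int M m (\<lambda>x. s x + t x) = simple_vm_int M m s + simple_vm_int M m t"
proof -
 have p: "simple_function M (\<lambda>x. (s x, t x))" by (rule simple_function_Pair[OF s t])
 show ?thesis
  using simple_vm_int_compose[OF p, of "\<lambda>(l, b). l + b"] simple_vm_int_compose[OF p, of fst]
   simple_vm_int_compose[OF p, of snd]
  by (simp add: case_prod_beta scaleC_add_left sum.distrib)
qed

lemma simple_vm_int_scale:
 assumes s: "simple_function M s"
 shows "simple_vm_int M m (\<lambda>x. c * s x) = c *\<^sub>C simple_vm_int M m s"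
 using simple_vm_int_compose[OF s, of "\<lambda>z. c * z"] simple_vm_int_compose[OF s, of "\<lambda>z. z"]
 by (simp add: scaleC_scaleC scaleC_sum_right)

lemma simple_vm_int_diff:
 assumes s: "simple_function M s" and t: "simple_function M t"
 shows "simple_vm_int M m (\<lambda>x. s x - t x) = simple_vm_int M m s - simple_vm_int M m t"
proof -
 have "simple_function M (\<lambda>x. (-1) * t x)" by (rule simple_function_compose1[OF t])
 from simple_vm_int_add[OF s this] show ?thesis
  using simple_vm_int_scale[OF t, of "-1"] by (simp add: scaleC_minus_one)
qed

lemma simple_vm_int_norm_le:
 assumes s: "simple_function M s" and B: "\<And>x. x \<in> space M \<Longrightarrow> cmod (s x) \<le> B" "0 \<le> B"
 shows "norm (simple_vm_int M m s) \<le> B * V"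
proof -
 have "norm (simple_vm_int M m s) \<le> (\<Sum>c\<in>s ` space M. norm (c *\<^sub>C m {x \<in> space M. s x = c}))"
  unfolding simple_vm_int_def by (rule norm_sum)
 also have "\<dots> \<le> (\<Sum>c\<in>s ` space M. B * norm (m {x \<in> space M. s x = c}))"
  using B by (intro sum_mono) (auto simp: norm_scaleC intro!: mult_right_mono)
 also have "\<dots> \<le> B * V"
  using sum_norm_level_sets[OF s] B(2) by (simp add: sum_distrib_left[symmetric] mult_left_mono)
 finally show ?thesis .
qed

text \<open>Existence of the integral together with a rate of convergence.\<close>

lemma vm_int_approx:
 assumes g: "g \<in> borel_measurable M" "\<And>x. x \<in> space M \<Longrightarrow> cmod (g x) \<le> B"
  and s: "simple_function M s" "\<And>x. x \<in> space M \<Longrightarrow> cmod (g x - s x) \<le> e" "0 \<le> e"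
 shows "norm (vm_int M m g - simple_vm_int M m s) \<le> e * V"
proof -
 have close: "norm (simple_vm_int M m u - simple_vm_int M m v) \<le> (l + b) * V"
  if u: "simple_function M u" "\<And>x. x \<in> space M \<Longrightarrow> cmod (u x - g x) \<le> l"
   and v: "simple_function M v" "\<And>x. x \<in> space M \<Longrightarrow> cmod (v x - g x) \<le> b" and ab: "0 \<le> l" "0 \<le> b" for u v l b
 proof -
  have "norm (simple_vm_int M m (\<lambda>x. u x - v x)) \<le> (l + b) * V"
  proof (rule simple_vm_int_norm_le)
   show "simple_function M (\<lambda>x. u x - v x)" by (rule simple_function_compose2[OF u(1) v(1)])
   fix x assume "x \<in> space M"
   then show "cmod (u x - v x) \<le> l + b"
    using u(2)[of x] v(2)[of x] norm_triangle_ineq4[of "u x - g x" "v x - g x"] by simp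
  qed (use ab in auto)
  then show ?thesis by (simp add: simple_vm_int_diff[OF u(1) v(1)])
 qed
 have "\<forall>n::nat. \<exists>u. simple_function M u \<and> (\<forall>x\<in>space M. cmod (u x - g x) \<le> 1 / real (Suc n))"
 proof
  fix n :: nat
  have "0 < 1 / real (Suc n)" by simp
  from simple_uniform_approx[OF g this]
  show "\<exists>u. simple_function M u \<and> (\<forall>x\<in>space M. cmod (u x - g x) \<le> 1 / real (Suc n))" by metis
 qed
 then obtain u where u: "\<And>n::nat. simple_function M (u n)" "\<And>n x. x \<in> space M \<Longrightarrow> cmod (u n x - g x) \<le> 1 / real (Suc n)"
  by metis
 have null: "(\<lambda>n. 1 / real (Suc n)) \<longlonglongrightarrow> 0" by (rule LIMSEQ_Suc[OF lim_1_over_n])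
 have ulim: "uniform_limit (space M) u g sequentially"
 proof (rule uniform_limitI)
  fix e :: real assume "e > 0"
  from order_tendstoD(2)[OF null this] show "\<forall>\<^sub>F n in sequentially. \<forall>x\<in>space M. dist (u n x) (g x) < e"
   by eventually_elim (use u(2) in \<open>auto simp: dist_norm intro: le_less_trans\<close>)
 qed
 have "Cauchy (\<lambda>n. simple_vm_int M m (u n))"
 proof (rule metric_CauchyI)
  fix e :: real assume e: "e > 0"
  have V1: "0 < V + 1" using V_nonneg by simp
  obtain N where N: "1 / real (Suc N) < e / (2 * (V + 1))" using nat_approx_posE[of "e / (2 * (V + 1))"] e V1 by auto
  show "\<exists>N. \<forall>k\<ge>N. \<forall>n\<ge>N. dist (simple_vm_int M m (u k)) (simple_vm_int M m (u n)) < e"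
  proof (intro exI allI impI)
   fix k n assume "k \<ge> N" "n \<ge> N"
   then have kn: "1 / real (Suc k) \<le> 1 / real (Suc N)" "1 / real (Suc n) \<le> 1 / real (Suc N)"
    by (auto intro!: divide_left_mono)
   have "norm (simple_vm_int M m (u k) - simple_vm_int M m (u n)) \<le> (1 / real (Suc k) + 1 / real (Suc n)) * V"
    by (rule close) (use u in auto)
   also have "\<dots> \<le> (1 / real (Suc N) + 1 / real (Suc N)) * (V + 1)"
    using kn V_nonneg by (intro mult_mono add_mono) auto
   also have "\<dots> < (e / (2 * (V + 1)) + e / (2 * (V + 1))) * (V + 1)"
    using N V1 by (intro mult_strict_right_mono add_strict_mono) auto
   also have "\<dots> = e"
   proof -
    have "(e / (2 * W) + e / (2 * W)) * W = e" if "W > 0" for W :: real using that by (simp add: field_simps)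
    then show ?thesis using V1 by blast
   qed
   finally show "dist (simple_vm_int M m (u k)) (simple_vm_int M m (u n)) < e" by (simp add: dist_norm)
  qed
 qed
 then obtain I where I: "(\<lambda>n. simple_vm_int M m (u n)) \<longlonglongrightarrow> I"
  using Cauchy_convergent convergent_def by blast
 have hI: "has_vm_int M m g I" unfolding has_vm_int_def using u(1) ulim I by blast
 have uniq: "norm (J - simple_vm_int M m r) \<le> d * V"
  if J: "has_vm_int M m g J" and r: "simple_function M r" "\<And>x. x \<in> space M \<Longrightarrow> cmod (g x - r x) \<le> d" "0 \<le> d" for J r d
 proof -
  obtain v where v: "\<And>n::nat. simple_function M (v n)" "uniform_limit (space M) v g sequentially"
    "(\<lambda>n. simple_vm_int M m (v n)) \<longlonglongrightarrow> J"
   using J unfolding has_vm_int_def by blast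
  have le: "norm (J - simple_vm_int M m r) \<le> (b + d) * V" if b: "b > 0" for b
  proof (rule tendsto_upperbound)
   show "(\<lambda>n. norm (simple_vm_int M m (v n) - simple_vm_int M m r)) \<longlonglongrightarrow> norm (J - simple_vm_int M m r)"
    by (intro tendsto_intros v)
   have "\<forall>\<^sub>F n in sequentially. \<forall>x\<in>space M. dist (v n x) (g x) < b" by (rule uniform_limitD[OF v(2) b])
   then show "\<forall>\<^sub>F n in sequentially. norm (simple_vm_int M m (v n) - simple_vm_int M m r) \<le> (b + d) * V"
   proof eventually_elim
    case (elim n)
    show ?case
     by (rule close[OF v(1) _ r(1)]) (use elim r b in \<open>auto simp: dist_norm norm_minus_commute intro: less_imp_le\<close>)
   qed
  qed simp
  have "((\<lambda>b. (b + d) * V) \<longlongrightarrow> (0 + d) * V) (at_right 0)" by (intro tendsto_intros)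
  then have "norm (J - simple_vm_int M m r) \<le> (0 + d) * V"
   by (rule tendsto_lowerbound[OF _ _ trivial_limit_at_right_real])
    (auto simp: eventually_at_right_field intro!: exI[of _ 1] le)
  then show ?thesis by simp
 qed
 have "J = I" if "has_vm_int M m g J" for J
 proof -
  have "(\<lambda>n. norm (J - simple_vm_int M m (u n))) \<longlonglongrightarrow> 0"
  proof (rule tendsto_sandwich[OF _ _ tendsto_const])
   have "norm (J - simple_vm_int M m (u n)) \<le> 1 / real (Suc n) * V" for n
    by (rule uniq[OF that u(1)]) (use u(2) in \<open>auto simp: norm_minus_commute\<close>)
   then show "\<forall>\<^sub>F n in sequentially. norm (J - simple_vm_int M m (u n)) \<le> 1 / real (Suc n) * V" by simp
   show "(\<lambda>n. 1 / real (Suc n) * V) \<longlonglongrightarrow> 0" using tendsto_mult_left_zero[OF null] .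
  qed auto
  moreover have "(\<lambda>n. norm (J - simple_vm_int M m (u n))) \<longlonglongrightarrow> norm (J - I)" by (intro tendsto_intros I)
  ultimately have "norm (J - I) = 0" using LIMSEQ_unique by blast
  then show ?thesis by simp
 qed
 with hI have "vm_int M m g = I" unfolding vm_int_def by blast
 then show ?thesis using uniq[OF hI s] by simp
qed

lemma vm_int_eqI:
 assumes g: "g \<in> borel_measurable M" "\<And>x. x \<in> space M \<Longrightarrow> cmod (g x) \<le> B"
  and C: "\<And>s e. 0 < e \<Longrightarrow> simple_function M s \<Longrightarrow> (\<And>x. x \<in> space M \<Longrightarrow> cmod (g x - s x) \<le> e) \<Longrightarrow> norm (I - simple_vm_int M m s) \<le> e * C"
 shows "vm_int M m g = I"
proof -
 have le: "norm (vm_int M m g - I) \<le> e * (V + C)" if e: "e > 0" for e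
 proof -
  obtain s where s: "simple_function M s" "\<And>x. x \<in> space M \<Longrightarrow> cmod (s x - g x) \<le> e"
   using simple_uniform_approx[OF g e] by metis
  have "norm (vm_int M m g - simple_vm_int M m s) \<le> e * V"
   by (rule vm_int_approx[OF g s(1)]) (use s(2) e in \<open>auto simp: norm_minus_commute\<close>)
  moreover have "norm (I - simple_vm_int M m s) \<le> e * C"
   by (rule C[OF e s(1)]) (use s(2) in \<open>auto simp: norm_minus_commute\<close>)
  ultimately show ?thesis
   using norm_triangle_ineq4[of "vm_int M m g - simple_vm_int M m s" "I - simple_vm_int M m s"]
   by (simp add: distrib_left)
 qed
 have "((\<lambda>e. e * (V + C)) \<longlongrightarrow> 0 * (V + C)) (at_right 0)" by (intro tendsto_intros)
 then have "norm (vm_int M m g - I) \<le> 0 * (V + C)"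
  by (rule tendsto_lowerbound[OF _ _ trivial_limit_at_right_real])
   (auto simp: eventually_at_right_field intro!: exI[of _ 1] le)
 then show ?thesis by simp
qed

lemma vm_int_simple:
 assumes s: "simple_function M s"
 shows "vm_int M m s = simple_vm_int M m s"
proof -
 have "finite (s ` space M)" by (rule simple_functionD(1)[OF s])
 then obtain B where B: "\<And>x. x \<in> space M \<Longrightarrow> cmod (s x) \<le> B"
  using finite_imp_bounded[of "s ` space M"] by (auto simp: bounded_iff)
 show ?thesis
  using vm_int_approx[OF borel_measurable_simple_function[OF s] B s, of 0] by simp
qed

lemma vm_int_norm_le:
 assumes g: "g \<in> borel_measurable M" "\<And>x. x \<in> space M \<Longrightarrow> cmod (g x) \<le> B" and B: "0 \<le> B"
 shows "norm (vm_int M m g) \<le> B * V"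
 using vm_int_approx[OF g, of "\<lambda>_. 0" B] g(2) B simple_vm_int_norm_le[of "\<lambda>_. 0" 0] by simp

lemma vm_int_add:
 assumes g: "g \<in> borel_measurable M" "\<And>x. x \<in> space M \<Longrightarrow> cmod (g x) \<le> B"
  and h: "h \<in> borel_measurable M" "\<And>x. x \<in> space M \<Longrightarrow> cmod (h x) \<le> B'"
 shows "vm_int M m (\<lambda>x. g x + h x) = vm_int M m g + vm_int M m h"
proof (rule vm_int_eqI)
 show "(\<lambda>x. g x + h x) \<in> borel_measurable M" using g h by measurable
 show "cmod (g x + h x) \<le> B + B'" if "x \<in> space M" for x
  using g(2)[OF that] h(2)[OF that] norm_triangle_ineq[of "g x" "h x"] by simp
 fix s e assume e: "0 < (e::real)" and s: "simple_function M s" "\<And>x. x \<in> space M \<Longrightarrow> cmod (g x + h x - s x) \<le> e"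
 obtain u where u: "simple_function M u" "\<And>x. x \<in> space M \<Longrightarrow> cmod (u x - g x) \<le> e"
  using simple_uniform_approx[OF g e] by metis
 have su: "simple_function M (\<lambda>x. s x - u x)" by (rule simple_function_compose2[OF s(1) u(1)])
 have "norm (vm_int M m g - simple_vm_int M m u) \<le> e * V"
  by (rule vm_int_approx[OF g u(1)]) (use u(2) e in \<open>auto simp: norm_minus_commute\<close>)
 moreover have "norm (vm_int M m h - simple_vm_int M m (\<lambda>x. s x - u x)) \<le> (2 * e) * V"
 proof (rule vm_int_approx[OF h su])
  fix x assume x: "x \<in> space M"
  show "cmod (h x - (s x - u x)) \<le> 2 * e"
   using s(2)[OF x] u(2)[OF x] norm_triangle_ineq[of "g x + h x - s x" "u x - g x"] by (simp add: algebra_simps)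
 qed (use e in auto)
 ultimately show "norm (vm_int M m g + vm_int M m h - simple_vm_int M m s) \<le> e * (3 * V)"
  using norm_triangle_ineq[of "vm_int M m g - simple_vm_int M m u" "vm_int M m h - simple_vm_int M m (\<lambda>x. s x - u x)"]
  by (simp add: simple_vm_int_diff[OF s(1) u(1)] algebra_simps)
qed

lemma vm_int_scale:
 assumes g: "g \<in> borel_measurable M" "\<And>x. x \<in> space M \<Longrightarrow> cmod (g x) \<le> B"
 shows "vm_int M m (\<lambda>x. c * g x) = c *\<^sub>C vm_int M m g"
proof (rule vm_int_eqI)
 show "(\<lambda>x. c * g x) \<in> borel_measurable M" using g by measurable
 show "cmod (c * g x) \<le> cmod c * B" if "x \<in> space M" for x
  using g(2)[OF that] by (simp add: norm_mult mult_left_mono)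
 fix s e assume e: "0 < (e::real)" and s: "simple_function M s" "\<And>x. x \<in> space M \<Longrightarrow> cmod (c * g x - s x) \<le> e"
 obtain u where u: "simple_function M u" "\<And>x. x \<in> space M \<Longrightarrow> cmod (u x - g x) \<le> e"
  using simple_uniform_approx[OF g e] by metis
 have cu: "simple_function M (\<lambda>x. c * u x)" by (rule simple_function_compose1[OF u(1)])
 have "norm (vm_int M m g - simple_vm_int M m u) \<le> e * V"
  by (rule vm_int_approx[OF g u(1)]) (use u(2) e in \<open>auto simp: norm_minus_commute\<close>)
 then have 1: "norm (c *\<^sub>C vm_int M m g - simple_vm_int M m (\<lambda>x. c * u x)) \<le> cmod c * (e * V)"
  unfolding simple_vm_int_scale[OF u(1)] scaleC_diff_right[symmetric] norm_scaleC by (intro mult_left_mono) auto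
 have "norm (simple_vm_int M m (\<lambda>x. c * u x - s x)) \<le> ((cmod c + 1) * e) * V"
 proof (rule simple_vm_int_norm_le)
  show "simple_function M (\<lambda>x. c * u x - s x)" by (rule simple_function_compose2[OF cu s(1)])
  fix x assume x: "x \<in> space M"
  have "cmod (c * u x - s x) \<le> cmod (c * (u x - g x)) + cmod (c * g x - s x)"
   using norm_triangle_ineq[of "c * (u x - g x)" "c * g x - s x"] by (simp add: algebra_simps)
  also have "\<dots> \<le> cmod c * e + e"
   using u(2)[OF x] s(2)[OF x] by (intro add_mono) (auto simp: norm_mult intro!: mult_left_mono)
  finally show "cmod (c * u x - s x) \<le> (cmod c + 1) * e" by (simp add: algebra_simps)
 qed (use e in auto)
 with 1 show "norm (c *\<^sub>C vm_int M m g - simple_vm_int M m s) \<le> e * ((2 * cmod c + 1) * V)"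
  using norm_triangle_ineq[of "c *\<^sub>C vm_int M m g - simple_vm_int M m (\<lambda>x. c * u x)"
    "simple_vm_int M m (\<lambda>x. c * u x) - simple_vm_int M m s"]
  by (simp add: simple_vm_int_diff[OF cu s(1)] algebra_simps)
qed

lemma vm_int_indicator:
 assumes A: "A \<in> sets M"
 shows "vm_int M m (indicator A) = m A"
proof -
 have "simple_vm_int M m (\<lambda>x. of_bool (x \<in> A)) = (\<Sum>d\<in>(\<lambda>x. x \<in> A) ` space M. of_bool d *\<^sub>C m {x \<in> space M. (x \<in> A) = d})"
 proof (rule simple_vm_int_compose)
  show "simple_function M (\<lambda>x. x \<in> A)"
   unfolding simple_function_def
  proof (intro conjI ballI)
   fix b :: bool
   have "(\<lambda>x. x \<in> A) -` {b} \<inter> space M = (if b then A else space M - A)"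
    using sets.sets_into_space[OF A] by auto
   then show "(\<lambda>x. x \<in> A) -` {b} \<inter> space M \<in> sets M" using A by auto
  qed (rule finite_subset[of _ UNIV], auto)
 qed
 also have "\<dots> = (\<Sum>d\<in>UNIV. of_bool d *\<^sub>C m {x \<in> space M. (x \<in> A) = d})"
 proof (rule sum.mono_neutral_left)
  show "\<forall>d\<in>UNIV - (\<lambda>x. x \<in> A) ` space M. of_bool d *\<^sub>C m {x \<in> space M. (x \<in> A) = d} = 0"
  proof
   fix d assume "d \<in> UNIV - (\<lambda>x. x \<in> A) ` space M"
   then have empty: "{x \<in> space M. (x \<in> A) = d} = {}" by auto
   show "of_bool d *\<^sub>C m {x \<in> space M. (x \<in> A) = d} = 0" unfolding empty by simp
  qed
 qed auto
 also have "\<dots> = m {x \<in> space M. x \<in> A}" by (simp add: UNIV_bool)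
 also have "{x \<in> space M. x \<in> A} = A" using sets.sets_into_space[OF A] by auto
 finally have "simple_vm_int M m (\<lambda>x. of_bool (x \<in> A)) = m A" .
 moreover have "(indicator A :: _ \<Rightarrow> complex) = (\<lambda>x. of_bool (x \<in> A))" by (auto simp: indicator_def)
 moreover have "simple_function M (indicator A :: _ \<Rightarrow> complex)" using A by (rule simple_function_indicator)
 ultimately show ?thesis using vm_int_simple[of "indicator A"] by simp
qed

lemma vm_int_cong: "(\<And>x. x \<in> space M \<Longrightarrow> g x = h x) \<Longrightarrow> vm_int M m g = vm_int M m h"
proof -
 assume eq: "\<And>x. x \<in> space M \<Longrightarrow> g x = h x"
 then have "uniform_limit (space M) s g sequentially \<longleftrightarrow> uniform_limit (space M) s h sequentially" for s
  by (intro uniform_limit_cong') auto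
 then have "has_vm_int M m g = has_vm_int M m h" unfolding has_vm_int_def by (intro ext) simp
 then show ?thesis by (simp add: vm_int_def)
qed

lemma vm_int_zero: "vm_int M m (\<lambda>_. 0) = 0"
 using vm_int_norm_le[of "\<lambda>_. 0" 0] by simp

lemma vm_int_sum:
 assumes "\<And>i. i \<in> I \<Longrightarrow> g i \<in> borel_measurable M" "\<And>i x. i \<in> I \<Longrightarrow> x \<in> space M \<Longrightarrow> cmod (g i x) \<le> B"
 shows "vm_int M m (\<lambda>x. \<Sum>i\<in>I. g i x) = (\<Sum>i\<in>I. vm_int M m (g i))"
 using assms
proof (induction I rule: infinite_finite_induct)
 case (insert i I)
 have "vm_int M m (\<lambda>x. g i x + (\<Sum>j\<in>I. g j x)) = vm_int M m (g i) + vm_int M m (\<lambda>x. \<Sum>j\<in>I. g j x)"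
 proof (rule vm_int_add[where B = B and B' = "real (card I) * B"])
  show "(\<lambda>x. \<Sum>j\<in>I. g j x) \<in> borel_measurable M" using insert.prems by measurable
  show "cmod (\<Sum>j\<in>I. g j x) \<le> real (card I) * B" if "x \<in> space M" for x
   using insert.prems(2) that by (intro order_trans[OF norm_sum] sum_bounded_above) auto
 qed (use insert.prems in auto)
 then show ?case using insert by simp
qed (auto simp: vm_int_zero)

end

text \<open>A selection from the cells of a fine enough finite partition.\<close>

lemma simple_selection:
 fixes \<phi> :: "'i \<Rightarrow> 'b \<Rightarrow> complex"
 assumes S: "finite S" and \<phi>: "\<And>i. i \<in> S \<Longrightarrow> \<phi> i \<in> borel_measurable M"
  "\<And>i x. i \<in> S \<Longrightarrow> x \<in> space M \<Longrightarrow> cmod (\<phi> i x) \<le> B" and e: "e > 0"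
 obtains \<sigma> where "simple_function M \<sigma>" "\<And>x. x \<in> space M \<Longrightarrow> \<sigma> x \<in> space M"
  "\<And>i x. i \<in> S \<Longrightarrow> x \<in> space M \<Longrightarrow> cmod (\<phi> i x - \<phi> i (\<sigma> x)) \<le> e"
proof -
 have "\<forall>i\<in>S. \<exists>t. simple_function M t \<and> (\<forall>x\<in>space M. cmod (t x - \<phi> i x) \<le> e / 2)"
 proof
  fix i assume i: "i \<in> S"
  have "0 < e / 2" using e by simp
  from simple_uniform_approx[OF \<phi>(1)[OF i] \<phi>(2)[OF i] this]
  show "\<exists>t. simple_function M t \<and> (\<forall>x\<in>space M. cmod (t x - \<phi> i x) \<le> e / 2)" by metis
 qed
 then obtain t where t: "\<And>i. i \<in> S \<Longrightarrow> simple_function M (t i)"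
   "\<And>i x. i \<in> S \<Longrightarrow> x \<in> space M \<Longrightarrow> cmod (t i x - \<phi> i x) \<le> e / 2" by metis
 obtain xs where xs: "set xs = S" using finite_list[OF S] by blast
 have "simple_function M (\<lambda>x. map (\<lambda>i. t i x) ys)" if "set ys \<subseteq> S" for ys
  using that
 proof (induction ys)
  case (Cons i ys)
  then show ?case using simple_function_compose2[of M "t i" "\<lambda>x. map (\<lambda>i. t i x) ys" "(#)"] t(1) by simp
 qed simp
 then have T: "simple_function M (\<lambda>x. map (\<lambda>i. t i x) xs)" using xs by simp
 define T where "T x = map (\<lambda>i. t i x) xs" for x
 define rep where "rep d = (SOME y. y \<in> space M \<and> T y = d)" for d
 have rep: "rep (T x) \<in> space M" "T (rep (T x)) = T x" if "x \<in> space M" for x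
  using someI[of "\<lambda>y. y \<in> space M \<and> T y = T x" x] that unfolding rep_def by auto
 show thesis
 proof (rule that[of "\<lambda>x. rep (T x)"])
  show "simple_function M (\<lambda>x. rep (T x))"
   using simple_function_compose1[OF T, of rep] by (simp add: T_def)
  fix i x assume i: "i \<in> S" and x: "x \<in> space M"
  have "t i (rep (T x)) = t i x" using rep(2)[OF x] i xs by (auto simp: T_def)
  then have "cmod (t i x - \<phi> i (rep (T x))) \<le> e / 2" using t(2)[OF i rep(1)[OF x]] by simp
  then show "cmod (\<phi> i x - \<phi> i (rep (T x))) \<le> e"
   using t(2)[OF i x] norm_triangle_ineq4[of "t i x - \<phi> i (rep (T x))" "t i x - \<phi> i x"] by simp
 qed (use rep in auto)
qed


section \<open>Fejer means\<close>

text \<open>The coefficients of the kernel \<open>\<bar>\<Sum>b\<in>B. w\<^sup>b\<bar>\<^sup>2 / card B\<close>, see \<open>fejer_kernel\<close>.\<close>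

definition fejer :: "(nat \<Rightarrow> int) set \<Rightarrow> (nat \<Rightarrow> int) \<Rightarrow> real" where
 "fejer B a = real (card {\<beta> \<in> B. (\<lambda>j. \<beta> j - a j) \<in> B}) / real (card B)"

definition difference_set :: "(nat \<Rightarrow> int) set \<Rightarrow> (nat \<Rightarrow> int) set" where
 "difference_set B = (\<lambda>(\<beta>, \<gamma>) j. \<beta> j - \<gamma> j) ` (B \<times> B)"

lemma finite_difference_set: "finite B \<Longrightarrow> finite (difference_set B)"
 by (simp add: difference_set_def)

lemma difference_set_Z_fin: "B \<subseteq> Z_fin \<Longrightarrow> difference_set B \<subseteq> Z_fin"
 by (auto simp: difference_set_def intro!: Z_fin_diff)

lemma fejer_bounds: "0 \<le> fejer B a" "fejer B a \<le> 1"
proof -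
 show "0 \<le> fejer B a" by (simp add: fejer_def)
 show "fejer B a \<le> 1"
 proof (cases "finite B")
  case True
  then have "card {\<beta> \<in> B. (\<lambda>j. \<beta> j - a j) \<in> B} \<le> card B" by (intro card_mono) auto
  then show ?thesis by (simp add: fejer_def divide_le_eq)
 qed (simp add: fejer_def)
qed

lemma fejer_outside: "a \<notin> difference_set B \<Longrightarrow> fejer B a = 0"
proof -
 assume a: "a \<notin> difference_set B"
 have "a \<in> difference_set B" if "\<beta> \<in> B" "(\<lambda>j. \<beta> j - a j) \<in> B" for \<beta>
  unfolding difference_set_def by (rule image_eqI[of _ _ "(\<beta>, \<lambda>j. \<beta> j - a j)"]) (use that in auto)
 then have "{\<beta> \<in> B. (\<lambda>j. \<beta> j - a j) \<in> B} = {}" using a by blast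
 then show ?thesis by (simp only: fejer_def) simp
qed

text \<open>The kernel with these coefficients is the square of a Dirichlet kernel, whence it is
 nonnegative.\<close>

lemma fejer_kernel:
 assumes B: "finite B" "B \<subseteq> Z_fin" and \<tau>: "\<tau> \<in> torus"
 shows "(\<Sum>a\<in>difference_set B. of_real (fejer B a) * monomial a \<tau>) = of_real ((cmod (\<Sum>\<beta>\<in>B. monomial \<beta> \<tau>))\<^sup>2 / real (card B))"
proof -
 let ?d = "\<lambda>(\<beta>, \<gamma>) j. \<beta> j - \<gamma> j :: int"
 have "complex_of_real ((cmod (\<Sum>\<beta>\<in>B. monomial \<beta> \<tau>))\<^sup>2) = (\<Sum>\<beta>\<in>B. monomial \<beta> \<tau>) * cnj (\<Sum>\<gamma>\<in>B. monomial \<gamma> \<tau>)"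
  by (rule complex_norm_square)
 also have "\<dots> = (\<Sum>p\<in>B \<times> B. monomial (fst p) \<tau> * cnj (monomial (snd p) \<tau>))"
  by (simp add: sum_product sum.cartesian_product case_prod_beta)
 also have "\<dots> = (\<Sum>p\<in>B \<times> B. monomial (?d p) \<tau>)"
  using B(2) \<tau> by (intro sum.cong refl) (auto simp: monomial_diff subset_iff)
 also have "\<dots> = (\<Sum>a\<in>?d ` (B \<times> B). \<Sum>p | p \<in> B \<times> B \<and> ?d p = a. monomial (?d p) \<tau>)"
  using B(1) by (intro sum.image_gen) simp
 also have "\<dots> = (\<Sum>a\<in>difference_set B. of_nat (card {\<beta> \<in> B. (\<lambda>j. \<beta> j - a j) \<in> B}) * monomial a \<tau>)"
  unfolding difference_set_def
 proof (rule sum.cong[OF refl])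
  fix a
  have "bij_betw (\<lambda>\<beta>. (\<beta>, \<lambda>j. \<beta> j - a j)) {\<beta> \<in> B. (\<lambda>j. \<beta> j - a j) \<in> B} {p. p \<in> B \<times> B \<and> ?d p = a}"
  proof (rule bij_betwI[where g = fst])
   show "(\<lambda>\<beta>. (\<beta>, \<lambda>j. \<beta> j - a j)) \<in> {\<beta> \<in> B. (\<lambda>j. \<beta> j - a j) \<in> B} \<rightarrow> {p. p \<in> B \<times> B \<and> ?d p = a}"
    by auto
   have *: "(\<lambda>j. \<beta> j - (\<beta> j - \<gamma> j)) = \<gamma>" for \<beta> \<gamma> :: "nat \<Rightarrow> int" by simp
   show "fst \<in> {p. p \<in> B \<times> B \<and> ?d p = a} \<rightarrow> {\<beta> \<in> B. (\<lambda>j. \<beta> j - a j) \<in> B}"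
    using * by auto
  qed auto
  from bij_betw_same_card[OF this]
  have card: "card {p. p \<in> B \<times> B \<and> ?d p = a} = card {\<beta> \<in> B. (\<lambda>j. \<beta> j - a j) \<in> B}" ..
  have "(\<Sum>p | p \<in> B \<times> B \<and> ?d p = a. monomial (?d p) \<tau>) = (\<Sum>p | p \<in> B \<times> B \<and> ?d p = a. monomial a \<tau>)"
   by (rule sum.cong[OF refl]) auto
  also have "\<dots> = of_nat (card {\<beta> \<in> B. (\<lambda>j. \<beta> j - a j) \<in> B}) * monomial a \<tau>"
   by (simp add: card)
  finally show "(\<Sum>p | p \<in> B \<times> B \<and> ?d p = a. monomial (?d p) \<tau>) = of_nat (card {\<beta> \<in> B. (\<lambda>j. \<beta> j - a j) \<in> B}) * monomial a \<tau>" .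
 qed
 finally have *: "complex_of_real ((cmod (\<Sum>\<beta>\<in>B. monomial \<beta> \<tau>))\<^sup>2) =
  (\<Sum>a\<in>difference_set B. of_nat (card {\<beta> \<in> B. (\<lambda>j. \<beta> j - a j) \<in> B}) * monomial a \<tau>)" .
 show ?thesis
  unfolding of_real_divide * by (simp add: fejer_def sum_divide_distrib)
qed

lemma fejer_zero: "finite B \<Longrightarrow> B \<noteq> {} \<Longrightarrow> fejer B (\<lambda>_. 0) = 1"
 by (simp add: fejer_def)

lemma fejer_kernel_integral:
 assumes B: "finite B" "B \<subseteq> Z_fin" "B \<noteq> {}" and \<eta>: "\<eta> \<in> torus"
 shows "(\<integral>w. (\<Sum>a\<in>difference_set B. of_real (fejer B a) * monomial a (\<lambda>j. w j * cnj (\<eta> j))) \<partial>haar) = 1"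
proof -
 have zero: "(\<lambda>_. 0) \<in> difference_set B"
 proof -
  obtain \<beta> where "\<beta> \<in> B" using B(3) by blast
  then show ?thesis
   unfolding difference_set_def by (intro image_eqI[of _ _ "(\<beta>, \<beta>)"]) auto
 qed
 have "(\<integral>w. (\<Sum>a\<in>difference_set B. of_real (fejer B a) * monomial a (\<lambda>j. w j * cnj (\<eta> j))) \<partial>haar)
   = (\<integral>w. (\<Sum>a\<in>difference_set B. (of_real (fejer B a) * monomial a (\<lambda>j. cnj (\<eta> j))) * monomial a w) \<partial>haar)"
  by (simp add: monomial_mult_arg mult_ac)
 also have "\<dots> = (\<Sum>a\<in>difference_set B. (of_real (fejer B a) * monomial a (\<lambda>j. cnj (\<eta> j))) * integral\<^sup>L haar (monomial a))"
  using integrable_monomial by simp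
 also have "\<dots> = (\<Sum>a\<in>difference_set B. if a = (\<lambda>_. 0) then 1 else 0)"
  using difference_set_Z_fin[OF B(2)] B by (intro sum.cong refl) (auto simp: integral_monomial fejer_zero)
 also have "\<dots> = 1" using zero finite_difference_set[OF B(1)] by simp
 finally show ?thesis .
qed

text \<open>Convolution with a probability density does not increase the variation. The measure is
 replaced by point masses sitting at the values of a selection.\<close>

theorem fejer_mean_norm_le:
 assumes m: "bounded_vector_measure borel_torus m V" and B: "finite B" "B \<subseteq> Z_fin" "B \<noteq> {}"
 shows "(\<integral>\<^sup>+w. ennreal (norm (\<Sum>a\<in>difference_set B. (of_real (fejer B a) * monomial a w) *\<^sub>C fourier_vm m a)) \<partial>haar) \<le> ennreal V"
proof -
 interpret bounded_vector_measure borel_torus m V by (rule m)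
 let ?S = "difference_set B"
 let ?q = "\<lambda>w. \<Sum>a\<in>?S. (of_real (fejer B a) * monomial a w) *\<^sub>C fourier_vm m a"
 have fin: "finite ?S" by (rule finite_difference_set[OF B(1)])
 have sp: "space borel_torus = torus" by (simp add: space_restrict_space)
 have meas: "monomial a \<in> borel_measurable borel_torus" for a
  using borel_measurable_monomial measurable_cong_sets[OF sets_haar refl] by blast
 have main: "(\<integral>\<^sup>+w. ennreal (norm (?q w)) \<partial>haar) \<le> ennreal (V + real (card ?S) * (e * V))" if e: "e > 0" for e
 proof -
  obtain \<sigma> where \<sigma>: "simple_function borel_torus \<sigma>" "\<And>x. x \<in> torus \<Longrightarrow> \<sigma> x \<in> torus"
   "\<And>a x. a \<in> ?S \<Longrightarrow> x \<in> torus \<Longrightarrow> cmod (monomial (\<lambda>j. - a j) x - monomial (\<lambda>j. - a j) (\<sigma> x)) \<le> e"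
   using simple_selection[OF fin, of "\<lambda>a. monomial (\<lambda>j. - a j)" borel_torus 1 e] meas e norm_monomial
   unfolding sp by (metis order_refl)
  define E where "E = \<sigma> ` torus"
  define L where "L \<eta> = {x \<in> torus. \<sigma> x = \<eta>}" for \<eta>
  have E: "finite E" "E \<subseteq> torus" using simple_functionD(1)[OF \<sigma>(1)] \<sigma>(2) by (auto simp: E_def sp)
  have LV: "(\<Sum>\<eta>\<in>E. norm (m (L \<eta>))) \<le> V"
   using sum_norm_level_sets[OF \<sigma>(1)] by (simp add: E_def L_def sp)
  define K where "K \<tau> = (cmod (\<Sum>\<beta>\<in>B. monomial \<beta> \<tau>))\<^sup>2 / real (card B)" for \<tau>
  define \<kappa> where "\<kappa> w \<eta> = (\<lambda>j. w j * cnj (\<eta> j))" for w \<eta> :: "nat \<Rightarrow> complex"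
  have \<kappa>: "\<kappa> w \<eta> \<in> torus" if "w \<in> torus" "\<eta> \<in> torus" for w \<eta>
   unfolding \<kappa>_def using torus_mult[OF that(1) torus_cnj[OF that(2)]] .
  have K0: "0 \<le> K \<tau>" for \<tau> by (simp add: K_def)
  have app: "norm (fourier_vm m a - (\<Sum>\<eta>\<in>E. monomial (\<lambda>j. - a j) \<eta> *\<^sub>C m (L \<eta>))) \<le> e * V" if a: "a \<in> ?S" for a
  proof -
   have "norm (vm_int borel_torus m (monomial (\<lambda>j. - a j)) - simple_vm_int borel_torus m (\<lambda>x. monomial (\<lambda>j. - a j) (\<sigma> x))) \<le> e * V"
   proof (rule vm_int_approx[OF meas, where B = 1])
    show "simple_function borel_torus (\<lambda>x. monomial (\<lambda>j. - a j) (\<sigma> x))"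
     by (rule simple_function_compose1[OF \<sigma>(1)])
   qed (use \<sigma>(3)[OF a] e in \<open>auto simp: sp norm_monomial\<close>)
   then show ?thesis
    unfolding simple_vm_int_compose[OF \<sigma>(1)] fourier_vm_def by (simp add: E_def L_def sp)
  qed
  have pt: "norm (?q w) \<le> (\<Sum>\<eta>\<in>E. K (\<kappa> w \<eta>) * norm (m (L \<eta>))) + real (card ?S) * (e * V)" if w: "w \<in> torus" for w
  proof -
   let ?c = "\<lambda>a. of_real (fejer B a) * monomial a w"
   have "(\<Sum>a\<in>?S. ?c a *\<^sub>C (\<Sum>\<eta>\<in>E. monomial (\<lambda>j. - a j) \<eta> *\<^sub>C m (L \<eta>)))
     = (\<Sum>\<eta>\<in>E. (\<Sum>a\<in>?S. ?c a * monomial (\<lambda>j. - a j) \<eta>) *\<^sub>C m (L \<eta>))"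
    by (simp add: scaleC_sum_left scaleC_sum_right scaleC_scaleC) (rule sum.swap)
   also have "\<dots> = (\<Sum>\<eta>\<in>E. of_real (K (\<kappa> w \<eta>)) *\<^sub>C m (L \<eta>))"
   proof (rule sum.cong[OF refl])
    fix \<eta> assume "\<eta> \<in> E"
    then have \<eta>: "\<eta> \<in> torus" using E by auto
    have "(\<Sum>a\<in>?S. ?c a * monomial (\<lambda>j. - a j) \<eta>) = (\<Sum>a\<in>?S. of_real (fejer B a) * monomial a (\<kappa> w \<eta>))"
     by (simp add: \<kappa>_def monomial_mult_arg monomial_cnj_arg[OF \<eta>] cnj_monomial[OF \<eta>] mult_ac)
    also have "\<dots> = of_real (K (\<kappa> w \<eta>))"
     unfolding K_def by (rule fejer_kernel[OF B(1,2) \<kappa>[OF w \<eta>]])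
    finally show "(\<Sum>a\<in>?S. ?c a * monomial (\<lambda>j. - a j) \<eta>) *\<^sub>C m (L \<eta>) = of_real (K (\<kappa> w \<eta>)) *\<^sub>C m (L \<eta>)" by simp
   qed
   finally have eq: "(\<Sum>a\<in>?S. ?c a *\<^sub>C (\<Sum>\<eta>\<in>E. monomial (\<lambda>j. - a j) \<eta> *\<^sub>C m (L \<eta>))) = (\<Sum>\<eta>\<in>E. of_real (K (\<kappa> w \<eta>)) *\<^sub>C m (L \<eta>))" .
   have "norm (?q w - (\<Sum>\<eta>\<in>E. of_real (K (\<kappa> w \<eta>)) *\<^sub>C m (L \<eta>)))
     = norm (\<Sum>a\<in>?S. ?c a *\<^sub>C (fourier_vm m a - (\<Sum>\<eta>\<in>E. monomial (\<lambda>j. - a j) \<eta> *\<^sub>C m (L \<eta>))))"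
    unfolding eq[symmetric] by (simp add: scaleC_diff_right sum_subtractf)
   also have "\<dots> \<le> (\<Sum>a\<in>?S. 1 * (e * V))"
   proof (intro order_trans[OF norm_sum] sum_mono)
    fix a assume a: "a \<in> ?S"
    have "cmod (?c a) \<le> 1" using fejer_bounds[of B a] by (simp add: norm_mult norm_monomial[OF w])
    then show "norm (?c a *\<^sub>C (fourier_vm m a - (\<Sum>\<eta>\<in>E. monomial (\<lambda>j. - a j) \<eta> *\<^sub>C m (L \<eta>)))) \<le> 1 * (e * V)"
     unfolding norm_scaleC using app[OF a] by (intro mult_mono) auto
   qed
   finally have "norm (?q w - (\<Sum>\<eta>\<in>E. of_real (K (\<kappa> w \<eta>)) *\<^sub>C m (L \<eta>))) \<le> real (card ?S) * (e * V)" by simp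
   moreover have "norm (\<Sum>\<eta>\<in>E. of_real (K (\<kappa> w \<eta>)) *\<^sub>C m (L \<eta>)) \<le> (\<Sum>\<eta>\<in>E. K (\<kappa> w \<eta>) * norm (m (L \<eta>)))"
    by (rule order_trans[OF norm_sum]) (simp add: norm_scaleC K0)
   ultimately show ?thesis
    using norm_triangle_ineq[of "?q w - (\<Sum>\<eta>\<in>E. of_real (K (\<kappa> w \<eta>)) *\<^sub>C m (L \<eta>))" "\<Sum>\<eta>\<in>E. of_real (K (\<kappa> w \<eta>)) *\<^sub>C m (L \<eta>)"]
    by simp
  qed
  have Kint: "integrable haar (\<lambda>w. K (\<kappa> w \<eta>))" "(\<integral>w. K (\<kappa> w \<eta>) \<partial>haar) = 1" if "\<eta> \<in> E" for \<eta>
  proof -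
   have \<eta>: "\<eta> \<in> torus" using that E by auto
   let ?f = "\<lambda>w. \<Sum>a\<in>?S. of_real (fejer B a) * monomial a (\<lambda>j. w j * cnj (\<eta> j))"
   have f: "integrable haar ?f"
    unfolding monomial_mult_arg using integrable_monomial by simp
   have eq: "K (\<kappa> w \<eta>) = Re (?f w)" if "w \<in> space haar" for w
    using fejer_kernel[OF B(1,2) \<kappa>[OF _ \<eta>], of w] that unfolding K_def \<kappa>_def space_haar by (simp del: Re_sum)
   have "integrable haar (\<lambda>w. Re (?f w))" using f by (rule integrable_Re)
   then show "integrable haar (\<lambda>w. K (\<kappa> w \<eta>))"
    using Bochner_Integration.integrable_cong[of haar haar "\<lambda>w. K (\<kappa> w \<eta>)" "\<lambda>w. Re (?f w)"] eq by blast
   have "(\<integral>w. K (\<kappa> w \<eta>) \<partial>haar) = (\<integral>w. Re (?f w) \<partial>haar)"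
    by (rule Bochner_Integration.integral_cong[OF refl]) (rule eq)
   also have "\<dots> = Re (\<integral>w. ?f w \<partial>haar)" using f by (rule integral_Re)
   also have "\<dots> = 1" using fejer_kernel_integral[OF B \<eta>] by simp
   finally show "(\<integral>w. K (\<kappa> w \<eta>) \<partial>haar) = 1" .
  qed
  have "(\<integral>\<^sup>+w. ennreal (norm (?q w)) \<partial>haar) \<le> (\<integral>\<^sup>+w. ennreal ((\<Sum>\<eta>\<in>E. K (\<kappa> w \<eta>) * norm (m (L \<eta>))) + real (card ?S) * (e * V)) \<partial>haar)"
   by (intro nn_integral_mono ennreal_leI pt) (simp add: space_haar)
  also have "\<dots> = ennreal (\<integral>w. (\<Sum>\<eta>\<in>E. K (\<kappa> w \<eta>) * norm (m (L \<eta>))) + real (card ?S) * (e * V) \<partial>haar)"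
   using Kint(1) K0 V_nonneg e
   by (intro nn_integral_eq_integral Bochner_Integration.integrable_add Bochner_Integration.integrable_sum integrable_mult_left)
    (auto intro!: AE_I2 add_nonneg_nonneg sum_nonneg mult_nonneg_nonneg)
  also have "(\<integral>w. (\<Sum>\<eta>\<in>E. K (\<kappa> w \<eta>) * norm (m (L \<eta>))) + real (card ?S) * (e * V) \<partial>haar)
    = (\<Sum>\<eta>\<in>E. norm (m (L \<eta>))) + real (card ?S) * (e * V)"
   using Kint by (subst Bochner_Integration.integral_add) (auto simp: haar.prob_space intro!: Bochner_Integration.integrable_sum)
  also have "ennreal \<dots> \<le> ennreal (V + real (card ?S) * (e * V))" using LV by (intro ennreal_leI) simp
  finally show ?thesis .
 qed
 have "((\<lambda>e. ennreal (V + real (card ?S) * (e * V))) \<longlongrightarrow> ennreal (V + real (card ?S) * (0 * V))) (at_right 0)"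
  by (intro tendsto_ennrealI tendsto_intros)
 then have "(\<integral>\<^sup>+w. ennreal (norm (?q w)) \<partial>haar) \<le> ennreal (V + real (card ?S) * (0 * V))"
  by (rule tendsto_lowerbound) (auto simp: eventually_at_right_field intro!: exI[of _ 1] main)
 then show ?thesis by simp
qed

definition cube :: "nat \<Rightarrow> (nat \<Rightarrow> int) set" where
 "cube k = PiE_dflt {..<k} 0 (\<lambda>_. {0..<int k})"

lemma finite_cube: "finite (cube k)"
 unfolding cube_def by (rule finite_PiE_dflt) auto

lemma cube_Z_fin: "cube k \<subseteq> Z_fin"
proof
 fix \<beta> assume "\<beta> \<in> cube k"
 then have "{j. \<beta> j \<noteq> 0} \<subseteq> {..<k}" by (auto simp: cube_def PiE_dflt_def)
 then show "\<beta> \<in> Z_fin" unfolding Z_fin_def by (auto intro: finite_subset)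
qed

lemma cube_nonempty: "cube k \<noteq> {}"
proof -
 have "(\<lambda>_. 0) \<in> cube k" by (auto simp: cube_def PiE_dflt_def)
 then show ?thesis by blast
qed

text \<open>Translating a large cube by a fixed exponent moves only a small fraction of it outside.\<close>

lemma fejer_cube_tendsto:
 assumes a: "a \<in> Z_fin"
 shows "(\<lambda>k. fejer (cube k) a) \<longlonglongrightarrow> 1"
proof -
 define J where "J = {j. a j \<noteq> 0}"
 have J: "finite J" using a by (simp add: J_def Z_fin_def)
 then obtain k0 where k0: "J \<subseteq> {..<k0}" using finite_nat_iff_bounded by blast
 define K where "K = max k0 (nat (\<Sum>j\<in>J. \<bar>a j\<bar>) + 1)"
 have le: "\<bar>a j\<bar> \<le> int k" if "k \<ge> K" for j k
 proof (cases "j \<in> J")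
  case True
  then have "\<bar>a j\<bar> \<le> (\<Sum>j\<in>J. \<bar>a j\<bar>)" using J by (intro member_le_sum) auto
  moreover have "(\<Sum>j\<in>J. \<bar>a j\<bar>) < int K" by (simp add: K_def)
  ultimately show ?thesis using that by linarith
 qed (simp add: J_def)
 have eq: "fejer (cube k) a = (\<Prod>j\<in>J. 1 - real_of_int \<bar>a j\<bar> / real k)" if k: "k \<ge> K" for k
 proof -
  have k_pos: "k > 0" using k by (simp add: K_def)
  have Jk: "J \<subseteq> {..<k}" using k0 k by (auto simp: K_def)
  have out: "a j = 0" if "j \<ge> k" for j using Jk that by (auto simp: J_def)
  have "{\<beta> \<in> cube k. (\<lambda>j. \<beta> j - a j) \<in> cube k} = PiE_dflt {..<k} 0 (\<lambda>j. {max 0 (a j)..<int k + min 0 (a j)})"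
   (is "?A = ?B")
  proof (intro equalityI subsetI)
   fix \<beta> assume "\<beta> \<in> ?A"
   then show "\<beta> \<in> ?B" by (force simp: cube_def PiE_dflt_def)
  next
   fix \<beta> assume b: "\<beta> \<in> ?B"
   have "\<beta> j \<in> {0..<int k}" "\<beta> j - a j \<in> {0..<int k}" if "j < k" for j
   proof -
    have "\<beta> j \<in> {max 0 (a j)..<int k + min 0 (a j)}" using b that by (auto simp: PiE_dflt_def)
    then show "\<beta> j \<in> {0..<int k}" "\<beta> j - a j \<in> {0..<int k}" by (auto simp: max_def min_def split: if_splits)
   qed
   moreover have "\<beta> j = 0" if "\<not> j < k" for j using b that by (auto simp: PiE_dflt_def)
   ultimately show "\<beta> \<in> ?A" using out by (auto simp: cube_def PiE_dflt_def)
  qed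
  then have "card {\<beta> \<in> cube k. (\<lambda>j. \<beta> j - a j) \<in> cube k} = (\<Prod>j<k. card {max 0 (a j)..<int k + min 0 (a j)})"
   by (simp add: card_PiE_dflt)
  also have "\<dots> = (\<Prod>j<k. nat (int k - \<bar>a j\<bar>))"
   by (rule prod.cong) (auto simp: max_def min_def)
  finally have "fejer (cube k) a = real (\<Prod>j<k. nat (int k - \<bar>a j\<bar>)) / real (card (cube k))"
   by (simp only: fejer_def)
  also have "card (cube k) = (\<Prod>j<k. k)" unfolding cube_def by (subst card_PiE_dflt) auto
  also have "real (\<Prod>j<k. nat (int k - \<bar>a j\<bar>)) / real (\<Prod>j<k. k) = (\<Prod>j<k. real (nat (int k - \<bar>a j\<bar>)) / real k)"
   by (simp add: prod_dividef)
  also have "\<dots> = (\<Prod>j<k. 1 - real_of_int \<bar>a j\<bar> / real k)"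
   using le[OF k] k_pos by (intro prod.cong refl) (simp add: of_nat_nat field_simps)
  also have "\<dots> = (\<Prod>j\<in>J. 1 - real_of_int \<bar>a j\<bar> / real k)"
   using Jk by (intro prod.mono_neutral_right) (auto simp: J_def)
  finally show ?thesis .
 qed
 have "(\<lambda>k. real_of_int \<bar>a j\<bar> / real k) \<longlonglongrightarrow> 0" for j by (rule lim_const_over_n)
 then have "(\<lambda>k. \<Prod>j\<in>J. 1 - real_of_int \<bar>a j\<bar> / real k) \<longlonglongrightarrow> (\<Prod>j\<in>J. 1 - 0)"
  by (intro tendsto_prod tendsto_diff tendsto_const)
 then have "(\<lambda>k. \<Prod>j\<in>J. 1 - real_of_int \<bar>a j\<bar> / real k) \<longlonglongrightarrow> 1" by simp
 then show ?thesis
  by (rule Lim_transform_eventually) (use eq in \<open>auto simp: eventually_sequentially intro!: exI[of _ K]\<close>)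
qed

section \<open>Power series with vector coefficients\<close>

lemma disc_algebra_continuous_on_sphere:
 "disc_algebra G \<Longrightarrow> continuous_on (sphere 0 1) (\<lambda>z. norm (G z))"
 by (auto simp: disc_algebra_def intro!: continuous_on_norm intro: continuous_on_subset)

text \<open>Termwise differentiation; the differentiated series is dominated on a slightly larger circle.\<close>

lemma vec_holomorphic_on_power_series:
 fixes b :: "nat \<Rightarrow> 'a::complex_banach"
 assumes b: "\<And>r. 0 \<le> r \<Longrightarrow> r < 1 \<Longrightarrow> summable (\<lambda>n. norm (b n) * r ^ n)"
 shows "vec_holomorphic_on (\<lambda>z. \<Sum>n. z ^ n *\<^sub>C b n) (ball 0 1)"
 unfolding vec_holomorphic_on_def
proof
 fix z :: complex assume z: "z \<in> ball 0 1"
 define r where "r = (1 + cmod z) / 2"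
 have r: "0 \<le> r" "r < 1" "cmod z < r" using z by (auto simp: r_def)
 define D where "D y n = (of_nat n * y ^ (n - 1)) *\<^sub>C b n" for y n
 define M where "M n = real n * r ^ (n - 1) * norm (b n)" for n
 have "summable (\<lambda>n. diffs (\<lambda>n. norm (b n)) n * r ^ n)"
 proof (rule termdiff_converges[where K = 1])
  fix x :: real assume "norm x < 1"
  then have "summable (\<lambda>n. norm (b n) * \<bar>x\<bar> ^ n)" by (intro b) auto
  then show "summable (\<lambda>n. norm (b n) * x ^ n)"
   using summable_norm_cancel[of "\<lambda>n. norm (b n) * x ^ n"] by (simp add: abs_mult power_abs)
 qed (use r in auto)
 then have "summable (\<lambda>n. M (Suc n))" by (simp add: diffs_def M_def mult_ac)
 then have M: "summable M" by (simp only: summable_Suc_iff)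
 have DM: "norm (D y n) \<le> M n" if "y \<in> ball 0 r" for y n
  using that unfolding D_def M_def norm_scaleC norm_mult norm_power
  by (intro mult_right_mono mult_mono power_mono) auto
 have der: "((\<lambda>y. y ^ n *\<^sub>C b n) has_derivative (\<lambda>h. h *\<^sub>C D y n)) (at y within ball 0 r)" for n y
 proof -
  have "((\<lambda>y. y ^ n) has_derivative (\<lambda>h. (of_nat n * y ^ (n - 1)) * h)) (at y within ball 0 r)"
   unfolding has_field_derivative_def[symmetric] by (auto intro!: derivative_eq_intros)
  from bounded_linear.has_derivative[OF bounded_bilinear.bounded_linear_left[OF bounded_bilinear_scaleC] this]
  show ?thesis by (simp add: D_def scaleC_scaleC mult.commute)
 qed
 have ul: "uniform_limit (ball 0 r) (\<lambda>n y. \<Sum>i<n. D y i) (\<lambda>y. \<Sum>i. D y i) sequentially"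
  by (rule Weierstrass_m_test[OF DM M])
 have zr: "z \<in> ball 0 r" using r by simp
 have "\<exists>g. \<forall>y\<in>ball 0 r. (\<lambda>n. y ^ n *\<^sub>C b n) sums g y \<and>
   (g has_derivative (\<lambda>h. h *\<^sub>C (\<Sum>i. D y i))) (at y within ball 0 r)"
 proof (rule has_derivative_series[OF convex_ball der _ zr])
  fix e :: real assume "e > 0"
  from uniform_limitD[OF ul this]
  show "\<forall>\<^sub>F n in sequentially. \<forall>y\<in>ball 0 r. \<forall>h. norm ((\<Sum>i<n. h *\<^sub>C D y i) - h *\<^sub>C (\<Sum>i. D y i)) \<le> e * norm h"
  proof eventually_elim
   case (elim n)
   show ?case
   proof (intro ballI allI)
    fix y h :: complex assume "y \<in> ball 0 r"
    then have "norm ((\<Sum>i<n. D y i) - (\<Sum>i. D y i)) \<le> e" using elim by (auto simp: dist_norm intro: less_imp_le)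
    from mult_left_mono[OF this norm_ge_zero[of h]]
    show "norm ((\<Sum>i<n. h *\<^sub>C D y i) - h *\<^sub>C (\<Sum>i. D y i)) \<le> e * norm h"
     unfolding scaleC_sum_right[symmetric] scaleC_diff_right[symmetric] norm_scaleC
     by (simp only: mult.commute)
   qed
  qed
 next
  have "summable (\<lambda>n. norm (z ^ n *\<^sub>C b n))"
   using b[of "cmod z"] z by (simp add: norm_scaleC norm_power mult.commute)
  then show "(\<lambda>n. z ^ n *\<^sub>C b n) sums (\<Sum>n. z ^ n *\<^sub>C b n)"
   by (rule summable_sums[OF summable_norm_cancel])
 qed
 then obtain g where g: "\<And>y. y \<in> ball 0 r \<Longrightarrow> (\<lambda>n. y ^ n *\<^sub>C b n) sums g y"
   "\<And>y. y \<in> ball 0 r \<Longrightarrow> (g has_derivative (\<lambda>h. h *\<^sub>C (\<Sum>i. D y i))) (at y within ball 0 r)" by blast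
 have "(g has_derivative (\<lambda>h. h *\<^sub>C (\<Sum>i. D z i))) (at z)"
  using g(2)[OF zr] by (simp add: at_within_open[OF zr])
 then have "((\<lambda>z. \<Sum>n. z ^ n *\<^sub>C b n) has_derivative (\<lambda>h. h *\<^sub>C (\<Sum>i. D z i))) (at z)"
  by (rule has_derivative_transform_within_open[OF _ open_ball zr]) (use g(1) sums_unique in auto)
 then show "\<exists>d. ((\<lambda>z. \<Sum>n. z ^ n *\<^sub>C b n) has_derivative (\<lambda>h. h *\<^sub>C d)) (at z within ball 0 1)"
  by (intro exI) (rule has_derivative_at_withinI)
qed

text \<open>Tannery's theorem.\<close>

lemma dominated_series_tendsto:
 fixes f :: "nat \<Rightarrow> nat \<Rightarrow> 'a::banach"
 assumes lim: "\<And>n. (\<lambda>k. f n k) \<longlonglongrightarrow> b n" and le: "\<And>n k. norm (f n k) \<le> M n" and M: "summable M"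
 shows "(\<lambda>k. \<Sum>n. f n k) \<longlonglongrightarrow> (\<Sum>n. b n)"
proof -
 have bM: "norm (b n) \<le> M n" for n
  by (rule LIMSEQ_le_const2[OF tendsto_norm[OF lim]]) (use le in auto)
 have sb: "summable b" by (rule summable_comparison_test'[OF M]) (use bM in auto)
 have sa: "summable (\<lambda>n. f n k)" for k by (rule summable_comparison_test'[OF M]) (use le in auto)
 show ?thesis
 proof (rule LIMSEQ_I)
  fix e :: real assume e: "e > 0"
  then have "e / 3 > 0" by simp
  from suminf_exist_split[OF this M] obtain N where N: "\<And>n. n \<ge> N \<Longrightarrow> norm (\<Sum>i. M (i + n)) < e / 3" by blast
  have tail: "norm (\<Sum>i. u (i + N)) \<le> e / 3" if u: "\<And>n. norm (u n) \<le> M n" for u :: "nat \<Rightarrow> 'a"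
  proof -
   have s: "summable (\<lambda>i. norm (u (i + N)))"
    by (rule summable_comparison_test'[OF summable_ignore_initial_segment[OF M, of N]]) (use u in auto)
   have "norm (\<Sum>i. u (i + N)) \<le> (\<Sum>i. norm (u (i + N)))" by (rule summable_norm[OF s])
   also have "\<dots> \<le> (\<Sum>i. M (i + N))" by (rule suminf_le[OF u s summable_ignore_initial_segment[OF M]])
   also have "\<dots> \<le> e / 3" using N[of N] by simp
   finally show ?thesis .
  qed
  have "(\<lambda>k. \<Sum>n<N. f n k) \<longlonglongrightarrow> (\<Sum>n<N. b n)" by (intro tendsto_sum lim)
  from LIMSEQ_D[OF this \<open>e / 3 > 0\<close>] obtain K where K: "\<And>k. k \<ge> K \<Longrightarrow> norm ((\<Sum>n<N. f n k) - (\<Sum>n<N. b n)) < e / 3" by blast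
  show "\<exists>K. \<forall>k\<ge>K. norm ((\<Sum>n. f n k) - (\<Sum>n. b n)) < e"
  proof (intro exI allI impI)
   fix k assume "k \<ge> K"
   have "(\<Sum>n. f n k) - (\<Sum>n. b n) = ((\<Sum>n<N. f n k) - (\<Sum>n<N. b n)) + ((\<Sum>i. f (i + N) k) - (\<Sum>i. b (i + N)))"
    by (simp add: suminf_split_initial_segment[OF sa, of k N] suminf_split_initial_segment[OF sb, of N])
   also have "norm \<dots> < e / 3 + (e / 3 + e / 3)"
    using K[OF \<open>k \<ge> K\<close>] tail[of "\<lambda>n. f n k"] tail[of b] le bM
    by (intro le_less_trans[OF norm_triangle_ineq] add_less_le_mono order_trans[OF norm_triangle_ineq4] add_mono) auto
   finally show "norm ((\<Sum>n. f n k) - (\<Sum>n. b n)) < e" by simp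
  qed
 qed
qed


section \<open>A circle action on the torus\<close>

text \<open>All coordinates are multiplied by positive powers, and these powers tend to infinity, so that only
 finitely many nonnegative exponents have a given \<open>weight\<close>.\<close>

definition flow :: "complex \<Rightarrow> point \<Rightarrow> nat \<Rightarrow> complex" where
 "flow z w j = z ^ Suc j * w j"

definition weight :: "(nat \<Rightarrow> int) \<Rightarrow> nat" where
 "weight a = (\<Sum>j | a j \<noteq> 0. Suc j * nat (a j))"

text \<open>Along an orbit a monomial is homogeneous of degree \<open>weight\<close>.\<close>

lemma monomial_flow:
 assumes "a \<in> N0_fin"
 shows "monomial a (flow z w) = z ^ weight a * monomial a w"
proof -
 have nn: "0 \<le> a j" for j using assms by (simp add: N0_fin_def)
 have "monomial a (flow z w) = (\<Prod>j | a j \<noteq> 0. z ^ (Suc j * nat (a j)) * w j powi a j)"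
  unfolding monomial_def
 proof (rule prod.cong[OF refl])
  fix j
  have "flow z w j powi a j = (z ^ Suc j * w j) ^ nat (a j)" using nn[of j] by (simp add: flow_def power_int_def)
  also have "\<dots> = z ^ (Suc j * nat (a j)) * w j ^ nat (a j)"
   by (simp only: power_mult_distrib power_mult)
  also have "w j ^ nat (a j) = w j powi a j" using nn[of j] by (simp add: power_int_def)
  finally show "flow z w j powi a j = z ^ (Suc j * nat (a j)) * w j powi a j" .
 qed
 then show ?thesis by (simp add: prod.distrib monomial_def weight_def power_sum del: mult_Suc)
qed

lemma measurable_flow: "(\<lambda>(z, w). flow z w) \<in> circle \<Otimes>\<^sub>M haar \<rightarrow>\<^sub>M haar"
proof (rule measurable_into_haar, rule measurable_into_circle)
 fix j
 have "(\<lambda>p. fst p ^ Suc j * snd p j) \<in> circle \<Otimes>\<^sub>M haar \<rightarrow>\<^sub>M borel"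
 proof (intro borel_measurable_times borel_measurable_power)
  show "fst \<in> circle \<Otimes>\<^sub>M haar \<rightarrow>\<^sub>M borel"
   using measurable_compose[OF measurable_fst measurable_circle_borel] by simp
  show "(\<lambda>p. snd p j) \<in> circle \<Otimes>\<^sub>M haar \<rightarrow>\<^sub>M borel"
   using measurable_compose[OF measurable_compose[OF measurable_snd measurable_coordinate_haar] measurable_circle_borel] by simp
 qed
 then show "(\<lambda>p. (case p of (z, w) \<Rightarrow> flow z w) j) \<in> circle \<Otimes>\<^sub>M haar \<rightarrow>\<^sub>M borel"
  by (simp add: case_prod_beta flow_def del: power_Suc)
 fix p assume "p \<in> space (circle \<Otimes>\<^sub>M haar)"
 then show "cmod ((case p of (z, w) \<Rightarrow> flow z w) j) = 1"
  by (auto simp: space_pair_measure space_circle space_haar flow_def torus_def norm_mult norm_power simp del: power_Suc)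
qed

text \<open>Each \<open>flow z\<close> preserves the Haar measure, so by Fubini's theorem averaging over the orbits
 does not change an integral.\<close>

lemma nn_integral_orbits:
 fixes g :: "point \<Rightarrow> ennreal"
 assumes g: "g \<in> borel_measurable haar"
 shows "(\<integral>\<^sup>+w. (\<integral>\<^sup>+z. g (flow z w) \<partial>circle) \<partial>haar) = (\<integral>\<^sup>+w. g w \<partial>haar)"
proof -
 interpret P: pair_sigma_finite circle haar
  by (intro pair_sigma_finite.intro prob_space_imp_sigma_finite prob_space_circle prob_space_haar)
 have "case_prod (\<lambda>z w. g (flow z w)) = (\<lambda>p. g (case p of (z, w) \<Rightarrow> flow z w))" by auto
 also have "\<dots> \<in> borel_measurable (circle \<Otimes>\<^sub>M haar)" by (rule measurable_compose[OF measurable_flow g])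
 finally have "(\<integral>\<^sup>+w. (\<integral>\<^sup>+z. g (flow z w) \<partial>circle) \<partial>haar) = (\<integral>\<^sup>+z. (\<integral>\<^sup>+w. g (flow z w) \<partial>haar) \<partial>circle)"
  by (rule P.Fubini')
 also have "\<dots> = (\<integral>\<^sup>+z. (\<integral>\<^sup>+w. g w \<partial>haar) \<partial>circle)"
 proof (rule nn_integral_cong)
  fix z assume "z \<in> space circle"
  then have \<tau>: "(\<lambda>j. z ^ Suc j) \<in> torus" by (simp add: torus_def space_circle norm_power del: power_Suc)
  have "(\<integral>\<^sup>+w. g w \<partial>haar) = (\<integral>\<^sup>+w. g w \<partial>distr haar haar (\<lambda>w j. z ^ Suc j * w j))"
   by (simp only: haar_rotation_invariant[OF \<tau>])
  also have "\<dots> = (\<integral>\<^sup>+w. g (\<lambda>j. z ^ Suc j * w j) \<partial>haar)"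
   by (rule nn_integral_distr[OF measurable_rotation_haar[OF \<tau>]]) (use g in simp)
  finally show "(\<integral>\<^sup>+w. g (flow z w) \<partial>haar) = (\<integral>\<^sup>+w. g w \<partial>haar)" by (simp add: flow_def[abs_def])
 qed
 also have "\<dots> = (\<integral>\<^sup>+w. g w \<partial>haar)" by (simp add: circle.emeasure_space_1)
 finally show ?thesis .
qed

definition layer :: "nat \<Rightarrow> (nat \<Rightarrow> int) set" where
 "layer n = {a \<in> N0_fin. weight a = n}"

text \<open>Both the support and the entries of an exponent are bounded by its weight.\<close>

lemma weight_less_imp_cube:
 assumes "a \<in> N0_fin" "weight a < N"
 shows "a \<in> cube N"
proof -
 have fin: "finite {j. a j \<noteq> 0}" and nn: "0 \<le> a j" for j using assms by (auto simp: N0_fin_def Z_fin_def)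
 have "j < N \<and> a j < int N" if j: "a j \<noteq> 0" for j
 proof -
  have y: "Suc j * nat (a j) \<le> weight a" unfolding weight_def using fin j by (intro member_le_sum) auto
  have "1 \<le> nat (a j)" using nn[of j] j by simp
  then have "Suc j * 1 \<le> Suc j * nat (a j)" by (rule mult_le_mono2)
  from order_trans[OF this y] have 1: "Suc j \<le> weight a" by simp
  have "1 * nat (a j) \<le> Suc j * nat (a j)" by (rule mult_le_mono1) simp
  from order_trans[OF this y] have 2: "nat (a j) \<le> weight a" by simp
  show ?thesis using 1 2 assms(2) by linarith
 qed
 moreover have "a j < int N" if "a j = 0" "j < N" for j using that by simp
 ultimately show ?thesis unfolding cube_def PiE_dflt_def using nn by (auto, metis)
qed

lemma finite_layer: "finite (layer n)"
 by (rule finite_subset[OF _ finite_cube[of "Suc n"]]) (auto simp: layer_def intro!: weight_less_imp_cube)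

lemma layer_subset: "layer n \<subseteq> N0_fin" "N0_fin \<subseteq> Z_fin"
 by (auto simp: layer_def N0_fin_def)

text \<open>The generating function of the layers is \<open>\<Prod>j. 1 / (1 - r\<^bsup>j + 1\<^esup>)\<close>.\<close>

lemma summable_card_layer:
 assumes r: "0 \<le> r" "r < (1::real)"
 shows "summable (\<lambda>n. real (card (layer n)) * r ^ n)"
proof (rule summableI_nonneg_bounded)
 fix N
 define q where "q j = r ^ Suc j" for j
 have q: "0 \<le> q j" "q j \<le> r" for j
  using r power_decreasing[of 1 "Suc j" r] by (auto simp: q_def)
 have geo: "(\<Sum>f\<in>{0..<int N}. q j ^ nat f) \<le> exp (q j / (1 - r))" for j
 proof -
  have q1: "q j < 1" using q[of j] r by linarith
  have "(\<Sum>f\<in>{0..<int N}. q j ^ nat f) = (\<Sum>f<N. q j ^ f)"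
   by (rule sum.reindex_bij_witness[of _ int nat]) auto
  also have "\<dots> = (1 - q j ^ N) / (1 - q j)" using q1 by (subst sum_gp_strict) auto
  also have "\<dots> \<le> 1 / (1 - q j)" using q[of j] q1 by (intro divide_right_mono) auto
  also have "\<dots> = 1 + q j / (1 - q j)" using q1 by (simp add: field_simps)
  also have "\<dots> \<le> 1 + q j / (1 - r)" using q[of j] r by (intro add_left_mono divide_left_mono mult_pos_pos) auto
  also have "\<dots> \<le> exp (q j / (1 - r))" by (rule exp_ge_add_one_self)
  finally show ?thesis .
 qed
 have "(\<Sum>n<N. real (card (layer n)) * r ^ n) = (\<Sum>n<N. \<Sum>a\<in>layer n. r ^ weight a)"
  by (intro sum.cong refl) (simp add: layer_def)
 also have "\<dots> = (\<Sum>a\<in>(\<Union>n<N. layer n). r ^ weight a)"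
  by (rule sum.UNION_disjoint[symmetric]) (simp_all add: finite_layer, auto simp: layer_def)
 also have "\<dots> \<le> (\<Sum>a\<in>cube N. r ^ weight a)"
  using r by (intro sum_mono2 finite_cube) (auto simp: layer_def intro: weight_less_imp_cube)
 also have "\<dots> = (\<Sum>a\<in>cube N. \<Prod>j<N. q j ^ nat (a j))"
 proof (rule sum.cong[OF refl])
  fix a assume "a \<in> cube N"
  then have "{j. a j \<noteq> 0} \<subseteq> {..<N}" by (auto simp: cube_def PiE_dflt_def)
  then have "weight a = (\<Sum>j<N. Suc j * nat (a j))"
   unfolding weight_def by (intro sum.mono_neutral_left) auto
  then show "r ^ weight a = (\<Prod>j<N. q j ^ nat (a j))"
   by (simp add: power_sum q_def power_mult del: mult_Suc power_Suc)
 qed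
 also have "\<dots> = (\<Sum>g\<in>PiE {..<N} (\<lambda>_. {0..<int N}). \<Prod>j<N. q j ^ nat (g j))"
  unfolding cube_def
  by (rule sum.reindex_bij_witness[of _ "\<lambda>h x. if x \<in> {..<N} then h x else 0" "\<lambda>h. restrict h {..<N}"])
   (auto simp: PiE_dflt_def PiE_def extensional_def fun_eq_iff)
 also have "\<dots> = (\<Prod>j<N. \<Sum>f\<in>{0..<int N}. q j ^ nat f)"
  by (rule prod_sum_PiE[symmetric]) auto
 also have "\<dots> \<le> (\<Prod>j<N. exp (q j / (1 - r)))"
  using geo q by (intro prod_mono conjI sum_nonneg) auto
 also have "\<dots> = exp ((\<Sum>j<N. q j) / (1 - r))" by (simp add: exp_sum sum_divide_distrib)
 also have "\<dots> \<le> exp (1 / (1 - r) / (1 - r))"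
 proof -
  have "(\<Sum>j<N. q j) = r * (\<Sum>j<N. r ^ j)" by (simp add: q_def sum_distrib_left)
  also have "\<dots> \<le> 1 * (\<Sum>j<N. r ^ j)" using r by (intro mult_right_mono sum_nonneg) auto
  also have "\<dots> = (1 - r ^ N) / (1 - r)" using r by (simp add: sum_gp_strict)
  also have "\<dots> \<le> 1 / (1 - r)" using r by (intro divide_right_mono) auto
  finally have "(\<Sum>j<N. q j) / (1 - r) \<le> 1 / (1 - r) / (1 - r)" using r by (intro divide_right_mono) auto
  then show ?thesis by (subst exp_le_cancel_iff)
 qed
 finally show "(\<Sum>n<N. real (card (layer n)) * r ^ n) \<le> exp (1 / (1 - r) / (1 - r))" .
qed (use r in auto)


section \<open>The extension of an analytic measure along the orbits\<close>

definition radius :: "nat \<Rightarrow> real" where "radius i = real (Suc i) / real (Suc (Suc i))"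

lemma radius: "0 \<le> radius i" "radius i < 1"
 by (auto simp: radius_def)

lemma radius_tendsto: "radius \<longlonglongrightarrow> 1"
proof -
 have "(\<lambda>i. 1 - 1 / real (Suc (Suc i))) \<longlonglongrightarrow> 1 - 0"
  by (intro tendsto_intros LIMSEQ_Suc[OF LIMSEQ_Suc[OF lim_1_over_n]])
 moreover have "radius = (\<lambda>i. 1 - 1 / real (Suc (Suc i)))" by (rule ext) (simp add: radius_def field_simps)
 ultimately show ?thesis by (simp only: diff_zero)
qed

locale analytic_measure = bounded_vector_measure borel_torus m V
 for m :: "point set \<Rightarrow> 'a::complex_banach" and V +
 assumes analytic: "a \<in> Z_fin - N0_fin \<Longrightarrow> fourier_vm m a = 0"
begin

abbreviation "c \<equiv> fourier_vm m"

definition homogeneous_part :: "nat \<Rightarrow> point \<Rightarrow> 'a" where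
 "homogeneous_part n w = (\<Sum>a\<in>layer n. monomial a w *\<^sub>C c a)"

definition extension :: "point \<Rightarrow> complex \<Rightarrow> 'a" where
 "extension w z = (\<Sum>n. z ^ n *\<^sub>C homogeneous_part n w)"

definition fejer_part :: "nat \<Rightarrow> nat \<Rightarrow> point \<Rightarrow> 'a" where
 "fejer_part k n w = (\<Sum>a\<in>layer n. (of_real (fejer (cube k) a) * monomial a w) *\<^sub>C c a)"

definition fejer_extension :: "nat \<Rightarrow> point \<Rightarrow> complex \<Rightarrow> 'a" where
 "fejer_extension k w z = (\<Sum>a\<in>difference_set (cube k) \<inter> N0_fin.
   (of_real (fejer (cube k) a) * monomial a w * z ^ weight a) *\<^sub>C c a)"

lemma borel_torus_monomial: "monomial a \<in> borel_measurable borel_torus"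
 using borel_measurable_monomial measurable_cong_sets[OF sets_haar refl] by blast

lemma norm_coefficient_le: "norm (c a) \<le> V"
 using vm_int_norm_le[OF borel_torus_monomial, of "\<lambda>j. - a j" 1]
 by (simp add: fourier_vm_def space_restrict_space norm_monomial)

lemma norm_homogeneous_part_le: "w \<in> torus \<Longrightarrow> norm (homogeneous_part n w) \<le> real (card (layer n)) * V"
 unfolding homogeneous_part_def
 by (intro order_trans[OF norm_sum] sum_bounded_above) (simp add: norm_scaleC norm_monomial norm_coefficient_le)

lemma norm_fejer_part_le:
 assumes "w \<in> torus"
 shows "norm (fejer_part k n w) \<le> real (card (layer n)) * V"
 unfolding fejer_part_def
proof (intro order_trans[OF norm_sum] sum_bounded_above)
 fix a
 have "fejer (cube k) a * norm (c a) \<le> 1 * V"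
  using fejer_bounds norm_coefficient_le by (intro mult_mono) auto
 then show "norm ((of_real (fejer (cube k) a) * monomial a w) *\<^sub>C c a) \<le> V"
  using fejer_bounds(1)[of "cube k" a] by (simp add: norm_scaleC norm_mult norm_monomial assms)
qed

lemma fejer_extension_series:
 "fejer_extension k w z = (\<Sum>n. z ^ n *\<^sub>C fejer_part k n w)"
proof -
 let ?S = "difference_set (cube k) \<inter> N0_fin"
 let ?g = "\<lambda>a. (of_real (fejer (cube k) a) * monomial a w * z ^ weight a) *\<^sub>C c a"
 have fin: "finite ?S" using finite_difference_set[OF finite_cube] by blast
 have part: "z ^ n *\<^sub>C fejer_part k n w = (\<Sum>a | a \<in> ?S \<and> weight a = n. ?g a)" for n
 proof -
  have "z ^ n *\<^sub>C fejer_part k n w = (\<Sum>a\<in>layer n. ?g a)"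
   unfolding fejer_part_def scaleC_sum_right
   by (rule sum.cong) (auto simp: layer_def scaleC_scaleC mult_ac)
  also have "\<dots> = (\<Sum>a | a \<in> ?S \<and> weight a = n. ?g a)"
  proof (rule sum.mono_neutral_right[OF finite_layer])
   show "\<forall>a\<in>layer n - {a. a \<in> ?S \<and> weight a = n}. ?g a = 0"
   proof
    fix a assume "a \<in> layer n - {a. a \<in> ?S \<and> weight a = n}"
    then have "a \<notin> difference_set (cube k)" by (auto simp: layer_def)
    then show "?g a = 0" by (simp add: fejer_outside)
   qed
  qed (auto simp: layer_def)
  finally show ?thesis .
 qed
 have "fejer_extension k w z = (\<Sum>n\<in>weight ` ?S. \<Sum>a | a \<in> ?S \<and> weight a = n. ?g a)"
  unfolding fejer_extension_def by (rule sum.image_gen[OF fin])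
 also have "\<dots> = (\<Sum>n\<in>weight ` ?S. z ^ n *\<^sub>C fejer_part k n w)" by (simp only: part)
 also have "\<dots> = (\<Sum>n. z ^ n *\<^sub>C fejer_part k n w)"
 proof (rule suminf_finite[symmetric])
  fix n assume "n \<notin> weight ` ?S"
  then have empty: "{a. a \<in> ?S \<and> weight a = n} = {}" by auto
  show "z ^ n *\<^sub>C fejer_part k n w = 0" unfolding part empty by simp
 qed (use fin in auto)
 finally show ?thesis .
qed

lemma dominating_series_summable:
 assumes "cmod z < 1"
 shows "summable (\<lambda>n. real (card (layer n)) * V * cmod z ^ n)"
 using summable_mult[OF summable_card_layer[of "cmod z"], of V] assms by (simp add: mult_ac)

lemma fejer_extension_tendsto:
 assumes w: "w \<in> torus" and z: "cmod z < 1"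
 shows "(\<lambda>k. fejer_extension k w z) \<longlonglongrightarrow> extension w z"
 unfolding fejer_extension_series extension_def
proof (rule dominated_series_tendsto[OF _ _ dominating_series_summable[OF z]])
 fix n
 have "(\<lambda>k. z ^ n *\<^sub>C fejer_part k n w) \<longlonglongrightarrow> z ^ n *\<^sub>C (\<Sum>a\<in>layer n. (of_real 1 * monomial a w) *\<^sub>C c a)"
  unfolding fejer_part_def using layer_subset
  by (intro tendsto_intros fejer_cube_tendsto) auto
 then show "(\<lambda>k. z ^ n *\<^sub>C fejer_part k n w) \<longlonglongrightarrow> z ^ n *\<^sub>C homogeneous_part n w"
  by (simp add: homogeneous_part_def)
 show "norm (z ^ n *\<^sub>C fejer_part k n w) \<le> real (card (layer n)) * V * cmod z ^ n" for k
  using norm_fejer_part_le[OF w, of k n] by (simp add: norm_scaleC norm_power mult.commute mult_left_mono)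
qed

lemma extension_holomorphic:
 assumes w: "w \<in> torus"
 shows "vec_holomorphic_on (extension w) (ball 0 1)"
 unfolding extension_def[abs_def]
proof (rule vec_holomorphic_on_power_series)
 fix r :: real assume r: "0 \<le> r" "r < 1"
 show "summable (\<lambda>n. norm (homogeneous_part n w) * r ^ n)"
 proof (rule summable_comparison_test')
  show "summable (\<lambda>n. real (card (layer n)) * V * r ^ n)"
   using dominating_series_summable[of "of_real r"] r by simp
  show "norm (norm (homogeneous_part n w) * r ^ n) \<le> real (card (layer n)) * V * r ^ n" for n
   using norm_homogeneous_part_le[OF w, of n] r by (simp add: mult_right_mono)
 qed
qed

lemma homogeneous_part_flow: "homogeneous_part n (flow z w) = z ^ n *\<^sub>C homogeneous_part n w"
 unfolding homogeneous_part_def scaleC_sum_right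
 by (rule sum.cong) (auto simp: layer_def monomial_flow scaleC_scaleC)

lemma extension_flow: "extension (flow z w) y = extension w (y * z)"
 by (simp add: extension_def homogeneous_part_flow scaleC_scaleC power_mult_distrib)

lemma fejer_extension_flow: "fejer_extension k (flow z w) y = fejer_extension k w (y * z)"
 unfolding fejer_extension_def
 by (rule sum.cong) (auto simp: monomial_flow power_mult_distrib mult_ac)

text \<open>At \<open>z = 1\<close> the extension is the Fejer mean itself, since the coefficients outside \<open>N0_fin\<close> vanish.\<close>

lemma fejer_extension_one:
 "fejer_extension k w 1 = (\<Sum>a\<in>difference_set (cube k). (of_real (fejer (cube k) a) * monomial a w) *\<^sub>C c a)"
proof -
 let ?g = "\<lambda>a. (of_real (fejer (cube k) a) * monomial a w) *\<^sub>C c a"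
 have "(\<Sum>a\<in>difference_set (cube k) \<inter> N0_fin. ?g a) = (\<Sum>a\<in>difference_set (cube k). ?g a)"
 proof (rule sum.mono_neutral_left[OF finite_difference_set[OF finite_cube]])
  show "\<forall>a\<in>difference_set (cube k) - difference_set (cube k) \<inter> N0_fin. ?g a = 0"
   using difference_set_Z_fin[OF cube_Z_fin[of k]] by (auto simp: subset_iff analytic)
 qed simp
 then show ?thesis by (simp add: fejer_extension_def)
qed

lemma disc_algebra_fejer_extension: "disc_algebra (fejer_extension k w)"
 unfolding disc_algebra_def
proof (intro conjI allI impI)
 show "continuous_on (cball 0 1) (fejer_extension k w)"
  unfolding fejer_extension_def by (intro continuous_intros)
 fix l :: "'a \<Rightarrow> complex" assume l: "contractive l"
 interpret l: bounded_linear l by (rule contractive_bounded_linear[OF l])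
 show "(\<lambda>z. l (fejer_extension k w z)) holomorphic_on ball 0 1"
  unfolding fejer_extension_def l.sum contractiveD(2)[OF l] by (intro holomorphic_intros)
qed

lemma continuous_on_fejer_extension: "continuous_on torus (\<lambda>w. fejer_extension k w z)"
 unfolding fejer_extension_def by (intro continuous_intros continuous_on_monomial)

definition maximal_function :: "point \<Rightarrow> ennreal" where
 "maximal_function w = (SUP i. ennreal (norm (extension w (of_real (radius i)))))"

text \<open>The maximal inequality on each orbit, integrated over the torus.\<close>

lemma fejer_maximal_integral:
 "(\<integral>\<^sup>+w. (SUP i. ennreal (norm (fejer_extension k w (of_real (radius i))))) \<partial>haar) \<le> 16 * ennreal V"
proof -
 let ?S = "\<lambda>w. SUP i. ennreal (norm (fejer_extension k w (of_real (radius i))))"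
 have nm: "(\<lambda>w. ennreal (norm (fejer_extension k w z))) \<in> borel_measurable haar" for z
  by (intro borel_measurable_haar continuous_on_compose2[OF continuous_on_ennreal] continuous_on_norm continuous_on_fejer_extension)
   auto
 have Sm: "?S \<in> borel_measurable haar" by (intro borel_measurable_SUP nm) auto
 have "(\<integral>\<^sup>+w. ?S w \<partial>haar) = (\<integral>\<^sup>+w. (\<integral>\<^sup>+z. ?S (flow z w) \<partial>circle) \<partial>haar)"
  by (rule nn_integral_orbits[OF Sm, symmetric])
 also have "\<dots> = (\<integral>\<^sup>+w. (\<integral>\<^sup>+z. (SUP \<rho>\<in>range radius. ennreal (norm (fejer_extension k w (of_real \<rho> * z)))) \<partial>circle) \<partial>haar)"
  by (simp add: fejer_extension_flow image_image)
 also have "\<dots> \<le> (\<integral>\<^sup>+w. 16 * (\<integral>\<^sup>+z. ennreal (norm (fejer_extension k w z)) \<partial>circle) \<partial>haar)"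
  by (intro nn_integral_mono maximal_inequality disc_algebra_fejer_extension) (auto simp: radius)
 also have "\<dots> = (\<integral>\<^sup>+w. (\<integral>\<^sup>+z. 16 * ennreal (norm (fejer_extension k (flow z w) 1)) \<partial>circle) \<partial>haar)"
 proof (rule nn_integral_cong)
  fix w
  have "continuous_on (sphere 0 1) (\<lambda>z. norm (fejer_extension k w z))"
   by (rule disc_algebra_continuous_on_sphere[OF disc_algebra_fejer_extension])
  then have "(\<lambda>z. ennreal (norm (fejer_extension k w z))) \<in> borel_measurable circle"
   using borel_measurable_circle by measurable
  then show "16 * (\<integral>\<^sup>+z. ennreal (norm (fejer_extension k w z)) \<partial>circle)
    = (\<integral>\<^sup>+z. 16 * ennreal (norm (fejer_extension k (flow z w) 1)) \<partial>circle)"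
   by (simp add: fejer_extension_flow nn_integral_cmult)
 qed
 also have "\<dots> = (\<integral>\<^sup>+w. 16 * ennreal (norm (fejer_extension k w 1)) \<partial>haar)"
  by (rule nn_integral_orbits) (intro borel_measurable_times_ennreal nm borel_measurable_const)
 also have "\<dots> = 16 * (\<integral>\<^sup>+w. ennreal (norm (fejer_extension k w 1)) \<partial>haar)"
  by (rule nn_integral_cmult[OF nm])
 also have "\<dots> \<le> 16 * ennreal V"
  unfolding fejer_extension_one
  by (intro mult_left_mono fejer_mean_norm_le[OF bounded_vector_measure_axioms finite_cube cube_Z_fin cube_nonempty]) auto
 finally show ?thesis .
qed

lemma measurable_norm_extension_diff:
 assumes "cmod z < 1" "cmod y < 1"
 shows "(\<lambda>w. norm (extension w z - extension w y)) \<in> borel_measurable haar"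
proof (rule borel_measurable_LIMSEQ_real)
 show "(\<lambda>k. norm (fejer_extension k w z - fejer_extension k w y)) \<longlonglongrightarrow> norm (extension w z - extension w y)"
  if "w \<in> space haar" for w
  using that assms by (intro tendsto_intros fejer_extension_tendsto) (auto simp: space_haar)
 show "(\<lambda>w. norm (fejer_extension k w z - fejer_extension k w y)) \<in> borel_measurable haar" for k
  by (intro borel_measurable_haar continuous_intros continuous_on_fejer_extension)
qed

lemma measurable_norm_extension:
 assumes "cmod z < 1"
 shows "(\<lambda>w. norm (extension w z)) \<in> borel_measurable haar"
proof (rule borel_measurable_LIMSEQ_real)
 show "(\<lambda>k. norm (fejer_extension k w z)) \<longlonglongrightarrow> norm (extension w z)" if "w \<in> space haar" for w
  using that assms by (intro tendsto_intros fejer_extension_tendsto) (auto simp: space_haar)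
 show "(\<lambda>w. norm (fejer_extension k w z)) \<in> borel_measurable haar" for k
  by (intro borel_measurable_haar continuous_intros continuous_on_fejer_extension)
qed

lemma norm_radius_less: "cmod (of_real (radius i)) < 1"
 using radius[of i] by simp

lemma measurable_maximal_function: "maximal_function \<in> borel_measurable haar"
 unfolding maximal_function_def[abs_def]
 using measurable_norm_extension[OF norm_radius_less] by (intro borel_measurable_SUP) auto

text \<open>The extension is the limit of the Fejer means, so Fatou's lemma applies.\<close>

theorem maximal_function_integral: "(\<integral>\<^sup>+w. maximal_function w \<partial>haar) \<le> 16 * ennreal V"
proof -
 let ?S = "\<lambda>k w. SUP i. ennreal (norm (fejer_extension k w (of_real (radius i))))"
 have nm: "(\<lambda>w. ennreal (norm (fejer_extension k w z))) \<in> borel_measurable haar" for k z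
  by (intro borel_measurable_haar continuous_on_compose2[OF continuous_on_ennreal] continuous_on_norm continuous_on_fejer_extension)
   auto
 have Sm: "?S k \<in> borel_measurable haar" for k by (intro borel_measurable_SUP nm) auto
 have le: "maximal_function w \<le> liminf (\<lambda>k. ?S k w)" if w: "w \<in> space haar" for w
  unfolding maximal_function_def
 proof (rule SUP_least)
  fix i
  have "(\<lambda>k. ennreal (norm (fejer_extension k w (of_real (radius i))))) \<longlonglongrightarrow> ennreal (norm (extension w (of_real (radius i))))"
   using w norm_radius_less by (intro tendsto_ennrealI tendsto_norm fejer_extension_tendsto) (auto simp: space_haar)
  then have "ennreal (norm (extension w (of_real (radius i)))) = liminf (\<lambda>k. ennreal (norm (fejer_extension k w (of_real (radius i)))))"
   by (rule lim_imp_Liminf[OF trivial_limit_sequentially, symmetric])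
  also have "\<dots> \<le> liminf (\<lambda>k. ?S k w)"
   by (intro Liminf_mono always_eventually allI SUP_upper) auto
  finally show "ennreal (norm (extension w (of_real (radius i)))) \<le> liminf (\<lambda>k. ?S k w)" .
 qed
 have "(\<integral>\<^sup>+w. maximal_function w \<partial>haar) \<le> (\<integral>\<^sup>+w. liminf (\<lambda>k. ?S k w) \<partial>haar)"
  by (rule nn_integral_mono[OF le])
 also have "\<dots> \<le> liminf (\<lambda>k. \<integral>\<^sup>+w. ?S k w \<partial>haar)" by (rule nn_integral_liminf[OF Sm])
 also have "\<dots> \<le> liminf (\<lambda>k. 16 * ennreal V)"
  by (intro Liminf_mono always_eventually allI fejer_maximal_integral)
 finally show ?thesis by (simp add: Liminf_const)
qed

lemma measurable_Cauchy_extension: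
 "{w \<in> space haar. Cauchy (\<lambda>i. extension w (of_real (radius i)))} \<in> sets haar"
proof -
 let ?g = "\<lambda>w i. extension w (of_real (radius i))"
 have CE: "Cauchy (?g w) \<longleftrightarrow> (\<forall>n. \<exists>N. \<forall>i\<ge>N. \<forall>j\<ge>N. norm (?g w i - ?g w j) < 1 / real (Suc n))" for w
 proof (intro iffI allI)
  fix n assume "Cauchy (?g w)"
  then show "\<exists>N. \<forall>i\<ge>N. \<forall>j\<ge>N. norm (?g w i - ?g w j) < 1 / real (Suc n)"
   by (rule CauchyD) simp
 next
  assume *: "\<forall>n. \<exists>N. \<forall>i\<ge>N. \<forall>j\<ge>N. norm (?g w i - ?g w j) < 1 / real (Suc n)"
  show "Cauchy (?g w)"
  proof (rule CauchyI)
   fix e :: real assume "e > 0"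
   then obtain n where n: "1 / real (Suc n) < e" using nat_approx_posE by blast
   then show "\<exists>N. \<forall>i\<ge>N. \<forall>j\<ge>N. norm (?g w i - ?g w j) < e" using * by (meson less_trans)
  qed
 qed
 note [measurable] = measurable_norm_extension_diff[OF norm_radius_less norm_radius_less]
 show ?thesis unfolding CE by measurable
qed

text \<open>On almost every orbit the maximal function is integrable, so that the property provides
 limits along almost every radius of the orbit. Invariance turns this into a statement about
 almost every point of the torus.\<close>

theorem ARNP_extension_converges:
 assumes X: "ARNP TYPE('a)"
 shows "AE w in haar. Cauchy (\<lambda>i. extension w (of_real (radius i)))"
proof -
 let ?g = "\<lambda>w i. extension w (of_real (radius i))"
 define E where "E = {w \<in> space haar. \<not> Cauchy (?g w)}"
 have "E = space haar - {w \<in> space haar. Cauchy (?g w)}" by (auto simp: E_def)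
 then have E: "E \<in> sets haar" using measurable_Cauchy_extension by auto
 have "(\<integral>\<^sup>+w. maximal_function w \<partial>haar) < \<infinity>"
  by (rule le_less_trans[OF maximal_function_integral]) (simp add: ennreal_mult_less_top)
 then have "(\<integral>\<^sup>+w. (\<integral>\<^sup>+z. maximal_function (flow z w) \<partial>circle) \<partial>haar) \<noteq> \<infinity>"
  by (simp add: nn_integral_orbits[OF measurable_maximal_function])
 moreover have meas: "(\<lambda>w. \<integral>\<^sup>+z. h (flow z w) \<partial>circle) \<in> borel_measurable haar" if h: "h \<in> borel_measurable haar" for h :: "_ \<Rightarrow> ennreal"
 proof -
  have "(\<lambda>(w, z). h (flow z w)) = (\<lambda>p. h ((\<lambda>(z, w). flow z w) (snd p, fst p)))" by auto
  also have "\<dots> \<in> borel_measurable (haar \<Otimes>\<^sub>M circle)"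
   by (rule measurable_compose[OF measurable_compose[OF measurable_Pair[OF measurable_snd measurable_fst] measurable_flow] h])
  finally show ?thesis by (rule circle.borel_measurable_nn_integral)
 qed
 ultimately have fin: "AE w in haar. (\<integral>\<^sup>+z. maximal_function (flow z w) \<partial>circle) \<noteq> \<infinity>"
  by (intro nn_integral_PInf_AE meas measurable_maximal_function)
 have "AE w in haar. (\<integral>\<^sup>+z. indicator E (flow z w) \<partial>circle) = 0"
  using fin AE_space
 proof eventually_elim
  case (elim w)
  then have w: "w \<in> torus" by (simp add: space_haar)
  define I where "I = (\<integral>\<^sup>+z. maximal_function (flow z w) \<partial>circle)"
  have I: "I < \<infinity>" using elim(1) by (simp add: I_def less_top)
  have vh: "vec_holomorphic_on (extension w) (ball 0 1)" by (rule extension_holomorphic[OF w])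
  have "(\<integral>z. ln (1 + norm (extension w (of_real (radius i) * z))) \<partial>circle) \<le> enn2real I" for i
  proof -
   have "disc_algebra (\<lambda>z. extension w (of_real (radius i) * z))" by (rule disc_algebra_dilation[OF vh radius])
   then have nc: "continuous_on (sphere 0 1) (\<lambda>z. norm (extension w (of_real (radius i) * z)))"
    by (auto intro!: disc_algebra_continuous_on_sphere)
   have lc: "continuous_on (sphere 0 1) (\<lambda>z. ln (1 + norm (extension w (of_real (radius i) * z))))"
    unfolding add.commute[of 1] by (rule continuous_on_ln_add[OF nc]) auto
   have "(\<integral>z. ln (1 + norm (extension w (of_real (radius i) * z))) \<partial>circle)
     \<le> (\<integral>z. norm (extension w (of_real (radius i) * z)) \<partial>circle)"
    using integrable_circle[OF lc] integrable_circle[OF nc] by (intro integral_mono ln_add_one_self_le_self) auto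
   also have "\<dots> = enn2real (\<integral>\<^sup>+z. ennreal (norm (extension w (of_real (radius i) * z))) \<partial>circle)"
    by (rule integral_eq_nn_integral) (use borel_measurable_circle[OF nc] in auto)
   also have "\<dots> \<le> enn2real I"
   proof (rule enn2real_mono)
    show "(\<integral>\<^sup>+z. ennreal (norm (extension w (of_real (radius i) * z))) \<partial>circle) \<le> I"
     unfolding I_def maximal_function_def extension_flow
     by (intro nn_integral_mono SUP_upper) auto
   qed (use I in auto)
   finally show ?thesis .
  qed
  from ARNP_radial_limits[OF X vh radius radius_tendsto this]
  have lim: "AE z in circle. \<exists>l. ((\<lambda>R. extension w (of_real R * z)) \<longlongrightarrow> l) (at_left (1::real))" .
  have left: "filterlim radius (at_left 1) sequentially"
   unfolding filterlim_at using radius radius_tendsto by (auto intro!: always_eventually simp: less_imp_neq)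
  have "AE z in circle. indicator E (flow z w) = (0::ennreal)"
   using lim
  proof eventually_elim
   case (elim z)
   then obtain l where "((\<lambda>R. extension w (of_real R * z)) \<longlongrightarrow> l) (at_left (1::real))" by blast
   from filterlim_compose[OF this left] have "(\<lambda>i. ?g (flow z w) i) \<longlonglongrightarrow> l" by (simp add: extension_flow)
   then have "Cauchy (?g (flow z w))" by (rule LIMSEQ_imp_Cauchy)
   then show ?case by (simp add: E_def)
  qed
  then have "(\<integral>\<^sup>+z. indicator E (flow z w) \<partial>circle) = (\<integral>\<^sup>+z. 0 \<partial>circle)" by (rule nn_integral_cong_AE)
  then show ?case by simp
 qed
 then have "(\<integral>\<^sup>+w. (\<integral>\<^sup>+z. indicator E (flow z w) \<partial>circle) \<partial>haar) = (\<integral>\<^sup>+w. 0 \<partial>haar)"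
  by (rule nn_integral_cong_AE)
 then have "(\<integral>\<^sup>+w. indicator E w \<partial>haar) = 0"
  using nn_integral_orbits[of "indicator E"] E by simp
 then have "E \<in> null_sets haar" using E by (simp add: null_sets_def)
 then show ?thesis by (rule AE_I') (auto simp: E_def)
qed

end

section \<open>Bochner integrals of products with scalar functions\<close>

lemma has_bochner_int_cong:
 assumes eq: "\<And>x. x \<in> space M \<Longrightarrow> f x = g x" and f: "has_bochner_int M f I"
 shows "has_bochner_int M g I"
proof -
 have sm: "strongly_measurable M g"
 proof -
  obtain s where s: "\<And>n. simple_function M (s n)" "AE x in M. (\<lambda>n::nat. s n x) \<longlonglongrightarrow> f x"
   using f unfolding has_bochner_int_def strongly_measurable_def by blast
  have "AE x in M. (\<lambda>n. s n x) \<longlonglongrightarrow> g x"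
   using s(2) AE_space by eventually_elim (simp add: eq)
  then show ?thesis unfolding strongly_measurable_def using s(1) by blast
 qed
 have "(L1_dist M f s) = (L1_dist M g s)" for s
  by (rule nn_integral_cong) (simp add: eq)
 then show ?thesis using f sm unfolding has_bochner_int_def by simp
qed

lemma has_bochner_int_scaleC_left:
 fixes f :: "'b \<Rightarrow> 'a::complex_banach"
 assumes f: "has_bochner_int M f I"
 shows "has_bochner_int M (\<lambda>x. c *\<^sub>C f x) (c *\<^sub>C I)"
proof -
 obtain s where s: "\<And>n. simple_bochner_integrable M (s n)"
   "(\<lambda>n::nat. L1_dist M f (s n)) \<longlonglongrightarrow> 0" "(\<lambda>n. simple_bochner_integral M (s n)) \<longlonglongrightarrow> I"
   and fm: "strongly_measurable M f"
  using f unfolding has_bochner_int_def by blast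
 have lin: "linear (\<lambda>x::'a. c *\<^sub>C x)"
  by (rule bounded_linear.linear[OF bounded_bilinear.bounded_linear_right[OF bounded_bilinear_scaleC]])
 obtain f' where f': "pointwise_measurable M f'" "AE x in M. f x = f' x"
  using strongly_measurable_version[OF fm] .
 have eq: "(\<integral>\<^sup>+x. ennreal (norm (c *\<^sub>C f x - c *\<^sub>C s n x)) \<partial>M) = ennreal (cmod c) * (L1_dist M f (s n))" for n
 proof -
  have ss: "simple_function M (s n)" using s(1) by (auto elim: Bochner_Integration.simple_bochner_integrable.cases)
  have "(\<integral>\<^sup>+x. ennreal (norm (c *\<^sub>C f x - c *\<^sub>C s n x)) \<partial>M) = (\<integral>\<^sup>+x. ennreal (cmod c) * ennreal (norm (f' x - s n x)) \<partial>M)"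
   by (rule nn_integral_cong_AE)
    (use f'(2) in eventually_elim, simp add: scaleC_diff_right[symmetric] norm_scaleC ennreal_mult)
  also have "\<dots> = ennreal (cmod c) * (L1_dist M f' (s n))"
   by (rule nn_integral_cmult)
    (rule pointwise_measurable_norm_diff[OF f'(1) pointwise_measurable_simple[OF ss]])
  also have "(L1_dist M f' (s n)) = (L1_dist M f (s n))"
   by (rule nn_integral_cong_AE) (use f'(2) in eventually_elim, simp)
  finally show ?thesis .
 qed
 show ?thesis
  unfolding has_bochner_int_def
 proof (intro conjI exI[of _ "\<lambda>n x. c *\<^sub>C s n x"] allI)
  show "strongly_measurable M (\<lambda>x. c *\<^sub>C f x)"
   by (rule strongly_measurable_combine[OF fm fm, of "\<lambda>d b. c *\<^sub>C d"]) (intro tendsto_intros)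
  show "simple_bochner_integrable M (\<lambda>x. c *\<^sub>C s n x)" for n
   by (rule simple_bochner_integrable_compose2[OF _ s(1) s(1), of "\<lambda>d b. c *\<^sub>C d"]) simp
  have "(\<lambda>n. ennreal (cmod c) * (L1_dist M f (s n))) \<longlonglongrightarrow> ennreal (cmod c) * 0"
   by (rule ennreal_tendsto_cmult[OF _ s(2)]) simp
  then show "(\<lambda>n. \<integral>\<^sup>+x. ennreal (norm (c *\<^sub>C f x - c *\<^sub>C s n x)) \<partial>M) \<longlonglongrightarrow> 0" by (simp add: eq)
  show "(\<lambda>n. simple_bochner_integral M (\<lambda>x. c *\<^sub>C s n x)) \<longlonglongrightarrow> c *\<^sub>C I"
   unfolding simple_bochner_integral_linear[OF lin s(1)] by (intro tendsto_intros s)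
 qed
qed

text \<open>The defining approximation of a scalar integral, multiplied by \<open>v\<close>.\<close>

lemma has_bochner_int_scaleC_const:
 fixes v :: "'a::complex_banach"
 assumes \<phi>: "integrable M \<phi>"
 shows "has_bochner_int M (\<lambda>x. \<phi> x *\<^sub>C v) ((\<integral>x. \<phi> x \<partial>M) *\<^sub>C v)"
proof -
 have m[measurable]: "\<phi> \<in> borel_measurable M" using \<phi> by auto
 obtain s where s: "\<And>n. simple_bochner_integrable M (s n)"
   "(\<lambda>n. L1_dist M \<phi> (s n)) \<longlonglongrightarrow> 0" "(\<lambda>n. simple_bochner_integral M (s n)) \<longlonglongrightarrow> (\<integral>x. \<phi> x \<partial>M)"
  using has_bochner_integral_integrable[OF \<phi>] by (elim has_bochner_integral.cases) (rule that, auto)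
 have lin: "linear (\<lambda>c. c *\<^sub>C v)"
  by (rule bounded_linear.linear[OF bounded_bilinear.bounded_linear_left[OF bounded_bilinear_scaleC]])
 have eq: "(\<integral>\<^sup>+x. ennreal (norm (\<phi> x *\<^sub>C v - s n x *\<^sub>C v)) \<partial>M) = ennreal (norm v) * (L1_dist M \<phi> (s n))" for n
 proof -
  have [measurable]: "s n \<in> borel_measurable M"
   using s(1)[of n] by (auto elim: Bochner_Integration.simple_bochner_integrable.cases intro: borel_measurable_simple_function)
  have "(\<integral>\<^sup>+x. ennreal (norm v) * ennreal (norm (\<phi> x - s n x)) \<partial>M) = ennreal (norm v) * (L1_dist M \<phi> (s n))"
   by (rule nn_integral_cmult) measurable
  then show ?thesis by (simp add: scaleC_diff_left[symmetric] norm_scaleC ennreal_mult mult.commute)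
 qed
 have "pointwise_measurable M \<phi>"
  using borel_measurable_implies_sequence_metric[OF m, of 0] unfolding pointwise_measurable_def by blast
 note sm = everywhere_imp_strongly_measurable[OF this]
 show ?thesis
  unfolding has_bochner_int_def
 proof (intro conjI exI[of _ "\<lambda>n x. s n x *\<^sub>C v"] allI)
  show "strongly_measurable M (\<lambda>x. \<phi> x *\<^sub>C v)"
   by (rule strongly_measurable_combine[OF sm sm, of "\<lambda>d b. d *\<^sub>C v"]) (intro tendsto_scaleC tendsto_const)
  show "simple_bochner_integrable M (\<lambda>x. s n x *\<^sub>C v)" for n
   by (rule simple_bochner_integrable_compose2[OF _ s(1) s(1), of "\<lambda>d b. d *\<^sub>C v"]) (simp add: scaleC_zero_left)
  have "(\<lambda>n. ennreal (norm v) * (L1_dist M \<phi> (s n))) \<longlonglongrightarrow> ennreal (norm v) * 0"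
   by (rule ennreal_tendsto_cmult[OF _ s(2)]) simp
  then show "(\<lambda>n. \<integral>\<^sup>+x. ennreal (norm (\<phi> x *\<^sub>C v - s n x *\<^sub>C v)) \<partial>M) \<longlonglongrightarrow> 0" by (simp add: eq)
  show "(\<lambda>n. simple_bochner_integral M (\<lambda>x. s n x *\<^sub>C v)) \<longlonglongrightarrow> (\<integral>x. \<phi> x \<partial>M) *\<^sub>C v"
   unfolding simple_bochner_integral_linear[OF lin s(1)] by (intro tendsto_scaleC tendsto_const s)
 qed
qed

lemma set_bochner_intI:
 fixes f :: "point \<Rightarrow> 'a::complex_banach"
 assumes f: "bochner_integrable haar f" and A: "A \<in> sets haar"
 shows "has_bochner_int haar (\<lambda>w. indicat_real A w *\<^sub>R f w) (set_bochner_int haar A f)"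
proof -
 have "bochner_integrable haar (\<lambda>w. complex_of_real (indicat_real A w) *\<^sub>C f w)"
  by (rule haar.bochner_integrable_scaleC[OF f, where B = 1]) (use A in \<open>auto simp: indicator_def\<close>)
 then have "bochner_integrable haar (\<lambda>w. indicat_real A w *\<^sub>R f w)" by (simp add: scaleC_of_real)
 from bochner_integrableD[OF this] show ?thesis by (simp add: set_bochner_int_def)
qed

lemma simple_approx_sum:
 fixes v :: "'i \<Rightarrow> 'a::complex_banach"
 assumes I: "finite I" and \<phi>: "\<And>i. i \<in> I \<Longrightarrow> \<phi> i \<in> borel_measurable M"
  "\<And>i x. i \<in> I \<Longrightarrow> x \<in> space M \<Longrightarrow> cmod (\<phi> i x) \<le> B" and e: "e > 0"
 obtains s where "simple_function M s" "\<And>x. x \<in> space M \<Longrightarrow> norm ((\<Sum>i\<in>I. \<phi> i x *\<^sub>C v i) - s x) \<le> e"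
proof -
 define K where "K = (\<Sum>i\<in>I. norm (v i)) + 1"
 have K: "K > 0" unfolding K_def by (intro add_nonneg_pos sum_nonneg) auto
 have "\<forall>i\<in>I. \<exists>t. simple_function M t \<and> (\<forall>x\<in>space M. cmod (t x - \<phi> i x) \<le> e / K)"
 proof
  fix i assume i: "i \<in> I"
  have "0 < e / K" using e K by simp
  from simple_uniform_approx[OF \<phi>(1)[OF i] \<phi>(2)[OF i] this]
  show "\<exists>t. simple_function M t \<and> (\<forall>x\<in>space M. cmod (t x - \<phi> i x) \<le> e / K)" by metis
 qed
 then obtain t where t: "\<And>i. i \<in> I \<Longrightarrow> simple_function M (t i)"
   "\<And>i x. i \<in> I \<Longrightarrow> x \<in> space M \<Longrightarrow> cmod (t i x - \<phi> i x) \<le> e / K" by metis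
 show thesis
 proof (rule that[of "\<lambda>x. \<Sum>i\<in>I. t i x *\<^sub>C v i"])
  show "simple_function M (\<lambda>x. \<Sum>i\<in>I. t i x *\<^sub>C v i)"
   by (intro simple_function_sum) (rule simple_function_compose1[OF t(1)])
  fix x assume x: "x \<in> space M"
  have "norm ((\<Sum>i\<in>I. \<phi> i x *\<^sub>C v i) - (\<Sum>i\<in>I. t i x *\<^sub>C v i)) \<le> (\<Sum>i\<in>I. norm (\<phi> i x *\<^sub>C v i - t i x *\<^sub>C v i))"
   unfolding sum_subtractf[symmetric] by (rule norm_sum)
  also have "\<dots> \<le> (\<Sum>i\<in>I. e / K * norm (v i))"
   unfolding scaleC_diff_left[symmetric] norm_scaleC using t(2)[OF _ x]
   by (intro sum_mono mult_right_mono) (auto simp: norm_minus_commute)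
  also have "\<dots> = e / K * (K - 1)" by (simp add: K_def sum_distrib_left)
  also have "\<dots> \<le> e" using e K by (simp add: field_simps)
  finally show "norm ((\<Sum>i\<in>I. \<phi> i x *\<^sub>C v i) - (\<Sum>i\<in>I. t i x *\<^sub>C v i)) \<le> e" .
 qed
qed


section \<open>The boundary value of the extension\<close>

context analytic_measure
begin

definition boundary_value :: "point \<Rightarrow> 'a" where
 "boundary_value w = (if Cauchy (\<lambda>i. extension w (of_real (radius i)))
   then lim (\<lambda>i. extension w (of_real (radius i))) else 0)"

lemma boundary_value_tendsto:
 assumes "Cauchy (\<lambda>i. extension w (of_real (radius i)))"
 shows "(\<lambda>i. extension w (of_real (radius i))) \<longlonglongrightarrow> boundary_value w"
 using assms by (simp add: boundary_value_def convergent_LIMSEQ_iff[symmetric] Cauchy_convergent_iff)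

definition truncation :: "nat \<Rightarrow> complex \<Rightarrow> point \<Rightarrow> 'a" where
 "truncation N z w = (\<Sum>a\<in>(\<Union>n<N. layer n). (z ^ weight a * monomial a w) *\<^sub>C c a)"

text \<open>Finite truncations make the extension a uniform limit of finite sums of scalar functions times
 vectors, which is what strong measurability asks for.\<close>

lemma truncation_uniform_limit:
 assumes z: "cmod z < 1"
 shows "uniform_limit torus (\<lambda>N. truncation N z) (\<lambda>w. extension w z) sequentially"
proof -
 have "truncation N z = (\<lambda>w. \<Sum>n<N. z ^ n *\<^sub>C homogeneous_part n w)" for N
 proof
  fix w
  have "truncation N z w = (\<Sum>n<N. \<Sum>a\<in>layer n. (z ^ weight a * monomial a w) *\<^sub>C c a)"
   unfolding truncation_def
   by (rule sum.UNION_disjoint) (simp_all add: finite_layer, auto simp: layer_def)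
  also have "\<dots> = (\<Sum>n<N. z ^ n *\<^sub>C homogeneous_part n w)"
   unfolding homogeneous_part_def scaleC_sum_right
   by (intro sum.cong refl) (auto simp: layer_def scaleC_scaleC)
  finally show "truncation N z w = (\<Sum>n<N. z ^ n *\<^sub>C homogeneous_part n w)" .
 qed
 moreover have "uniform_limit torus (\<lambda>N w. \<Sum>n<N. z ^ n *\<^sub>C homogeneous_part n w) (\<lambda>w. extension w z) sequentially"
  unfolding extension_def
 proof (rule Weierstrass_m_test[OF _ dominating_series_summable[OF z]])
  fix n w assume "w \<in> torus"
  then show "norm (z ^ n *\<^sub>C homogeneous_part n w) \<le> real (card (layer n)) * V * cmod z ^ n"
   using norm_homogeneous_part_le[of w n] by (simp add: norm_scaleC norm_power mult.commute mult_left_mono)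
 qed
 ultimately show ?thesis by simp
qed

lemma extension_simple_approx:
 assumes z: "cmod z < 1" and e: "e > 0"
 obtains s where "simple_function haar s" "\<And>w. w \<in> torus \<Longrightarrow> norm (extension w z - s w) \<le> e"
proof -
 have "e / 2 > 0" using e by simp
 from uniform_limitD[OF truncation_uniform_limit[OF z] this]
 obtain N where N: "\<And>w. w \<in> torus \<Longrightarrow> dist (truncation N z w) (extension w z) < e / 2"
  by (auto simp: eventually_sequentially)
 have fin: "finite (\<Union>n<N. layer n)" by (simp add: finite_layer)
 have le: "cmod (z ^ weight a * monomial a w) \<le> 1" if "w \<in> space haar" for a w
  using z that by (simp add: norm_mult norm_power norm_monomial space_haar power_le_one)
 have meas: "(\<lambda>w. z ^ weight a * monomial a w) \<in> borel_measurable haar" for a by measurable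
 obtain s where s: "simple_function haar s" "\<And>w. w \<in> torus \<Longrightarrow> norm (truncation N z w - s w) \<le> e / 2"
 proof (rule simple_approx_sum[OF fin meas le \<open>e / 2 > 0\<close>, where v = c])
  fix s assume "simple_function haar s"
   "\<And>w. w \<in> space haar \<Longrightarrow> norm ((\<Sum>a\<in>(\<Union>n<N. layer n). (z ^ weight a * monomial a w) *\<^sub>C c a) - s w) \<le> e / 2"
  then show thesis by (intro that[of s]) (auto simp: truncation_def space_haar)
 qed
 show thesis
 proof (rule that[OF s(1)])
  fix w assume "w \<in> torus"
  then show "norm (extension w z - s w) \<le> e"
   using N[of w] s(2)[of w] norm_triangle_ineq[of "extension w z - truncation N z w" "truncation N z w - s w"]
   by (simp add: dist_norm norm_minus_commute)
 qed
qed

lemma simple_approx_sequence: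
 obtains s where "\<And>i. simple_function haar (s i)"
  "\<And>i w. w \<in> torus \<Longrightarrow> norm (extension w (of_real (radius i)) - s i w) \<le> 1 / real (Suc i)"
proof -
 have "\<exists>s. simple_function haar s \<and> (\<forall>w\<in>torus. norm (extension w (of_real (radius i)) - s w) \<le> 1 / real (Suc i))" for i
 proof -
  have "0 < 1 / real (Suc i)" by simp
  from extension_simple_approx[OF norm_radius_less this, of i] show ?thesis by metis
 qed
 then show thesis using that by metis
qed

lemma boundary_value_strongly_measurable: "pointwise_measurable haar boundary_value"
proof -
 obtain s where s: "\<And>i. simple_function haar (s i)"
  "\<And>i w. w \<in> torus \<Longrightarrow> norm (extension w (of_real (radius i)) - s i w) \<le> 1 / real (Suc i)"
  using simple_approx_sequence by blast
 let ?G = "{w \<in> space haar. Cauchy (\<lambda>i. extension w (of_real (radius i)))}"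
 have G: "?G \<in> sets haar" by (rule measurable_Cauchy_extension)
 show ?thesis
  unfolding pointwise_measurable_def
 proof (intro exI[of _ "\<lambda>i w. if w \<in> ?G then s i w else 0"] conjI allI ballI)
  show "simple_function haar (\<lambda>w. if w \<in> ?G then s i w else 0)" for i
   by (rule simple_function_If_set[OF s(1) simple_function_const]) (use G in auto)
  fix w assume w: "w \<in> space haar"
  show "(\<lambda>i. if w \<in> ?G then s i w else 0) \<longlonglongrightarrow> boundary_value w"
  proof (cases "Cauchy (\<lambda>i. extension w (of_real (radius i)))")
   case True
   have "(\<lambda>i. extension w (of_real (radius i)) - s i w) \<longlonglongrightarrow> 0"
   proof (rule Lim_null_comparison)
    show "\<forall>\<^sub>F i in sequentially. norm (extension w (of_real (radius i)) - s i w) \<le> 1 / real (Suc i)"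
     using s(2) w by (simp add: space_haar)
    show "(\<lambda>i. 1 / real (Suc i)) \<longlonglongrightarrow> 0" by (rule LIMSEQ_Suc[OF lim_1_over_n])
   qed
   from tendsto_diff[OF boundary_value_tendsto[OF True] this]
   have "(\<lambda>i. s i w) \<longlonglongrightarrow> boundary_value w" by simp
   then show ?thesis using True w by simp
  qed (simp add: boundary_value_def)
 qed
qed

lemma extension_strongly_measurable:
 assumes z: "cmod z < 1"
 shows "pointwise_measurable haar (\<lambda>w. extension w z)"
proof -
 have "\<exists>s. simple_function haar s \<and> (\<forall>w\<in>torus. norm (extension w z - s w) \<le> 1 / real (Suc i))" for i
 proof -
  have "0 < 1 / real (Suc i)" by simp
  from extension_simple_approx[OF z this] show ?thesis by metis
 qed
 then obtain s where s: "\<And>i. simple_function haar (s i)"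
  "\<And>i w. w \<in> torus \<Longrightarrow> norm (extension w z - s i w) \<le> 1 / real (Suc i)" by metis
 have "(\<lambda>i. s i w) \<longlonglongrightarrow> extension w z" if "w \<in> torus" for w
 proof -
  have "(\<lambda>i. extension w z - s i w) \<longlonglongrightarrow> 0"
  proof (rule Lim_null_comparison)
   show "\<forall>\<^sub>F i in sequentially. norm (extension w z - s i w) \<le> 1 / real (Suc i)" using s(2) that by simp
   show "(\<lambda>i. 1 / real (Suc i)) \<longlonglongrightarrow> 0" by (rule LIMSEQ_Suc[OF lim_1_over_n])
  qed
  from tendsto_diff[OF tendsto_const[of "extension w z"] this] show ?thesis by simp
 qed
 then show ?thesis unfolding pointwise_measurable_def space_haar using s(1) by blast
qed

lemma extension_le_maximal: "ennreal (norm (extension w (of_real (radius i)))) \<le> maximal_function w"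
 unfolding maximal_function_def by (intro SUP_upper) auto

lemma boundary_value_le_maximal:
 assumes "Cauchy (\<lambda>i. extension w (of_real (radius i)))"
 shows "ennreal (norm (boundary_value w)) \<le> maximal_function w"
proof (rule LIMSEQ_le_const2)
 show "(\<lambda>i. ennreal (norm (extension w (of_real (radius i))))) \<longlonglongrightarrow> ennreal (norm (boundary_value w))"
  by (intro tendsto_ennrealI tendsto_norm boundary_value_tendsto assms)
qed (use extension_le_maximal in auto)

text \<open>Dominated convergence with the maximal function as dominating function.\<close>

lemma extension_L1_tendsto:
 assumes conv: "AE w in haar. Cauchy (\<lambda>i. extension w (of_real (radius i)))"
 shows "(\<lambda>i. \<integral>\<^sup>+w. ennreal (norm (boundary_value w - extension w (of_real (radius i)))) \<partial>haar) \<longlonglongrightarrow> 0"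
proof -
 have "(\<lambda>i. \<integral>\<^sup>+w. ennreal (norm (boundary_value w - extension w (of_real (radius i)))) \<partial>haar) \<longlonglongrightarrow> (\<integral>\<^sup>+w. 0 \<partial>haar)"
 proof (rule nn_integral_dominated_convergence[where w = "\<lambda>w. 2 * maximal_function w"])
  show "(\<lambda>w. ennreal (norm (boundary_value w - extension w (of_real (radius i))))) \<in> borel_measurable haar" for i
   by (rule pointwise_measurable_norm_diff[OF boundary_value_strongly_measurable
      extension_strongly_measurable[OF norm_radius_less]])
  show "(\<lambda>w. 2 * maximal_function w) \<in> borel_measurable haar" using measurable_maximal_function by measurable
  have "(\<integral>\<^sup>+w. 2 * maximal_function w \<partial>haar) = 2 * (\<integral>\<^sup>+w. maximal_function w \<partial>haar)"
   by (rule nn_integral_cmult[OF measurable_maximal_function])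
  also have "\<dots> \<le> 2 * (16 * ennreal V)" by (intro mult_left_mono maximal_function_integral) auto
  also have "\<dots> < \<infinity>" by (simp add: ennreal_mult_less_top)
  finally show "(\<integral>\<^sup>+w. 2 * maximal_function w \<partial>haar) < \<infinity>" .
  show "AE w in haar. ennreal (norm (boundary_value w - extension w (of_real (radius i)))) \<le> 2 * maximal_function w" for i
   using conv
  proof eventually_elim
   case (elim w)
   have "ennreal (norm (boundary_value w - extension w (of_real (radius i))))
     \<le> ennreal (norm (boundary_value w) + norm (extension w (of_real (radius i))))"
    by (intro ennreal_leI norm_triangle_ineq4)
   also have "\<dots> = ennreal (norm (boundary_value w)) + ennreal (norm (extension w (of_real (radius i))))"
    by (rule ennreal_plus) auto
   also have "\<dots> \<le> maximal_function w + maximal_function w" by (intro add_mono boundary_value_le_maximal[OF elim] extension_le_maximal)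
   finally show ?case by (simp add: mult_2)
  qed
  show "AE w in haar. (\<lambda>i. ennreal (norm (boundary_value w - extension w (of_real (radius i))))) \<longlonglongrightarrow> 0"
   using conv
  proof eventually_elim
   case (elim w)
   have "(\<lambda>i. ennreal (norm (boundary_value w - extension w (of_real (radius i))))) \<longlonglongrightarrow> ennreal (norm (boundary_value w - boundary_value w))"
    by (intro tendsto_ennrealI tendsto_norm tendsto_diff tendsto_const boundary_value_tendsto elim)
   then show ?case by simp
  qed
 qed auto
 then show ?thesis by simp
qed

lemma boundary_value_integrable:
 assumes conv: "AE w in haar. Cauchy (\<lambda>i. extension w (of_real (radius i)))"
 shows "bochner_integrable haar boundary_value"
 unfolding haar.bochner_integrable_iff
proof
 show "strongly_measurable haar boundary_value"
  by (rule everywhere_imp_strongly_measurable[OF boundary_value_strongly_measurable])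
 have "(\<integral>\<^sup>+w. ennreal (norm (boundary_value w)) \<partial>haar) \<le> (\<integral>\<^sup>+w. maximal_function w \<partial>haar)"
  by (rule nn_integral_mono_AE) (use conv in eventually_elim, rule boundary_value_le_maximal)
 also have "\<dots> \<le> 16 * ennreal V" by (rule maximal_function_integral)
 also have "\<dots> < \<infinity>" by (simp add: ennreal_mult_less_top)
 finally show "(\<integral>\<^sup>+w. ennreal (norm (boundary_value w)) \<partial>haar) < \<infinity>" .
qed

lemma truncation_fourier_coefficient:
 assumes a: "a \<in> Z_fin" and N: "weight a < N"
 shows "has_bochner_int haar (\<lambda>w. monomial (\<lambda>j. - a j) w *\<^sub>C truncation N z w) (z ^ weight a *\<^sub>C c a)"
proof -
 let ?L = "\<Union>n<N. layer n"
 have fin: "finite ?L" by (simp add: finite_layer)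
 have "has_bochner_int haar (\<lambda>w. \<Sum>\<beta>\<in>?L. monomial (\<lambda>j. \<beta> j - a j) w *\<^sub>C (z ^ weight \<beta> *\<^sub>C c \<beta>))
   (\<Sum>\<beta>\<in>?L. (integral\<^sup>L haar (monomial (\<lambda>j. \<beta> j - a j))) *\<^sub>C (z ^ weight \<beta> *\<^sub>C c \<beta>))"
  by (intro has_bochner_int_sum has_bochner_int_scaleC_const integrable_monomial)
 also have "(\<Sum>\<beta>\<in>?L. (integral\<^sup>L haar (monomial (\<lambda>j. \<beta> j - a j))) *\<^sub>C (z ^ weight \<beta> *\<^sub>C c \<beta>))
   = (\<Sum>\<beta>\<in>?L. if \<beta> = a then z ^ weight a *\<^sub>C c a else 0)"
 proof (rule sum.cong[OF refl])
  fix \<beta> assume "\<beta> \<in> ?L"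
  then have \<beta>: "\<beta> \<in> Z_fin" using layer_subset by auto
  have "(\<lambda>j. \<beta> j - a j) = (\<lambda>_. 0) \<longleftrightarrow> \<beta> = a" by (auto simp: fun_eq_iff)
  then show "(integral\<^sup>L haar (monomial (\<lambda>j. \<beta> j - a j))) *\<^sub>C (z ^ weight \<beta> *\<^sub>C c \<beta>)
    = (if \<beta> = a then z ^ weight a *\<^sub>C c a else 0)"
   by (simp add: integral_monomial[OF Z_fin_diff[OF \<beta> a]])
 qed
 also have "\<dots> = (if a \<in> ?L then z ^ weight a *\<^sub>C c a else 0)" using fin by (simp add: sum.delta)
 also have "\<dots> = z ^ weight a *\<^sub>C c a"
  using N a analytic[of a] by (auto simp: layer_def)
 finally show ?thesis
 proof (rule has_bochner_int_cong[rotated])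
  fix w assume "w \<in> space haar"
  then have w: "w \<in> torus" by (simp add: space_haar)
  show "(\<Sum>\<beta>\<in>?L. monomial (\<lambda>j. \<beta> j - a j) w *\<^sub>C (z ^ weight \<beta> *\<^sub>C c \<beta>)) = monomial (\<lambda>j. - a j) w *\<^sub>C truncation N z w"
   unfolding truncation_def scaleC_sum_right
  proof (rule sum.cong[OF refl])
   fix \<beta> assume "\<beta> \<in> ?L"
   then have \<beta>: "\<beta> \<in> Z_fin" using layer_subset by auto
   show "monomial (\<lambda>j. \<beta> j - a j) w *\<^sub>C (z ^ weight \<beta> *\<^sub>C c \<beta>) = monomial (\<lambda>j. - a j) w *\<^sub>C (z ^ weight \<beta> * monomial \<beta> w) *\<^sub>C c \<beta>"
    by (simp add: monomial_diff[OF \<beta> a w] cnj_monomial[OF w] scaleC_scaleC mult_ac)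
  qed
 qed
qed

text \<open>On the circle of radius \<open>r\<close> the coefficient is \<open>r ^ weight a *\<^sub>C c a\<close>, by orthogonality; then let \<open>r\<close> tend
 to \<open>1\<close> in the mean.\<close>

theorem boundary_value_fourier:
 assumes conv: "AE w in haar. Cauchy (\<lambda>i. extension w (of_real (radius i)))" and a: "a \<in> Z_fin"
 shows "has_bochner_int haar (\<lambda>w. monomial (\<lambda>j. - a j) w *\<^sub>C boundary_value w) (c a)"
proof -
 let ?D = "\<lambda>i. \<integral>\<^sup>+w. ennreal (norm (boundary_value w - extension w (of_real (radius i)))) \<partial>haar"
 have "bochner_integrable haar (\<lambda>w. monomial (\<lambda>j. - a j) w *\<^sub>C boundary_value w)"
  by (rule haar.bochner_integrable_scaleC[OF boundary_value_integrable[OF conv], where B = 1])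
   (auto simp: space_haar norm_monomial)
 then obtain J where J: "has_bochner_int haar (\<lambda>w. monomial (\<lambda>j. - a j) w *\<^sub>C boundary_value w) J"
  unfolding bochner_integrable_def by blast
 have le: "ennreal (norm (J - of_real (radius i) ^ weight a *\<^sub>C c a)) \<le> ?D i" for i
 proof (rule ennreal_le_epsilon)
  fix e :: real assume e: "e > 0"
  have "\<forall>\<^sub>F N in sequentially. \<forall>w\<in>torus. dist (truncation N (of_real (radius i)) w) (extension w (of_real (radius i))) < e"
   by (rule uniform_limitD[OF truncation_uniform_limit[OF norm_radius_less] e])
  then have "\<forall>\<^sub>F N in sequentially. (\<forall>w\<in>torus. dist (truncation N (of_real (radius i)) w) (extension w (of_real (radius i))) < e) \<and> weight a < N"
   using eventually_gt_at_top by (rule eventually_conj)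
  then obtain N where N: "\<And>w. w \<in> torus \<Longrightarrow> dist (truncation N (of_real (radius i)) w) (extension w (of_real (radius i))) < e"
    "weight a < N" by (auto simp: eventually_sequentially)
  let ?T = "truncation N (of_real (radius i))"
  have "ennreal (norm (J - of_real (radius i) ^ weight a *\<^sub>C c a))
    \<le> (\<integral>\<^sup>+w. ennreal (norm (monomial (\<lambda>j. - a j) w *\<^sub>C boundary_value w - monomial (\<lambda>j. - a j) w *\<^sub>C ?T w)) \<partial>haar)"
   by (rule bochner_dist_le[OF J truncation_fourier_coefficient[OF a N(2)]])
  also have "\<dots> \<le> (\<integral>\<^sup>+w. ennreal (norm (boundary_value w - extension w (of_real (radius i)))) + ennreal e \<partial>haar)"
  proof (rule nn_integral_mono)
   fix w assume "w \<in> space haar"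
   then have w: "w \<in> torus" by (simp add: space_haar)
   have "norm (monomial (\<lambda>j. - a j) w *\<^sub>C boundary_value w - monomial (\<lambda>j. - a j) w *\<^sub>C ?T w) = norm (boundary_value w - ?T w)"
    unfolding scaleC_diff_right[symmetric] norm_scaleC by (simp add: norm_monomial[OF w])
   also have "\<dots> \<le> norm (boundary_value w - extension w (of_real (radius i))) + e"
    using N(1)[OF w] norm_triangle_ineq[of "boundary_value w - extension w (of_real (radius i))" "extension w (of_real (radius i)) - ?T w"]
    by (simp add: dist_norm norm_minus_commute)
   finally show "ennreal (norm (monomial (\<lambda>j. - a j) w *\<^sub>C boundary_value w - monomial (\<lambda>j. - a j) w *\<^sub>C ?T w))
     \<le> ennreal (norm (boundary_value w - extension w (of_real (radius i)))) + ennreal e"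
    using e by (simp add: ennreal_leI flip: ennreal_plus)
  qed
  also have "\<dots> = ?D i + ennreal e"
   using pointwise_measurable_norm_diff[OF boundary_value_strongly_measurable
     extension_strongly_measurable[OF norm_radius_less]]
   by (subst nn_integral_add) (auto simp: haar.emeasure_space_1)
  finally show "ennreal (norm (J - of_real (radius i) ^ weight a *\<^sub>C c a)) \<le> ?D i + ennreal e" .
 qed
 have "(\<lambda>i. ennreal (norm (J - of_real (radius i) ^ weight a *\<^sub>C c a))) \<longlonglongrightarrow> 0"
  by (rule tendsto_sandwich[OF _ _ tendsto_const extension_L1_tendsto[OF conv]]) (auto simp: le)
 moreover have "(\<lambda>i. ennreal (norm (J - of_real (radius i) ^ weight a *\<^sub>C c a))) \<longlonglongrightarrow> ennreal (norm (J - of_real 1 ^ weight a *\<^sub>C c a))"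
  by (intro tendsto_ennrealI tendsto_intros radius_tendsto)
 ultimately have "ennreal (norm (J - of_real 1 ^ weight a *\<^sub>C c a)) = 0" by (rule LIMSEQ_unique[symmetric])
 then have "J = c a" by (simp add: ennreal_eq_0_iff)
 then show ?thesis using J by simp
qed

end

section \<open>Vector measures with the same Fourier coefficients as a function\<close>

lemma urysohn_compact_open:
 fixes K U :: "'b::metric_space set"
 assumes K: "compact K" and U: "open U" and KU: "K \<subseteq> U"
 obtains \<phi> :: "'b \<Rightarrow> real" where "continuous_on UNIV \<phi>" "\<And>x. 0 \<le> \<phi> x \<and> \<phi> x \<le> 1"
  "\<And>x. x \<in> K \<Longrightarrow> \<phi> x = 1" "\<And>x. x \<notin> U \<Longrightarrow> \<phi> x = 0"
proof -
 have C: "closed (- U)" by (rule closed_Compl[OF U])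
 have Kc: "closed K" using K by (rule compact_imp_closed)
 consider "K = {}" | "U = UNIV" | "K \<noteq> {}" "- U \<noteq> {}" by blast
 then show thesis
 proof cases
  case 1
  then show thesis using that[of "\<lambda>_. 0"] by auto
 next
  case 2
  then show thesis using that[of "\<lambda>_. 1"] by auto
 next
  case 3
  define \<phi> where "\<phi> x = infdist x (- U) / (infdist x (- U) + infdist x K)" for x
  have pos: "0 < infdist x (- U) + infdist x K" for x
  proof -
   have "infdist x (- U) \<noteq> 0 \<or> infdist x K \<noteq> 0"
    using in_closed_iff_infdist_zero[OF C 3(2), of x] in_closed_iff_infdist_zero[OF Kc 3(1), of x] KU by blast
   then show ?thesis using infdist_nonneg[of x "- U"] infdist_nonneg[of x K] by linarith
  qed
  show thesis
  proof (rule that[of \<phi>])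
   show "continuous_on UNIV \<phi>"
    unfolding \<phi>_def by (intro continuous_intros) (use pos in \<open>auto simp: less_imp_neq[THEN not_sym]\<close>)
   show "0 \<le> \<phi> x \<and> \<phi> x \<le> 1" for x
    using pos[of x] infdist_nonneg[of x "- U"] infdist_nonneg[of x K] by (simp add: \<phi>_def)
   show "\<phi> x = 1" if "x \<in> K" for x using that pos[of x] by (simp add: \<phi>_def)
   show "\<phi> x = 0" if "x \<notin> U" for x using that by (simp add: \<phi>_def)
  qed
 qed
qed

lemma measurable_ident_haar_borel: "(\<lambda>w. w) \<in> haar \<rightarrow>\<^sub>M borel"
proof -
 have "(\<lambda>w. w) \<in> borel_torus \<rightarrow>\<^sub>M borel" by (rule measurable_restrict_space1) simp
 then show ?thesis by (simp add: measurable_cong_sets[OF sets_haar refl])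
qed

lemma closed_torus: "closed torus"
 using compact_torus by (rule compact_imp_closed)

lemma sets_borel_torus_iff: "A \<in> sets borel_torus \<longleftrightarrow> A \<in> sets borel \<and> A \<subseteq> torus"
 using closed_torus by (subst sets_restrict_space_iff) auto

text \<open>Finite Borel measures on the Polish space of all complex sequences are regular.\<close>

lemma density_regular:
 assumes h[measurable]: "h \<in> borel_measurable haar" and fin: "(\<integral>\<^sup>+w. h w \<partial>haar) < \<infinity>"
  and A: "A \<in> sets borel_torus" and e: "e > 0"
 obtains K U where "compact K" "open U" "K \<subseteq> A" "A \<subseteq> U" "(\<integral>\<^sup>+w. h w * indicator (U - K) w \<partial>haar) \<le> ennreal e"
proof -
 \<comment> \<open>Regularity is available for measures on a whole Polish space, not on the torus as a subspace.\<close>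
 define \<nu> where "\<nu> = distr (density haar h) borel (\<lambda>w. w)"
 have id: "(\<lambda>w. w) \<in> density haar h \<rightarrow>\<^sub>M borel"
  using measurable_ident_haar_borel by simp
 have \<nu>: "emeasure \<nu> B = (\<integral>\<^sup>+w. h w * indicator B w \<partial>haar)" if B: "B \<in> sets borel" for B
 proof -
  have Bt: "B \<inter> torus \<in> sets haar"
   using B closed_torus by (auto simp: sets_haar sets_borel_torus_iff)
  have "emeasure \<nu> B = emeasure (density haar h) (B \<inter> torus)"
   unfolding \<nu>_def using B id by (subst emeasure_distr) (auto simp: space_haar vimage_def Int_def conj_commute)
  also have "\<dots> = (\<integral>\<^sup>+w. h w * indicator (B \<inter> torus) w \<partial>haar)" by (rule emeasure_density[OF h Bt])
  also have "\<dots> = (\<integral>\<^sup>+w. h w * indicator B w \<partial>haar)"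
   by (rule nn_integral_cong) (auto simp: space_haar indicator_def)
  finally show ?thesis .
 qed
 have sets: "sets \<nu> = sets borel" by (simp add: \<nu>_def)
 have "emeasure \<nu> (space \<nu>) = (\<integral>\<^sup>+w. h w \<partial>haar)" using \<nu>[of UNIV] by (simp add: \<nu>_def)
 then have fm: "emeasure \<nu> (space \<nu>) \<noteq> \<infinity>" using fin by auto
 then interpret \<nu>: finite_measure \<nu> by (rule finite_measureI)
 have Ab: "A \<in> sets borel" using A by (simp add: sets_borel_torus_iff)
 have e2: "0 < e / 2" using e by simp
 have "\<exists>K\<in>{K. K \<subseteq> A \<and> compact K}. emeasure \<nu> A < emeasure \<nu> K + ennreal (e / 2)"
  by (rule SUP_approx_ennreal[OF e2 _ inner_regular[OF sets fm Ab]])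
   (auto simp: \<nu>.emeasure_eq_measure intro: exI[of _ "{}"])
 then obtain K where K: "K \<subseteq> A" "compact K" "emeasure \<nu> A < emeasure \<nu> K + ennreal (e / 2)" by blast
 have "\<exists>U\<in>{U. A \<subseteq> U \<and> open U}. emeasure \<nu> U < emeasure \<nu> A + ennreal (e / 2)"
  by (rule INF_approx_ennreal[OF e2 outer_regular[OF sets fm Ab]]) (auto simp: \<nu>.emeasure_eq_measure)
 then obtain U where U: "A \<subseteq> U" "open U" "emeasure \<nu> U < emeasure \<nu> A + ennreal (e / 2)" by blast
 have Kb: "K \<in> sets \<nu>" using K(2) sets by (simp add: borel_compact)
 have Ub: "U \<in> sets \<nu>" using U(2) sets by simp
 have "measure \<nu> U < measure \<nu> A + e / 2" "measure \<nu> A < measure \<nu> K + e / 2"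
  using K(3) U(3) e by (simp_all add: \<nu>.emeasure_eq_measure ennreal_less_iff flip: ennreal_plus)
 moreover have "measure \<nu> (U - K) = measure \<nu> U - measure \<nu> K"
  by (rule \<nu>.finite_measure_Diff[OF Ub Kb]) (use K U in auto)
 ultimately have "emeasure \<nu> (U - K) \<le> ennreal e" by (simp add: \<nu>.emeasure_eq_measure ennreal_leI)
 then have "(\<integral>\<^sup>+w. h w * indicator (U - K) w \<partial>haar) \<le> ennreal e"
  using Kb Ub sets by (subst \<nu>[symmetric]) auto
 then show thesis using that K U by blast
qed

text \<open>An Urysohn function between a compact and an open set that are close for the measure
 \<open>h\<close> times Haar measure, approximated uniformly by a trigonometric polynomial. The sets \<open>K'\<close>
 and \<open>U'\<close> leave room for a second measure for which the same function has to be suitable.\<close>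

lemma weighted_trig_approx:
 assumes h[measurable]: "h \<in> borel_measurable haar" and I: "(\<integral>\<^sup>+w. h w \<partial>haar) = ennreal I" "0 \<le> I"
  and A: "A \<in> sets borel_torus" and e: "e > 0"
  and 1: "compact K'" "open U'" "K' \<subseteq> A" "A \<subseteq> U'"
 obtains \<phi> t :: "point \<Rightarrow> real" where "continuous_on UNIV \<phi>" "\<And>x. 0 \<le> \<phi> x \<and> \<phi> x \<le> 1"
  "\<And>x. x \<in> K' \<Longrightarrow> \<phi> x = 1" "\<And>x. x \<notin> U' \<Longrightarrow> \<phi> x = 0"
  "trig (\<lambda>w. of_real (t w))" "continuous_on torus t" "\<And>w. w \<in> torus \<Longrightarrow> \<bar>\<phi> w - t w\<bar> < e"
  "(\<integral>\<^sup>+w. ennreal \<bar>indicat_real A w - t w\<bar> * h w \<partial>haar) \<le> ennreal (e * I + e)"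
proof -
 have "(\<integral>\<^sup>+w. h w \<partial>haar) < \<infinity>" by (simp add: I)
 from density_regular[OF h this A e]
 obtain K2 U2 where 2: "compact K2" "open U2" "K2 \<subseteq> A" "A \<subseteq> U2" "(\<integral>\<^sup>+w. h w * indicator (U2 - K2) w \<partial>haar) \<le> ennreal e"
  by blast
 have K: "compact (K' \<union> K2)" "K' \<union> K2 \<subseteq> A" and U: "open (U' \<inter> U2)" "A \<subseteq> U' \<inter> U2" using 1 2 by auto
 obtain \<phi> :: "point \<Rightarrow> real" where \<phi>: "continuous_on UNIV \<phi>" "\<And>x. 0 \<le> \<phi> x \<and> \<phi> x \<le> 1"
   "\<And>x. x \<in> K' \<union> K2 \<Longrightarrow> \<phi> x = 1" "\<And>x. x \<notin> U' \<inter> U2 \<Longrightarrow> \<phi> x = 0"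
  using urysohn_compact_open[OF K(1) U(1)] K(2) U(2) by blast
 have "continuous_on torus \<phi>" by (rule continuous_on_subset[OF \<phi>(1)]) simp
 from trig_dense[OF this e]
 obtain t where t: "trig (\<lambda>w. of_real (t w))" "continuous_on torus t" "\<And>w. w \<in> torus \<Longrightarrow> \<bar>\<phi> w - t w\<bar> < e" by metis
 have "(\<integral>\<^sup>+w. ennreal \<bar>indicat_real A w - t w\<bar> * h w \<partial>haar) \<le> (\<integral>\<^sup>+w. ennreal e * h w + h w * indicator (U2 - K2) w \<partial>haar)"
 proof (rule nn_integral_mono)
  fix w assume "w \<in> space haar"
  then have w: "w \<in> torus" by (simp add: space_haar)
  have "\<bar>\<phi> w - indicat_real A w\<bar> \<le> indicat_real (U2 - K2) w"
  proof (cases "w \<in> U2 - K2")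
   case True
   then show ?thesis using \<phi>(2)[of w] by (auto simp: indicator_def)
  next
   case False
   then have "w \<in> K' \<union> K2 \<or> w \<notin> U' \<inter> U2" by auto
   then show ?thesis using \<phi>(3,4)[of w] K(2) U(2) by (auto simp: indicator_def)
  qed
  then have "\<bar>indicat_real A w - t w\<bar> \<le> e + indicat_real (U2 - K2) w" using t(3)[OF w] by linarith
  then have "ennreal \<bar>indicat_real A w - t w\<bar> * h w \<le> ennreal (e + indicat_real (U2 - K2) w) * h w"
   by (intro mult_right_mono ennreal_leI) auto
  also have "\<dots> = ennreal e * h w + h w * indicator (U2 - K2) w"
   using e by (cases "w \<in> U2 - K2") (simp_all add: ennreal_plus distrib_right)
  finally show "ennreal \<bar>indicat_real A w - t w\<bar> * h w \<le> ennreal e * h w + h w * indicator (U2 - K2) w" .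
 qed
 also have "\<dots> = (\<integral>\<^sup>+w. ennreal e * h w \<partial>haar) + (\<integral>\<^sup>+w. h w * indicator (U2 - K2) w \<partial>haar)"
 proof (rule nn_integral_add)
  have "U2 - K2 \<in> sets borel" using 2 by (auto intro: borel_compact)
  then have "(indicator (U2 - K2) :: _ \<Rightarrow> ennreal) \<in> borel_measurable borel" by (rule borel_measurable_indicator)
  from measurable_compose[OF measurable_ident_haar_borel this]
  have [measurable]: "(indicator (U2 - K2) :: _ \<Rightarrow> ennreal) \<in> borel_measurable haar" .
  show "(\<lambda>w. h w * indicator (U2 - K2) w) \<in> borel_measurable haar" by measurable
 qed measurable
 also have "\<dots> \<le> ennreal e * ennreal I + ennreal e"
  using 2(5) I(1) by (intro add_mono) (simp_all add: nn_integral_cmult)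
 also have "\<dots> = ennreal (e * I + e)" using e I(2) by (simp add: ennreal_plus ennreal_mult)
 finally show thesis using \<phi>(3,4) by (intro that[OF \<phi>(1,2) _ _ t]) auto
qed

lemma trig_measurable_bounded:
 assumes "trig t"
 shows "t \<in> borel_measurable haar \<and> (\<exists>B. \<forall>w\<in>torus. cmod (t w) \<le> B)"
 using assms
proof (induction rule: trig.induct)
 case (trig_monomial a t c)
 have "t \<in> borel_measurable haar \<longleftrightarrow> (\<lambda>w. c * monomial a w) \<in> borel_measurable haar"
  by (rule measurable_cong) (simp add: space_haar trig_monomial)
 then show ?case
  using trig_monomial by (auto simp: norm_mult norm_monomial intro!: exI[of _ "cmod c"])
next
 case (trig_add s t u)
 then obtain B B' where B: "\<forall>w\<in>torus. cmod (s w) \<le> B" "\<forall>w\<in>torus. cmod (t w) \<le> B'" by blast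
 have "u \<in> borel_measurable haar \<longleftrightarrow> (\<lambda>w. s w + t w) \<in> borel_measurable haar"
  by (rule measurable_cong) (simp add: space_haar trig_add)
 moreover have "\<forall>w\<in>torus. cmod (u w) \<le> B + B'"
  using B trig_add(3) by (auto intro: norm_triangle_mono)
 ultimately show ?case using trig_add.IH by auto
qed

context
 fixes m :: "point set \<Rightarrow> 'a::complex_banach" and V f
 assumes m: "bounded_vector_measure borel_torus m V" and reg: "regular_vm borel_torus m"
  and f: "bochner_integrable haar f"
  and coeff: "\<And>a. a \<in> Z_fin \<Longrightarrow> has_bochner_int haar (\<lambda>w. monomial (\<lambda>j. - a j) w *\<^sub>C f w) (fourier_vm m a)"
begin

interpretation bounded_vector_measure borel_torus m V by (rule m)

lemma trig_integrals_agree: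
 assumes "trig t"
 shows "has_bochner_int haar (\<lambda>w. t w *\<^sub>C f w) (vm_int borel_torus m t)"
 using assms
proof (induction rule: trig.induct)
 case (trig_monomial a t c)
 have mono: "monomial a \<in> borel_measurable borel_torus"
  using borel_measurable_monomial measurable_cong_sets[OF sets_haar refl] by blast
 have "vm_int borel_torus m t = vm_int borel_torus m (\<lambda>w. c * monomial a w)"
  by (rule vm_int_cong) (simp add: space_restrict_space trig_monomial)
 also have "\<dots> = c *\<^sub>C vm_int borel_torus m (monomial a)"
  by (rule vm_int_scale[OF mono, where B = 1]) (simp add: space_restrict_space norm_monomial)
 finally have v: "vm_int borel_torus m t = c *\<^sub>C fourier_vm m (\<lambda>j. - a j)" by (simp add: fourier_vm_def)
 show ?case
  unfolding v
  by (rule has_bochner_int_cong[OF _ has_bochner_int_scaleC_left[OF coeff[OF Z_fin_uminus[OF trig_monomial(1)]]]])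
   (simp add: space_haar trig_monomial scaleC_scaleC)
next
 case (trig_add s t u)
 obtain B B' where B: "\<And>w. w \<in> torus \<Longrightarrow> cmod (s w) \<le> B" "\<And>w. w \<in> torus \<Longrightarrow> cmod (t w) \<le> B'"
  using trig_measurable_bounded[OF trig_add(1)] trig_measurable_bounded[OF trig_add(2)] by blast
 have meas: "s \<in> borel_measurable borel_torus" "t \<in> borel_measurable borel_torus"
  using trig_measurable_bounded[OF trig_add(1)] trig_measurable_bounded[OF trig_add(2)]
   measurable_cong_sets[OF sets_haar refl] by blast+
 have "vm_int borel_torus m u = vm_int borel_torus m (\<lambda>w. s w + t w)"
  by (rule vm_int_cong) (simp add: space_restrict_space trig_add)
 also have "\<dots> = vm_int borel_torus m s + vm_int borel_torus m t"
  by (rule vm_int_add[OF meas(1) _ meas(2)]) (use B in \<open>auto simp: space_restrict_space\<close>)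
 finally have v: "vm_int borel_torus m u = vm_int borel_torus m s + vm_int borel_torus m t" .
 show ?case
  unfolding v
  by (rule has_bochner_int_cong[OF _ has_bochner_int_add[OF trig_add.IH]])
   (simp add: space_haar trig_add scaleC_add_left)
qed

text \<open>The layer cake formula turns smallness of \<open>m\<close> on the subsets of \<open>U - K\<close> into smallness of
 the difference between \<open>m A\<close> and the integral of a function between the indicators of
 \<open>K\<close> and \<open>U\<close>.\<close>

lemma vm_int_near_indicator:
 assumes A: "A \<in> sets borel_torus" and K: "K \<subseteq> A" and U: "A \<subseteq> U"
  and small: "\<And>B. B \<in> sets borel_torus \<Longrightarrow> B \<subseteq> U - K \<Longrightarrow> norm (m B) < e"
  and \<phi>: "continuous_on UNIV \<phi>" "\<And>x. 0 \<le> \<phi> x \<and> \<phi> x \<le> (1::real)" "\<And>x. x \<in> K \<Longrightarrow> \<phi> x = 1" "\<And>x. x \<notin> U \<Longrightarrow> \<phi> x = 0"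
 shows "norm (vm_int borel_torus m (\<lambda>w. of_real (\<phi> w)) - m A) \<le> 2 * e"
proof -
 have sp: "space borel_torus = torus" by (simp add: space_restrict_space)
 have \<phi>m: "\<phi> \<in> borel_measurable borel_torus"
  by (rule measurable_restrict_space1) (rule borel_measurable_continuous_onI[OF \<phi>(1)])
 have le: "norm (vm_int borel_torus m (\<lambda>w. of_real (\<phi> w)) - m A) \<le> 1 / real N * V + 2 * e" if N: "N > 0" for N :: nat
 proof -
  \<comment> \<open>The superlevel sets of \<open>\<phi>\<close>; each of them differs from \<open>A\<close> by subsets of \<open>U - K\<close>.\<close>
  define E where "E i = {w \<in> space borel_torus. real i / real N < \<phi> w}" for i
  have E: "E i \<in> sets borel_torus" for i unfolding E_def using \<phi>m by measurable
  have mE: "norm (m (E i) - m A) \<le> 2 * e" if i: "i < N" for i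
  proof -
   have KE: "x \<in> E i" if "x \<in> K" for x
    using that i N K sets.sets_into_space[OF A] by (auto simp: E_def \<phi>(3))
   have EU: "E i \<subseteq> U"
   proof
    fix x assume "x \<in> E i"
    then have "real i / real N < \<phi> x" by (simp add: E_def)
    moreover have "0 \<le> real i / real N" by simp
    ultimately have "\<phi> x \<noteq> 0" by linarith
    then show "x \<in> U" using \<phi>(4) by blast
   qed
   have "m ((E i \<inter> A) \<union> (E i - A)) = m (E i \<inter> A) + m (E i - A)" using E A by (intro additive) auto
   moreover have "(E i \<inter> A) \<union> (E i - A) = E i" by auto
   moreover have "m ((E i \<inter> A) \<union> (A - E i)) = m (E i \<inter> A) + m (A - E i)" using E A by (intro additive) auto
   moreover have "(E i \<inter> A) \<union> (A - E i) = A" by auto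
   ultimately have "m (E i) - m A = m (E i - A) - m (A - E i)" by simp
   moreover have "norm (m (E i - A)) < e" using E A K EU by (intro small) auto
   moreover have "norm (m (A - E i)) < e" using E A U KE by (intro small) auto
   ultimately show ?thesis using norm_triangle_ineq4[of "m (E i - A)" "m (A - E i)"] by simp
  qed
  define s where "s = (\<lambda>w. \<Sum>i<N. complex_of_real (1 / real N) * indicator (E i) w)"
  have s: "simple_function borel_torus s"
   unfolding s_def
   by (intro simple_function_sum simple_function_compose1[OF simple_function_indicator[OF E]])
  have "vm_int borel_torus m s = (\<Sum>i<N. complex_of_real (1 / real N) *\<^sub>C m (E i))"
  proof -
   have "vm_int borel_torus m s = (\<Sum>i<N. vm_int borel_torus m (\<lambda>w. complex_of_real (1 / real N) * indicator (E i) w))"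
    unfolding s_def using E by (intro vm_int_sum[where B = "1 / real N"]) (auto simp: norm_mult norm_divide indicator_def)
   also have "\<dots> = (\<Sum>i<N. complex_of_real (1 / real N) *\<^sub>C vm_int borel_torus m (indicator (E i)))"
    using E by (intro sum.cong refl vm_int_scale[where B = 1]) (auto simp: indicator_def)
   finally show ?thesis using E by (simp add: vm_int_indicator)
  qed
  then have sE: "simple_vm_int borel_torus m s = (\<Sum>i<N. complex_of_real (1 / real N) *\<^sub>C m (E i))"
   by (simp add: vm_int_simple[OF s])
  have "norm (vm_int borel_torus m (\<lambda>w. of_real (\<phi> w)) - simple_vm_int borel_torus m s) \<le> 1 / real N * V"
  proof (rule vm_int_approx[where B = 1])
   show "(\<lambda>w. complex_of_real (\<phi> w)) \<in> borel_measurable borel_torus" using \<phi>m by measurable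
   show "cmod (of_real (\<phi> x)) \<le> 1" for x using \<phi>(2)[of x] by simp
   fix w assume w: "w \<in> space borel_torus"
   define k where "k = nat \<lceil>real N * \<phi> w\<rceil>"
   have nn: "0 \<le> real N * \<phi> w" using \<phi>(2)[of w] by simp
   have le: "real N * \<phi> w \<le> real N" using \<phi>(2)[of w] N by simp
   have k: "real N * \<phi> w \<le> real k" "real k < real N * \<phi> w + 1" "k \<le> N"
    using nn le unfolding k_def by linarith+
   have iff: "w \<in> E i \<longleftrightarrow> i < k" for i
   proof -
    have "w \<in> E i \<longleftrightarrow> real i < real N * \<phi> w" using w N by (simp add: E_def field_simps)
    also have "\<dots> \<longleftrightarrow> i < k" unfolding k_def by linarith
    finally show ?thesis .
   qed
   have "s w = (\<Sum>i<N. if i < k then complex_of_real (1 / real N) else 0)"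
    unfolding s_def by (rule sum.cong) (auto simp: indicator_def iff)
   also have "\<dots> = (\<Sum>i<k. complex_of_real (1 / real N))"
    using k(3) by (intro sum.mono_neutral_cong_right) auto
   also have "\<dots> = complex_of_real (real k / real N)" by simp
   finally have "of_real (\<phi> w) - s w = complex_of_real (\<phi> w - real k / real N)" by (simp only: of_real_diff)
   then have "cmod (of_real (\<phi> w) - s w) = \<bar>\<phi> w - real k / real N\<bar>" by (simp only: norm_of_real)
   also have "\<dots> \<le> 1 / real N"
   proof -
    have "\<phi> w - real k / real N = (real N * \<phi> w - real k) / real N" using N by (simp add: field_simps)
    moreover have "\<bar>real N * \<phi> w - real k\<bar> \<le> 1" using k by linarith
    ultimately show ?thesis using N by (simp add: divide_right_mono)
   qed
   finally show "cmod (of_real (\<phi> w) - s w) \<le> 1 / real N" .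
  qed (use s in auto)
  moreover have "norm (simple_vm_int borel_torus m s - m A) \<le> 2 * e"
  proof -
   have "(\<Sum>i<N. complex_of_real (1 / real N)) = 1" using N by simp
   then have "m A = (\<Sum>i<N. complex_of_real (1 / real N) *\<^sub>C m A)" by (simp flip: scaleC_sum_left)
   then have "norm (simple_vm_int borel_torus m s - m A) = norm (\<Sum>i<N. complex_of_real (1 / real N) *\<^sub>C (m (E i) - m A))"
    by (simp add: sE scaleC_diff_right sum_subtractf)
   also have "\<dots> \<le> (\<Sum>i<N. 1 / real N * (2 * e))"
    using mE by (intro order_trans[OF norm_sum] sum_mono) (auto simp: norm_scaleC norm_divide intro!: divide_right_mono)
   also have "\<dots> = 2 * e" using N by simp
   finally show ?thesis .
  qed
  ultimately show ?thesis
   using norm_triangle_ineq[of "vm_int borel_torus m (\<lambda>w. of_real (\<phi> w)) - simple_vm_int borel_torus m s" "simple_vm_int borel_torus m s - m A"]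
   by simp
 qed
 have "(\<lambda>N. 1 / real N * V + 2 * e) \<longlonglongrightarrow> 0 * V + 2 * e" by (intro tendsto_intros lim_1_over_n)
 then have "norm (vm_int borel_torus m (\<lambda>w. of_real (\<phi> w)) - m A) \<le> 0 * V + 2 * e"
  by (rule LIMSEQ_le_const) (use le in \<open>auto intro!: exI[of _ 1]\<close>)
 then show ?thesis by simp
qed

text \<open>The indicator of \<open>A\<close> is approximated by a trigonometric polynomial that is suitable both for
 \<open>m\<close> and for the density; on the polynomial the two integrals agree.\<close>

theorem measure_eq_set_bochner_int:
 assumes A: "A \<in> sets borel_torus"
 shows "m A = set_bochner_int haar A f"
proof -
 have Ah: "A \<in> sets haar" using A by (simp add: sets_haar)
 have fm: "strongly_measurable haar f" using f unfolding bochner_integrable_def has_bochner_int_def by blast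
 obtain f' where f': "pointwise_measurable haar f'" "AE w in haar. f w = f' w"
  using strongly_measurable_version[OF fm] .
 have nm[measurable]: "(\<lambda>w. norm (f' w)) \<in> borel_measurable haar"
  by (rule pointwise_measurable_norm[OF f'(1)])
 define h where "h w = ennreal (norm (f' w))" for w
 have h[measurable]: "h \<in> borel_measurable haar" unfolding h_def by measurable
 have hfin: "(\<integral>\<^sup>+w. h w \<partial>haar) < \<infinity>"
 proof -
  have "(\<integral>\<^sup>+w. h w \<partial>haar) = (\<integral>\<^sup>+w. ennreal (norm (f w)) \<partial>haar)"
   unfolding h_def by (rule nn_integral_cong_AE) (use f'(2) in eventually_elim, simp)
  then show ?thesis using f unfolding haar.bochner_integrable_iff by simp
 qed
 define I where "I = enn2real (\<integral>\<^sup>+w. h w \<partial>haar)"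
 have I: "(\<integral>\<^sup>+w. h w \<partial>haar) = ennreal I" "0 \<le> I" using hfin by (auto simp: I_def)
 note bA = set_bochner_intI[OF f Ah]
 have le: "norm (m A - set_bochner_int haar A f) \<le> e * (V + 3 + I)" if e: "e > 0" for e
 proof -
  have "\<exists>K U. compact K \<and> open U \<and> K \<subseteq> A \<and> A \<subseteq> U \<and> (\<forall>B\<in>sets borel_torus. B \<subseteq> U - K \<longrightarrow> norm (m B) < e)"
   by (rule reg[unfolded regular_vm_def, rule_format, OF A e])
  then obtain K1 U1 where K1: "compact K1 \<and> open U1 \<and> K1 \<subseteq> A \<and> A \<subseteq> U1 \<and> (\<forall>B\<in>sets borel_torus. B \<subseteq> U1 - K1 \<longrightarrow> norm (m B) < e)"
   by (elim exE)
  then have 1: "compact K1" "open U1" "K1 \<subseteq> A" "A \<subseteq> U1"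
    "\<And>B. B \<in> sets borel_torus \<Longrightarrow> B \<subseteq> U1 - K1 \<Longrightarrow> norm (m B) < e" by simp_all
  obtain \<phi> t :: "point \<Rightarrow> real" where \<phi>: "continuous_on UNIV \<phi>" "\<And>x. 0 \<le> \<phi> x \<and> \<phi> x \<le> 1"
    "\<And>x. x \<in> K1 \<Longrightarrow> \<phi> x = 1" "\<And>x. x \<notin> U1 \<Longrightarrow> \<phi> x = 0"
   and t: "trig (\<lambda>w. of_real (t w))" "continuous_on torus t" "\<And>w. w \<in> torus \<Longrightarrow> \<bar>\<phi> w - t w\<bar> < e"
   and close: "(\<integral>\<^sup>+w. ennreal \<bar>indicat_real A w - t w\<bar> * h w \<partial>haar) \<le> ennreal (e * I + e)"
  proof (rule weighted_trig_approx[OF h I A e 1(1-4)])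
   fix \<phi> t :: "point \<Rightarrow> real"
   assume "continuous_on UNIV \<phi>" "\<And>x. 0 \<le> \<phi> x \<and> \<phi> x \<le> 1" "\<And>x. x \<in> K1 \<Longrightarrow> \<phi> x = 1" "\<And>x. x \<notin> U1 \<Longrightarrow> \<phi> x = 0"
    "trig (\<lambda>w. of_real (t w))" "continuous_on torus t" "\<And>w. w \<in> torus \<Longrightarrow> \<bar>\<phi> w - t w\<bar> < e"
    "(\<integral>\<^sup>+w. ennreal \<bar>indicat_real A w - t w\<bar> * h w \<partial>haar) \<le> ennreal (e * I + e)"
   then show thesis by (rule that)
  qed
  have a1: "norm (vm_int borel_torus m (\<lambda>w. of_real (\<phi> w)) - m A) \<le> 2 * e"
   by (rule vm_int_near_indicator[OF A 1(3,4) 1(5) \<phi>])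
  have \<phi>T: "continuous_on torus \<phi>" by (rule continuous_on_subset[OF \<phi>(1)]) simp
  let ?t = "\<lambda>w. complex_of_real (t w)" and ?\<phi> = "\<lambda>w. complex_of_real (\<phi> w)"
  have tm: "?t \<in> borel_measurable borel_torus" "?\<phi> \<in> borel_measurable borel_torus"
   using borel_measurable_haar[OF t(2)] borel_measurable_haar[OF \<phi>T]
   unfolding measurable_cong_sets[OF sets_haar refl] by (auto intro: measurable_compose)
  have diff: "norm (vm_int borel_torus m (\<lambda>w. ?t w - ?\<phi> w)) \<le> e * V"
  proof (rule vm_int_norm_le)
   fix w assume "w \<in> space borel_torus"
   then have "\<bar>\<phi> w - t w\<bar> < e" by (intro t(3)) (simp add: space_restrict_space)
   then show "cmod (?t w - ?\<phi> w) \<le> e" by (simp flip: of_real_diff)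
  qed (use tm e in auto)
  have "vm_int borel_torus m ?t = vm_int borel_torus m (\<lambda>w. ?\<phi> w + (?t w - ?\<phi> w))" by simp
  also have "\<dots> = vm_int borel_torus m ?\<phi> + vm_int borel_torus m (\<lambda>w. ?t w - ?\<phi> w)"
  proof (rule vm_int_add[where B = 1 and B' = e])
   fix w assume "w \<in> space borel_torus"
   then have "\<bar>\<phi> w - t w\<bar> < e" by (intro t(3)) (simp add: space_restrict_space)
   then show "cmod (?t w - ?\<phi> w) \<le> e" by (simp flip: of_real_diff)
  qed (use tm \<phi>(2) in auto)
  finally have a2: "norm (vm_int borel_torus m ?t - vm_int borel_torus m ?\<phi>) \<le> e * V" using diff by simp
  have "ennreal (norm (vm_int borel_torus m ?t - set_bochner_int haar A f))
    \<le> (\<integral>\<^sup>+w. ennreal (norm (?t w *\<^sub>C f w - indicat_real A w *\<^sub>R f w)) \<partial>haar)"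
   by (rule bochner_dist_le[OF trig_integrals_agree[OF t(1)] bA])
  also have "\<dots> = (\<integral>\<^sup>+w. ennreal \<bar>indicat_real A w - t w\<bar> * h w \<partial>haar)"
  proof (rule nn_integral_cong_AE)
   have norm: "norm (?t w *\<^sub>C x - indicat_real A w *\<^sub>R x) = \<bar>indicat_real A w - t w\<bar> * norm x" for w and x :: 'a
    by (simp add: scaleR_diff_left[symmetric] scaleC_of_real abs_minus_commute del: scaleR_diff_left)
   show "AE w in haar. ennreal (norm (?t w *\<^sub>C f w - indicat_real A w *\<^sub>R f w)) = ennreal \<bar>indicat_real A w - t w\<bar> * h w"
    using f'(2) by eventually_elim (simp add: norm h_def ennreal_mult)
  qed
  also note close
  finally have a3: "norm (vm_int borel_torus m ?t - set_bochner_int haar A f) \<le> e * I + e"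
   by (subst (asm) ennreal_le_iff) (use e I(2) in auto)
  have "m A - set_bochner_int haar A f = - (vm_int borel_torus m ?\<phi> - m A) - (vm_int borel_torus m ?t - vm_int borel_torus m ?\<phi>)
    + (vm_int borel_torus m ?t - set_bochner_int haar A f)" by simp
  also have "norm \<dots> \<le> 2 * e + e * V + (e * I + e)"
   using norm_triangle_ineq[of "- (vm_int borel_torus m ?\<phi> - m A) - (vm_int borel_torus m ?t - vm_int borel_torus m ?\<phi>)"
     "vm_int borel_torus m ?t - set_bochner_int haar A f"]
    norm_triangle_ineq4[of "- (vm_int borel_torus m ?\<phi> - m A)" "vm_int borel_torus m ?t - vm_int borel_torus m ?\<phi>"]
    norm_minus_cancel[of "vm_int borel_torus m ?\<phi> - m A"] a1 a2 a3 by linarith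
  finally show ?thesis by (simp add: algebra_simps)
 qed
 have "((\<lambda>e. e * (V + 3 + I)) \<longlongrightarrow> 0 * (V + 3 + I)) (at_right 0)" by (intro tendsto_intros)
 then have "norm (m A - set_bochner_int haar A f) \<le> 0 * (V + 3 + I)"
  by (rule tendsto_lowerbound[OF _ _ trivial_limit_at_right_real])
   (auto simp: eventually_at_right_field intro!: exI[of _ 1] le)
 then show ?thesis by simp
qed

end


section \<open>The property implies densities\<close>

text \<open>A finite disjoint family is completed to a partition by the complement of its union.\<close>

lemma M_torus_bounded_vector_measure:
 assumes "m \<in> M_torus"
 obtains V where "bounded_vector_measure borel_torus m V"
proof -
 have ca: "\<And>A. range A \<subseteq> sets borel_torus \<Longrightarrow> disjoint_family A \<Longrightarrow> (\<lambda>n. m (A n)) sums m (\<Union>n. A n)"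
  using assms unfolding M_torus_def countably_additive_vm_def by blast
 obtain V where V: "\<And>P. finite P \<Longrightarrow> partition_on (space borel_torus) P \<Longrightarrow> P \<subseteq> sets borel_torus \<Longrightarrow> (\<Sum>A\<in>P. norm (m A)) \<le> V"
  using assms unfolding M_torus_def bounded_variation_vm_def bdd_above_def by blast
 have "(\<lambda>n::nat. m {}) sums m (\<Union>n::nat. {})" by (rule ca) (auto simp: disjoint_family_on_def)
 then have "(\<lambda>n::nat. m {}) \<longlonglongrightarrow> 0" by (intro summable_LIMSEQ_zero sums_summable)
 then have empty: "m {} = 0" by (simp add: LIMSEQ_const_iff)
 have add: "m (A \<union> B) = m A + m B" if AB: "A \<in> sets borel_torus" "B \<in> sets borel_torus" "A \<inter> B = {}" for A B
 proof -
  have "(\<lambda>n. m (binaryset A B n)) sums m (\<Union>n. binaryset A B n)"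
   by (rule ca) (use AB in \<open>auto simp: range_binaryset_eq binaryset_def disjoint_family_on_def\<close>)
  moreover have "(\<lambda>n. m (binaryset A B n)) sums (m A + m B)"
   by (rule binaryset_sums[of m A B]) (rule empty)
  ultimately show ?thesis using sums_unique2 UN_binaryset_eq by metis
 qed
 have var: "(\<Sum>A\<in>P. norm (m A)) \<le> V" if P: "finite P" "P \<subseteq> sets borel_torus" "disjoint P" for P
 proof -
  define R where "R = space borel_torus - \<Union>P"
  define Q where "Q = insert R P - {{}}"
  have R: "R \<in> sets borel_torus" unfolding R_def using P by (intro sets.Diff sets.top sets.finite_Union) auto
  have "partition_on (space borel_torus) Q"
  proof (rule partition_onI)
   have "\<Union>P \<subseteq> space borel_torus"
   proof (rule Union_least)
    fix p assume "p \<in> P"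
    then show "p \<subseteq> space borel_torus" using P(2) by (intro sets.sets_into_space) (rule subsetD)
   qed
   moreover have "\<Union>Q = R \<union> \<Union>P" unfolding Q_def by blast
   ultimately show "\<Union>Q = space borel_torus" unfolding R_def by blast
   show "disjnt p q" if "p \<in> Q" "q \<in> Q" "p \<noteq> q" for p q
   proof -
    have R_disj: "disjnt R p" if "p \<in> P" for p using that unfolding R_def disjnt_def by blast
    from that have "p = R \<or> p \<in> P" "q = R \<or> q \<in> P" unfolding Q_def by blast+
    then show ?thesis
     using R_disj[of p] R_disj[of q] disjointD[OF P(3), of p q] \<open>p \<noteq> q\<close> by (auto simp: disjnt_sym disjnt_def)
   qed
  qed (auto simp: Q_def)
  then have "(\<Sum>A\<in>Q. norm (m A)) \<le> V" using P R by (intro V) (auto simp: Q_def)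
  moreover have "(\<Sum>A\<in>P. norm (m A)) = (\<Sum>A\<in>P - {{}}. norm (m A))"
   using P(1) by (intro sum.mono_neutral_right) (auto simp: empty)
  moreover have "(\<Sum>A\<in>P - {{}}. norm (m A)) \<le> (\<Sum>A\<in>Q. norm (m A))"
   using P(1) by (intro sum_mono2) (auto simp: Q_def)
  ultimately show ?thesis by simp
 qed
 show thesis by (rule that[of V]) (unfold_locales, use add var in auto)
qed

text \<open>The density is the boundary value of the extension.\<close>

theorem ARNP_imp_density:
 fixes m :: "point set \<Rightarrow> 'a::complex_banach"
 assumes X: "ARNP TYPE('a)" and m: "m \<in> M_plus_torus"
 shows "\<exists>f\<in>H1. \<forall>A\<in>sets borel_torus. m A = set_bochner_int haar A f"
proof -
 have mT: "m \<in> M_torus" and an: "\<And>a. a \<in> Z_fin - N0_fin \<Longrightarrow> fourier_vm m a = 0"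
  using m by (auto simp: M_plus_torus_def)
 obtain V where V: "bounded_vector_measure borel_torus m V" using M_torus_bounded_vector_measure[OF mT] .
 have reg: "regular_vm borel_torus m" using mT by (simp add: M_torus_def)
 interpret analytic_measure m V
  by (intro analytic_measure.intro V analytic_measure_axioms.intro an)
 note conv = ARNP_extension_converges[OF X]
 have fv: "has_bochner_int haar (\<lambda>w. monomial (\<lambda>j. - a j) w *\<^sub>C boundary_value w) (fourier_vm m a)"
  if "a \<in> Z_fin" for a
  by (rule boundary_value_fourier[OF conv that])
 have "boundary_value \<in> H1"
  unfolding H1_def fourier_fun_def
  by (simp add: boundary_value_integrable[OF conv] bochner_int_eq[OF fv] an)
 moreover have "m A = set_bochner_int haar A boundary_value" if "A \<in> sets borel_torus" for A
  by (rule measure_eq_set_bochner_int[OF V reg boundary_value_integrable[OF conv] fv that])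
 ultimately show ?thesis by (intro bexI[of _ boundary_value] ballI)
qed

section \<open>Vector measures with bounded density with respect to Haar measure\<close>

definition bdd_measurable :: "(point \<Rightarrow> complex) \<Rightarrow> bool" where
 "bdd_measurable \<phi> \<longleftrightarrow> \<phi> \<in> borel_measurable haar \<and> (\<exists>B. \<forall>w\<in>torus. cmod (\<phi> w) \<le> B)"

lemma bdd_measurable_integrable: "bdd_measurable \<phi> \<Longrightarrow> integrable haar \<phi>"
 unfolding bdd_measurable_def by (elim conjE exE) (rule integrable_haar_bounded, auto)

lemma bdd_measurable_trig: "trig t \<Longrightarrow> bdd_measurable t"
 unfolding bdd_measurable_def by (rule trig_measurable_bounded)

lemma bdd_measurable_monomial: "bdd_measurable (monomial a)"
 unfolding bdd_measurable_def using norm_monomial by (intro conjI exI[of _ 1]) auto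

lemma bdd_measurable_add:
 assumes "bdd_measurable \<phi>" "bdd_measurable \<psi>"
 shows "bdd_measurable (\<lambda>w. \<phi> w + \<psi> w)"
proof -
 obtain B where "\<forall>w\<in>torus. cmod (\<phi> w) \<le> B" using assms(1) by (auto simp: bdd_measurable_def)
 moreover obtain C where "\<forall>w\<in>torus. cmod (\<psi> w) \<le> C" using assms(2) by (auto simp: bdd_measurable_def)
 ultimately have "\<forall>w\<in>torus. cmod (\<phi> w + \<psi> w) \<le> B + C" by (auto intro: norm_triangle_mono)
 then show ?thesis using assms by (auto simp: bdd_measurable_def)
qed

lemma bdd_measurable_mult:
 assumes "bdd_measurable \<phi>" "bdd_measurable \<psi>"
 shows "bdd_measurable (\<lambda>w. \<phi> w * \<psi> w)"
proof -
 obtain B where B: "\<And>w. w \<in> torus \<Longrightarrow> cmod (\<phi> w) \<le> B" using assms(1) by (auto simp: bdd_measurable_def)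
 obtain C where C: "\<And>w. w \<in> torus \<Longrightarrow> cmod (\<psi> w) \<le> C" using assms(2) by (auto simp: bdd_measurable_def)
 have "cmod (\<phi> w * \<psi> w) \<le> B * C" if "w \<in> torus" for w
  unfolding norm_mult using B[OF that] C[OF that] order_trans[OF norm_ge_zero B[OF that]] by (intro mult_mono) auto
 then show ?thesis using assms by (auto simp: bdd_measurable_def)
qed

lemma bdd_measurable_const: "bdd_measurable (\<lambda>_. c)"
 unfolding bdd_measurable_def by auto

lemma bdd_measurable_scale: "bdd_measurable \<phi> \<Longrightarrow> bdd_measurable (\<lambda>w. c * \<phi> w)"
 by (rule bdd_measurable_mult[OF bdd_measurable_const])

lemma bdd_measurable_diff:
 "bdd_measurable \<phi> \<Longrightarrow> bdd_measurable \<psi> \<Longrightarrow> bdd_measurable (\<lambda>w. \<phi> w - \<psi> w)"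
 using bdd_measurable_add[of \<phi> "\<lambda>w. (-1) * \<psi> w"] bdd_measurable_scale[of \<psi> "-1"] by simp

lemma bdd_measurable_sum:
 "(\<And>i. i \<in> I \<Longrightarrow> bdd_measurable (\<phi> i)) \<Longrightarrow> bdd_measurable (\<lambda>w. \<Sum>i\<in>I. \<phi> i w)"
 by (induction I rule: infinite_finite_induct) (auto intro: bdd_measurable_const bdd_measurable_add)

lemma bdd_measurable_indicator:
 assumes "A \<in> sets borel_torus"
 shows "bdd_measurable (indicator A)"
proof -
 have "A \<in> sets haar" using assms by (simp add: sets_haar)
 then show ?thesis unfolding bdd_measurable_def by (intro conjI exI[of _ 1]) (auto simp: indicator_def)
qed

lemma bdd_measurable_simple:
 assumes "simple_function borel_torus s"
 shows "bdd_measurable s"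
proof -
 have "bounded (s ` torus)"
  using simple_functionD(1)[OF assms] by (intro finite_imp_bounded) (simp add: space_restrict_space)
 moreover have "s \<in> borel_measurable haar"
  unfolding measurable_cong_sets[OF sets_haar refl] by (rule borel_measurable_simple_function[OF assms])
 ultimately show ?thesis by (auto simp: bdd_measurable_def bounded_iff)
qed

lemma bdd_measurable_norm_integrable:
 "bdd_measurable \<phi> \<Longrightarrow> integrable haar (\<lambda>w. cmod (\<phi> w))"
 by (rule integrable_norm[OF bdd_measurable_integrable])

lemma norm_integral_monomial_le:
 assumes \<phi>: "bdd_measurable \<phi>"
 shows "cmod (\<integral>w. \<phi> w * monomial a w \<partial>haar) \<le> (\<integral>w. cmod (\<phi> w) \<partial>haar)"
proof -
 have "cmod (\<integral>w. \<phi> w * monomial a w \<partial>haar) \<le> (\<integral>w. cmod (\<phi> w * monomial a w) \<partial>haar)"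
  by (rule integral_norm_bound)
 also have "\<dots> = (\<integral>w. cmod (\<phi> w) \<partial>haar)"
  by (rule Bochner_Integration.integral_cong) (simp_all add: norm_mult norm_monomial space_haar)
 finally show ?thesis .
qed

lemma integral_monomial_mult:
 assumes "a \<in> Z_fin" "b \<in> Z_fin"
 shows "(\<integral>w. monomial (\<lambda>j. - a j) w * monomial b w \<partial>haar) = (if b = a then 1 else 0)"
proof -
 note a = Z_fin_uminus[OF assms(1)]
 have "(\<integral>w. monomial (\<lambda>j. - a j) w * monomial b w \<partial>haar) = integral\<^sup>L haar (monomial (\<lambda>j. - a j + b j))"
  by (rule Bochner_Integration.integral_cong[OF refl]) (simp only: space_haar monomial_add[OF a assms(2)])
 also have "\<dots> = (if (\<lambda>j. - a j + b j) = (\<lambda>_. 0) then 1 else 0)"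
  by (rule integral_monomial[OF Z_fin_add[OF a assms(2)]])
 also have "(\<lambda>j. - a j + b j) = (\<lambda>_. 0) \<longleftrightarrow> b = a" by (auto simp: fun_eq_iff)
 finally show ?thesis .
qed

text \<open>A functional that is bounded for the norm of \<open>L\<^sup>1\<close> represents a vector measure dominated by \<open>K\<close> times
 Haar measure. Working with the functional avoids limits of set functions.\<close>

locale L1_functional =
 fixes \<Lambda> :: "(point \<Rightarrow> complex) \<Rightarrow> 'a::complex_banach" and K :: real
 assumes add: "bdd_measurable \<phi> \<Longrightarrow> bdd_measurable \<psi> \<Longrightarrow> \<Lambda> (\<lambda>w. \<phi> w + \<psi> w) = \<Lambda> \<phi> + \<Lambda> \<psi>"
  and scale: "bdd_measurable \<phi> \<Longrightarrow> \<Lambda> (\<lambda>w. c * \<phi> w) = c *\<^sub>C \<Lambda> \<phi>"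
  and bound: "bdd_measurable \<phi> \<Longrightarrow> norm (\<Lambda> \<phi>) \<le> K * (\<integral>w. cmod (\<phi> w) \<partial>haar)"
begin

lemma K_nonneg: "0 \<le> K"
 using order_trans[OF norm_ge_zero bound[OF bdd_measurable_const[of 1]]] by (simp add: haar.prob_space)

lemma diff: "bdd_measurable \<phi> \<Longrightarrow> bdd_measurable \<psi> \<Longrightarrow> \<Lambda> (\<lambda>w. \<phi> w - \<psi> w) = \<Lambda> \<phi> - \<Lambda> \<psi>"
 using add[of \<phi> "\<lambda>w. (-1) * \<psi> w"] scale[of \<psi> "-1"] bdd_measurable_scale[of \<psi> "-1"]
 by (simp add: scaleC_minus_one)

lemma dist_le:
 "bdd_measurable \<phi> \<Longrightarrow> bdd_measurable \<psi> \<Longrightarrow>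
  norm (\<Lambda> \<phi> - \<Lambda> \<psi>) \<le> K * (\<integral>w. cmod (\<phi> w - \<psi> w) \<partial>haar)"
 using bound[OF bdd_measurable_diff] diff by metis

lemma uniform_dist_le:
 assumes "bdd_measurable \<phi>" "bdd_measurable \<psi>" "\<And>w. w \<in> torus \<Longrightarrow> cmod (\<phi> w - \<psi> w) \<le> e"
 shows "norm (\<Lambda> \<phi> - \<Lambda> \<psi>) \<le> K * e"
proof -
 have "(\<integral>w. cmod (\<phi> w - \<psi> w) \<partial>haar) \<le> (\<integral>w. e \<partial>haar)"
  using assms by (intro integral_mono bdd_measurable_norm_integrable bdd_measurable_diff) (auto simp: space_haar)
 then show ?thesis
  using order_trans[OF dist_le[OF assms(1,2)] mult_left_mono[OF _ K_nonneg]] by (simp add: haar.prob_space)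
qed

lemma cong:
 assumes "bdd_measurable \<phi>" "bdd_measurable \<psi>" "\<And>w. w \<in> torus \<Longrightarrow> \<phi> w = \<psi> w"
 shows "\<Lambda> \<phi> = \<Lambda> \<psi>"
 using uniform_dist_le[OF assms(1,2), of 0] assms(3) by simp

lemma sum:
 assumes "\<And>i. i \<in> I \<Longrightarrow> bdd_measurable (\<phi> i)"
 shows "\<Lambda> (\<lambda>w. \<Sum>i\<in>I. \<phi> i w) = (\<Sum>i\<in>I. \<Lambda> (\<phi> i))"
proof -
 have zero: "\<Lambda> (\<lambda>w. 0) = 0" using bound[OF bdd_measurable_const[of 0]] by simp
 show ?thesis using assms
 proof (induction I rule: infinite_finite_induct)
  case (insert i I)
  then have "\<Lambda> (\<lambda>w. \<phi> i w + (\<Sum>i\<in>I. \<phi> i w)) = \<Lambda> (\<phi> i) + \<Lambda> (\<lambda>w. \<Sum>i\<in>I. \<phi> i w)"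
   by (intro add bdd_measurable_sum) auto
  then show ?case using insert by simp
 qed (simp_all add: zero)
qed

definition induced_measure :: "point set \<Rightarrow> 'a" where
 "induced_measure A = \<Lambda> (indicator A)"

lemma induced_measure_norm_le:
 assumes A: "A \<in> sets borel_torus"
 shows "norm (induced_measure A) \<le> K * measure haar A"
proof -
 have "norm (induced_measure A) \<le> K * (\<integral>w. cmod (indicator A w) \<partial>haar)"
  unfolding induced_measure_def by (rule bound[OF bdd_measurable_indicator[OF A]])
 also have "(\<lambda>w. cmod (indicator A w)) = indicat_real A" by (auto simp: indicator_def)
 also have "(\<integral>w. indicat_real A w \<partial>haar) = measure haar A"
  using A by (simp add: sets_haar)
 finally show ?thesis .
qed

lemma bounded_vector_measure_induced: "bounded_vector_measure borel_torus induced_measure K"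
proof
 fix A B :: "point set"
 assume AB: "A \<in> sets borel_torus" "B \<in> sets borel_torus" "A \<inter> B = {}"
 have "induced_measure (A \<union> B) = \<Lambda> (\<lambda>w. indicator A w + indicator B w)"
  unfolding induced_measure_def using AB
  by (intro cong bdd_measurable_add bdd_measurable_indicator) (auto simp: indicator_def)
 also have "\<dots> = induced_measure A + induced_measure B"
  unfolding induced_measure_def by (intro add bdd_measurable_indicator AB)
 finally show "induced_measure (A \<union> B) = induced_measure A + induced_measure B" .
next
 fix P :: "point set set"
 assume P: "finite P" "P \<subseteq> sets borel_torus" "disjoint P"
 have "(\<Sum>A\<in>P. norm (induced_measure A)) \<le> (\<Sum>A\<in>P. K * measure haar A)"
  using P by (intro sum_mono induced_measure_norm_le) auto
 also have "\<dots> = K * measure haar (\<Union>P)"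
 proof -
  have "measure haar (\<Union>A\<in>P. A) = (\<Sum>A\<in>P. measure haar A)"
   using P by (intro haar.finite_measure_finite_Union) (auto simp: sets_haar disjoint_family_on_def disjoint_def)
  then show ?thesis by (simp add: sum_distrib_left)
 qed
 also have "\<dots> \<le> K * 1" using K_nonneg by (intro mult_left_mono haar.prob_le_1)
 finally show "(\<Sum>A\<in>P. norm (induced_measure A)) \<le> K" by simp
qed

lemma functional_simple:
 assumes s: "simple_function borel_torus s"
 shows "\<Lambda> s = simple_vm_int borel_torus induced_measure s"
proof -
 let ?L = "\<lambda>c. {w \<in> space borel_torus. s w = c}"
 have L: "?L c \<in> sets borel_torus" for c
  by (rule bounded_vector_measure.simple_function_level_sets[OF bounded_vector_measure_induced s])
 have bm: "bdd_measurable (\<lambda>w. c * indicator (?L c) w)" for c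
  by (intro bdd_measurable_scale bdd_measurable_indicator L)
 have "\<Lambda> s = \<Lambda> (\<lambda>w. \<Sum>c\<in>s ` space borel_torus. c * indicator (?L c) w)"
 proof (rule cong)
  fix w :: "nat \<Rightarrow> complex" assume w: "w \<in> torus"
  have "(\<Sum>c\<in>s ` space borel_torus. c * indicator (?L c) w)
    = (\<Sum>c\<in>s ` space borel_torus. if c = s w then s w else 0)"
   using w by (intro sum.cong) (auto simp: indicator_def space_restrict_space)
  also have "\<dots> = s w"
   using w simple_functionD(1)[OF s] by (simp add: space_restrict_space)
  finally show "s w = (\<Sum>c\<in>s ` space borel_torus. c * indicator (?L c) w)" by simp
 qed (intro bdd_measurable_simple[OF s] bdd_measurable_sum bm)+
 also have "\<dots> = (\<Sum>c\<in>s ` space borel_torus. \<Lambda> (\<lambda>w. c * indicator (?L c) w))"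
  by (rule sum) (rule bm)
 also have "\<dots> = simple_vm_int borel_torus induced_measure s"
  unfolding simple_vm_int_def induced_measure_def
  by (intro sum.cong refl scale bdd_measurable_indicator L)
 finally show ?thesis .
qed

lemma vm_int_induced:
 assumes \<phi>: "bdd_measurable \<phi>"
 shows "vm_int borel_torus induced_measure \<phi> = \<Lambda> \<phi>"
proof -
 interpret bounded_vector_measure borel_torus induced_measure K by (rule bounded_vector_measure_induced)
 obtain B where B: "\<And>w. w \<in> torus \<Longrightarrow> cmod (\<phi> w) \<le> B" using \<phi> by (auto simp: bdd_measurable_def)
 show ?thesis
 proof (rule vm_int_eqI)
  show "\<phi> \<in> borel_measurable borel_torus"
   using \<phi> unfolding bdd_measurable_def measurable_cong_sets[OF sets_haar refl] by simp
  show "cmod (\<phi> w) \<le> B" if "w \<in> space borel_torus" for w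
   using that by (intro B) (simp add: space_restrict_space)
  fix s e assume s: "simple_function borel_torus s" "\<And>w. w \<in> space borel_torus \<Longrightarrow> cmod (\<phi> w - s w) \<le> e"
  have "norm (\<Lambda> \<phi> - \<Lambda> s) \<le> K * e"
   by (rule uniform_dist_le[OF \<phi> bdd_measurable_simple[OF s(1)] s(2)]) (simp add: space_restrict_space)
  then show "norm (\<Lambda> \<phi> - simple_vm_int borel_torus induced_measure s) \<le> e * K"
   by (simp add: functional_simple[OF s(1)] mult.commute)
 qed
qed

lemma fourier_vm_induced: "fourier_vm induced_measure a = \<Lambda> (monomial (\<lambda>j. - a j))"
 unfolding fourier_vm_def by (rule vm_int_induced[OF bdd_measurable_monomial])

text \<open>Countable additivity, bounded variation and regularity are inherited from Haar measure.\<close>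

lemma induced_measure_M_torus: "induced_measure \<in> M_torus"
proof -
 interpret bounded_vector_measure borel_torus induced_measure K by (rule bounded_vector_measure_induced)
 have "countably_additive_vm borel_torus induced_measure"
  unfolding countably_additive_vm_def
 proof (intro allI impI)
  fix A :: "nat \<Rightarrow> point set"
  assume A: "range A \<subseteq> sets borel_torus" and dis: "disjoint_family A"
  have As: "A n \<in> sets borel_torus" for n using A by auto
  have "(\<lambda>n. measure haar (A n)) sums measure haar (\<Union>n. A n)"
   using A dis by (intro haar.finite_measure_UNION) (auto simp: sets_haar)
  then have "(\<lambda>n. K * (measure haar (\<Union>n. A n) - (\<Sum>i<n. measure haar (A i)))) \<longlonglongrightarrow> K * (measure haar (\<Union>n. A n) - measure haar (\<Union>n. A n))"
   unfolding sums_def by (intro tendsto_intros)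
  then have null: "(\<lambda>n. K * (measure haar (\<Union>n. A n) - (\<Sum>i<n. measure haar (A i)))) \<longlonglongrightarrow> 0" by simp
  have le: "norm ((\<Sum>i<n. induced_measure (A i)) - induced_measure (\<Union>n. A n))
    \<le> K * (measure haar (\<Union>n. A n) - (\<Sum>i<n. measure haar (A i)))" for n
  proof -
   let ?F = "\<Union>i<n. A i" and ?R = "(\<Union>n. A n) - (\<Union>i<n. A i)"
   have U: "(\<Union>n. A n) \<in> sets borel_torus" using A by auto
   have F: "?F \<in> sets borel_torus" using As by auto
   have dn: "disjoint_family_on A {..<n}" using dis by (rule disjoint_family_on_mono[rotated]) simp
   have split: "(\<Union>n. A n) = ?F \<union> ?R" by blast
   have "induced_measure (?F \<union> ?R) = induced_measure ?F + induced_measure ?R"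
    by (rule additive) (use U F in auto)
   also have "induced_measure ?F = (\<Sum>i<n. induced_measure (A i))"
    by (rule m_UN) (use As dn in auto)
   finally have "induced_measure (\<Union>n. A n) = (\<Sum>i<n. induced_measure (A i)) + induced_measure ?R"
    by (rule trans[OF arg_cong[OF split]])
   then have "norm ((\<Sum>i<n. induced_measure (A i)) - induced_measure (\<Union>n. A n)) = norm (induced_measure ?R)"
    by (simp only: diff_add_eq_diff_diff_swap diff_self norm_minus_cancel) simp
   also have "\<dots> \<le> K * measure haar ?R"
    by (rule induced_measure_norm_le) (use U F in auto)
   also have "measure haar ?R = measure haar (\<Union>n. A n) - measure haar ?F"
    using U F by (intro haar.finite_measure_Diff) (auto simp: sets_haar)
   also have "measure haar ?F = (\<Sum>i<n. measure haar (A i))"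
    using As dn by (intro haar.finite_measure_finite_Union) (auto simp: sets_haar)
   finally show ?thesis .
  qed
  have "(\<lambda>n. (\<Sum>i<n. induced_measure (A i)) - induced_measure (\<Union>n. A n)) \<longlonglongrightarrow> 0"
   by (rule Lim_null_comparison[OF _ null]) (use le in auto)
  then show "(\<lambda>n. induced_measure (A n)) sums induced_measure (\<Union>n. A n)"
   unfolding sums_def by (rule LIM_zero_cancel)
 qed
 moreover have "bounded_variation_vm borel_torus induced_measure"
  unfolding bounded_variation_vm_def bdd_above_def
 proof (intro exI[of _ K] ballI, elim CollectE exE conjE)
  fix x P assume "x = (\<Sum>A\<in>P. norm (induced_measure A))" "finite P" "partition_on (space borel_torus) P" "P \<subseteq> sets borel_torus"
  then show "x \<le> K" using variation partition_onD2 by blast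
 qed
 moreover have "regular_vm borel_torus induced_measure"
  unfolding regular_vm_def
 proof (intro ballI allI impI)
  fix A :: "point set" and e :: real
  assume A: "A \<in> sets borel_torus" and e: "0 < e"
  have e': "0 < e / (K + 1)" using e K_nonneg by simp
  have "(\<integral>\<^sup>+w. 1 \<partial>haar) < \<infinity>" by (simp add: haar.emeasure_space_1)
  from density_regular[OF _ this A e']
  obtain R U where RU: "compact R" "open U" "R \<subseteq> A" "A \<subseteq> U"
    "(\<integral>\<^sup>+w. 1 * indicator (U - R) w \<partial>haar) \<le> ennreal (e / (K + 1))" by auto
  have "norm (induced_measure B) < e" if B: "B \<in> sets borel_torus" "B \<subseteq> U - R" for B
  proof -
   have "ennreal (measure haar B) = (\<integral>\<^sup>+w. indicator B w \<partial>haar)"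
    using B by (simp add: sets_haar haar.emeasure_eq_measure)
   also have "\<dots> \<le> (\<integral>\<^sup>+w. 1 * indicator (U - R) w \<partial>haar)"
    using B(2) by (intro nn_integral_mono) (auto simp: indicator_def)
   also note RU(5)
   finally have "measure haar B \<le> e / (K + 1)" by (subst (asm) ennreal_le_iff) (use e' in auto)
   then have "K * measure haar B \<le> K * (e / (K + 1))" using K_nonneg by (rule mult_left_mono)
   also have "\<dots> < e" using e K_nonneg by (simp add: field_simps)
   finally show ?thesis using induced_measure_norm_le[OF B(1)] by simp
  qed
  then show "\<exists>R U. compact R \<and> open U \<and> R \<subseteq> A \<and> A \<subseteq> U \<and> (\<forall>B\<in>sets borel_torus. B \<subseteq> U - R \<longrightarrow> norm (induced_measure B) < e)"
   using RU by (intro exI[of _ R] exI[of _ U] conjI ballI impI) auto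
 qed
 ultimately show ?thesis by (simp add: M_torus_def)
qed

end


section \<open>Limits of functionals that converge on monomials\<close>

lemma indicator_trig_approx:
 assumes A: "A \<in> sets borel_torus" and e: "e > 0"
 obtains t where "trig t" "(\<integral>w. cmod (indicator A w - t w) \<partial>haar) \<le> e"
proof -
 have one: "(\<integral>\<^sup>+w. 1 \<partial>haar) = ennreal 1" by (simp add: haar.emeasure_space_1)
 have e2: "e / 2 > 0" using e by simp
 obtain t where t: "trig (\<lambda>w. of_real (t w))" "(\<integral>\<^sup>+w. ennreal \<bar>indicat_real A w - t w\<bar> * 1 \<partial>haar) \<le> ennreal (e / 2 * 1 + e / 2)"
 proof (rule weighted_trig_approx[where h = "\<lambda>_. 1" and I = 1 and K' = "{}" and U' = UNIV, OF _ one _ A e2])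
  fix t :: "point \<Rightarrow> real"
  assume "trig (\<lambda>w. of_real (t w))" "(\<integral>\<^sup>+w. ennreal \<bar>indicat_real A w - t w\<bar> * 1 \<partial>haar) \<le> ennreal (e / 2 * 1 + e / 2)"
  then show thesis by (rule that)
 qed auto
 have eq: "cmod (indicator A w - complex_of_real (t w)) = \<bar>indicat_real A w - t w\<bar>" for w
 proof -
  have "indicator A w - complex_of_real (t w) = complex_of_real (indicat_real A w - t w)" by (simp add: indicator_def)
  then show ?thesis by (simp only: norm_of_real)
 qed
 have int: "integrable haar (\<lambda>w. cmod (indicator A w - complex_of_real (t w)))"
  by (intro bdd_measurable_norm_integrable bdd_measurable_diff bdd_measurable_indicator[OF A]
    bdd_measurable_trig[OF t(1)])
 have "ennreal (\<integral>w. cmod (indicator A w - complex_of_real (t w)) \<partial>haar)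
   = (\<integral>\<^sup>+w. ennreal (cmod (indicator A w - complex_of_real (t w))) \<partial>haar)"
  by (rule nn_integral_eq_integral[symmetric, OF int]) simp
 also have "\<dots> \<le> ennreal e" using t(2) by (simp add: eq)
 finally have "(\<integral>w. cmod (indicator A w - complex_of_real (t w)) \<partial>haar) \<le> e"
  by (subst (asm) ennreal_le_iff) (use e in auto)
 with t(1) show thesis by (rule that)
qed

context
 fixes \<Lambda> :: "nat \<Rightarrow> (point \<Rightarrow> complex) \<Rightarrow> 'a::complex_banach" and K :: real
 assumes L1: "\<And>i. L1_functional (\<Lambda> i) K"
  and monomials: "\<And>a. a \<in> Z_fin \<Longrightarrow> convergent (\<lambda>i. \<Lambda> i (monomial a))"
begin

text \<open>Equicontinuity: the functionals share the bound \<open>K\<close>, so convergence passes to limits in the mean.\<close>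

lemma convergent_closure:
 assumes \<phi>: "bdd_measurable \<phi>"
  and approx: "\<And>e. e > 0 \<Longrightarrow> \<exists>\<psi>. bdd_measurable \<psi> \<and> convergent (\<lambda>i. \<Lambda> i \<psi>) \<and> (\<integral>w. cmod (\<phi> w - \<psi> w) \<partial>haar) \<le> e"
 shows "convergent (\<lambda>i. \<Lambda> i \<phi>)"
proof -
 have K: "0 \<le> K" by (rule L1_functional.K_nonneg[OF L1])
 have "Cauchy (\<lambda>i. \<Lambda> i \<phi>)"
 proof (rule metric_CauchyI)
  fix e :: real assume e: "e > 0"
  have "0 < e / (3 * (K + 1))" using e K by simp
  from approx[OF this] obtain \<psi> where \<psi>: "bdd_measurable \<psi>" "convergent (\<lambda>i. \<Lambda> i \<psi>)"
    "(\<integral>w. cmod (\<phi> w - \<psi> w) \<partial>haar) \<le> e / (3 * (K + 1))" by auto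
  have close: "norm (\<Lambda> i \<phi> - \<Lambda> i \<psi>) \<le> e / 3" for i
  proof -
   have "norm (\<Lambda> i \<phi> - \<Lambda> i \<psi>) \<le> K * (e / (3 * (K + 1)))"
    by (rule order_trans[OF L1_functional.dist_le[OF L1 \<phi> \<psi>(1)] mult_left_mono[OF \<psi>(3) K]])
   also have "\<dots> \<le> e / 3" using e K by (simp add: field_simps)
   finally show ?thesis .
  qed
  have "Cauchy (\<lambda>i. \<Lambda> i \<psi>)" using \<psi>(2) by (rule convergent_Cauchy)
  then obtain N where N: "\<And>i j. i \<ge> N \<Longrightarrow> j \<ge> N \<Longrightarrow> dist (\<Lambda> i \<psi>) (\<Lambda> j \<psi>) < e / 3"
   using e unfolding Cauchy_def by (meson divide_pos_pos zero_less_numeral)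
  show "\<exists>N. \<forall>i\<ge>N. \<forall>j\<ge>N. dist (\<Lambda> i \<phi>) (\<Lambda> j \<phi>) < e"
  proof (intro exI[of _ N] allI impI)
   fix i j assume "i \<ge> N" "j \<ge> N"
   then have "dist (\<Lambda> i \<psi>) (\<Lambda> j \<psi>) < e / 3" by (rule N)
   moreover have "dist (\<Lambda> i \<phi>) (\<Lambda> i \<psi>) \<le> e / 3" "dist (\<Lambda> j \<phi>) (\<Lambda> j \<psi>) \<le> e / 3"
    using close by (auto simp: dist_norm)
   moreover have "dist (\<Lambda> i \<phi>) (\<Lambda> j \<phi>) \<le> dist (\<Lambda> i \<phi>) (\<Lambda> i \<psi>) + dist (\<Lambda> i \<psi>) (\<Lambda> j \<psi>) + dist (\<Lambda> j \<phi>) (\<Lambda> j \<psi>)"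
    using dist_triangle[of "\<Lambda> i \<phi>" "\<Lambda> j \<phi>" "\<Lambda> i \<psi>"] dist_triangle[of "\<Lambda> i \<psi>" "\<Lambda> j \<phi>" "\<Lambda> j \<psi>"]
    by (simp add: dist_commute)
   ultimately show "dist (\<Lambda> i \<phi>) (\<Lambda> j \<phi>) < e" by linarith
  qed
 qed
 then show ?thesis by (rule Cauchy_convergent)
qed

lemma convergent_trig: "trig t \<Longrightarrow> convergent (\<lambda>i. \<Lambda> i t)"
proof (induction rule: trig.induct)
 case (trig_monomial a t c)
 have bt: "bdd_measurable t" by (intro bdd_measurable_trig trig.trig_monomial[OF trig_monomial])
 have "\<Lambda> i t = c *\<^sub>C \<Lambda> i (monomial a)" for i
  using L1_functional.cong[OF L1 bt bdd_measurable_scale[OF bdd_measurable_monomial] trig_monomial(2)]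
   L1_functional.scale[OF L1 bdd_measurable_monomial] by simp
 moreover obtain l where "(\<lambda>i. \<Lambda> i (monomial a)) \<longlonglongrightarrow> l"
  using monomials[OF trig_monomial(1)] by (auto simp: convergent_def)
 then have "(\<lambda>i. c *\<^sub>C \<Lambda> i (monomial a)) \<longlonglongrightarrow> c *\<^sub>C l" by (intro tendsto_scaleC tendsto_const)
 ultimately show ?case by (auto simp: convergent_def)
next
 case (trig_add s t u)
 have b: "bdd_measurable s" "bdd_measurable t" by (intro bdd_measurable_trig trig_add)+
 have bu: "bdd_measurable u" by (intro bdd_measurable_trig trig.trig_add[OF trig_add(1,2,3)])
 have "\<Lambda> i u = \<Lambda> i s + \<Lambda> i t" for i
  using L1_functional.cong[OF L1 bu bdd_measurable_add[OF b] trig_add(3)]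
   L1_functional.add[OF L1 b] by simp
 then show ?case using trig_add.IH by (simp add: convergent_add)
qed

text \<open>From trigonometric polynomials to indicators, simple functions and uniform limits of these.\<close>

lemma convergent_bdd_measurable:
 assumes \<phi>: "bdd_measurable \<phi>"
 shows "convergent (\<lambda>i. \<Lambda> i \<phi>)"
proof -
 have ind: "convergent (\<lambda>i. \<Lambda> i (indicator A))" if A: "A \<in> sets borel_torus" for A
 proof (rule convergent_closure[OF bdd_measurable_indicator[OF A]])
  fix e :: real assume "e > 0"
  from indicator_trig_approx[OF A this]
  obtain t where "trig t" "(\<integral>w. cmod (indicator A w - t w) \<partial>haar) \<le> e" .
  then show "\<exists>\<psi>. bdd_measurable \<psi> \<and> convergent (\<lambda>i. \<Lambda> i \<psi>) \<and> (\<integral>w. cmod (indicator A w - \<psi> w) \<partial>haar) \<le> e"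
   by (intro exI[of _ t] conjI bdd_measurable_trig convergent_trig)
 qed
 have simple: "convergent (\<lambda>i. \<Lambda> i s)" if s: "simple_function borel_torus s" for s
 proof -
  let ?L = "\<lambda>c. {w \<in> space borel_torus. s w = c}"
  have L: "?L c \<in> sets borel_torus" for c
   by (rule bounded_vector_measure.simple_function_level_sets[OF L1_functional.bounded_vector_measure_induced[OF L1[of 0]] s])
  have "\<exists>l. (\<lambda>i. \<Lambda> i (indicator (?L c))) \<longlonglongrightarrow> l" for c using ind[OF L] by (simp only: convergent_def)
  then obtain l where l: "\<And>c. (\<lambda>i. \<Lambda> i (indicator (?L c))) \<longlonglongrightarrow> l c" by metis
  have "(\<lambda>i. \<Sum>c\<in>s ` space borel_torus. c *\<^sub>C \<Lambda> i (indicator (?L c))) \<longlonglongrightarrow> (\<Sum>c\<in>s ` space borel_torus. c *\<^sub>C l c)"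
   by (intro tendsto_sum tendsto_scaleC tendsto_const l)
  then show ?thesis
   unfolding L1_functional.functional_simple[OF L1 s] simple_vm_int_def L1_functional.induced_measure_def[OF L1]
   by (rule convergentI)
 qed
 obtain B where B: "\<And>w. w \<in> torus \<Longrightarrow> cmod (\<phi> w) \<le> B" using \<phi> by (auto simp: bdd_measurable_def)
 have \<phi>m: "\<phi> \<in> borel_measurable borel_torus"
  using \<phi> unfolding bdd_measurable_def measurable_cong_sets[OF sets_haar refl] by simp
 have \<phi>B: "cmod (\<phi> w) \<le> B" if "w \<in> space borel_torus" for w
  using that by (intro B) (simp add: space_restrict_space)
 show ?thesis
 proof (rule convergent_closure[OF \<phi>])
  fix e :: real assume e: "e > 0"
  obtain s where s: "simple_function borel_torus s" "\<And>w. w \<in> space borel_torus \<Longrightarrow> cmod (s w - \<phi> w) \<le> e"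
   using simple_uniform_approx[OF \<phi>m \<phi>B e] by metis
  have "(\<integral>w. cmod (\<phi> w - s w) \<partial>haar) \<le> (\<integral>w. e \<partial>haar)"
  proof (intro integral_mono bdd_measurable_norm_integrable bdd_measurable_diff \<phi> bdd_measurable_simple s(1))
   show "cmod (\<phi> w - s w) \<le> e" if "w \<in> space haar" for w
    using s(2)[of w] that by (simp add: space_haar space_restrict_space norm_minus_commute)
  qed simp
  then show "\<exists>\<psi>. bdd_measurable \<psi> \<and> convergent (\<lambda>i. \<Lambda> i \<psi>) \<and> (\<integral>w. cmod (\<phi> w - \<psi> w) \<partial>haar) \<le> e"
   by (intro exI[of _ s] conjI bdd_measurable_simple simple s(1)) (simp add: haar.prob_space)
 qed
qed

lemma L1_functional_limit: "L1_functional (\<lambda>\<phi>. lim (\<lambda>i. \<Lambda> i \<phi>)) K"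
proof
 have lim: "(\<lambda>i. \<Lambda> i \<phi>) \<longlonglongrightarrow> lim (\<lambda>i. \<Lambda> i \<phi>)" if "bdd_measurable \<phi>" for \<phi>
  using convergent_bdd_measurable[OF that] by (simp add: convergent_LIMSEQ_iff)
 fix \<phi> \<psi> :: "point \<Rightarrow> complex" and c :: complex
 assume \<phi>: "bdd_measurable \<phi>"
 show "lim (\<lambda>i. \<Lambda> i (\<lambda>w. \<phi> w + \<psi> w)) = lim (\<lambda>i. \<Lambda> i \<phi>) + lim (\<lambda>i. \<Lambda> i \<psi>)" if \<psi>: "bdd_measurable \<psi>"
  unfolding L1_functional.add[OF L1 \<phi> \<psi>] by (rule limI) (intro tendsto_add lim \<phi> \<psi>)
 show "lim (\<lambda>i. \<Lambda> i (\<lambda>w. c * \<phi> w)) = c *\<^sub>C lim (\<lambda>i. \<Lambda> i \<phi>)"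
  unfolding L1_functional.scale[OF L1 \<phi>] by (rule limI) (intro tendsto_scaleC tendsto_const lim \<phi>)
 show "norm (lim (\<lambda>i. \<Lambda> i \<phi>)) \<le> K * (\<integral>w. cmod (\<phi> w) \<partial>haar)"
  by (rule LIMSEQ_le_const2[OF tendsto_norm[OF lim[OF \<phi>]]]) (use L1_functional.bound[OF L1 \<phi>] in auto)
qed

end

section \<open>The boundary measure of a bounded holomorphic function\<close>

definition unit_exponent :: "nat \<Rightarrow> nat \<Rightarrow> int" where
 "unit_exponent n j = (if j = 0 then int n else 0)"

lemma unit_exponent_zero [simp]: "unit_exponent n 0 = int n"
 by (simp add: unit_exponent_def)

lemma inj_unit_exponent: "inj unit_exponent"
 by (rule injI) (metis unit_exponent_zero of_nat_eq_iff)

lemma unit_exponent_N0_fin: "unit_exponent n \<in> N0_fin"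
 by (auto simp: N0_fin_def Z_fin_def unit_exponent_def)

lemma unit_exponent_Z_fin: "unit_exponent n \<in> Z_fin"
 using unit_exponent_N0_fin by (simp add: N0_fin_def)

lemma monomial_unit_exponent: "monomial (unit_exponent n) w = w 0 ^ n"
 by (subst monomial_superset[of "{0}"]) (auto simp: unit_exponent_def)

locale bounded_holomorphic =
 fixes F :: "complex \<Rightarrow> 'a::complex_banach" and B :: real
 assumes holomorphic: "vec_holomorphic_on F (ball 0 1)"
  and bounded: "cmod z < 1 \<Longrightarrow> norm (F z) \<le> B"
begin

text \<open>Cauchy's integral formula on the circle of radius \<open>1 / 2\<close>.\<close>

definition taylor :: "nat \<Rightarrow> 'a" where
 "taylor n = (1 / (2 * pi)) *\<^sub>R integral {0..2 * pi} (\<lambda>t. (2 * cis (- t)) ^ n *\<^sub>C F (cis t / 2))"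

lemma taylor_functional:
 assumes l: "contractive l"
 shows "l (taylor n) = (deriv ^^ n) (\<lambda>z. l (F z)) 0 / fact n"
proof -
 interpret l: bounded_linear l by (rule contractive_bounded_linear[OF l])
 let ?f = "\<lambda>t. (2 * cis (- t)) ^ n *\<^sub>C F (cis t / 2)"
 let ?D = "(deriv ^^ n) (\<lambda>z. l (F z)) 0"
 have cancel: "- \<i> * (\<i> * x) = x" for x by (simp flip: mult.assoc)
 have "c * \<i> / x * y = \<i> * (c * (y / x))" for c x y :: complex by simp
 then have cancel': "- \<i> * (c * \<i> / x * y) = c * (y / x)" for c x y using cancel by presburger
 have "continuous_on {0..2 * pi} (\<lambda>t. F (cis t / 2))"
  by (rule continuous_on_compose2[OF vec_holomorphic_on_imp_continuous_on[OF holomorphic]])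
   (auto intro!: continuous_intros)
 then have "continuous_on {0..2 * pi} ?f"
  by (intro continuous_on_scaleC continuous_intros) auto
 then have int: "?f integrable_on {0..2 * pi}" by (rule integrable_continuous_real)
 have hol: "(\<lambda>z. l (F z)) holomorphic_on ball 0 1" by (rule vec_holomorphic_on_functional[OF holomorphic l])
 have sub: "cball 0 (1 / 2) \<subseteq> ball (0::complex) 1" by auto
 have "((\<lambda>u. l (F u) / (u - 0) ^ Suc n) has_contour_integral (2 * pi * \<i>) / fact n * ?D) (circlepath 0 (1 / 2))"
  by (rule Cauchy_has_contour_integral_higher_derivative_circlepath)
   (use sub in \<open>auto intro!: holomorphic_on_imp_continuous_on holomorphic_on_subset[OF hol]\<close>)
 then have "((\<lambda>t. l (F (0 + of_real (1 / 2) * cis t)) / (0 + of_real (1 / 2) * cis t - 0) ^ Suc n * of_real (1 / 2) * \<i> * cis t)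
   has_integral (2 * pi * \<i>) / fact n * ?D) {0..2 * pi}"
  unfolding circlepath_def by (subst (asm) has_contour_integral_part_circlepath_iff) simp_all
 also have "(\<lambda>t. l (F (0 + of_real (1 / 2) * cis t)) / (0 + of_real (1 / 2) * cis t - 0) ^ Suc n * of_real (1 / 2) * \<i> * cis t)
   = (\<lambda>t. \<i> * l (?f t))"
 proof
  fix t
  have v: "2 * cis (- t) = 1 / (cis t / 2)" by (simp add: cis_inverse[symmetric] field_simps)
  show "l (F (0 + of_real (1 / 2) * cis t)) / (0 + of_real (1 / 2) * cis t - 0) ^ Suc n * of_real (1 / 2) * \<i> * cis t = \<i> * l (?f t)"
   unfolding v contractiveD(2)[OF l] by (simp add: field_simps power_divide)
 qed
 finally have "((\<lambda>t. - \<i> * (\<i> * l (?f t))) has_integral - \<i> * ((2 * pi * \<i>) / fact n * ?D)) {0..2 * pi}"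
  by (rule has_integral_mult_right)
 then have "((\<lambda>t. l (?f t)) has_integral 2 * pi * (?D / fact n)) {0..2 * pi}"
  unfolding cancel cancel' .
 moreover have "((\<lambda>t. l (?f t)) has_integral l (integral {0..2 * pi} ?f)) {0..2 * pi}"
  using has_integral_linear[OF integrable_integral[OF int] l.bounded_linear_axioms] by (simp add: o_def)
 ultimately have "l (integral {0..2 * pi} ?f) = 2 * pi * (?D / fact n)" by (rule has_integral_unique[rotated])
 then show ?thesis unfolding taylor_def l.scaleR by (simp add: scaleR_conv_of_real)
qed

text \<open>Cauchy's inequality on circles of radius tending to \<open>1\<close>.\<close>

lemma norm_taylor_le: "norm (taylor n) \<le> B"
proof (rule norm_le_by_functionals)
 fix l :: "'a \<Rightarrow> complex" assume l: "contractive l"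
 let ?D = "(deriv ^^ n) (\<lambda>z. l (F z)) 0"
 have hol: "(\<lambda>z. l (F z)) holomorphic_on ball 0 1" by (rule vec_holomorphic_on_functional[OF holomorphic l])
 have le: "cmod (l (taylor n)) \<le> B / radius i ^ n" for i
 proof -
  have sub: "cball 0 (radius i) \<subseteq> ball (0::complex) 1" using radius(2)[of i] by auto
  have "cmod ?D \<le> fact n * B / radius i ^ n"
  proof (rule Cauchy_inequality)
   show "(\<lambda>z. l (F z)) holomorphic_on ball 0 (radius i)"
    by (rule holomorphic_on_subset[OF hol]) (use sub in auto)
   show "continuous_on (cball 0 (radius i)) (\<lambda>z. l (F z))"
    by (rule holomorphic_on_imp_continuous_on[OF holomorphic_on_subset[OF hol sub]])
   show "0 < radius i" by (simp add: radius_def)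
   show "cmod (l (F x)) \<le> B" if "cmod (0 - x) = radius i" for x
    using order_trans[OF contractiveD(3)[OF l] bounded[of x]] that radius(2)[of i] by simp
  qed
  then show ?thesis unfolding taylor_functional[OF l] by (simp add: norm_divide field_simps)
 qed
 have "(\<lambda>i. B / radius i ^ n) \<longlonglongrightarrow> B / 1 ^ n" by (intro tendsto_intros radius_tendsto) simp
 then have "cmod (l (taylor n)) \<le> B / 1 ^ n" by (rule LIMSEQ_le_const) (use le in auto)
 then show "cmod (l (taylor n)) \<le> B" by simp
qed

lemma summable_power_B: "0 \<le> r \<Longrightarrow> r < 1 \<Longrightarrow> summable (\<lambda>n. r ^ n * C * B)"
 by (intro summable_mult2 summable_geometric) simp

lemma taylor_series_summable:
 assumes z: "cmod z < 1"
 shows "summable (\<lambda>n. z ^ n *\<^sub>C taylor n)"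
proof (rule summable_comparison_test')
 show "summable (\<lambda>n. cmod z ^ n * 1 * B)" using z by (intro summable_power_B) auto
 show "norm (z ^ n *\<^sub>C taylor n) \<le> cmod z ^ n * 1 * B" for n
  using norm_taylor_le[of n] by (simp add: norm_scaleC norm_power mult_left_mono)
qed

lemma taylor_functional_sums:
 assumes l: "contractive l" and z: "cmod z < 1"
 shows "(\<lambda>n. z ^ n * l (taylor n)) sums l (F z)"
 using holomorphic_power_series[OF vec_holomorphic_on_functional[OF holomorphic l], of z] z
 by (simp add: taylor_functional[OF l] mult.commute)

text \<open>After pairing with functionals this is the scalar Taylor series.\<close>

lemma taylor_series:
 assumes z: "cmod z < 1"
 shows "(\<Sum>n. z ^ n *\<^sub>C taylor n) = F z"
proof -
 have "norm ((\<Sum>n. z ^ n *\<^sub>C taylor n) - F z) \<le> 0"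
 proof (rule norm_le_by_functionals)
  fix l :: "'a \<Rightarrow> complex" assume l: "contractive l"
  interpret l: bounded_linear l by (rule contractive_bounded_linear[OF l])
  have "(\<lambda>n. l (z ^ n *\<^sub>C taylor n)) sums l (\<Sum>n. z ^ n *\<^sub>C taylor n)"
   by (rule l.sums[OF summable_sums[OF taylor_series_summable[OF z]]])
  then have "(\<lambda>n. z ^ n * l (taylor n)) sums l (\<Sum>n. z ^ n *\<^sub>C taylor n)"
   by (simp add: contractiveD(2)[OF l])
  then have "l (\<Sum>n. z ^ n *\<^sub>C taylor n) = l (F z)" by (rule sums_unique2[OF _ taylor_functional_sums[OF l z]])
  then show "cmod (l ((\<Sum>n. z ^ n *\<^sub>C taylor n) - F z)) \<le> 0" by (simp add: l.diff)
 qed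
 then show ?thesis by simp
qed

text \<open>The integral of \<open>\<phi>\<close> against the function \<open>F (r * w 0)\<close>, written as a series of scalar
 integrals.\<close>

definition radial_functional :: "real \<Rightarrow> (point \<Rightarrow> complex) \<Rightarrow> 'a" where
 "radial_functional r \<phi> = (\<Sum>n. (of_real r ^ n * (\<integral>w. \<phi> w * w 0 ^ n \<partial>haar)) *\<^sub>C taylor n)"

lemma bdd_measurable_power: "bdd_measurable (\<lambda>w. w 0 ^ n)"
 using bdd_measurable_monomial[of "unit_exponent n"] by (simp add: monomial_unit_exponent[abs_def])

lemma norm_coordinate_power: "w \<in> torus \<Longrightarrow> cmod (w 0 ^ n) = 1"
 by (simp add: norm_power torus_def)

lemma moment_norm_le:
 "bdd_measurable \<phi> \<Longrightarrow> cmod (\<integral>w. \<phi> w * w 0 ^ n \<partial>haar) \<le> (\<integral>w. cmod (\<phi> w) \<partial>haar)"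
 using norm_integral_monomial_le[of \<phi> "unit_exponent n"] by (simp add: monomial_unit_exponent)

lemma radial_functional_summable:
 assumes \<phi>: "bdd_measurable \<phi>" and r: "0 \<le> r" "r < 1"
 shows "summable (\<lambda>n. (of_real r ^ n * (\<integral>w. \<phi> w * w 0 ^ n \<partial>haar)) *\<^sub>C taylor n)"
proof (rule summable_comparison_test')
 show "summable (\<lambda>n. r ^ n * (\<integral>w. cmod (\<phi> w) \<partial>haar) * B)" by (rule summable_power_B[OF r])
 show "norm ((of_real r ^ n * (\<integral>w. \<phi> w * w 0 ^ n \<partial>haar)) *\<^sub>C taylor n) \<le> r ^ n * (\<integral>w. cmod (\<phi> w) \<partial>haar) * B" for n
  using r moment_norm_le[OF \<phi>, of n] norm_taylor_le[of n]
  by (simp add: norm_scaleC norm_mult norm_power mult_mono)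
qed

text \<open>Termwise integration, possible after pairing with a functional; this yields the bound by the
 supremum of \<open>F\<close> that the series itself does not show.\<close>

lemma radial_functional_eq_integral:
 assumes \<phi>: "bdd_measurable \<phi>" and r: "0 \<le> r" "r < 1" and l: "contractive l"
 shows "integrable haar (\<lambda>w. \<phi> w * l (F (of_real r * w 0)))"
  "l (radial_functional r \<phi>) = (\<integral>w. \<phi> w * l (F (of_real r * w 0)) \<partial>haar)"
proof -
 interpret l: bounded_linear l by (rule contractive_bounded_linear[OF l])
 define f where "f n w = (of_real r ^ n * l (taylor n)) * (\<phi> w * w 0 ^ n)" for n and w :: "nat \<Rightarrow> complex"
 have int: "integrable haar (f n)" for n
  unfolding f_def
  by (intro bdd_measurable_integrable bdd_measurable_scale bdd_measurable_mult \<phi> bdd_measurable_power)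
 have sum: "(\<lambda>n. f n w) sums (\<phi> w * l (F (of_real r * w 0)))" if "w \<in> torus" for w
 proof -
  have "cmod (of_real r * w 0) < 1" using that r by (simp add: norm_mult torus_def)
  from sums_mult[OF taylor_functional_sums[OF l this], of "\<phi> w"]
  show ?thesis by (simp add: f_def power_mult_distrib mult_ac)
 qed
 have le: "cmod (f n w) \<le> r ^ n * cmod (\<phi> w) * B" if "w \<in> torus" for n w
 proof -
  have "cmod (l (taylor n)) \<le> B" by (rule order_trans[OF contractiveD(3)[OF l] norm_taylor_le])
  then have "r ^ n * cmod (\<phi> w) * cmod (l (taylor n)) \<le> r ^ n * cmod (\<phi> w) * B"
   using r by (intro mult_left_mono) auto
  then show ?thesis using norm_coordinate_power[OF that, of n] r by (simp add: f_def norm_mult norm_power mult_ac)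
 qed
 have sumn: "summable (\<lambda>n. norm (f n w))" if "w \<in> torus" for w
  by (rule summable_comparison_test'[OF summable_power_B[OF r]]) (use le[OF that] in auto)
 have 1: "AE w in haar. summable (\<lambda>n. norm (f n w))" by (rule AE_I2) (simp add: space_haar sumn)
 have 2: "summable (\<lambda>n. \<integral>w. norm (f n w) \<partial>haar)"
 proof (rule summable_comparison_test')
  show "summable (\<lambda>n. r ^ n * (\<integral>w. cmod (\<phi> w) \<partial>haar) * B)" by (rule summable_power_B[OF r])
  fix n
  have "(\<integral>w. norm (f n w) \<partial>haar) \<le> (\<integral>w. r ^ n * cmod (\<phi> w) * B \<partial>haar)"
   using le by (intro integral_mono integrable_norm int integrable_mult_left integrable_mult_right
     bdd_measurable_norm_integrable[OF \<phi>]) (simp add: space_haar)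
  then show "norm (\<integral>w. norm (f n w) \<partial>haar) \<le> r ^ n * (\<integral>w. cmod (\<phi> w) \<partial>haar) * B" by simp
 qed
 have eq: "(\<Sum>n. f n w) = \<phi> w * l (F (of_real r * w 0))" if "w \<in> space haar" for w
  using sums_unique[OF sum[of w]] that by (simp add: space_haar)
 have "integrable haar (\<lambda>w. \<Sum>n. f n w)" by (rule integrable_suminf[OF int 1 2])
 then show "integrable haar (\<lambda>w. \<phi> w * l (F (of_real r * w 0)))"
  by (simp only: Bochner_Integration.integrable_cong[OF refl eq])
 have "l (radial_functional r \<phi>) = (\<Sum>n. l ((of_real r ^ n * (\<integral>w. \<phi> w * w 0 ^ n \<partial>haar)) *\<^sub>C taylor n))"
  unfolding radial_functional_def by (rule l.suminf[OF radial_functional_summable[OF \<phi> r]])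
 also have "\<dots> = (\<Sum>n. \<integral>w. f n w \<partial>haar)"
  unfolding f_def contractiveD(2)[OF l] integral_mult_right_zero by (simp add: mult_ac)
 also have "\<dots> = (\<integral>w. (\<Sum>n. f n w) \<partial>haar)" by (rule integral_suminf[OF int 1 2, symmetric])
 also have "\<dots> = (\<integral>w. \<phi> w * l (F (of_real r * w 0)) \<partial>haar)"
  by (rule Bochner_Integration.integral_cong[OF refl eq])
 finally show "l (radial_functional r \<phi>) = (\<integral>w. \<phi> w * l (F (of_real r * w 0)) \<partial>haar)" .
qed

lemma L1_functional_radial:
 assumes r: "0 \<le> r" "r < 1"
 shows "L1_functional (radial_functional r) B"
proof
 fix \<phi> \<psi> :: "point \<Rightarrow> complex" and c :: complex
 assume \<phi>: "bdd_measurable \<phi>"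
 have int: "integrable haar (\<lambda>w. \<phi> w * w 0 ^ n)" if "bdd_measurable \<phi>" for n \<phi>
  by (intro bdd_measurable_integrable bdd_measurable_mult bdd_measurable_power that)
 show "radial_functional r (\<lambda>w. \<phi> w + \<psi> w) = radial_functional r \<phi> + radial_functional r \<psi>" if \<psi>: "bdd_measurable \<psi>"
  unfolding radial_functional_def suminf_add[OF radial_functional_summable[OF \<phi> r] radial_functional_summable[OF \<psi> r]]
  by (simp add: distrib_right distrib_left int[OF \<phi>] int[OF \<psi>] scaleC_add_left)
 have "bounded_linear (\<lambda>x::'a. c *\<^sub>C x)" by (rule bounded_bilinear.bounded_linear_right[OF bounded_bilinear_scaleC])
 from bounded_linear.suminf[OF this radial_functional_summable[OF \<phi> r]]
 show "radial_functional r (\<lambda>w. c * \<phi> w) = c *\<^sub>C radial_functional r \<phi>"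
  unfolding radial_functional_def by (simp add: mult.assoc scaleC_scaleC mult.left_commute)
 show "norm (radial_functional r \<phi>) \<le> B * (\<integral>w. cmod (\<phi> w) \<partial>haar)"
 proof (rule norm_le_by_functionals)
  fix l :: "'a \<Rightarrow> complex" assume l: "contractive l"
  note int = radial_functional_eq_integral(1)[OF \<phi> r l]
  have "cmod (l (radial_functional r \<phi>)) \<le> (\<integral>w. cmod (\<phi> w * l (F (of_real r * w 0))) \<partial>haar)"
   unfolding radial_functional_eq_integral(2)[OF \<phi> r l] by (rule integral_norm_bound)
  also have "\<dots> \<le> (\<integral>w. B * cmod (\<phi> w) \<partial>haar)"
  proof (rule integral_mono[OF integrable_norm[OF int]])
   show "integrable haar (\<lambda>w. B * cmod (\<phi> w))"
    by (intro integrable_mult_right bdd_measurable_norm_integrable \<phi>)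
   fix w assume "w \<in> space haar"
   then have "cmod (of_real r * w 0) < 1" using r by (simp add: norm_mult space_haar torus_def)
   then have "cmod (l (F (of_real r * w 0))) \<le> B"
    by (rule order_trans[OF contractiveD(3)[OF l] bounded])
   then show "cmod (\<phi> w * l (F (of_real r * w 0))) \<le> B * cmod (\<phi> w)"
    unfolding norm_mult by (subst mult.commute) (rule mult_right_mono, auto)
  qed
  finally show "cmod (l (radial_functional r \<phi>)) \<le> B * (\<integral>w. cmod (\<phi> w) \<partial>haar)" by simp
 qed
qed

text \<open>The Fourier coefficients that boundary values of \<open>w \<mapsto> F (w 0)\<close> ought to have.\<close>

definition coefficient :: "(nat \<Rightarrow> int) \<Rightarrow> 'a" where
 "coefficient a = (if a \<in> range unit_exponent then taylor (nat (a 0)) else 0)"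

lemma radial_functional_monomial:
 assumes a: "a \<in> Z_fin"
 shows "radial_functional r (monomial (\<lambda>j. - a j)) = of_real (r ^ nat (a 0)) *\<^sub>C coefficient a"
proof -
 have moment: "(\<integral>w. monomial (\<lambda>j. - a j) w * w 0 ^ n \<partial>haar) = (if a = unit_exponent n then 1 else 0)" for n
  using integral_monomial_mult[OF a unit_exponent_Z_fin[of n]] by (auto simp: monomial_unit_exponent)
 show ?thesis
 proof (cases "a \<in> range unit_exponent")
  case True
  then obtain k where k: "a = unit_exponent k" by blast
  have "radial_functional r (monomial (\<lambda>j. - a j)) = (\<Sum>n\<in>{k}. (of_real r ^ n * (\<integral>w. monomial (\<lambda>j. - a j) w * w 0 ^ n \<partial>haar)) *\<^sub>C taylor n)"
   unfolding radial_functional_def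
   by (rule suminf_finite) (auto simp: moment[unfolded k] k inj_unit_exponent[THEN inj_eq] scaleC_zero_left)
  then show ?thesis by (simp add: moment[unfolded k] k coefficient_def)
 next
  case False
  then have "a \<noteq> unit_exponent n" for n by blast
  then show ?thesis using False
   by (simp add: radial_functional_def moment coefficient_def scaleC_zero_left scaleC_zero_right)
 qed
qed

definition boundary_functional :: "(point \<Rightarrow> complex) \<Rightarrow> 'a" where
 "boundary_functional \<phi> = lim (\<lambda>i. radial_functional (radius i) \<phi>)"

lemma radial_functional_tendsto:
 assumes a: "a \<in> Z_fin"
 shows "(\<lambda>i. radial_functional (radius i) (monomial (\<lambda>j. - a j))) \<longlonglongrightarrow> coefficient a"
proof -
 have "(\<lambda>i. of_real (radius i ^ nat (a 0)) *\<^sub>C coefficient a) \<longlonglongrightarrow> of_real (1 ^ nat (a 0)) *\<^sub>C coefficient a"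
  by (intro tendsto_scaleC tendsto_const tendsto_of_real tendsto_power radius_tendsto)
 then show ?thesis by (simp add: radial_functional_monomial[OF a] scaleC_one)
qed

sublocale boundary: L1_functional boundary_functional B
 unfolding boundary_functional_def[abs_def]
proof (rule L1_functional_limit[OF L1_functional_radial[OF radius]])
 fix a :: "nat \<Rightarrow> int" assume "a \<in> Z_fin"
 from radial_functional_tendsto[OF Z_fin_uminus[OF this]]
 show "convergent (\<lambda>i. radial_functional (radius i) (monomial a))" by (auto intro: convergentI)
qed

lemma boundary_functional_monomial:
 "a \<in> Z_fin \<Longrightarrow> boundary_functional (monomial (\<lambda>j. - a j)) = coefficient a"
 unfolding boundary_functional_def by (rule limI[OF radial_functional_tendsto])

lemma boundary_measure_analytic: "boundary.induced_measure \<in> M_plus_torus"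
 unfolding M_plus_torus_def
proof (intro CollectI conjI ballI boundary.induced_measure_M_torus)
 fix a :: "nat \<Rightarrow> int" assume a: "a \<in> Z_fin - N0_fin"
 then have "a \<notin> range unit_exponent" using unit_exponent_N0_fin by auto
 with a show "fourier_vm boundary.induced_measure a = 0"
  by (simp add: boundary.fourier_vm_induced boundary_functional_monomial coefficient_def)
qed

end

section \<open>Trigonometric polynomials with vector coefficients are dense\<close>

definition vector_trig :: "(point \<Rightarrow> 'a::complex_banach) \<Rightarrow> bool" where
 "vector_trig q \<longleftrightarrow> (\<exists>S p. finite S \<and> S \<subseteq> Z_fin \<and> (\<forall>w\<in>torus. q w = (\<Sum>a\<in>S. monomial a w *\<^sub>C p a)))"

lemma vector_trig_add:
 assumes "vector_trig q" "vector_trig q'" "\<And>w. w \<in> torus \<Longrightarrow> u w = q w + q' w"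
 shows "vector_trig u"
proof -
 obtain S p where S: "finite S" "S \<subseteq> Z_fin" "\<And>w. w \<in> torus \<Longrightarrow> q w = (\<Sum>a\<in>S. monomial a w *\<^sub>C p a)"
  using assms(1) unfolding vector_trig_def by auto
 obtain S' p' where S': "finite S'" "S' \<subseteq> Z_fin" "\<And>w. w \<in> torus \<Longrightarrow> q' w = (\<Sum>a\<in>S'. monomial a w *\<^sub>C p' a)"
  using assms(2) unfolding vector_trig_def by auto
 define r where "r a = (if a \<in> S then p a else 0) + (if a \<in> S' then p' a else 0)" for a
 have "u w = (\<Sum>a\<in>S \<union> S'. monomial a w *\<^sub>C r a)" if w: "w \<in> torus" for w
 proof -
  have "(\<Sum>a\<in>S. monomial a w *\<^sub>C p a) = (\<Sum>a\<in>S \<union> S'. monomial a w *\<^sub>C (if a \<in> S then p a else 0))"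
   by (rule sum.mono_neutral_cong_left) (use S(1) S'(1) in \<open>auto simp: scaleC_zero_right\<close>)
  moreover have "(\<Sum>a\<in>S'. monomial a w *\<^sub>C p' a) = (\<Sum>a\<in>S \<union> S'. monomial a w *\<^sub>C (if a \<in> S' then p' a else 0))"
   by (rule sum.mono_neutral_cong_left) (use S(1) S'(1) in \<open>auto simp: scaleC_zero_right\<close>)
  ultimately show ?thesis
   by (simp only: assms(3)[OF w] S(3)[OF w] S'(3)[OF w] r_def scaleC_add_right sum.distrib)
 qed
 then show ?thesis using S(1,2) S'(1,2) unfolding vector_trig_def by (intro exI[of _ "S \<union> S'"] exI[of _ r]) auto
qed

lemma vector_trig_scale: "trig t \<Longrightarrow> vector_trig (\<lambda>w. t w *\<^sub>C v)"
proof (induction rule: trig.induct)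
 case (trig_monomial a t c)
 then show ?case
  unfolding vector_trig_def
  by (intro exI[of _ "{a}"] exI[of _ "\<lambda>_. c *\<^sub>C v"]) (simp add: scaleC_scaleC mult.commute)
next
 case (trig_add s t u)
 show ?case by (rule vector_trig_add[OF trig_add.IH]) (simp add: trig_add(3) scaleC_add_left)
qed

lemma vector_trig_sum:
 "(\<And>i. i \<in> I \<Longrightarrow> vector_trig (q i)) \<Longrightarrow> vector_trig (\<lambda>w. \<Sum>i\<in>I. q i w)"
proof (induction I rule: infinite_finite_induct)
 case (insert i I)
 have "vector_trig (q i)" by (rule insert.prems) simp
 moreover have "vector_trig (\<lambda>w. \<Sum>i\<in>I. q i w)" by (rule insert.IH) (rule insert.prems, simp)
 ultimately show ?case by (rule vector_trig_add) (use insert.hyps in simp)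
qed (auto simp: vector_trig_def intro!: exI[of _ "{}"])

lemma has_bochner_int_bdd_measurable:
 fixes v :: "'a::complex_banach"
 assumes "bdd_measurable \<phi>"
 shows "has_bochner_int haar (\<lambda>w. \<phi> w *\<^sub>C v) ((\<integral>w. \<phi> w \<partial>haar) *\<^sub>C v)"
 by (rule has_bochner_int_scaleC_const[OF bdd_measurable_integrable[OF assms]])

text \<open>Approximate by a simple function, and each indicator by a trigonometric polynomial.\<close>

theorem bochner_integrable_trig_approx:
 fixes f :: "point \<Rightarrow> 'a::complex_banach"
 assumes f: "bochner_integrable haar f" and e: "e > 0"
 obtains S p where "finite S" "S \<subseteq> Z_fin"
  "(\<integral>\<^sup>+w. ennreal (norm (f w - (\<Sum>a\<in>S. monomial a w *\<^sub>C p a))) \<partial>haar) \<le> ennreal e"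
proof -
 obtain s where s: "simple_bochner_integrable haar s" "(L1_dist haar f s) \<le> ennreal (e / 2)"
  using bochner_integrable_approx[OF f, of "e / 2"] e by auto
 have ss: "simple_function haar s" using s(1) by (auto elim: Bochner_Integration.simple_bochner_integrable.cases)
 define W where "W = s ` space haar"
 define L where "L v = {w \<in> space haar. s w = v}" for v
 define N where "N = (\<Sum>v\<in>W. norm v) + 1"
 have W: "finite W" unfolding W_def by (rule simple_functionD(1)[OF ss])
 have N: "0 < N" unfolding N_def by (intro add_nonneg_pos sum_nonneg) auto
 have "L v \<in> sets haar" for v
  using simple_functionD(2)[OF ss, of "{v}"] by (simp add: L_def vimage_def Int_def conj_commute)
 then have L: "L v \<in> sets borel_torus" for v by (simp add: sets_haar)
 have e': "0 < e / (2 * N)" using e N by simp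
 have "\<exists>t. trig t \<and> (\<integral>w. cmod (indicator (L v) w - t w) \<partial>haar) \<le> e / (2 * N)" for v
  using indicator_trig_approx[OF L e'] by metis
 then obtain t where t: "\<And>v. trig (t v)" "\<And>v. (\<integral>w. cmod (indicator (L v) w - t v w) \<partial>haar) \<le> e / (2 * N)" by metis
 define q where "q w = (\<Sum>v\<in>W. t v w *\<^sub>C v)" for w
 have "vector_trig q" unfolding q_def by (intro vector_trig_sum vector_trig_scale t)
 then obtain S p where S: "finite S" "S \<subseteq> Z_fin" "\<And>w. w \<in> torus \<Longrightarrow> q w = (\<Sum>a\<in>S. monomial a w *\<^sub>C p a)"
  unfolding vector_trig_def by auto
 have bm: "bdd_measurable (\<lambda>w. indicator (L v) w - t v w)" for v
  by (intro bdd_measurable_diff bdd_measurable_indicator L bdd_measurable_trig t)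
 have sq: "norm (s w - q w) \<le> (\<Sum>v\<in>W. cmod (indicator (L v) w - t v w) * norm v)" if "w \<in> space haar" for w
 proof -
  have "(\<Sum>v\<in>W. indicator (L v) w *\<^sub>C v) = (\<Sum>v\<in>W. if v = s w then s w else 0)"
   using that by (intro sum.cong) (auto simp: indicator_def L_def scaleC_one scaleC_zero_left)
  also have "\<dots> = s w" using that W by (simp add: W_def)
  finally have "s w - q w = (\<Sum>v\<in>W. (indicator (L v) w - t v w) *\<^sub>C v)"
   by (simp add: q_def scaleC_diff_left sum_subtractf)
  also have "norm \<dots> \<le> (\<Sum>v\<in>W. norm ((indicator (L v) w - t v w) *\<^sub>C v))" by (rule norm_sum)
  finally show ?thesis by (simp add: norm_scaleC)
 qed
 have "(L1_dist haar s q)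
   \<le> (\<integral>\<^sup>+w. ennreal (\<Sum>v\<in>W. cmod (indicator (L v) w - t v w) * norm v) \<partial>haar)"
  by (intro nn_integral_mono ennreal_leI sq)
 also have "\<dots> = ennreal (\<integral>w. (\<Sum>v\<in>W. cmod (indicator (L v) w - t v w) * norm v) \<partial>haar)"
  by (rule nn_integral_eq_integral)
   (auto intro!: integrable_sum integrable_mult_left bdd_measurable_norm_integrable[OF bm] sum_nonneg)
 also have "(\<integral>w. (\<Sum>v\<in>W. cmod (indicator (L v) w - t v w) * norm v) \<partial>haar)
   = (\<Sum>v\<in>W. (\<integral>w. cmod (indicator (L v) w - t v w) \<partial>haar) * norm v)"
  by (subst Bochner_Integration.integral_sum)
   (auto intro!: integrable_mult_left bdd_measurable_norm_integrable[OF bm])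
 also have "ennreal \<dots> \<le> ennreal (\<Sum>v\<in>W. e / (2 * N) * norm v)"
  by (intro ennreal_leI sum_mono mult_right_mono t) simp
 also have "(\<Sum>v\<in>W. e / (2 * N) * norm v) = e / (2 * N) * (N - 1)"
  by (simp add: N_def sum_distrib_left)
 also have "ennreal \<dots> \<le> ennreal (e / 2)" using N e by (intro ennreal_leI) (simp add: field_simps)
 finally have sq2: "(L1_dist haar s q) \<le> ennreal (e / 2)" .
 have "has_bochner_int haar q (\<Sum>v\<in>W. (\<integral>w. t v w \<partial>haar) *\<^sub>C v)"
  unfolding q_def by (intro has_bochner_int_sum has_bochner_int_bdd_measurable bdd_measurable_trig t)
 then have qm: "strongly_measurable haar q" by (simp add: has_bochner_int_def)
 have fm: "strongly_measurable haar f" using f unfolding bochner_integrable_def has_bochner_int_def by blast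
 have "(L1_dist haar f q) \<le> ennreal (e / 2) + ennreal (e / 2)"
  by (rule order_trans[OF nn_integral_triangle[OF fm simple_bochner_strongly_measurable[OF s(1)] qm] add_mono[OF s(2) sq2]])
 also have "\<dots> = ennreal e" using e by (simp flip: ennreal_plus)
 also have "(L1_dist haar f q) = (\<integral>\<^sup>+w. ennreal (norm (f w - (\<Sum>a\<in>S. monomial a w *\<^sub>C p a))) \<partial>haar)"
  by (rule nn_integral_cong) (simp add: S(3) space_haar)
 finally show thesis using S(1,2) by (intro that[of S p])
qed

text \<open>The differences are bounded by the finite measure with density \<open>norm (f - q)\<close>.\<close>

lemma variation_le_L1_dist:
 fixes f q :: "point \<Rightarrow> 'a::complex_banach"
 assumes f: "bochner_integrable haar f" and q: "bochner_integrable haar q"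
  and P: "finite P" "P \<subseteq> sets haar" "disjoint P"
 shows "ennreal (\<Sum>A\<in>P. norm (set_bochner_int haar A f - set_bochner_int haar A q)) \<le> (L1_dist haar f q)"
proof -
 have "strongly_measurable haar f" "strongly_measurable haar q"
  using f q unfolding bochner_integrable_def has_bochner_int_def by blast+
 then have "strongly_measurable haar (\<lambda>w. f w - q w)"
  by (rule strongly_measurable_combine) (rule tendsto_diff)
 then obtain d where d: "pointwise_measurable haar d" "AE w in haar. f w - q w = d w"
  by (rule strongly_measurable_version)
 define h where "h w = ennreal (norm (d w))" for w
 have "(\<lambda>w. norm (d w)) \<in> borel_measurable haar" by (rule pointwise_measurable_norm[OF d(1)])
 then have [measurable]: "h \<in> borel_measurable haar" unfolding h_def by measurable
 have "ennreal (norm (set_bochner_int haar A f - set_bochner_int haar A q)) \<le> emeasure (density haar h) A" if "A \<in> P" for A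
 proof -
  have A: "A \<in> sets haar" using that P(2) by blast
  have "ennreal (norm (set_bochner_int haar A f - set_bochner_int haar A q))
    \<le> (\<integral>\<^sup>+w. ennreal (norm (indicat_real A w *\<^sub>R f w - indicat_real A w *\<^sub>R q w)) \<partial>haar)"
   by (rule bochner_dist_le[OF set_bochner_intI[OF f A] set_bochner_intI[OF q A]])
  also have "\<dots> = (\<integral>\<^sup>+w. h w * indicator A w \<partial>haar)"
  proof (rule nn_integral_cong_AE)
   show "AE w in haar. ennreal (norm (indicat_real A w *\<^sub>R f w - indicat_real A w *\<^sub>R q w)) = h w * indicator A w"
    using d(2) by eventually_elim (auto simp: h_def indicator_def)
  qed
  also have "\<dots> = emeasure (density haar h) A" using A by (simp add: emeasure_density)
  finally show ?thesis .
 qed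
 then have "(\<Sum>A\<in>P. ennreal (norm (set_bochner_int haar A f - set_bochner_int haar A q))) \<le> (\<Sum>A\<in>P. emeasure (density haar h) A)"
  by (rule sum_mono)
 also have "\<dots> = emeasure (density haar h) (\<Union>A\<in>P. A)"
  by (rule sum_emeasure) (use P in \<open>auto simp: disjoint_family_on_def disjoint_def\<close>)
 also have "\<dots> \<le> emeasure (density haar h) (space (density haar h))" by (rule emeasure_space)
 also have "\<dots> = (\<integral>\<^sup>+w. h w \<partial>haar)" by (simp add: emeasure_density cong: nn_integral_cong)
 also have "\<dots> = (L1_dist haar f q)"
  unfolding h_def by (rule nn_integral_cong_AE) (use d(2) in eventually_elim, simp)
 finally show ?thesis by (simp add: sum_ennreal)
qed

lemma L1_functional_polynomial:
 assumes S: "finite S"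
 shows "L1_functional (\<lambda>\<phi>. \<Sum>a\<in>S. (\<integral>w. \<phi> w * monomial a w \<partial>haar) *\<^sub>C p a) (\<Sum>a\<in>S. norm (p a))"
proof
 fix \<phi> \<psi> :: "point \<Rightarrow> complex" and c :: complex
 assume \<phi>: "bdd_measurable \<phi>"
 have int: "integrable haar (\<lambda>w. \<phi> w * monomial a w)" if "bdd_measurable \<phi>" for a \<phi>
  by (intro bdd_measurable_integrable bdd_measurable_mult bdd_measurable_monomial that)
 show "(\<Sum>a\<in>S. (\<integral>w. (\<phi> w + \<psi> w) * monomial a w \<partial>haar) *\<^sub>C p a)
   = (\<Sum>a\<in>S. (\<integral>w. \<phi> w * monomial a w \<partial>haar) *\<^sub>C p a) + (\<Sum>a\<in>S. (\<integral>w. \<psi> w * monomial a w \<partial>haar) *\<^sub>C p a)"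
  if \<psi>: "bdd_measurable \<psi>"
  by (simp add: distrib_right int[OF \<phi>] int[OF \<psi>] scaleC_add_left sum.distrib)
 show "(\<Sum>a\<in>S. (\<integral>w. c * \<phi> w * monomial a w \<partial>haar) *\<^sub>C p a) = c *\<^sub>C (\<Sum>a\<in>S. (\<integral>w. \<phi> w * monomial a w \<partial>haar) *\<^sub>C p a)"
  by (simp add: mult.assoc scaleC_scaleC scaleC_sum_right)
 note norm_integral_monomial_le[OF \<phi>]
 then have "(\<Sum>a\<in>S. norm ((\<integral>w. \<phi> w * monomial a w \<partial>haar) *\<^sub>C p a)) \<le> (\<Sum>a\<in>S. (\<integral>w. cmod (\<phi> w) \<partial>haar) * norm (p a))"
  unfolding norm_scaleC by (intro sum_mono mult_right_mono) auto
 then show "norm (\<Sum>a\<in>S. (\<integral>w. \<phi> w * monomial a w \<partial>haar) *\<^sub>C p a) \<le> (\<Sum>a\<in>S. norm (p a)) * (\<integral>w. cmod (\<phi> w) \<partial>haar)"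
  by (intro order_trans[OF norm_sum]) (simp add: sum_distrib_left sum_distrib_right mult.commute)
qed

lemma L1_functional_diff:
 assumes "L1_functional \<Lambda> K" "L1_functional \<Lambda>' K'"
 shows "L1_functional (\<lambda>\<phi>. \<Lambda> \<phi> - \<Lambda>' \<phi>) (K + K')"
proof
 fix \<phi> \<psi> :: "point \<Rightarrow> complex" and c :: complex
 assume \<phi>: "bdd_measurable \<phi>"
 show "\<Lambda> (\<lambda>w. \<phi> w + \<psi> w) - \<Lambda>' (\<lambda>w. \<phi> w + \<psi> w) = \<Lambda> \<phi> - \<Lambda>' \<phi> + (\<Lambda> \<psi> - \<Lambda>' \<psi>)" if "bdd_measurable \<psi>"
  using L1_functional.add[OF assms(1) \<phi> that] L1_functional.add[OF assms(2) \<phi> that] by simp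
 show "\<Lambda> (\<lambda>w. c * \<phi> w) - \<Lambda>' (\<lambda>w. c * \<phi> w) = c *\<^sub>C (\<Lambda> \<phi> - \<Lambda>' \<phi>)"
  using L1_functional.scale[OF assms(1) \<phi>] L1_functional.scale[OF assms(2) \<phi>] by (simp add: scaleC_diff_right)
 show "norm (\<Lambda> \<phi> - \<Lambda>' \<phi>) \<le> (K + K') * (\<integral>w. cmod (\<phi> w) \<partial>haar)"
  using norm_triangle_ineq4[of "\<Lambda> \<phi>" "\<Lambda>' \<phi>"] L1_functional.bound[OF assms(1) \<phi>] L1_functional.bound[OF assms(2) \<phi>]
  by (simp add: distrib_right)
qed


section \<open>Fejer means of the boundary measure converge in the mean\<close>

context bounded_holomorphic
begin

definition partial_exponents :: "nat \<Rightarrow> nat set" where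
 "partial_exponents k = unit_exponent -` difference_set (cube k)"

definition fejer_poly :: "nat \<Rightarrow> complex \<Rightarrow> 'a" where
 "fejer_poly k z =
   (\<Sum>n\<in>partial_exponents k. z ^ n *\<^sub>C (of_real (fejer (cube k) (unit_exponent n)) *\<^sub>C taylor n))"

lemma finite_partial_exponents: "finite (partial_exponents k)"
 unfolding partial_exponents_def
 by (rule finite_vimageI[OF finite_difference_set[OF finite_cube] inj_unit_exponent])

text \<open>Only exponents supported on the first coordinate contribute.\<close>

lemma fejer_poly_coordinate:
 "(\<Sum>a\<in>difference_set (cube k). (of_real (fejer (cube k) a) * monomial a w) *\<^sub>C coefficient a) = fejer_poly k (w 0)"
proof -
 let ?D = "difference_set (cube k)"
 have "(\<Sum>a\<in>?D. (of_real (fejer (cube k) a) * monomial a w) *\<^sub>C coefficient a)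
   = (\<Sum>a\<in>unit_exponent ` partial_exponents k. (of_real (fejer (cube k) a) * monomial a w) *\<^sub>C coefficient a)"
 proof (rule sum.mono_neutral_right)
  show "finite ?D" by (rule finite_difference_set[OF finite_cube])
  show "unit_exponent ` partial_exponents k \<subseteq> ?D" by (auto simp: partial_exponents_def)
  show "\<forall>a\<in>?D - unit_exponent ` partial_exponents k. (of_real (fejer (cube k) a) * monomial a w) *\<^sub>C coefficient a = 0"
  proof
   fix a assume "a \<in> ?D - unit_exponent ` partial_exponents k"
   then have "a \<notin> range unit_exponent" by (auto simp: partial_exponents_def)
   then show "(of_real (fejer (cube k) a) * monomial a w) *\<^sub>C coefficient a = 0"
    by (simp add: coefficient_def scaleC_zero_right)
  qed
 qed
 also have "\<dots> = fejer_poly k (w 0)"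
  unfolding fejer_poly_def
  by (subst sum.reindex[OF inj_on_subset[OF inj_unit_exponent]])
   (auto simp: coefficient_def monomial_unit_exponent scaleC_scaleC mult.commute)
 finally show ?thesis .
qed

lemma fejer_poly_tendsto:
 assumes z: "cmod z < 1"
 shows "(\<lambda>k. fejer_poly k z) \<longlonglongrightarrow> F z"
proof -
 have eq: "fejer_poly k z = (\<Sum>n. z ^ n *\<^sub>C (of_real (fejer (cube k) (unit_exponent n)) *\<^sub>C taylor n))" for k
  unfolding fejer_poly_def
  by (rule suminf_finite[symmetric, OF finite_partial_exponents])
   (simp add: partial_exponents_def fejer_outside scaleC_zero_left scaleC_zero_right)
 have "(\<lambda>k. \<Sum>n. z ^ n *\<^sub>C (of_real (fejer (cube k) (unit_exponent n)) *\<^sub>C taylor n)) \<longlonglongrightarrow> (\<Sum>n. z ^ n *\<^sub>C taylor n)"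
 proof (rule dominated_series_tendsto)
  fix n
  have "(\<lambda>k. z ^ n *\<^sub>C (of_real (fejer (cube k) (unit_exponent n)) *\<^sub>C taylor n)) \<longlonglongrightarrow> z ^ n *\<^sub>C (of_real 1 *\<^sub>C taylor n)"
   by (intro tendsto_scaleC tendsto_const tendsto_of_real fejer_cube_tendsto unit_exponent_Z_fin)
  then show "(\<lambda>k. z ^ n *\<^sub>C (of_real (fejer (cube k) (unit_exponent n)) *\<^sub>C taylor n)) \<longlonglongrightarrow> z ^ n *\<^sub>C taylor n"
   by (simp add: scaleC_one)
  fix k
  have "fejer (cube k) (unit_exponent n) * norm (taylor n) \<le> 1 * B"
   using fejer_bounds norm_taylor_le by (intro mult_mono) auto
  then show "norm (z ^ n *\<^sub>C (of_real (fejer (cube k) (unit_exponent n)) *\<^sub>C taylor n)) \<le> cmod z ^ n * 1 * B"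
   using fejer_bounds(1) by (simp add: norm_scaleC norm_power mult_left_mono)
 next
  show "summable (\<lambda>n. cmod z ^ n * 1 * B)" using z by (intro summable_power_B) auto
 qed
 then show ?thesis by (simp only: eq taylor_series[OF z])
qed

lemma continuous_on_fejer_poly: "continuous_on S (fejer_poly k)"
 unfolding fejer_poly_def[abs_def]
 by (intro continuous_on_sum continuous_on_scaleC continuous_intros)

lemma disc_algebra_fejer_poly_diff: "disc_algebra (\<lambda>z. fejer_poly k z - fejer_poly j z)"
 unfolding disc_algebra_def
proof (intro conjI allI impI)
 show "continuous_on (cball 0 1) (\<lambda>z. fejer_poly k z - fejer_poly j z)"
  by (intro continuous_on_diff continuous_on_fejer_poly)
 fix l :: "'a \<Rightarrow> complex" assume l: "contractive l"
 interpret l: bounded_linear l by (rule contractive_bounded_linear[OF l])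
 show "(\<lambda>z. l (fejer_poly k z - fejer_poly j z)) holomorphic_on ball 0 1"
  unfolding fejer_poly_def l.diff l.sum contractiveD(2)[OF l]
  by (intro holomorphic_intros)
qed

text \<open>Subtracting from the measure the integral of a trigonometric polynomial close to its
 density leaves a measure of small variation, whose Fejer means are small in the mean. The
 Fejer means of the polynomial converge uniformly.\<close>

theorem fejer_poly_Cauchy:
 assumes f: "bochner_integrable haar f"
  and density: "\<And>A. A \<in> sets borel_torus \<Longrightarrow> boundary.induced_measure A = set_bochner_int haar A f"
  and e: "e > 0"
 shows "\<exists>N. \<forall>k\<ge>N. \<forall>j\<ge>N. (L1_dist circle (fejer_poly k) (fejer_poly j)) \<le> ennreal (3 * e)"
proof -
 obtain S p where S: "finite S" "S \<subseteq> Z_fin"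
   and approx: "(\<integral>\<^sup>+w. ennreal (norm (f w - (\<Sum>a\<in>S. monomial a w *\<^sub>C p a))) \<partial>haar) \<le> ennreal e"
  by (rule bochner_integrable_trig_approx[OF f e])
 define q where "q w = (\<Sum>a\<in>S. monomial a w *\<^sub>C p a)" for w
 define Q where "Q \<phi> = (\<Sum>a\<in>S. (\<integral>w. \<phi> w * monomial a w \<partial>haar) *\<^sub>C p a)" for \<phi>
 define p' where "p' a = (if a \<in> S then p a else 0)" for a
 have LQ: "L1_functional Q (\<Sum>a\<in>S. norm (p a))"
  unfolding Q_def[abs_def] by (rule L1_functional_polynomial[OF S(1)])
 interpret R: L1_functional "\<lambda>\<phi>. boundary_functional \<phi> - Q \<phi>" "B + (\<Sum>a\<in>S. norm (p a))"
  by (rule L1_functional_diff[OF boundary.L1_functional_axioms LQ])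
 have "has_bochner_int haar q (\<Sum>a\<in>S. (\<integral>w. monomial a w \<partial>haar) *\<^sub>C p a)"
  unfolding q_def[abs_def]
  by (intro has_bochner_int_sum has_bochner_int_bdd_measurable bdd_measurable_monomial)
 then have q: "bochner_integrable haar q" unfolding bochner_integrable_def by (rule exI)
 have Qset: "set_bochner_int haar A q = Q (indicator A)" if A: "A \<in> sets borel_torus" for A
 proof -
  have "has_bochner_int haar (\<lambda>w. \<Sum>a\<in>S. (indicator A w * monomial a w) *\<^sub>C p a) (Q (indicator A))"
   unfolding Q_def
   by (intro has_bochner_int_sum has_bochner_int_bdd_measurable bdd_measurable_mult
     bdd_measurable_indicator[OF A] bdd_measurable_monomial)
  then have "has_bochner_int haar (\<lambda>w. indicat_real A w *\<^sub>R q w) (Q (indicator A))"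
   by (rule has_bochner_int_cong[rotated]) (simp add: q_def indicator_def scaleC_zero_left)
  then show ?thesis unfolding set_bochner_int_def by (rule bochner_int_eq)
 qed
 have R_eq: "R.induced_measure A = set_bochner_int haar A f - set_bochner_int haar A q" if "A \<in> sets borel_torus" for A
  using density[OF that] Qset[OF that] by (simp add: R.induced_measure_def boundary.induced_measure_def)
 have R: "bounded_vector_measure borel_torus R.induced_measure e"
 proof
  show "R.induced_measure (A \<union> A') = R.induced_measure A + R.induced_measure A'"
   if "A \<in> sets borel_torus" "A' \<in> sets borel_torus" "A \<inter> A' = {}" for A A'
   using that by (rule bounded_vector_measure.additive[OF R.bounded_vector_measure_induced])
  fix P :: "point set set" assume P: "finite P" "P \<subseteq> sets borel_torus" "disjoint P"
  have "(\<Sum>A\<in>P. norm (R.induced_measure A)) = (\<Sum>A\<in>P. norm (set_bochner_int haar A f - set_bochner_int haar A q))"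
   using P(2) by (intro sum.cong refl arg_cong[of _ _ norm] R_eq) auto
  also have "ennreal \<dots> \<le> (L1_dist haar f q)"
   using P by (intro variation_le_L1_dist f q) (auto simp: sets_haar)
  also have "\<dots> \<le> ennreal e" using approx by (simp add: q_def)
  finally show "(\<Sum>A\<in>P. norm (R.induced_measure A)) \<le> e" using e by simp
 qed
 have coeff: "fourier_vm R.induced_measure a = coefficient a - p' a" if a: "a \<in> Z_fin" for a
 proof -
  have "(\<integral>w. monomial (\<lambda>j. - a j) w * monomial \<beta> w \<partial>haar) = (if \<beta> = a then 1 else 0)" if "\<beta> \<in> S" for \<beta>
   using that S(2) by (intro integral_monomial_mult a) auto
  then have "Q (monomial (\<lambda>j. - a j)) = (\<Sum>\<beta>\<in>S. if \<beta> = a then p a else 0)"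
   unfolding Q_def by (intro sum.cong) (auto simp: scaleC_one scaleC_zero_left)
  also have "\<dots> = p' a" using S(1) by (simp add: p'_def)
  finally show ?thesis by (simp add: R.fourier_vm_induced boundary_functional_monomial[OF a])
 qed
 define T where "T k w = (\<Sum>a\<in>S. (of_real (fejer (cube k) a) * monomial a w) *\<^sub>C p a)" for k w
 have R_mean: "(\<integral>\<^sup>+w. ennreal (norm (fejer_poly k (w 0) - T k w)) \<partial>haar) \<le> ennreal e" for k
 proof -
  let ?D = "difference_set (cube k)" and ?c = "\<lambda>a w. of_real (fejer (cube k) a) * monomial a w"
  have fin: "finite ?D" by (rule finite_difference_set[OF finite_cube])
  have "(\<Sum>a\<in>?D. ?c a w *\<^sub>C fourier_vm R.induced_measure a) = fejer_poly k (w 0) - T k w" for w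
  proof -
   have "(\<Sum>a\<in>?D. ?c a w *\<^sub>C fourier_vm R.induced_measure a) = (\<Sum>a\<in>?D. ?c a w *\<^sub>C coefficient a - ?c a w *\<^sub>C p' a)"
    by (rule sum.cong[OF refl]) (simp only: coeff[OF subsetD[OF difference_set_Z_fin[OF cube_Z_fin]]] scaleC_diff_right)
   also have "\<dots> = fejer_poly k (w 0) - (\<Sum>a\<in>?D. ?c a w *\<^sub>C p' a)"
    by (simp only: sum_subtractf fejer_poly_coordinate)
   also have "(\<Sum>a\<in>?D. ?c a w *\<^sub>C p' a) = (\<Sum>a\<in>?D \<inter> S. ?c a w *\<^sub>C p' a)"
    by (rule sum.mono_neutral_right[OF fin]) (auto simp: p'_def scaleC_zero_right)
   also have "\<dots> = T k w"
    unfolding T_def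
   proof (rule sum.mono_neutral_cong_left[OF S(1)])
    show "\<forall>a\<in>S - ?D \<inter> S. ?c a w *\<^sub>C p a = 0"
    proof
     fix a assume "a \<in> S - ?D \<inter> S"
     then have "fejer (cube k) a = 0" by (intro fejer_outside) blast
     then show "?c a w *\<^sub>C p a = 0" by (simp add: scaleC_zero_left)
    qed
   qed (auto simp: p'_def)
   finally show ?thesis .
  qed
  then show ?thesis using fejer_mean_norm_le[OF R finite_cube[of k] cube_Z_fin cube_nonempty] by simp
 qed
 have "\<exists>N. \<forall>k\<ge>N. \<forall>j\<ge>N. (\<Sum>a\<in>S. \<bar>fejer (cube k) a - fejer (cube j) a\<bar> * norm (p a)) \<le> e"
 proof -
  define s where "s = (\<Sum>a\<in>S. norm (p a)) + 1"
  have s: "0 < s" unfolding s_def by (intro add_nonneg_pos sum_nonneg) auto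
  have "\<forall>\<^sub>F k in sequentially. \<forall>a\<in>S. \<bar>fejer (cube k) a - 1\<bar> < e / (2 * s)"
  proof (rule eventually_ball_finite[OF S(1)], rule ballI)
   fix a assume "a \<in> S"
   then have "(\<lambda>k. fejer (cube k) a) \<longlonglongrightarrow> 1" using S(2) by (intro fejer_cube_tendsto) auto
   from tendstoD[OF this, of "e / (2 * s)"] show "\<forall>\<^sub>F k in sequentially. \<bar>fejer (cube k) a - 1\<bar> < e / (2 * s)"
    using e s by (simp add: dist_real_def)
  qed
  then obtain N where N: "\<And>k a. k \<ge> N \<Longrightarrow> a \<in> S \<Longrightarrow> \<bar>fejer (cube k) a - 1\<bar> < e / (2 * s)"
   unfolding eventually_sequentially by blast
  have "(\<Sum>a\<in>S. \<bar>fejer (cube k) a - fejer (cube j) a\<bar> * norm (p a)) \<le> e" if kj: "k \<ge> N" "j \<ge> N" for k j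
  proof -
   have "\<bar>fejer (cube k) a - fejer (cube j) a\<bar> \<le> e / s" if "a \<in> S" for a
   proof -
    have "e / (2 * s) + e / (2 * s) = e / s" by (simp add: field_simps)
    then show ?thesis using N[OF kj(1) that] N[OF kj(2) that] by linarith
   qed
   then have "(\<Sum>a\<in>S. \<bar>fejer (cube k) a - fejer (cube j) a\<bar> * norm (p a)) \<le> (\<Sum>a\<in>S. e / s * norm (p a))"
    by (intro sum_mono mult_right_mono) auto
   also have "\<dots> = e / s * (s - 1)" by (simp add: s_def sum_distrib_left)
   also have "\<dots> \<le> e" using e s by (simp add: field_simps)
   finally show ?thesis .
  qed
  then show ?thesis by blast
 qed
 then obtain N where N: "\<And>k j. k \<ge> N \<Longrightarrow> j \<ge> N \<Longrightarrow> (\<Sum>a\<in>S. \<bar>fejer (cube k) a - fejer (cube j) a\<bar> * norm (p a)) \<le> e"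
  by blast
 have Tdiff: "norm (T k w - T j w) \<le> e" if "k \<ge> N" "j \<ge> N" "w \<in> torus" for k j w
 proof -
  have "T k w - T j w = (\<Sum>a\<in>S. (of_real (fejer (cube k) a - fejer (cube j) a) * monomial a w) *\<^sub>C p a)"
   by (simp add: T_def sum_subtractf[symmetric] scaleC_diff_left[symmetric] left_diff_distrib)
  also have "norm \<dots> \<le> (\<Sum>a\<in>S. norm ((of_real (fejer (cube k) a - fejer (cube j) a) * monomial a w) *\<^sub>C p a))"
   by (rule norm_sum)
  also have "\<dots> = (\<Sum>a\<in>S. \<bar>fejer (cube k) a - fejer (cube j) a\<bar> * norm (p a))"
   unfolding norm_scaleC norm_mult norm_of_real norm_monomial[OF that(3)] by simp
  also have "\<dots> \<le> e" by (rule N[OF that(1,2)])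
  finally show ?thesis .
 qed
 have cont: "continuous_on torus (\<lambda>w. norm (fejer_poly k (w 0) - T k w))" for k
  unfolding T_def
  by (intro continuous_on_norm continuous_on_diff continuous_on_compose2[OF continuous_on_fejer_poly[of UNIV]]
    continuous_on_coordinate continuous_on_sum continuous_on_scaleC continuous_on_mult continuous_on_const continuous_on_monomial) auto
 have meas: "(\<lambda>w. ennreal (norm (fejer_poly k (w 0) - T k w))) \<in> borel_measurable haar" for k
  using borel_measurable_haar[OF cont[of k]] by measurable
 show ?thesis
 proof (intro exI[of _ N] allI impI)
  fix k j assume kj: "k \<ge> N" "j \<ge> N"
  have "(\<lambda>z. ennreal (norm (fejer_poly k z - fejer_poly j z))) \<in> borel_measurable circle"
   by (intro measurable_compose[OF _ measurable_ennreal] borel_measurable_circle continuous_on_norm continuous_on_diff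
     continuous_on_fejer_poly)
  then have "(L1_dist circle (fejer_poly k) (fejer_poly j))
    = (\<integral>\<^sup>+w. ennreal (norm (fejer_poly k (w 0) - fejer_poly j (w 0))) \<partial>haar)"
   by (subst distr_haar_coordinate[of 0, symmetric])
    (rule nn_integral_distr, rule measurable_coordinate_haar, simp add: distr_haar_coordinate)
  also have "\<dots> \<le> (\<integral>\<^sup>+w. ennreal (norm (fejer_poly k (w 0) - T k w))
    + ennreal (norm (fejer_poly j (w 0) - T j w)) + ennreal e \<partial>haar)"
  proof (rule nn_integral_mono)
   fix w assume "w \<in> space haar"
   then have "norm (T k w - T j w) \<le> e" by (intro Tdiff kj) (simp add: space_haar)
   moreover have "fejer_poly k (w 0) - fejer_poly j (w 0)
     = (fejer_poly k (w 0) - T k w) - (fejer_poly j (w 0) - T j w) + (T k w - T j w)" by simp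
   ultimately have "norm (fejer_poly k (w 0) - fejer_poly j (w 0))
     \<le> norm (fejer_poly k (w 0) - T k w) + norm (fejer_poly j (w 0) - T j w) + e"
    using norm_triangle_ineq[of "(fejer_poly k (w 0) - T k w) - (fejer_poly j (w 0) - T j w)" "T k w - T j w"]
     norm_triangle_ineq4[of "fejer_poly k (w 0) - T k w" "fejer_poly j (w 0) - T j w"] by simp
   then show "ennreal (norm (fejer_poly k (w 0) - fejer_poly j (w 0)))
     \<le> ennreal (norm (fejer_poly k (w 0) - T k w)) + ennreal (norm (fejer_poly j (w 0) - T j w)) + ennreal e"
    using e by (simp add: ennreal_leI flip: ennreal_plus)
  qed
  also have "\<dots> = (\<integral>\<^sup>+w. ennreal (norm (fejer_poly k (w 0) - T k w)) \<partial>haar)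
    + (\<integral>\<^sup>+w. ennreal (norm (fejer_poly j (w 0) - T j w)) \<partial>haar) + ennreal e"
   using meas by (simp add: nn_integral_add haar.emeasure_space_1)
  also have "\<dots> \<le> ennreal e + ennreal e + ennreal e" by (intro add_mono R_mean order_refl)
  also have "\<dots> = ennreal (3 * e)" using e by (simp flip: ennreal_plus)
  finally show "(L1_dist circle (fejer_poly k) (fejer_poly j)) \<le> ennreal (3 * e)" .
 qed
qed

end

section \<open>Radial limits from a density\<close>

text \<open>Cauchy's criterion: a function that is uniformly approximated by functions with a limit has one.\<close>

lemma convergent_at_left_of_approx:
 fixes u :: "real \<Rightarrow> 'a::banach"
 assumes approx: "\<And>e. e > 0 \<Longrightarrow> \<exists>g l. (g \<longlongrightarrow> l) (at_left 1) \<and> (\<forall>R\<in>{0..<1}. norm (g R - u R) \<le> e)"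
 shows "\<exists>l. (u \<longlongrightarrow> l) (at_left (1::real))"
proof -
 have "cauchy_filter (filtermap u (at_left 1))"
  unfolding cauchy_filter_metric_filtermap
 proof (intro allI impI)
  fix e :: real assume "e > 0"
  then have e: "e / 5 > 0" by simp
  from approx[OF this] obtain g l where g: "(g \<longlongrightarrow> l) (at_left 1)" "\<And>R. R \<in> {0..<1} \<Longrightarrow> norm (g R - u R) \<le> e / 5"
   by blast
  define P where "P R \<longleftrightarrow> R \<in> {0..<1} \<and> dist (g R) l < e / 5" for R :: real
  have "eventually (\<lambda>R. R \<in> {0<..<1}) (at_left (1::real))" by (rule eventually_at_left_real) simp
  with tendstoD[OF g(1) e] have "eventually P (at_left 1)"
   by eventually_elim (auto simp: P_def)
  moreover have "dist (u x) (u y) < e" if "P x" "P y" for x y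
  proof -
   have near: "dist (u R) l \<le> 2 * (e / 5)" if "P R" for R
   proof -
    have "dist (u R) (g R) \<le> e / 5" using g(2)[of R] that by (simp add: P_def dist_norm norm_minus_commute)
    then show ?thesis using dist_triangle[of "u R" l "g R"] that by (simp add: P_def)
   qed
   show ?thesis using near[OF that(1)] near[OF that(2)] dist_triangle2[of "u x" "u y" l] \<open>e > 0\<close> by simp
  qed
  ultimately show "\<exists>P. eventually P (at_left 1) \<and> (\<forall>x y. P x \<and> P y \<longrightarrow> dist (u x) (u y) < e)" by blast
 qed
 moreover have "filtermap u (at_left (1::real)) \<noteq> bot" by (simp add: filtermap_bot_iff)
 ultimately obtain l where "filtermap u (at_left 1) \<le> nhds l"
  using complete_UNIV[where 'a = 'a] unfolding complete_uniform by auto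
 then show ?thesis unfolding filterlim_def by blast
qed

text \<open>Countably many radii keep the supremum \<open>deviation\<close> measurable; by continuity they suffice.\<close>

lemma rational_bound_extends:
 fixes u :: "real \<Rightarrow> real"
 assumes cont: "continuous_on {0..<1} u" and le: "\<And>\<rho>. \<rho> \<in> \<rat> \<inter> {0..<1} \<Longrightarrow> u \<rho> \<le> e" and R: "R \<in> {0..<1}"
 shows "u R \<le> e"
proof (rule ccontr)
 assume "\<not> u R \<le> e"
 then have "0 < u R - e" by simp
 with cont R obtain d where d: "d > 0" "\<And>x. x \<in> {0..<1} \<Longrightarrow> dist x R < d \<Longrightarrow> dist (u x) (u R) < u R - e"
  unfolding continuous_on_iff by metis
 have "R < min 1 (R + d)" using R d(1) by simp
 from Rats_dense_in_real[OF this] obtain x where x: "x \<in> \<rat>" "R < x" "x < min 1 (R + d)" by blast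
 then have "dist (u x) (u R) < u R - e" using R by (intro d(2)) (auto simp: dist_real_def)
 moreover have "u x \<le> e" using x R by (intro le) auto
 ultimately show False by (simp add: dist_real_def)
qed

context bounded_holomorphic
begin

definition deviation :: "nat \<Rightarrow> complex \<Rightarrow> ennreal" where
 "deviation k w = (SUP \<rho>\<in>\<rat> \<inter> {0..<1}. ennreal (norm (fejer_poly k (of_real \<rho> * w) - F (of_real \<rho> * w))))"

lemma borel_measurable_radial:
 assumes g: "continuous_on (ball 0 1) g" and \<rho>: "\<rho> \<in> \<rat> \<inter> {0..<1}"
 shows "(\<lambda>w. ennreal (norm (g (of_real \<rho> * w)))) \<in> borel_measurable circle"
proof -
 have "continuous_on (sphere 0 1) (\<lambda>w. norm (g (of_real \<rho> * w)))"
  using \<rho> by (intro continuous_on_norm continuous_on_compose2[OF g] continuous_intros) (auto simp: norm_mult)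
 from borel_measurable_circle[OF this] show ?thesis by measurable
qed

lemma countable_rational_radii: "countable (\<rat> \<inter> {0..<1::real})"
 by (rule countable_Int1[OF countable_rat])

lemma borel_measurable_deviation: "deviation k \<in> borel_measurable circle"
 unfolding deviation_def[abs_def]
 by (intro borel_measurable_SUP countable_rational_radii
   borel_measurable_radial[of "\<lambda>z. fejer_poly k z - F z"] continuous_on_diff continuous_on_fejer_poly
   vec_holomorphic_on_imp_continuous_on[OF holomorphic])

text \<open>Fatou's lemma passes from the maximal inequality for the differences of the polynomials
 to their distance from the limit.\<close>

lemma deviation_integral_le:
 assumes f: "bochner_integrable haar f"
  and density: "\<And>A. A \<in> sets borel_torus \<Longrightarrow> boundary.induced_measure A = set_bochner_int haar A f"
  and e: "e > 0"
 shows "\<exists>k. (\<integral>\<^sup>+w. deviation k w \<partial>circle) \<le> ennreal e"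
proof -
 let ?C = "\<rat> \<inter> {0..<1::real}"
 \<comment> \<open>The Cauchy estimate loses a factor \<open>3\<close> and the maximal inequality a factor \<open>16\<close>.\<close>
 have "0 < e / 48" using e by simp
 from fejer_poly_Cauchy[OF f density this]
 obtain N where N: "\<And>k j. k \<ge> N \<Longrightarrow> j \<ge> N \<Longrightarrow>
   (L1_dist circle (fejer_poly k) (fejer_poly j)) \<le> ennreal (3 * (e / 48))" by blast
 define S where "S j w = (SUP \<rho>\<in>?C. ennreal (norm (fejer_poly N (of_real \<rho> * w) - fejer_poly j (of_real \<rho> * w))))" for j and w :: complex
 have S_le: "(\<integral>\<^sup>+w. S j w \<partial>circle) \<le> ennreal e" if "j \<ge> N" for j
 proof -
  have "(\<integral>\<^sup>+w. S j w \<partial>circle) \<le> 16 * (L1_dist circle (fejer_poly N) (fejer_poly j))"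
   unfolding S_def by (rule maximal_inequality[OF disc_algebra_fejer_poly_diff]) simp
  also have "\<dots> \<le> 16 * ennreal (3 * (e / 48))" by (intro mult_left_mono N that) auto
  also have "\<dots> = ennreal e"
   using e by (simp add: ennreal_mult[symmetric] flip: ennreal_numeral)
  finally show ?thesis .
 qed
 have meas: "S j \<in> borel_measurable circle" for j
  unfolding S_def[abs_def]
  by (intro borel_measurable_SUP countable_rational_radii
    borel_measurable_radial[of "\<lambda>z. fejer_poly N z - fejer_poly j z"] continuous_on_diff continuous_on_fejer_poly)
 have "deviation N w \<le> liminf (\<lambda>j. S j w)" if w: "w \<in> space circle" for w
  unfolding deviation_def
 proof (rule SUP_least)
  fix \<rho> assume \<rho>: "\<rho> \<in> ?C"
  let ?z = "of_real \<rho> * w :: complex"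
  have "cmod ?z < 1" using w \<rho> by (simp add: space_circle norm_mult)
  then have "(\<lambda>j. ennreal (norm (fejer_poly N ?z - fejer_poly j ?z))) \<longlonglongrightarrow> ennreal (norm (fejer_poly N ?z - F ?z))"
   by (intro tendsto_ennrealI tendsto_norm tendsto_diff tendsto_const fejer_poly_tendsto)
  then have "ennreal (norm (fejer_poly N ?z - F ?z)) = liminf (\<lambda>j. ennreal (norm (fejer_poly N ?z - fejer_poly j ?z)))"
   by (intro lim_imp_Liminf[symmetric]) simp_all
  also have "\<dots> \<le> liminf (\<lambda>j. S j w)"
   unfolding S_def using \<rho> by (intro Liminf_mono always_eventually allI SUP_upper2[of \<rho>]) auto
  finally show "ennreal (norm (fejer_poly N ?z - F ?z)) \<le> liminf (\<lambda>j. S j w)" .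
 qed
 then have "(\<integral>\<^sup>+w. deviation N w \<partial>circle) \<le> (\<integral>\<^sup>+w. liminf (\<lambda>j. S j w) \<partial>circle)" by (rule nn_integral_mono)
 also have "\<dots> \<le> liminf (\<lambda>j. \<integral>\<^sup>+w. S j w \<partial>circle)" by (rule nn_integral_liminf[OF meas])
 also have "\<dots> \<le> liminf (\<lambda>j::nat. ennreal e)"
  using S_le by (intro Liminf_mono) (auto simp: eventually_sequentially)
 also have "\<dots> = ennreal e" by (intro Liminf_const) simp
 finally show ?thesis by (rule exI)
qed

text \<open>The infimum of the deviations has integral \<open>0\<close>, so that along almost every radius \<open>F\<close> is uniformly
 approximated by polynomials.\<close>

theorem density_imp_radial_limits:
 assumes f: "bochner_integrable haar f"
  and density: "\<And>A. A \<in> sets borel_torus \<Longrightarrow> boundary.induced_measure A = set_bochner_int haar A f"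
 shows "AE w in circle. \<exists>l. ((\<lambda>R. F (of_real R * w)) \<longlongrightarrow> l) (at_left (1::real))"
proof -
 have meas: "(\<lambda>w. INF k. deviation k w) \<in> borel_measurable circle"
  by (intro borel_measurable_INF borel_measurable_deviation) simp
 have "(\<integral>\<^sup>+w. (INF k. deviation k w) \<partial>circle) \<le> 0"
 proof (rule ennreal_le_epsilon)
  fix e :: real assume "e > 0"
  from deviation_integral_le[OF f density this] obtain k where "(\<integral>\<^sup>+w. deviation k w \<partial>circle) \<le> ennreal e" by blast
  moreover have "(\<integral>\<^sup>+w. (INF k. deviation k w) \<partial>circle) \<le> (\<integral>\<^sup>+w. deviation k w \<partial>circle)"
   by (intro nn_integral_mono INF_lower) simp
  ultimately show "(\<integral>\<^sup>+w. (INF k. deviation k w) \<partial>circle) \<le> 0 + ennreal e" by simp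
 qed
 then have "AE w in circle. (INF k. deviation k w) = 0"
  using nn_integral_0_iff_AE[OF meas] by simp
 then show ?thesis
 proof (rule AE_mp, intro AE_I2 impI)
  fix w assume w: "w \<in> space circle" and inf: "(INF k. deviation k w) = 0"
  have w1: "cmod w = 1" using w by (simp add: space_circle)
  show "\<exists>l. ((\<lambda>R. F (of_real R * w)) \<longlongrightarrow> l) (at_left 1)"
  proof (rule convergent_at_left_of_approx)
   fix e :: real assume e: "e > 0"
   then have "(INF k. deviation k w) < ennreal e" using inf by simp
   then obtain k where k: "deviation k w < ennreal e" by (auto simp: INF_less_iff)
   let ?g = "\<lambda>R. fejer_poly k (of_real R * w)"
   have "continuous_on UNIV ?g"
    by (intro continuous_on_compose2[OF continuous_on_fejer_poly[of UNIV]] continuous_intros) auto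
   then have "isCont ?g 1" by (simp add: continuous_on_eq_continuous_at)
   then have "(?g \<longlongrightarrow> ?g 1) (at_left 1)"
    by (simp add: isCont_def filterlim_at_split)
   moreover have "norm (?g R - F (of_real R * w)) \<le> e" if R: "R \<in> {0..<1}" for R
   proof (rule rational_bound_extends[OF _ _ R])
    show "continuous_on {0..<1} (\<lambda>R. norm (?g R - F (of_real R * w)))"
     using w1 by (intro continuous_on_norm continuous_on_diff continuous_on_subset[OF \<open>continuous_on UNIV ?g\<close>]
      continuous_on_compose2[OF vec_holomorphic_on_imp_continuous_on[OF holomorphic]] continuous_intros)
      (auto simp: norm_mult)
    fix \<rho> :: real assume "\<rho> \<in> \<rat> \<inter> {0..<1}"
    then have "ennreal (norm (?g \<rho> - F (of_real \<rho> * w))) \<le> deviation k w"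
     unfolding deviation_def by (rule SUP_upper)
    then have "ennreal (norm (?g \<rho> - F (of_real \<rho> * w))) \<le> ennreal e" using k by simp
    then show "norm (?g \<rho> - F (of_real \<rho> * w)) \<le> e" by (subst (asm) ennreal_le_iff) (use e in auto)
   qed
   ultimately show "\<exists>g l. (g \<longlongrightarrow> l) (at_left 1) \<and> (\<forall>R\<in>{0..<1}. norm (g R - F (of_real R * w)) \<le> e)"
    by blast
  qed
 qed
qed

end

theorem density_imp_ARNP:
 assumes density: "\<And>m :: point set \<Rightarrow> 'a::complex_banach. m \<in> M_plus_torus \<Longrightarrow>
  \<exists>f\<in>H1. \<forall>A\<in>sets borel_torus. m A = set_bochner_int haar A f"
 shows "ARNP TYPE('a)"
 unfolding ARNP_def
proof (intro allI impI, elim conjE)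
 fix F :: "complex \<Rightarrow> 'a"
 assume hol: "vec_holomorphic_on F (ball 0 1)" and "bounded (F ` ball 0 1)"
 then obtain B where B: "\<forall>x\<in>F ` ball 0 1. norm x \<le> B" unfolding bounded_iff by blast
 interpret bounded_holomorphic F B
 proof
  show "norm (F z) \<le> B" if "cmod z < 1" for z using B that by simp
 qed (rule hol)
 obtain f where f: "f \<in> H1" "\<forall>A\<in>sets borel_torus. boundary.induced_measure A = set_bochner_int haar A f"
  using density[OF boundary_measure_analytic] by blast
 then have "bochner_integrable haar f" by (simp add: H1_def)
 from density_imp_radial_limits[OF this] f(2)
 show "AE w in circle. \<exists>l. ((\<lambda>R. F (of_real R * w)) \<longlongrightarrow> l) (at_left (1::real))" by blast
qed

theorem theorem7p1:
  shows "ARNP TYPE('a::complex_banach) \<longleftrightarrow>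
    (\<forall>m \<in> (M_plus_torus :: ((nat \<Rightarrow> complex) set \<Rightarrow> 'a) set).
       \<exists>f \<in> H1. \<forall>A \<in> sets borel_torus. m A = set_bochner_int haar A f)"
 using ARNP_imp_density density_imp_ARNP by blast

end
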